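(* Let $\mathcal{X}: Z^d+L_{d,Z}(X,Y)=0$ be a smooth plane curve of degree $d\geq 4$ over $K$ for which $P=(0:0:1)$ is the unique outer Galois point. Consider the binary forms $$\mathcal{G}_{12,a}(X,Y)=XY\,(X^{10}+a(XY)^5+Y^{10}),$$ $$\mathcal{G}_{30,b,c}(X,Y)=(X^{30}-Y^{30})+b(XY)^5(X^{20}-Y^{20})+c(XY)^{10}(X^{10}-Y^{10}),$$ $$\mathcal{G}_{20,u,v}(X,Y)=(X^{20}+Y^{20})+u(XY)^5(X^{10}+Y^{10})+v(XY)^{10},$$ $$\mathcal{G}_{60,a}(X,Y)=X^{60}+Y^{60}+a(XY)^{30}+\sum_{i=1}^{5}e_i(XY)^{5i}(X^{60-10i}+Y^{60-10i}),$$ where $$e_1=\tfrac{\zeta_4}{134761}(58964600+a),\quad e_2=\tfrac{-1}{12251}(2094783554-5a),\quad e_3=\tfrac{-5\zeta_4}{134761}(329638533728+241a),$$ $$e_4=\tfrac{35}{12251}(28242591823-34a),\quad e_5=\tfrac{3\zeta_4}{134761}(5100249334348+23195a).$$ Then $\operatorname{Aut}_{\operatorname{red}}(\mathcal{X})$ is isomorphic to $\operatorname{A}_5$ if and only if $d=12\epsilon+20\epsilon'+30\epsilon''+60t$ for some $\epsilon,\epsilon',\epsilon''\in\{0,1\}$ and some integer $t\ge 0$, and, up to $K$-equivalence, $$L_{d,Z}=\mathcal{G}_{12,-11\zeta_4}^{\epsilon}\cdot\mathcal{G}_{20,228\zeta_4,-494}^{\epsilon'}\cdot\mathcal{G}_{30,-522\zeta_4,10005}^{\epsilon''}\cdot\prod_{i=1}^t\mathcal{G}_{60,a_i},$$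 where $a_i\in K$, $a_i\neq 2^2\cdot19\cdot436999$ (when $\epsilon'=1$), $a_i\neq-2^2\cdot9377\cdot5323$ (when $\epsilon''=1$), and $a_i\neq a_j$ for $i\neq j$. In this case (with $L_{d,Z}$ as displayed), $\operatorname{Aut}(\mathcal{X})$, which is a central extension of $\operatorname{A}_5$ by $C_d$, is generated in $\operatorname{PGL}_3(K)$ by $$\rho=\operatorname{diag}(1,1,\zeta_d),\quad \tau=[Y:X:\zeta_{2d}^{\epsilon''}Z],\quad \rho'=\operatorname{diag}(\zeta_5,1,\zeta_{5d}^{\epsilon}),\quad \sigma=\begin{pmatrix}-\frac{1+\sqrt5}{2}&-\zeta_4&0\\ \zeta_4&\frac{1+\sqrt5}{2}&0\\0&0&\nu\end{pmatrix},$$ where $$\nu=\sqrt[d]{(-1)^{\epsilon''}2^{-\epsilon'}5^{3\epsilon+5\epsilon'+7\epsilon''+15t}(9+4\sqrt5)^{\epsilon}(123+55\sqrt5)^{\epsilon'}(1525+682\sqrt5)^{\epsilon''}(930249+416020\sqrt5)^{t}}.$$ Write $d=2^e d_0$ with $d_0$ odd. Then $\operatorname{Aut}(\mathcal{X})\cong C_{d_0}\times G_0$, where $G_0$ is a non-split central extension of $\operatorname{A}_5$ by $C_{2^e}$, and $$G_0\cong\begin{cases}\widetilde{\operatorname{A}}_5&\text{if }e=1,\\ \widetilde{\operatorname{A}}_5\rtimes C_2&\text{if }e=2,\\ \widetilde{\operatorname{A}}_5\,{}^{\bullet}\,C_{2^{e-1}}&\text{if }e\geq3.\end{cases}$$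
   Context: $K$ is an algebraically closed field of characteristic $0$; $X,Y,Z$ are homogeneous coordinates on $\mathbb{P}^2(K)$; $L_{d,Z}(X,Y)$ is a homogeneous polynomial of degree $d$ in $X,Y$. $\zeta_n$ is a fixed primitive $n$th root of unity in $K$, chosen compatibly ($\zeta_{mn}^m=\zeta_n$). An outer Galois point of a plane curve $\mathcal{X}$ is a point $P\notin\mathcal{X}$ such that projection from $P$, $\mathcal{X}\to\mathbb{P}^1$, induces a Galois extension of function fields. $\operatorname{Aut}(\mathcal{X})$ is the full automorphism group of $\mathcal{X}$, viewed as a subgroup of $\operatorname{PGL}_3(K)$. Since $P=(0:0:1)$ is the unique outer Galois point, $\operatorname{Aut}(\mathcal{X})$ lies in $\operatorname{PBD}(2,1)$, the subgroup of $\operatorname{PGL}_3(K)$ of classes of block matrices $\begin{pmatrix}*&*&0\\ *&*&0\\0&0&1\end{pmatrix}$. Let $\Lambda:\operatorname{PBD}(2,1)\to\operatorname{PGL}_2(K)$ be the map taking the upper-left $2\times2$ block. Then $\operatorname{Aut}_{\operatorname{red}}(\mathcal{X}):=\Lambda(\operatorname{Aut}(\mathcal{X}))$, and the kernel of $\Lambda$ on $\operatorname{Aut}(\mathcal{X})$ is $N=\langle\operatorname{diag}(1,1,\zeta_d)\rangle\cong C_d$. "Up to $K$-equivalence" means after a projective linear change of coordinates of $\mathbb{P}^2(K)$. A matrix $A=(a_{ij})\in\operatorname{PGL}_3(K)$ is also written $[a_{11}X+a_{12}Y+a_{13}Z:a_{21}X+a_{22}Y+a_{23}Z:a_{31}X+a_{32}Y+a_{33}Z]$.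 $C_n$ is the cyclic group of order $n$; $\widetilde{\operatorname{A}}_5=\operatorname{SL}_2(\mathbb{F}_5)$ is the binary icosahedral group of order 120. $G\rtimes H$ is a semidirect product with $H$ acting on $G$. $\widetilde{\operatorname{A}}_5\,{}^{\bullet}\,C_{2^{e-1}}$ denotes the non-split extension with normal subgroup $\widetilde{\operatorname{A}}_5$ and quotient $C_{2^{e-1}}$ obtained from $\widetilde{\operatorname{A}}_5$ and a central cyclic group $C_{2^e}$ by amalgamating their common central involution. *)

theory Defs
  imports
    "HOL-Analysis.Determinants"
    "HOL-Algebra.Algebra"
    "HOL-Algebra.Bij"
    "HOL-Algebra.Elementary_Groups"
    "HOL-Algebra.Embedded_Algebras"
    "HOL-Algebra.Generated_Fields"
    "HOL-Algebra.Generated_Groups"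
    "HOL-Algebra.Sym_Groups"
    "HOL-Computational_Algebra.Polynomial"
    "HOL-Library.Numeral_Type"
    "HOL-Library.Poly_Mapping"
begin

section \<open>Multivariate polynomials\<close>

text \<open>
  Polynomials in variables indexed by a finite type \<open>'n\<close>, as finitely supported functions from
  exponent vectors to coefficients; \<^theory>\<open>HOL-Library.Poly_Mapping\<close> provides the ring structure.
\<close>

type_synonym ('n, 'a) mpoly = "('n \<Rightarrow>\<^sub>0 nat) \<Rightarrow>\<^sub>0 'a"

definition Var :: "'n \<Rightarrow> ('n, 'a::comm_ring_1) mpoly" where
  "Var i = Poly_Mapping.single (Poly_Mapping.single i 1) 1"

definition Const :: "'a \<Rightarrow> ('n, 'a::comm_ring_1) mpoly" where
  "Const c = Poly_Mapping.single 0 c"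

definition mp_eval :: "('n::finite, 'a::comm_ring_1) mpoly \<Rightarrow> 'a ^ 'n \<Rightarrow> 'a" where
  "mp_eval p v =
     (\<Sum>m\<in>Poly_Mapping.keys p.
        Poly_Mapping.lookup p m * (\<Prod>i\<in>UNIV. (v $ i) ^ Poly_Mapping.lookup m i))"

definition mp_pderiv :: "'n \<Rightarrow> ('n, 'a::comm_ring_1) mpoly \<Rightarrow> ('n, 'a) mpoly" where
  "mp_pderiv i p =
     (\<Sum>m\<in>Poly_Mapping.keys p.
        Poly_Mapping.single (m - Poly_Mapping.single i 1)
          (of_nat (Poly_Mapping.lookup m i) * Poly_Mapping.lookup p m))"

definition homogeneous :: "nat \<Rightarrow> ('n::finite, 'a::zero) mpoly \<Rightarrow> bool" where
  "homogeneous d p \<longleftrightarrow>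
     (\<forall>m\<in>Poly_Mapping.keys p. (\<Sum>i\<in>UNIV. Poly_Mapping.lookup m i) = d)"

text \<open>
  The homogeneous coordinates \<open>X, Y, Z\<close> are the variables with indices \<open>1, 2, 3\<close> of the type \<open>3\<close>
  (where \<open>3 = 0\<close>), matching the component convention of \<^const>\<open>vector\<close>.
\<close>

abbreviation pX :: "(3, 'a::comm_ring_1) mpoly" where "pX \<equiv> Var 1"
abbreviation pY :: "(3, 'a::comm_ring_1) mpoly" where "pY \<equiv> Var 2"
abbreviation pZ :: "(3, 'a::comm_ring_1) mpoly" where "pZ \<equiv> Var 3"

definition binary_form :: "nat \<Rightarrow> (3, 'a::zero) mpoly \<Rightarrow> bool" where
  "binary_form d L \<longleftrightarrow>
     homogeneous d L \<and> (\<forall>m\<in>Poly_Mapping.keys L. Poly_Mapping.lookup m 3 = 0)"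


section \<open>Projective spaces and projective linear groups\<close>

text \<open>A point of projective space is the set of all its homogeneous coordinate vectors.\<close>

definition proj_point :: "'a::field ^ 'n \<Rightarrow> ('a ^ 'n) set" where
  "proj_point v = {c *s v |c. c \<noteq> 0}"

definition proj_space :: "('a::field ^ 'n) set set" where
  "proj_space = proj_point ` {v. v \<noteq> 0}"

definition GL :: "('a::field ^ 'n ^ 'n) monoid" where
  "GL = \<lparr>carrier = {M. invertible M}, monoid.mult = (**), one = mat 1\<rparr>"

definition scalar_matrices :: "('a::field ^ 'n ^ 'n) set" where
  "scalar_matrices = {mat c |c. c \<noteq> 0}"

definition PGL :: "('a::field ^ 'n ^ 'n) set monoid" where
  "PGL = GL Mod scalar_matrices"

definition pgl_class :: "'a::field ^ 'n ^ 'n \<Rightarrow> ('a ^ 'n ^ 'n) set" where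
  "pgl_class M = scalar_matrices #>\<^bsub>GL\<^esub> M"

text \<open>
  Elements of \<^const>\<open>PGL\<close> and projective points are both sets of representatives, so the action is
  elementwise multiplication.
\<close>

definition pgl_act :: "('a::field ^ 'n ^ 'n) set \<Rightarrow> ('a ^ 'n) set \<Rightarrow> ('a ^ 'n) set" where
  "pgl_act A P = {M *v v |M v. M \<in> A \<and> v \<in> P}"

definition diag3 :: "'a::field \<Rightarrow> 'a \<Rightarrow> 'a \<Rightarrow> 'a ^ 3 ^ 3" where
  "diag3 a b c = vector [vector [a, 0, 0], vector [0, b, 0], vector [0, 0, c]]"


section \<open>Plane curves and their function fields\<close>

definition plane_curve :: "(3, 'a::field) mpoly \<Rightarrow> ('a ^ 3) set set" where
  "plane_curve f = {P \<in> proj_space. \<forall>v\<in>P. mp_eval f v = 0}"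

definition smooth_form :: "(3, 'a::field) mpoly \<Rightarrow> bool" where
  "smooth_form f \<longleftrightarrow>
     (\<forall>v. v \<noteq> 0 \<and> mp_eval f v = 0 \<longrightarrow> (\<exists>i. mp_eval (mp_pderiv i f) v \<noteq> 0))"

text \<open>
  The function field of an irreducible curve \<open>f = 0\<close>: fractions \<open>g / h\<close> of forms of equal degree with
  \<open>h\<close> not vanishing identically on the curve, where \<open>g / h = g' / h'\<close> if \<open>f\<close> divides \<open>g h' - g' h\<close>.
\<close>

definition frac_pairs :: "(3, 'a::field) mpoly \<Rightarrow> ((3, 'a) mpoly \<times> (3, 'a) mpoly) set" where
  "frac_pairs f = {(g, h). (\<exists>n. homogeneous n g \<and> homogeneous n h) \<and> \<not> f dvd h}"

definition frac_rel ::
  "(3, 'a::field) mpoly \<Rightarrow> (((3, 'a) mpoly \<times> (3, 'a) mpoly) \<times> ((3, 'a) mpoly \<times> (3, 'a) mpoly)) set"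
  where
  "frac_rel f =
     {((g, h), (g', h')). (g, h) \<in> frac_pairs f \<and> (g', h') \<in> frac_pairs f \<and> f dvd g * h' - g' * h}"

definition ff_frac ::
  "(3, 'a::field) mpoly \<Rightarrow> (3, 'a) mpoly \<Rightarrow> (3, 'a) mpoly \<Rightarrow> ((3, 'a) mpoly \<times> (3, 'a) mpoly) set"
  where
  "ff_frac f g h = frac_rel f `` {(g, h)}"

definition function_field ::
  "(3, 'a::field) mpoly \<Rightarrow> ((3, 'a) mpoly \<times> (3, 'a) mpoly) set ring" where
  "function_field f =
     \<lparr>carrier = frac_pairs f // frac_rel f,
      mult = (\<lambda>A B. \<Union>(g, h)\<in>A. \<Union>(g', h')\<in>B. ff_frac f (g * g') (h * h')),
      one = ff_frac f 1 1,
      ring.zero = ff_frac f 0 1,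
      ring.add = (\<lambda>A B. \<Union>(g, h)\<in>A. \<Union>(g', h')\<in>B. ff_frac f (g * h' + g' * h) (h * h'))\<rparr>"

text \<open>
  Projection from \<open>P\<close> is \<open>(l : l')\<close> for independent linear forms \<open>l, l'\<close> vanishing at \<open>P\<close>, so the
  function field of the projective line pulls back to the field generated over the constants by
  the quotients of such forms.
\<close>

definition projection_subfield ::
  "(3, 'a::field) mpoly \<Rightarrow> ('a ^ 3) set \<Rightarrow> ((3, 'a) mpoly \<times> (3, 'a) mpoly) set set" where
  "projection_subfield f P =
     generate_field (function_field f)
       ({ff_frac f (Const c) 1 |c. True} \<union>
        {ff_frac f l l' |l l'. homogeneous 1 l \<and> homogeneous 1 l' \<and> \<not> f dvd l' \<and>
           (\<forall>v\<in>P. mp_eval l v = 0 \<and> mp_eval l' v = 0)})"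

definition galois_extension :: "('b, 'c) ring_scheme \<Rightarrow> 'b set \<Rightarrow> bool" where
  "galois_extension E F \<longleftrightarrow>
     field E \<and> subfield F E \<and> ring.finite_dimension E F (carrier E) \<and>
     {x \<in> carrier E. \<forall>s\<in>ring_iso E E. (\<forall>y\<in>F. s y = y) \<longrightarrow> s x = x} = F"

definition outer_galois_points :: "(3, 'a::field) mpoly \<Rightarrow> ('a ^ 3) set set" where
  "outer_galois_points f =
     {P \<in> proj_space. P \<notin> plane_curve f \<and>
        galois_extension (function_field f) (projection_subfield f P)}"


section \<open>Automorphism groups\<close>

definition Aut :: "(3, 'a::field) mpoly \<Rightarrow> ('a ^ 3 ^ 3) set monoid" where
  "Aut f = PGL\<lparr>carrier := {A \<in> carrier PGL. pgl_act A ` plane_curve f = plane_curve f}\<rparr>"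

definition upper_left_block :: "'a ^ 3 ^ 3 \<Rightarrow> 'a::zero ^ 2 ^ 2" where
  "upper_left_block M = vector [vector [M $ 1 $ 1, M $ 1 $ 2], vector [M $ 2 $ 1, M $ 2 $ 2]]"

definition PBD21 :: "('a::field ^ 3 ^ 3) set set" where
  "PBD21 = {pgl_class M |M. invertible M \<and>
      M $ 1 $ 3 = 0 \<and> M $ 2 $ 3 = 0 \<and> M $ 3 $ 1 = 0 \<and> M $ 3 $ 2 = 0 \<and> M $ 3 $ 3 = 1}"

text \<open>
  Taking the block of every representative of a class in \<^const>\<open>PBD21\<close> gives precisely the class
  in \<open>PGL\<^sub>2\<close> of the block of any one representative.
\<close>

definition Lambda :: "('a::field ^ 3 ^ 3) set \<Rightarrow> ('a ^ 2 ^ 2) set" where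
  "Lambda = (\<lambda>A\<in>PBD21. upper_left_block ` A)"

definition Aut_red :: "(3, 'a::field) mpoly \<Rightarrow> ('a ^ 2 ^ 2) set monoid" where
  "Aut_red f = PGL\<lparr>carrier := Lambda ` carrier (Aut f)\<rparr>"

definition proj_equivalent :: "(3, 'a::field) mpoly \<Rightarrow> (3, 'a) mpoly \<Rightarrow> bool" where
  "proj_equivalent f g \<longleftrightarrow> (\<exists>A\<in>carrier PGL. pgl_act A ` plane_curve f = plane_curve g)"


section \<open>Abstract groups\<close>

text \<open>The numeral type \<open>5\<close> with its ring structure is the field of integers modulo \<open>5\<close>.\<close>

definition SL2_F5 :: "(5 ^ 2 ^ 2) monoid" where
  "SL2_F5 = \<lparr>carrier = {M. det M = 1}, monoid.mult = (**), one = mat 1\<rparr>"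

definition group_extension ::
  "('e, 'm) monoid_scheme \<Rightarrow> ('n, 'o) monoid_scheme \<Rightarrow> ('q, 'p) monoid_scheme \<Rightarrow>
     ('n \<Rightarrow> 'e) \<Rightarrow> ('e \<Rightarrow> 'q) \<Rightarrow> bool" where
  "group_extension E N Q \<iota> \<pi> \<longleftrightarrow>
     group E \<and> group N \<and> group Q \<and> \<iota> \<in> mon N E \<and> \<pi> \<in> epi E Q \<and> kernel E Q \<pi> = \<iota> ` carrier N"

definition central_map :: "('e, 'm) monoid_scheme \<Rightarrow> ('n, 'o) monoid_scheme \<Rightarrow> ('n \<Rightarrow> 'e) \<Rightarrow> bool" where
  "central_map E N \<iota> \<longleftrightarrow> (\<forall>n\<in>carrier N. \<forall>x\<in>carrier E. \<iota> n \<otimes>\<^bsub>E\<^esub> x = x \<otimes>\<^bsub>E\<^esub> \<iota> n)"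

definition has_section :: "('e, 'm) monoid_scheme \<Rightarrow> ('q, 'p) monoid_scheme \<Rightarrow> ('e \<Rightarrow> 'q) \<Rightarrow> bool" where
  "has_section E Q \<pi> \<longleftrightarrow> (\<exists>s\<in>hom Q E. \<forall>q\<in>carrier Q. \<pi> (s q) = q)"

text \<open>In these predicates \<open>N\<close> is the normal subgroup and \<open>Q\<close> the quotient.\<close>

definition is_central_extension ::
  "('e, 'm) monoid_scheme \<Rightarrow> ('n, 'o) monoid_scheme \<Rightarrow> ('q, 'p) monoid_scheme \<Rightarrow> bool" where
  "is_central_extension E N Q \<longleftrightarrow> (\<exists>\<iota> \<pi>. group_extension E N Q \<iota> \<pi> \<and> central_map E N \<iota>)"

definition is_nonsplit_central_extension ::
  "('e, 'm) monoid_scheme \<Rightarrow> ('n, 'o) monoid_scheme \<Rightarrow> ('q, 'p) monoid_scheme \<Rightarrow> bool" where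
  "is_nonsplit_central_extension E N Q \<longleftrightarrow>
     (\<exists>\<iota> \<pi>. group_extension E N Q \<iota> \<pi> \<and> central_map E N \<iota> \<and> \<not> has_section E Q \<pi>)"

definition is_nonsplit_extension ::
  "('e, 'm) monoid_scheme \<Rightarrow> ('n, 'o) monoid_scheme \<Rightarrow> ('q, 'p) monoid_scheme \<Rightarrow> bool" where
  "is_nonsplit_extension E N Q \<longleftrightarrow> (\<exists>\<iota> \<pi>. group_extension E N Q \<iota> \<pi> \<and> \<not> has_section E Q \<pi>)"

definition semidirect_product ::
  "('n, 'm) monoid_scheme \<Rightarrow> ('h, 'o) monoid_scheme \<Rightarrow> ('h \<Rightarrow> 'n \<Rightarrow> 'n) \<Rightarrow> ('n \<times> 'h) monoid" where
  "semidirect_product N H \<phi> =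
     \<lparr>carrier = carrier N \<times> carrier H,
      monoid.mult = (\<lambda>(n, h) (n', h'). (n \<otimes>\<^bsub>N\<^esub> \<phi> h n', h \<otimes>\<^bsub>H\<^esub> h')),
      one = (\<one>\<^bsub>N\<^esub>, \<one>\<^bsub>H\<^esub>)\<rparr>"

text \<open>
  The central product of the binary icosahedral group and \<open>C\<^bsub>2^e\<^esub>\<close>: the involutions \<open>-1\<close> and
  \<open>2^(e-1)\<close> (the group \<^const>\<open>integer_mod_group\<close> being additive) are identified.
\<close>

definition SL2_F5_amalgam :: "nat \<Rightarrow> ((5 ^ 2 ^ 2) \<times> int) set monoid" where
  "SL2_F5_amalgam e =
     (SL2_F5 \<times>\<times> integer_mod_group (2 ^ e)) Mod {(mat 1, 0), (mat (-1), 2 ^ (e - 1))}"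


section \<open>Roots of unity and the invariant forms\<close>

definition primitive_root_of_unity :: "nat \<Rightarrow> 'a::field \<Rightarrow> bool" where
  "primitive_root_of_unity n z \<longleftrightarrow> z ^ n = 1 \<and> (\<forall>k. 0 < k \<and> k < n \<longrightarrow> z ^ k \<noteq> 1)"

definition compatible_roots :: "(nat \<Rightarrow> 'a::field) \<Rightarrow> bool" where
  "compatible_roots \<zeta> \<longleftrightarrow>
     (\<forall>n>0. primitive_root_of_unity n (\<zeta> n)) \<and> (\<forall>m>0. \<forall>n>0. \<zeta> (m * n) ^ m = \<zeta> n)"

definition G12 :: "'a::field \<Rightarrow> (3, 'a) mpoly" where
  "G12 a = pX * pY * (pX ^ 10 + Const a * (pX * pY) ^ 5 + pY ^ 10)"

definition G30 :: "'a::field \<Rightarrow> 'a \<Rightarrow> (3, 'a) mpoly" where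
  "G30 b c = (pX ^ 30 - pY ^ 30) + Const b * (pX * pY) ^ 5 * (pX ^ 20 - pY ^ 20)
     + Const c * (pX * pY) ^ 10 * (pX ^ 10 - pY ^ 10)"

definition G20 :: "'a::field \<Rightarrow> 'a \<Rightarrow> (3, 'a) mpoly" where
  "G20 u v = (pX ^ 20 + pY ^ 20) + Const u * (pX * pY) ^ 5 * (pX ^ 10 + pY ^ 10)
     + Const v * (pX * pY) ^ 10"

text \<open>The coefficients \<open>e\<^sub>1, \<dots>, e\<^sub>5\<close> of the form of degree 60; \<open>i4\<close> stands for \<open>\<zeta>\<^sub>4\<close>.\<close>

definition e60 :: "'a::field \<Rightarrow> 'a \<Rightarrow> nat \<Rightarrow> 'a" where
  "e60 i4 a i =
     (if i = 1 then i4 / 134761 * (58964600 + a)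
      else if i = 2 then - 1 / 12251 * (2094783554 - 5 * a)
      else if i = 3 then - 5 * i4 / 134761 * (329638533728 + 241 * a)
      else if i = 4 then 35 / 12251 * (28242591823 - 34 * a)
      else if i = 5 then 3 * i4 / 134761 * (5100249334348 + 23195 * a)
      else 0)"

definition G60 :: "'a::field \<Rightarrow> 'a \<Rightarrow> (3, 'a) mpoly" where
  "G60 i4 a = pX ^ 60 + pY ^ 60 + Const a * (pX * pY) ^ 30
     + (\<Sum>i=1..5. Const (e60 i4 a i) * (pX * pY) ^ (5 * i)
          * (pX ^ (60 - 10 * i) + pY ^ (60 - 10 * i)))"

text \<open>
  In the following, \<open>\<epsilon>\<^sub>1, \<epsilon>\<^sub>2, \<epsilon>\<^sub>3\<close> are the exponents of the forms of degree 12, 20, 30, and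
  \<open>a 1, \<dots>, a t\<close> are the parameters of the forms of degree 60.
\<close>

definition A5_form ::
  "'a::field \<Rightarrow> nat \<Rightarrow> nat \<Rightarrow> nat \<Rightarrow> nat \<Rightarrow> (nat \<Rightarrow> 'a) \<Rightarrow> (3, 'a) mpoly" where
  "A5_form i4 \<epsilon>\<^sub>1 \<epsilon>\<^sub>2 \<epsilon>\<^sub>3 t a =
     G12 (- 11 * i4) ^ \<epsilon>\<^sub>1 * G20 (228 * i4) (- 494) ^ \<epsilon>\<^sub>2 * G30 (- 522 * i4) 10005 ^ \<epsilon>\<^sub>3
       * (\<Prod>i=1..t. G60 i4 (a i))"

definition A5_parameters ::
  "nat \<Rightarrow> nat \<Rightarrow> nat \<Rightarrow> nat \<Rightarrow> nat \<Rightarrow> (nat \<Rightarrow> 'a::field) \<Rightarrow> bool" where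
  "A5_parameters d \<epsilon>\<^sub>1 \<epsilon>\<^sub>2 \<epsilon>\<^sub>3 t a \<longleftrightarrow>
     \<epsilon>\<^sub>1 \<in> {0, 1} \<and> \<epsilon>\<^sub>2 \<in> {0, 1} \<and> \<epsilon>\<^sub>3 \<in> {0, 1} \<and>
     d = 12 * \<epsilon>\<^sub>1 + 20 * \<epsilon>\<^sub>2 + 30 * \<epsilon>\<^sub>3 + 60 * t \<and>
     (\<forall>i\<in>{1..t}. (\<epsilon>\<^sub>2 = 1 \<longrightarrow> a i \<noteq> 2 ^ 2 * 19 * 436999) \<and>
                  (\<epsilon>\<^sub>3 = 1 \<longrightarrow> a i \<noteq> - (2 ^ 2 * 9377 * 5323))) \<and>
     (\<forall>i\<in>{1..t}. \<forall>j\<in>{1..t}. i \<noteq> j \<longrightarrow> a i \<noteq> a j)"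

end

theory Submission
  imports Defs
begin

text \<open>
  An isomorphism between two of these curves carries outer Galois points to outer Galois points, so
  the automorphisms fix \<open>(0:0:1)\<close> and are block matrices, and the reduced automorphism group is the
  stabiliser in \<open>PGL\<^sub>2\<close> of the binary form up to scalars. A subgroup of \<open>PGL\<^sub>2\<close> isomorphic to \<open>A\<^sub>5\<close> is
  brought into the normal form of Klein by diagonalising an element of order five, and the Bruhat
  decomposition of \<open>SL\<^sub>2\<close> over the field with five elements yields its lift to \<open>SL\<^sub>2\<close> of the ground
  field. Counting fixed points on the projective line shows that the orbits of this subgroup have 12, 20,
  30 or 60 elements and that no finite subgroup contains it properly. The zeros of the form, which are
  distinct because the curve is smooth, are therefore a union of the three exceptional orbits and of
  regular orbits; the latter are the zeros of the members of the pencil spanned by the cube of the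
  form of degree 20 and the fifth power of the form of degree 12. The linear group that preserves the form is the product of the lift with the scalar \<open>d\<close>-th roots of unity, and
  the structure of the automorphism group is read off from it.
\<close>

text \<open>Maximality of the icosahedral group comes from counting alone: the hypotheses of the
  orbit count (no orbit of at most two points, some stabiliser of order divisible by 5) hold for
  every finite subgroup of PGL_2 containing two fixed generators, so all these subgroups have order
  60. Uniqueness of the outer Galois point is known for the given curve only. On the far side of a
  projective equivalence the image of that point has to be located; it is fixed by the known
  automorphisms of the normal form, and these have (0:0:1) as their only common fixed point. The
  parameter of a form of degree 60 is its coefficient of \<open>(XY)^30\<close>. This coefficient is
  33211924 in the cube of the form of degree 20 and \<open>-134761 i\<close> in the fifth power of
  the form of degree 12, with \<open>i\<close> for \<open>\<zeta> 4\<close>; hence the denominators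
  134761 and 12251 = 134761 / 11. The excluded parameters belong to that cube and to the square of
  the form of degree 30. All degrees are even, so -1 is a scalar \<open>d\<close>-th root of unity,
  and the product of the scalars with the lift is amalgamated over -1.\<close>

lemma card_le_two_fixed:
  assumes "inj_on f A" "f ` A \<subseteq> A" "finite A" "card A \<le> 2" "x \<in> A"
  shows "f (f x) = x"
proof (rule ccontr)
  assume ne: "f (f x) \<noteq> x"
  have fx: "f x \<in> A" "f (f x) \<in> A" using assms by auto
  have "f x \<noteq> x" using ne by auto
  moreover have "f (f x) \<noteq> f x" using assms(1,5) fx \<open>f x \<noteq> x\<close> by (auto dest: inj_onD)
  ultimately have "card {x, f x, f (f x)} = 3" using ne by auto
  moreover have "card {x, f x, f (f x)} \<le> card A"
    using assms fx by (intro card_mono) auto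
  ultimately show False using assms by auto
qed

section \<open>Orbit counting for finite groups whose nontrivial elements have two fixed
  points\<close>

text \<open>Here \<open>a\<close>, \<open>b\<close>, \<open>c\<close> are orbit lengths and
  \<open>x\<close>, \<open>y\<close>, \<open>z\<close> the orders of the stabilisers, so
  \<open>sum\<close> reads \<open>1/x + 1/y + 1/z = 1 + 2/n\<close>, the equation of the spherical
  triangle groups. The bound \<open>a \<ge> 3\<close> excludes the dihedral solutions, and
  divisibility by 5 selects (5, 3, 2) among the remaining ones.\<close>

lemma klein_sizes:
  fixes a b c x y z n :: nat
  assumes n: "a * x = n" "b * y = n" "c * z = n" and sum: "a + b + c = n + 2"
    and le: "x \<ge> 2" "y \<ge> 2" "z \<ge> 2" "a \<ge> 3" "a \<le> b" "b \<le> c"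
    and five: "5 dvd x \<or> 5 dvd y \<or> 5 dvd z"
  shows "n = 60" "a = 12" "b = 20" "c = 30"
proof -
  \<comment> \<open>The largest of three numbers with sum \<open>n + 2\<close> exceeds a third of
    \<open>n\<close>, so its cofactor \<open>z\<close> is below 3.\<close>
  have c3: "3 * c \<ge> n + 2" using sum le by linarith
  have "z < 3"
  proof (rule ccontr)
    assume "\<not> z < 3"
    then have "c * 3 \<le> c * z" by simp
    then show False using c3 n by linarith
  qed
  then have z: "z = 2" using le by simp
  have n2: "n = 2 * c" using n z by simp
  have ab: "a + b = c + 2" using sum n2 by simp
  have "y < 4"
  proof (rule ccontr)
    assume "\<not> y < 4"
    then have "b * 4 \<le> b * y" by simp
    then show False using ab n n2 le by linarith
  qed
  then have y: "y = 2 \<or> y = 3" using le by auto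
  \<comment> \<open>The value 2 would give \<open>b = c\<close> and then \<open>a = 2\<close>, the
    dihedral case.\<close>
  have "y \<noteq> 2" using ab n n2 le by auto
  then have y3: "y = 3" using y by simp
  have "x < 6"
  proof (rule ccontr)
    assume "\<not> x < 6"
    then have "a * 6 \<le> a * x" by simp
    moreover have "b * 3 = n" using n y3 by simp
    ultimately show False using ab n n2 le by linarith
  qed
  moreover have "5 dvd x" using five y3 z by auto
  ultimately have "x = 5" using le by (auto simp: dvd_def)
  then show "n = 60" "a = 12" "b = 20" "c = 30"
    using n n2 ab y3 by auto
qed

text \<open>Abstracts what the count uses about a finite subgroup of PGL_2 acting on the projective
  line. The set \<open>E\<close> may be infinite; only the points with nontrivial stabiliser are
  summed over, and these are finite in number.\<close>

locale two_point_action = group G for G :: "('g, 'm) monoid_scheme" (structure) +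
  fixes E :: "'x set" and act :: "'g \<Rightarrow> 'x \<Rightarrow> 'x"
  assumes fin: "finite (carrier G)"
    and act_in: "g \<in> carrier G \<Longrightarrow> x \<in> E \<Longrightarrow> act g x \<in> E"
    and act_one: "x \<in> E \<Longrightarrow> act \<one> x = x"
    and act_mult: "g \<in> carrier G \<Longrightarrow> h \<in> carrier G \<Longrightarrow> x \<in> E \<Longrightarrow> act (g \<otimes> h) x = act g (act h x)"
    and two_fixed: "g \<in> carrier G \<Longrightarrow> g \<noteq> \<one> \<Longrightarrow> card {x \<in> E. act g x = x} = 2"
begin

definition orb :: "'x \<Rightarrow> 'x set" where "orb x = (\<lambda>g. act g x) ` carrier G"
definition stb :: "'x \<Rightarrow> 'g set" where "stb x = {g \<in> carrier G. act g x = x}"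
definition special :: "'x set" where "special = {x \<in> E. stb x \<noteq> {\<one>}}"

lemma act_inv: "g \<in> carrier G \<Longrightarrow> x \<in> E \<Longrightarrow> act (inv g) (act g x) = x"
  by (simp flip: act_mult add: act_one)

lemma act_inv2: "g \<in> carrier G \<Longrightarrow> x \<in> E \<Longrightarrow> act g (act (inv g) x) = x"
  by (simp flip: act_mult add: act_one)

lemma one_stb: "x \<in> E \<Longrightarrow> \<one> \<in> stb x"
  by (simp add: stb_def act_one)

text \<open>The elements of \<open>BijGroup\<close> are extensional, hence the restriction of
  \<open>act\<close> to \<open>E\<close>. The purpose is access to the orbit-stabiliser
  theorem.\<close>

lemma action: "group_action G E (\<lambda>g. restrict (act g) E)"
proof -
  have bij: "restrict (act g) E \<in> Bij E" if g: "g \<in> carrier G" for g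
  proof -
    have "bij_betw (act g) E E"
      by (rule bij_betwI[where g = "act (inv g)"]) (use g in \<open>auto simp: act_in act_inv act_inv2\<close>)
    then show ?thesis by (simp add: Bij_def)
  qed
  interpret B: group "BijGroup E" by (rule group_BijGroup)
  show ?thesis
    apply unfold_locales
    apply (rule homI)
    using bij apply (auto simp: BijGroup_def compose_def act_mult act_in fun_eq_iff restrict_def)
    done
qed

lemma orb_eq: "x \<in> E \<Longrightarrow> orbit G (\<lambda>g. restrict (act g) E) x = orb x"
  by (auto simp: orbit_def orb_def)

lemma orb_stb: assumes "x \<in> E" shows "card (orb x) * card (stb x) = card (carrier G)"
proof -
  interpret A: group_action G E "\<lambda>g. restrict (act g) E" by (rule action)
  have "stabilizer G (\<lambda>g. restrict (act g) E) x = stb x"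
    using assms by (auto simp: stabilizer_def stb_def)
  then show ?thesis using A.orbit_stabilizer_theorem[OF assms] orb_eq[OF assms]
    by (simp add: Coset.order_def)
qed

lemma orb_refl: "x \<in> E \<Longrightarrow> x \<in> orb x"
  unfolding orb_def using act_one by (metis image_eqI one_closed)

lemma orb_sub: "x \<in> E \<Longrightarrow> orb x \<subseteq> E"
  by (auto simp: orb_def act_in)

lemma orb_cong: assumes "x \<in> E" "y \<in> orb x" shows "orb y = orb x"
proof -
  obtain g where g: "g \<in> carrier G" "y = act g x" using assms by (auto simp: orb_def)
  have 1: "orb y \<subseteq> orb x"
  proof
    fix z assume "z \<in> orb y"
    then obtain h where "h \<in> carrier G" "z = act h (act g x)" using g by (auto simp: orb_def)
    then show "z \<in> orb x" using g assms by (auto simp: orb_def simp flip: act_mult)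
  qed
  moreover have "orb x \<subseteq> orb y"
  proof
    fix z assume "z \<in> orb x"
    then obtain h where h: "h \<in> carrier G" "z = act h x" by (auto simp: orb_def)
    have "z = act (h \<otimes> inv g) y" using h g assms by (simp add: act_mult act_in act_inv)
    then show "z \<in> orb y" using h g by (auto simp: orb_def)
  qed
  ultimately show ?thesis by auto
qed

lemma fin_orb: "finite (orb x)"
  by (simp add: orb_def fin)

lemma fin_stb: "finite (stb x)"
  by (simp add: stb_def fin)

lemma n_pos: "card (carrier G) > 0"
  using fin one_closed by (auto simp: card_gt_0_iff)

lemma special_alt: "x \<in> special \<longleftrightarrow> x \<in> E \<and> card (orb x) < card (carrier G)"
proof (cases "x \<in> E")
  case True
  have "stb x \<noteq> {\<one>} \<longleftrightarrow> card (stb x) \<noteq> 1"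
    using one_stb[OF True] by (auto simp: card_1_singleton_iff)
  moreover have "card (stb x) \<noteq> 1 \<longleftrightarrow> card (orb x) < card (carrier G)"
  proof -
    have pos: "card (stb x) > 0" "card (orb x) > 0"
      using one_stb[OF True] orb_refl[OF True] fin_stb fin_orb by (auto simp: card_gt_0_iff)
    obtain k where k: "card (stb x) = Suc k" using pos by (cases "card (stb x)") auto
    show ?thesis using orb_stb[OF True] pos k by (cases k) auto
  qed
  ultimately show ?thesis using True by (simp add: special_def)
qed (simp add: special_def)

lemma special_orb: "x \<in> special \<Longrightarrow> orb x \<subseteq> special"
proof (rule subsetI)
  fix y assume x: "x \<in> special" and y: "y \<in> orb x"
  then have "x \<in> E" by (simp add: special_def)
  then have "orb y = orb x" "y \<in> E" using y orb_cong[of x y] orb_sub[of x] by auto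
  then show "y \<in> special" using x by (simp add: special_alt)
qed

lemma fin_special: "finite special"
proof -
  have "special \<subseteq> (\<Union>g \<in> carrier G - {\<one>}. {x \<in> E. act g x = x})"
    using one_stb by (fastforce simp: special_def stb_def)
  moreover have "finite (\<Union>g \<in> carrier G - {\<one>}. {x \<in> E. act g x = x})"
  proof (rule finite_UN_I)
    fix g assume "g \<in> carrier G - {\<one>}"
    then have "g \<in> carrier G" "g \<noteq> \<one>" by simp_all
    from two_fixed[OF this] show "finite {x \<in> E. act g x = x}" by (intro card_ge_0_finite) linarith
  qed (use fin in simp)
  ultimately show ?thesis by (rule finite_subset)
qed

text \<open>Counting the pairs of a nontrivial group element and one of its fixed points in two ways.\<close>

lemma class_sum:
  "2 * (card (carrier G) - 1) = (\<Sum>Q\<in>orb ` special. card (carrier G) - card Q)"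
proof -
  let ?n = "card (carrier G)"
  have S: "special \<subseteq> E" by (auto simp: special_def)
  have "2 * (?n - 1) = (\<Sum>g\<in>carrier G - {\<one>}. card {x \<in> E. act g x = x})"
    using two_fixed fin by (simp add: card_Diff_subset)
  also have "\<dots> = (\<Sum>g\<in>carrier G - {\<one>}. \<Sum>x\<in>special. if act g x = x then 1 else 0)"
  proof (rule sum.cong)
    fix g assume g: "g \<in> carrier G - {\<one>}"
    have "{x \<in> E. act g x = x} = {x \<in> special. act g x = x}"
      using g by (auto simp: special_def stb_def)
    then show "card {x \<in> E. act g x = x} = (\<Sum>x\<in>special. if act g x = x then 1 else 0)"
      using fin_special by (simp add: sum.inter_filter [symmetric])
  qed simp
  also have "\<dots> = (\<Sum>x\<in>special. \<Sum>g\<in>carrier G - {\<one>}. if act g x = x then 1 else 0)"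
    by (rule sum.swap)
  also have "\<dots> = (\<Sum>x\<in>special. card (stb x) - 1)"
  proof (rule sum.cong)
    fix x assume x: "x \<in> special"
    have "(\<Sum>g\<in>carrier G - {\<one>}. if act g x = x then 1 else 0) = card (stb x - {\<one>})"
    proof -
      have "stb x - {\<one>} = {g \<in> carrier G - {\<one>}. act g x = x}" by (auto simp: stb_def)
      then show ?thesis using fin by (simp add: sum.inter_filter [symmetric])
    qed
    also have "\<dots> = card (stb x) - 1" using one_stb x S fin_stb by (subst card_Diff_subset) auto
    finally show "(\<Sum>g\<in>carrier G - {\<one>}. if act g x = x then 1 else 0) = card (stb x) - 1" .
  qed simp
  \<comment> \<open>Stabiliser orders are constant on an orbit \<open>Q\<close>, so the whole orbit
    contributes \<open>card Q\<close> times (order of stabiliser minus 1), which is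
    \<open>n - card Q\<close>.\<close>
  also have "\<dots> = (\<Sum>Q\<in>orb ` special. \<Sum>x\<in>{x \<in> special. orb x = Q}. card (stb x) - 1)"
    using fin_special by (rule sum.image_gen)
  also have "\<dots> = (\<Sum>Q\<in>orb ` special. ?n - card Q)"
  proof (rule sum.cong)
    fix Q assume "Q \<in> orb ` special"
    then obtain y where y: "y \<in> special" "Q = orb y" by auto
    have yX: "y \<in> E" using y S by auto
    have "{x \<in> special. orb x = Q} = Q"
    proof
      show "{x \<in> special. orb x = Q} \<subseteq> Q" using orb_refl S by auto
      show "Q \<subseteq> {x \<in> special. orb x = Q}"
        unfolding y(2) using orb_cong[OF yX] special_orb[OF y(1)] by auto
    qed
    moreover have "card (stb x) - 1 = card (stb y) - 1" if x: "x \<in> Q" for x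
    proof -
      have "x \<in> E" "orb x = orb y" using x y orb_cong[OF yX] orb_sub[OF yX] by auto
      then have "card (orb y) * card (stb x) = card (orb y) * card (stb y)"
        using orb_stb[OF yX] orb_stb[of x] by simp
      moreover have "card (orb y) \<noteq> 0" using orb_refl[OF yX] fin_orb[of y] by auto
      ultimately show ?thesis by simp
    qed
    ultimately have "(\<Sum>x\<in>{x \<in> special. orb x = Q}. card (stb x) - 1) = card Q * (card (stb y) - 1)"
      by simp
    also have "\<dots> = ?n - card Q" using orb_stb[OF yX] y by (simp add: diff_mult_distrib2)
    finally show "(\<Sum>x\<in>{x \<in> special. orb x = Q}. card (stb x) - 1) = ?n - card Q" .
  qed simp
  finally show ?thesis .
qed

text \<open>Special orbits satisfy \<open>3 \<le> card Q \<le> n / 2\<close>, so by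
  \<open>class_sum\<close> their number \<open>r\<close> obeys both
  \<open>2 (n - 1) \<le> r (n - 3)\<close> and \<open>r n / 2 \<le> 2 (n - 1)\<close>. This leaves
  \<open>r = 3\<close>, and \<open>klein_sizes\<close> does the rest. That the order 60 is part of
  the conclusion is what later rules out larger finite groups.\<close>

theorem icosahedral_orbits:
  assumes big: "\<And>x. x \<in> E \<Longrightarrow> card (orb x) > 2"
    and five: "y \<in> E" "5 dvd card (stb y)"
  obtains x12 x20 x30 where "card (carrier G) = 60" "x12 \<in> E" "x20 \<in> E" "x30 \<in> E"
    "card (orb x12) = 12" "card (orb x20) = 20" "card (orb x30) = 30"
    "\<And>x. x \<in> E \<Longrightarrow> card (orb x) = 60 \<or> orb x = orb x12 \<or> orb x = orb x20 \<or> orb x = orb x30"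
proof -
  note result = that
  let ?n = "card (carrier G)" and ?O = "orb ` special"
  have SX: "special \<subseteq> E" by (auto simp: special_def)
  have fO: "finite ?O" using fin_special by simp
  have y: "card (stb y) \<ge> 5" using five fin_stb[of y] one_stb[of y]
    by (metis card_gt_0_iff dvd_imp_le empty_iff)
  have ys: "y \<in> special" using y five by (auto simp: special_def)
  have half: "\<exists>e. card Q * e = ?n \<and> e \<ge> 2 \<and> card Q \<ge> 3" if Q: "Q \<in> ?O" for Q
  proof -
    obtain x where x: "x \<in> special" "Q = orb x" using Q by auto
    have xX: "x \<in> E" using x SX by auto
    have "card (orb x) < ?n" using x special_alt by auto
    with orb_stb[OF xX] n_pos have "card (stb x) \<noteq> 0" "card (stb x) \<noteq> 1"
      by (metis mult_0_right less_irrefl, metis mult.right_neutral less_irrefl)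
    then have "card (stb x) \<ge> 2" by linarith
    then show ?thesis using orb_stb[OF xX] big[OF xX] x by auto
  qed
  have n3: "?n \<ge> 6" using half[of "orb y"] ys
  proof -
    obtain e where "card (orb y) * e = ?n" "e \<ge> 2" "card (orb y) \<ge> 3" using half[of "orb y"] ys by auto
    then show ?thesis using mult_le_mono[of 3 "card (orb y)" 2 e] by simp
  qed
  have half': "2 * card Q \<le> ?n" "card Q \<ge> 3" if Q: "Q \<in> ?O" for Q
  proof -
    obtain e where e: "card Q * e = ?n" "e \<ge> 2" "card Q \<ge> 3" using half[OF Q] by auto
    then show "2 * card Q \<le> ?n" using mult_le_mono2[of 2 e "card Q"] by simp
    show "card Q \<ge> 3" by (rule e)
  qed
  have "(\<Sum>Q\<in>?O. ?n - card Q) \<le> (\<Sum>Q\<in>?O. ?n - 3)"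
    by (rule sum_mono) (use half' in force)
  then have "2 * (?n - 1) \<le> card ?O * (?n - 3)" using class_sum by simp
  then have c3: "card ?O \<ge> 3"
  proof (rule contrapos_pp)
    assume "\<not> card ?O \<ge> 3"
    then have "card ?O * (?n - 3) \<le> 2 * (?n - 3)" by simp
    then show "\<not> 2 * (?n - 1) \<le> card ?O * (?n - 3)" using n3 by linarith
  qed
  have "(\<Sum>Q\<in>?O. ?n) \<le> (\<Sum>Q\<in>?O. 2 * (?n - card Q))"
    by (rule sum_mono) (use half' in force)
  then have "card ?O * ?n \<le> 2 * (2 * (?n - 1))" unfolding class_sum by (simp flip: sum_distrib_left)
  then have "card ?O < 4"
  proof (rule contrapos_pp)
    assume "\<not> card ?O < 4"
    then have "4 * ?n \<le> card ?O * ?n" by simp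
    then show "\<not> card ?O * ?n \<le> 2 * (2 * (?n - 1))" using n3 by linarith
  qed
  with c3 have "card ?O = 3" by simp
  then obtain A B C where O: "?O = {A, B, C}" and ne: "A \<noteq> B" "B \<noteq> C" "A \<noteq> C"
    by (auto simp: card_3_iff)
  \<comment> \<open>The three special orbits arrive unordered. Proving the goal for an arbitrary
    labelling by increasing length makes each of the six possible orders an instance.\<close>
  have step: thesis if O: "?O = {A, B, C}" and ne: "A \<noteq> B" "B \<noteq> C" "A \<noteq> C"
     and le: "card A \<le> card B" "card B \<le> card C" for A B C
  proof -
    obtain a where a: "a \<in> special" "A = orb a" using O by (metis imageE insertI1)
    obtain b where b: "b \<in> special" "B = orb b" using O by (metis imageE insertI1 insert_commute)
    obtain c where c: "c \<in> special" "C = orb c" using O by (metis imageE insertI1 insert_commute)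
    have E: "a \<in> E" "b \<in> E" "c \<in> E" using a b c SX by auto
    have ge: "card (stb x) \<ge> 2" if x: "x \<in> special" for x
    proof -
      have xX: "x \<in> E" and "card (orb x) < ?n" using x special_alt by auto
      with orb_stb[OF xX] n_pos have "card (stb x) \<noteq> 0" "card (stb x) \<noteq> 1"
      by (metis mult_0_right less_irrefl, metis mult.right_neutral less_irrefl)
      then show ?thesis by linarith
    qed
    have eqst: "card (stb x) = card (stb z)" if x: "x \<in> E" "z \<in> E" "orb x = orb z" for x z
    proof -
      have "card (orb x) * card (stb x) = card (orb x) * card (stb z)"
        using orb_stb[OF x(1)] orb_stb[OF x(2)] x by simp
      then show ?thesis using big[OF x(1)] by simp
    qed
    have "orb y \<in> {A, B, C}" using ys O by blast
    then have "orb y = orb a \<or> orb y = orb b \<or> orb y = orb c" using a b c by simp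
    then have five': "5 dvd card (stb a) \<or> 5 dvd card (stb b) \<or> 5 dvd card (stb c)"
      using five(2) eqst[OF five(1) E(1)] eqst[OF five(1) E(2)] eqst[OF five(1) E(3)] by metis
    have sm: "card A + card B + card C = ?n + 2"
    proof -
      have "2 * (?n - 1) = (?n - card A) + (?n - card B) + (?n - card C)"
        unfolding class_sum O using ne by (simp add: add.assoc)
      moreover have "2 * card A \<le> ?n" "2 * card B \<le> ?n" "2 * card C \<le> ?n" using half' O by auto
      ultimately show ?thesis using n3 by linarith
    qed
    note K = klein_sizes[OF orb_stb[OF E(1)] orb_stb[OF E(2)] orb_stb[OF E(3)]]
    have K4: "?n = 60" "card A = 12" "card B = 20" "card C = 30"
      using K[OF _ ge[OF a(1)] ge[OF b(1)] ge[OF c(1)] _ _ _ five'] sm le half'[of A] O a b c by auto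
    show thesis
    proof (rule result[of a b c])
      fix x assume x: "x \<in> E"
      show "card (orb x) = 60 \<or> orb x = orb a \<or> orb x = orb b \<or> orb x = orb c"
      proof (cases "x \<in> special")
        case True
        then have "orb x \<in> {A, B, C}" using O by blast
        then show ?thesis using a b c by auto
      next
        case False
        then have "\<not> card (orb x) < ?n" using x special_alt by auto
        moreover have "card (orb x) \<le> ?n" unfolding orb_def by (rule card_image_le) (rule fin)
        ultimately show ?thesis using K4 by simp
      qed
    qed (use K4 E a b c in auto)
  qed
  consider "card A \<le> card B" "card B \<le> card C" | "card A \<le> card C" "card C \<le> card B"
    | "card B \<le> card A" "card A \<le> card C" | "card B \<le> card C" "card C \<le> card A"
    | "card C \<le> card A" "card A \<le> card B" | "card C \<le> card B" "card B \<le> card A" by linarith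
  then show thesis
  proof cases
    case 1 show thesis by (rule step[OF O ne 1])
  next
    case 2
    have "{A, B, C} = {A, C, B}" by auto
    with O have "?O = {A, C, B}" by simp
    from step[OF this _ _ _ 2] ne show thesis by metis
  next
    case 3
    have "{A, B, C} = {B, A, C}" by auto
    with O have "?O = {B, A, C}" by simp
    from step[OF this _ _ _ 3] ne show thesis by metis
  next
    case 4
    have "{A, B, C} = {B, C, A}" by auto
    with O have "?O = {B, C, A}" by simp
    from step[OF this _ _ _ 4] ne show thesis by metis
  next
    case 5
    have "{A, B, C} = {C, A, B}" by auto
    with O have "?O = {C, A, B}" by simp
    from step[OF this _ _ _ 5] ne show thesis by metis
  next
    case 6
    have "{A, B, C} = {C, B, A}" by auto
    with O have "?O = {C, B, A}" by simp
    from step[OF this _ _ _ 6] ne show thesis by metis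
  qed
qed

end

section \<open>SL_2 over the field with five elements and homomorphisms out of it\<close>

text \<open>Reduces statements about the field with five elements to finitely many numeral
  computations, which \<open>red5\<close> then evaluates.\<close>

lemma forall_5: "(\<forall>x::5. P x) \<longleftrightarrow> P 0 \<and> P 1 \<and> P 2 \<and> P 3 \<and> P 4"
proof
  assume P: "P 0 \<and> P 1 \<and> P 2 \<and> P 3 \<and> P 4"
  show "\<forall>x. P x"
  proof
    fix x :: 5
    obtain z where z: "x = of_int z" "0 \<le> z" "z < 5" by (cases x) auto
    then have "z = 0 \<or> z = 1 \<or> z = 2 \<or> z = 3 \<or> z = 4" by auto
    then show "P x" using z P by auto
  qed
qed auto

lemma red5 [simp]:
  "(5::5) = 0" "(6::5) = 1" "(7::5) = 2" "(8::5) = 3" "(9::5) = 4" "(12::5) = 2" "(16::5) = 1" "(27::5) = 2" "(64::5) = 4"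
  "(- 1 ::5) = 4" "(- 2 ::5) = 3" "(- 3 ::5) = 2" "(- 4 ::5) = 1"
  by simp_all

lemma ne5 [simp]: "(1::5) \<noteq> 0" "(0::5) \<noteq> 1"
   by simp_all

text \<open>The representative between 0 and 4, for use as an exponent of an element of order
  five.\<close>

definition e5 :: "5 \<Rightarrow> nat" where
  "e5 t = (if t = 0 then 0 else if t = 1 then 1 else if t = 2 then 2 else if t = 3 then 3 else 4)"

lemma e5_simps [simp]: "e5 0 = 0" "e5 1 = 1" "e5 2 = 2" "e5 3 = 3" "e5 4 = 4"
  by (simp_all add: e5_def)

definition m2 :: "'a \<Rightarrow> 'a \<Rightarrow> 'a \<Rightarrow> 'a \<Rightarrow> 'a::zero^2^2" where
  "m2 a b c d = vector [vector [a, b], vector [c, d]]"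

lemma m2_nth [simp]: "m2 a b c d $ 1 $ 1 = a" "m2 a b c d $ 1 $ 2 = b" "m2 a b c d $ 2 $ 1 = c" "m2 a b c d $ 2 $ 2 = d"
  by (simp_all add: m2_def)

lemma m2_cases: obtains a b c d where "M = m2 a b c d"
proof
  show "M = m2 (M$1$1) (M$1$2) (M$2$1) (M$2$2)" by (simp add: vec_eq_iff forall_2)
qed

lemma m2_eq [simp]: "m2 a b c d = m2 a' b' c' d' \<longleftrightarrow> a = a' \<and> b = b' \<and> c = c' \<and> d = d'"
  by (auto simp: vec_eq_iff forall_2)

lemma m2_mult: "m2 a b c d ** m2 a' b' c' d' =
    m2 (a * a' + b * c') (a * b' + b * d') (c * a' + d * c') (c * b' + d * (d'::'a::comm_ring_1))"
  by (simp add: vec_eq_iff forall_2 matrix_matrix_mult_def sum_2)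

lemma m2_one: "mat 1 = m2 1 0 0 (1::'a::comm_ring_1)" and m2_minus_one: "mat (-1) = m2 (-1) 0 0 (-1::'a::comm_ring_1)"
  by (simp_all add: vec_eq_iff forall_2 mat_def)

lemma m2_det: "det (m2 a b c d) = a * d - b * (c::'a::comm_ring_1)"
  by (simp add: det_2)

lemma SL2_carrier: "m2 a b c d \<in> carrier SL2_F5 \<longleftrightarrow> a * d - b * c = 1"
  by (simp add: SL2_F5_def m2_det)

lemma SL2_mult: "g \<otimes>\<^bsub>SL2_F5\<^esub> h = g ** h" and SL2_one: "\<one>\<^bsub>SL2_F5\<^esub> = m2 1 0 0 1"
  by (simp_all add: SL2_F5_def m2_one)

lemma SL2_group: "group SL2_F5"
proof (rule groupI)
  fix x assume "x \<in> carrier SL2_F5"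
  moreover obtain a b c d where x: "x = m2 a b c d" by (rule m2_cases)
  ultimately show "\<exists>y\<in>carrier SL2_F5. y \<otimes>\<^bsub>SL2_F5\<^esub> x = \<one>\<^bsub>SL2_F5\<^esub>"
    by (intro bexI[of _ "m2 d (-b) (-c) a"])
      (simp_all add: SL2_carrier SL2_mult SL2_one m2_mult algebra_simps)
qed (auto simp: SL2_F5_def det_mul matrix_mul_assoc)

text \<open>Fermat's \<open>c^4 = 1\<close>. From here on \<open>c^3\<close> is the way the inverse
  of \<open>c\<close> is written.\<close>

lemma inv5: "c \<noteq> 0 \<Longrightarrow> c * c ^ 3 = (1::5)"
proof -
  have "\<forall>c::5. c \<noteq> 0 \<longrightarrow> c * c ^ 3 = 1" unfolding forall_5 by simp
  then show "c \<noteq> 0 \<Longrightarrow> c * c ^ 3 = 1" by auto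
qed

lemma mult5_eq_0: "a * b = 0 \<longleftrightarrow> a = 0 \<or> b = (0::5)"
proof -
  have "\<forall>a b::5. a * b = 0 \<longleftrightarrow> a = 0 \<or> b = 0" unfolding forall_5 by simp
  then show ?thesis by auto
qed

lemma neg5: "- x = 4 * (x::5)"
proof -
  have "- x = (- 1) * x" by simp
  also have "\<dots> = 4 * x" by (simp only: red5)
  finally show ?thesis .
qed

text \<open>\<open>D\<close>, \<open>T\<close>, \<open>W\<close>, \<open>Z\<close> stand for the
  images of (1 1; 0 1), diag(2, 3), (0 -1; 1 0) and -1. The relations are those that bring a product
  of two Bruhat cells back into normal form: with upper unipotent \<open>u(t)\<close>, diagonal
  \<open>h(a)\<close> and Weyl element \<open>w\<close>, the axioms \<open>R1\<close> to
  \<open>R4\<close> are the instances 1, 2, 3, 4 for \<open>x\<close> of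
  \<open>u(1/x) w u(x) w = w u(-x) h(x)\<close>. Interpretations in the alternating group and in
  GL_2 yield both homomorphisms out of SL_2(F_5) from one proof.\<close>

locale bruhat = group G for G (structure) +
  fixes D T W Z
  assumes closed [simp]: "D \<in> carrier G" "T \<in> carrier G" "W \<in> carrier G" "Z \<in> carrier G"
    and D5: "D [^] (5::nat) = \<one>" and TT: "T \<otimes> T = Z" and WW: "W \<otimes> W = Z" and ZZ: "Z \<otimes> Z = \<one>"
    and TD: "T \<otimes> D = D [^] (4::nat) \<otimes> T" and TW: "T \<otimes> W = W \<otimes> (Z \<otimes> T)"
    and R1: "D \<otimes> W \<otimes> D \<otimes> W = W \<otimes> D [^] (4::nat)"
    and R2: "D [^] (3::nat) \<otimes> W \<otimes> D [^] (2::nat) \<otimes> W = W \<otimes> D [^] (3::nat) \<otimes> T"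
    and R3: "D [^] (2::nat) \<otimes> W \<otimes> D [^] (3::nat) \<otimes> W = W \<otimes> D [^] (2::nat) \<otimes> (Z \<otimes> T)"
    and R4: "D [^] (4::nat) \<otimes> W \<otimes> D [^] (4::nat) \<otimes> W = W \<otimes> D \<otimes> Z"
begin

definition U :: "5 \<Rightarrow> 'a" where "U t = D [^] e5 t"
definition H :: "5 \<Rightarrow> 'a" where
  "H a = (if a = 1 then \<one> else if a = 2 then T else if a = 3 then Z \<otimes> T else Z)"

text \<open>Read through the Bruhat decomposition: (a b; c d) equals \<open>u(ab) h(a)\<close> for
  \<open>c = 0\<close> and \<open>u(a/c) w h(c) u(d/c)\<close> otherwise, with cubes in place of
  inverses.\<close>

definition hom2 :: "5^2^2 \<Rightarrow> 'a" where
  "hom2 g = (if g$2$1 = 0 then U (g$1$1 * g$1$2) \<otimes> H (g$1$1)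
     else U (g$1$1 * (g$2$1)^3) \<otimes> W \<otimes> H (g$2$1) \<otimes> U ((g$2$1)^3 * g$2$2))"

lemma U_closed [simp]: "U t \<in> carrier G" and H_closed [simp]: "H t \<in> carrier G"
  by (simp_all add: U_def H_def)

lemma hom2_closed [simp]: "hom2 g \<in> carrier G"
  by (simp add: hom2_def)

lemma U_0 [simp]: "U 0 = \<one>" and H_1 [simp]: "H 1 = \<one>"
  by (simp_all add: U_def H_def)

lemma D_mod: "D [^] n = D [^] (n mod 5)" for n :: nat
proof -
  have "D [^] n = D [^] (5 * (n div 5) + n mod 5)" by simp
  also have "\<dots> = (D [^] (5::nat)) [^] (n div 5) \<otimes> D [^] (n mod 5)"
    by (simp only: nat_pow_mult nat_pow_pow closed nat_pow_closed flip: nat_pow_mult nat_pow_pow)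
  finally show ?thesis by (simp add: D5)
qed

lemma U_add: "U s \<otimes> U t = U (s + t)"
proof -
  have "\<forall>s t. e5 (s + t) = (e5 s + e5 t) mod 5" unfolding forall_5 by simp
  then show ?thesis using D_mod[of "e5 s + e5 t"] by (simp add: U_def nat_pow_mult)
qed

lemma ZT: "Z \<otimes> T = T \<otimes> Z"
  by (simp add: m_assoc flip: TT)

lemma ZW: "Z \<otimes> W = W \<otimes> Z"
  by (simp add: m_assoc flip: WW)

lemma T_pow_D: "T \<otimes> D [^] (n::nat) = D [^] (4 * n) \<otimes> T"
proof (induction n)
  case (Suc n)
  have "T \<otimes> D [^] Suc n = (T \<otimes> D [^] n) \<otimes> D" by (simp add: m_assoc)
  also have "\<dots> = D [^] (4 * n) \<otimes> (T \<otimes> D)" by (simp add: Suc m_assoc)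
  also have "\<dots> = D [^] (4 * n) \<otimes> D [^] (4::nat) \<otimes> T" by (simp add: TD m_assoc)
  also have "\<dots> = D [^] (4 * Suc n) \<otimes> T" by (simp add: nat_pow_mult add.commute)
  finally show ?case .
qed simp

lemma TU: "T \<otimes> U t = U (4 * t) \<otimes> T"
proof -
  have "\<forall>t. e5 (4 * t) = (4 * e5 t) mod 5" unfolding forall_5 by simp
  then show ?thesis using T_pow_D[of "e5 t"] D_mod[of "4 * e5 t"] by (simp add: U_def)
qed

lemma ZU: "Z \<otimes> U t = U t \<otimes> Z"
proof -
  have "Z \<otimes> U t = T \<otimes> (T \<otimes> U t)" by (simp add: m_assoc flip: TT)
  also have "\<dots> = T \<otimes> U (4 * t) \<otimes> T" by (simp add: TU flip: m_assoc)
  also have "\<dots> = U (4 * (4 * t)) \<otimes> (T \<otimes> T)" by (simp only: TU m_assoc closed U_closed)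
  also have "4 * (4 * t) = t" by (simp flip: mult.assoc)
  finally show ?thesis by (simp add: TT)
qed

lemma HU: "a \<noteq> 0 \<Longrightarrow> H a \<otimes> U t = U (a ^ 2 * t) \<otimes> H a"
proof -
  have "\<forall>a. a \<noteq> 0 \<longrightarrow> H a \<otimes> U t = U (a ^ 2 * t) \<otimes> H a"
    unfolding forall_5 by (simp add: H_def TU ZU m_assoc) (simp add: TU ZU flip: m_assoc)
  then show "a \<noteq> 0 \<Longrightarrow> H a \<otimes> U t = U (a ^ 2 * t) \<otimes> H a" by auto
qed

lemma HH: "a \<noteq> 0 \<Longrightarrow> b \<noteq> 0 \<Longrightarrow> H a \<otimes> H b = H (a * b)"
proof -
  have z: "Z \<otimes> (Z \<otimes> x) = x" "T \<otimes> (T \<otimes> x) = Z \<otimes> x" "T \<otimes> (Z \<otimes> x) = Z \<otimes> (T \<otimes> x)" if "x \<in> carrier G" for x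
    using that by (simp_all add: ZZ TT ZT flip: m_assoc)
  have "\<forall>a b. a \<noteq> 0 \<longrightarrow> b \<noteq> 0 \<longrightarrow> H a \<otimes> H b = H (a * b)"
    unfolding forall_5 by (simp add: H_def m_assoc z ZZ TT ZT[symmetric])
  then show "a \<noteq> 0 \<Longrightarrow> b \<noteq> 0 \<Longrightarrow> H a \<otimes> H b = H (a * b)" by auto
qed

lemma HW: "a \<noteq> 0 \<Longrightarrow> H a \<otimes> W = W \<otimes> H (a ^ 3)"
proof -
  have "Z \<otimes> T \<otimes> W = W \<otimes> T"
  proof -
    have "Z \<otimes> T \<otimes> W = Z \<otimes> W \<otimes> (Z \<otimes> T)" by (simp add: m_assoc TW)
    also have "\<dots> = W \<otimes> (Z \<otimes> Z) \<otimes> T" by (simp add: ZW m_assoc)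
    finally show ?thesis by (simp add: ZZ)
  qed
  then have "\<forall>a. a \<noteq> 0 \<longrightarrow> H a \<otimes> W = W \<otimes> H (a ^ 3)"
    unfolding forall_5 by (simp add: H_def TW ZW)
  then show "a \<noteq> 0 \<Longrightarrow> H a \<otimes> W = W \<otimes> H (a ^ 3)" by auto
qed

lemma R: "u \<noteq> 0 \<Longrightarrow> U (u ^ 3) \<otimes> W \<otimes> U u \<otimes> W = W \<otimes> U (- u) \<otimes> H u"
proof -
  have "\<forall>u. u \<noteq> 0 \<longrightarrow> U (u ^ 3) \<otimes> W \<otimes> U u \<otimes> W = W \<otimes> U (- u) \<otimes> H u"
    unfolding forall_5 using R1 R2 R3 R4 by (simp add: H_def U_def)
  then show "u \<noteq> 0 \<Longrightarrow> U (u ^ 3) \<otimes> W \<otimes> U u \<otimes> W = W \<otimes> U (- u) \<otimes> H u" by auto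
qed

lemma hom2_m2: "hom2 (m2 a b c d) = (if c = 0 then U (a * b) \<otimes> H a
    else U (a * c ^ 3) \<otimes> W \<otimes> H c \<otimes> U (c ^ 3 * d))"
  by (simp add: hom2_def)

lemma hom2_U:
  assumes "m2 a b c d \<in> carrier SL2_F5"
  shows "hom2 (m2 a b c d ** m2 1 t 0 1) = hom2 (m2 a b c d) \<otimes> U t"
proof (cases "c = 0")
  case True
  with assms have a: "a \<noteq> 0" by (auto simp: SL2_carrier)
  have "U (a * (a * t + b)) \<otimes> H a = U (a * b) \<otimes> (U (a ^ 2 * t) \<otimes> H a)"
    by (simp add: U_add algebra_simps power2_eq_square flip: m_assoc)
  then show ?thesis using True a by (simp add: m2_mult hom2_m2 m_assoc HU)
next
  case False
  have "U (c ^ 3 * (c * t + d)) = U (c ^ 3 * d) \<otimes> U t"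
  proof -
    have "c ^ 3 * (c * t + d) = (c * c ^ 3) * t + c ^ 3 * d" by (simp add: algebra_simps)
    then show ?thesis using inv5[OF False] by (simp add: U_add add.commute)
  qed
  then show ?thesis using False by (simp add: m2_mult hom2_m2 m_assoc)
qed

lemma hom2_H:
  assumes "m2 a b c d \<in> carrier SL2_F5" "x \<noteq> 0"
  shows "hom2 (m2 a b c d ** m2 x 0 0 (x ^ 3)) = hom2 (m2 a b c d) \<otimes> H x"
proof (cases "c = 0")
  case True
  with assms have a: "a \<noteq> 0" by (auto simp: SL2_carrier)
  have "a * x * (b * x ^ 3) = a * b * (x * x ^ 3)" by (simp add: algebra_simps)
  then show ?thesis using True a assms by (simp add: m2_mult hom2_m2 m_assoc HH inv5)
next
  case False
  have x3: "x ^ 3 \<noteq> 0" using inv5[OF assms(2)] by auto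
  have 1: "a * x * (c * x) ^ 3 = a * c ^ 3 * (x ^ 4)" "x ^ 4 = x * x ^ 3"
    by (simp_all add: algebra_simps power_mult_distrib eval_nat_numeral)
  have 2: "x ^ 2 * ((c * x) ^ 3 * (d * x ^ 3)) = c ^ 3 * d * (x * x ^ 3) * (x * x ^ 3)"
    by (simp add: algebra_simps power_mult_distrib eval_nat_numeral)
  have "hom2 (m2 a b c d) \<otimes> H x = U (a * c ^ 3) \<otimes> W \<otimes> (H c \<otimes> (U (c ^ 3 * d) \<otimes> H x))"
    using False by (simp add: hom2_m2 m_assoc)
  also have "U (c ^ 3 * d) \<otimes> H x = H x \<otimes> U ((c * x) ^ 3 * (d * x ^ 3))"
    using assms by (simp add: HU 2 inv5)
  also have "H c \<otimes> \<dots> = H (c * x) \<otimes> U ((c * x) ^ 3 * (d * x ^ 3))"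
    using False assms by (simp add: HH flip: m_assoc)
  finally show ?thesis using False assms by (simp add: m2_mult hom2_m2 m_assoc mult5_eq_0 1 inv5)
qed

lemma H_minus: "x \<noteq> 0 \<Longrightarrow> Z \<otimes> H x = H (- x)"
proof -
  assume "x \<noteq> 0"
  moreover have "H 4 = Z" by (simp add: H_def)
  ultimately show ?thesis using HH[of 4 x] by (simp add: neg5)
qed

text \<open>The critical case, as right multiplication by the Weyl element can change the cell. For
  \<open>c = 0\<close> the product enters the big cell, for \<open>d = 0\<close> it leaves it, and
  for \<open>c d \<noteq> 0\<close> it stays there and the inner part \<open>w u(cd) w\<close> is
  rewritten by \<open>R\<close>.\<close>

lemma hom2_W:
  assumes "m2 a b c d \<in> carrier SL2_F5"
  shows "hom2 (m2 a b c d ** m2 0 (-1) 1 0) = hom2 (m2 a b c d) \<otimes> W"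
proof -
  have det: "a * d - b * c = 1" using assms by (simp add: SL2_carrier)
  show ?thesis
  proof (cases "c = 0")
    case True
    then have ad: "a * d = 1" using det by simp
    have a: "a \<noteq> 0" "d \<noteq> 0" using ad by auto
    have "a ^ 3 = a ^ 3 * (a * d)" using ad by simp
    also have "\<dots> = (a * a ^ 3) * d" by (simp add: algebra_simps)
    finally have d: "a ^ 3 = d" using inv5[OF a(1)] by simp
    have "d ^ 3 = d ^ 3 * (a * d)" using ad by simp
    also have "\<dots> = (d * d ^ 3) * a" by (simp add: algebra_simps)
    finally have d': "d ^ 3 = a" using inv5[OF a(2)] by simp
    show ?thesis using True a d d'
      by (simp add: m2_mult hom2_m2 m_assoc HW mult.commute)
  next
    case c: False
    show ?thesis
    proof (cases "d = 0")
      case True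
      then have bc: "b * c = -1" using det by (metis add.inverse_inverse diff_0 mult_zero_right)
      have b: "b \<noteq> 0" using bc by auto
      have "c ^ 3 = - (c ^ 3 * (b * c))" using bc by simp
      also have "\<dots> = - ((c * c ^ 3) * b)" by (simp add: algebra_simps)
      finally have c3: "c ^ 3 = - b" using inv5[OF c] by simp
      have "W \<otimes> H c \<otimes> W = W \<otimes> W \<otimes> H (c ^ 3)" using c by (simp add: HW m_assoc)
      also have "\<dots> = H b" using b by (simp add: WW c3 H_minus)
      finally have "U (a * - b) \<otimes> (W \<otimes> H c \<otimes> W) = U (a * - b) \<otimes> H b" by simp
      then show ?thesis using True c c3 by (simp add: m2_mult hom2_m2 m_assoc mult.commute neg5 mult.left_commute)
    next
      case d: False
      have cd: "c * d \<noteq> 0" using c d by (simp add: mult5_eq_0)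
      have c3: "c ^ 3 \<noteq> 0" using inv5[OF c] by auto
      have c33: "(c ^ 3) ^ 3 = c"
      proof -
        have "(c ^ 3) ^ 3 = (c * c ^ 3) * (c * c ^ 3) * c" by (simp add: eval_nat_numeral algebra_simps)
        then show ?thesis using inv5[OF c] by simp
      qed
      \<comment> \<open>This is \<open>a/c = b/d + 1/(cd)\<close>, the determinant condition divided
        by \<open>c d\<close>. It splits off the factor \<open>u(1/(cd))\<close> on the left that
        \<open>R\<close> consumes.\<close>
      have 1: "a * c ^ 3 = b * d ^ 3 + (c * d) ^ 3"
      proof -
        have "b * d ^ 3 + (c * d) ^ 3 = b * d ^ 3 * (c * c ^ 3) + (a * d - b * c) * (c * d) ^ 3"
          using det inv5[OF c] by simp
        also have "\<dots> = a * c ^ 3 * (d * d ^ 3) + (b * d ^ 3 * c ^ 4 - b * d ^ 3 * c ^ 4)"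
          by (simp add: eval_nat_numeral algebra_simps)
        finally show ?thesis using inv5[OF d] by simp
      qed
      have 2: "c\<^sup>2 * (c ^ 3 * d) = c * d"
      proof -
        have "c\<^sup>2 * (c ^ 3 * d) = (c * c ^ 3) * (c * d)" by (simp add: eval_nat_numeral algebra_simps)
        then show ?thesis using inv5[OF c] by simp
      qed
      have 3: "(c ^ 3)\<^sup>2 * (d ^ 3 * - c) = - (c ^ 3 * d ^ 3 * (c * c ^ 3))"
        by (simp add: eval_nat_numeral algebra_simps)
      have "hom2 (m2 a b c d) \<otimes> W = U (a * c ^ 3) \<otimes> W \<otimes> (H c \<otimes> U (c ^ 3 * d)) \<otimes> W"
        using c by (simp add: hom2_m2 m_assoc)
      also have "\<dots> = U (a * c ^ 3) \<otimes> W \<otimes> U (c * d) \<otimes> (H c \<otimes> W)"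
        using c by (simp add: HU[OF c, of "c ^ 3 * d", unfolded 2] m_assoc)
      also have "\<dots> = U (b * d ^ 3) \<otimes> (U ((c * d) ^ 3) \<otimes> W \<otimes> U (c * d) \<otimes> W) \<otimes> H (c ^ 3)"
        using c by (simp add: HW m_assoc 1 flip: U_add)
      also have "\<dots> = U (b * d ^ 3) \<otimes> (W \<otimes> U (- (c * d)) \<otimes> H (c * d)) \<otimes> H (c ^ 3)"
        by (simp only: R[OF cd])
      also have "\<dots> = U (b * d ^ 3) \<otimes> W \<otimes> U (- (c * d)) \<otimes> (H (c * d) \<otimes> H (c ^ 3))"
        by (simp add: m_assoc)
      also have "H (c * d) \<otimes> H (c ^ 3) = H d"
      proof -
        have "c * d * c ^ 3 = (c * c ^ 3) * d" by (simp add: algebra_simps)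
        then show ?thesis using cd c3 inv5[OF c] by (simp add: HH)
      qed
      also have "U (b * d ^ 3) \<otimes> W \<otimes> U (- (c * d)) \<otimes> H d = U (b * d ^ 3) \<otimes> W \<otimes> (H d \<otimes> U (d ^ 3 * - c))"
      proof -
        have "d\<^sup>2 * (d ^ 3 * - c) = - ((d * d ^ 3) * (c * d))" by (simp add: eval_nat_numeral algebra_simps)
        then have "H d \<otimes> U (d ^ 3 * - c) = U (- (c * d)) \<otimes> H d" using d inv5[OF d] by (simp add: HU)
        then show ?thesis by (simp add: m_assoc)
      qed
      finally show ?thesis using d by (simp add: m2_mult hom2_m2 m_assoc neg5 mult.commute mult.left_commute)
    qed
  qed
qed

lemma SL2_mult_closed: "g \<in> carrier SL2_F5 \<Longrightarrow> h \<in> carrier SL2_F5 \<Longrightarrow> g ** h \<in> carrier SL2_F5"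
  by (simp add: SL2_F5_def det_mul)

text \<open>Only the right factor is decomposed: \<open>h\<close> is a product of unipotent,
  diagonal and Weyl matrices, and \<open>hom2_U\<close>, \<open>hom2_H\<close>,
  \<open>hom2_W\<close> allow an arbitrary left factor from SL_2.\<close>

lemma hom2_hom: "hom2 \<in> hom SL2_F5 G"
proof (rule homI)
  fix g h assume g: "g \<in> carrier SL2_F5" and h: "h \<in> carrier SL2_F5"
  have u: "hom2 (x ** m2 1 t 0 1) = hom2 x \<otimes> U t" if "x \<in> carrier SL2_F5" for x t
    using that hom2_U by (metis m2_cases)
  have hh: "hom2 (x ** m2 y 0 0 (y ^ 3)) = hom2 x \<otimes> H y" if "x \<in> carrier SL2_F5" "y \<noteq> 0" for x y
    using that hom2_H by (metis m2_cases)
  have w: "hom2 (x ** m2 0 (-1) 1 0) = hom2 x \<otimes> W" if "x \<in> carrier SL2_F5" for x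
    using that hom2_W by (metis m2_cases)
  obtain a b c d where m: "h = m2 a b c d" by (rule m2_cases)
  have det: "a * d - b * c = 1" using h m by (simp add: SL2_carrier)
  have gen: "m2 1 t 0 1 \<in> carrier SL2_F5" "m2 0 (-1) 1 0 \<in> carrier SL2_F5"
    "y \<noteq> 0 \<Longrightarrow> m2 y 0 0 (y ^ 3) \<in> carrier SL2_F5" for t y
    by (simp_all add: SL2_carrier inv5)
  show "hom2 (g \<otimes>\<^bsub>SL2_F5\<^esub> h) = hom2 g \<otimes> hom2 h"
  proof (cases "c = 0")
    case True
    then have ad: "a * d = 1" using det by simp
    have a: "a \<noteq> 0" "d \<noteq> 0" using ad by auto
    have "a ^ 3 = a ^ 3 * (a * d)" using ad by simp
    also have "\<dots> = (a * a ^ 3) * d" by (simp add: algebra_simps)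
    finally have d: "a ^ 3 = d" using inv5[OF a(1)] by simp
    have "a * b * d = (a * d) * b" by (simp only: ac_simps)
    with ad have "a * b * d = b" by simp
    then have "h = m2 1 (a * b) 0 1 ** m2 a 0 0 (a ^ 3)"
      using True m inv5[OF a(1)] by (simp add: m2_mult d)
    then have "hom2 (g ** h) = hom2 (g ** m2 1 (a * b) 0 1 ** m2 a 0 0 (a ^ 3))"
      by (simp add: matrix_mul_assoc)
    also have "\<dots> = hom2 g \<otimes> U (a * b) \<otimes> H a"
      using g gen a by (simp add: u hh SL2_mult_closed)
    finally show ?thesis using True m by (simp add: SL2_mult hom2_m2 m_assoc)
  next
    case c: False
    have "c ^ 3 \<noteq> 0" using inv5[OF c] by auto
    have "a * c ^ 3 * d - c ^ 3 * (a * d - b * c) = b * (c * c ^ 3)" by (simp add: algebra_simps)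
    then have b: "b = a * (c ^ 3 * d) + 4 * c ^ 3"
      using inv5[OF c] det by (simp add: neg5 mult.assoc flip: add_uminus_conv_diff)
    have "h = m2 1 (a * c ^ 3) 0 1 ** m2 0 (-1) 1 0 ** m2 c 0 0 (c ^ 3) ** m2 1 (c ^ 3 * d) 0 1"
    proof -
      have "a * c ^ 3 * c = a * (c * c ^ 3)" "a * c ^ 3 * c * (c ^ 3 * d) = a * c ^ 3 * d * (c * c ^ 3)"
        "c * (c ^ 3 * d) = c * c ^ 3 * d" by (simp_all only: ac_simps)
      then show ?thesis using m b inv5[OF c] by (simp add: m2_mult)
    qed
    then have "hom2 (g ** h) = hom2 (g ** m2 1 (a * c ^ 3) 0 1 ** m2 0 (-1) 1 0 ** m2 c 0 0 (c ^ 3) ** m2 1 (c ^ 3 * d) 0 1)"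
      by (simp add: matrix_mul_assoc)
    also have "\<dots> = hom2 g \<otimes> U (a * c ^ 3) \<otimes> W \<otimes> H c \<otimes> U (c ^ 3 * d)"
      using g gen c by (simp add: u hh w[simplified] SL2_mult_closed)
    finally show ?thesis using c m by (simp add: SL2_mult hom2_m2 m_assoc)
  qed
qed simp

end

section \<open>Projective linear groups\<close>

lemma mat_mult_nth: "(mat c ** M) $ i $ j = (c::'a::comm_ring_1) * M $ i $ j"
  by (simp add: matrix_matrix_mult_def mat_def if_distrib[of "\<lambda>x. x * _"] cong: if_cong)

lemma mult_mat_nth: "(M ** mat c) $ i $ j = (c::'a::comm_ring_1) * M $ i $ j"
  by (simp add: matrix_matrix_mult_def mat_def if_distrib[of "\<lambda>x. _ * x"] mult.commute cong: if_cong)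

lemma mat_commute: "mat c ** M = M ** mat (c::'a::comm_ring_1)"
  by (simp add: vec_eq_iff mat_mult_nth mult_mat_nth)

lemma mat_mult_mat: "mat c ** mat d = mat ((c::'a::comm_ring_1) * d)"
  by (simp add: vec_eq_iff mat_mult_nth) (simp add: mat_def)

lemma mat_mult_vec: "(mat c ** M) *v v = c *s (M *v (v::'a::comm_ring_1^'n))"
  by (simp add: vec_eq_iff matrix_vector_mult_def mat_mult_nth sum_distrib_left mult.assoc)

lemma invertible_mat: "c \<noteq> 0 \<Longrightarrow> invertible (mat c :: 'a::field^'n^'n)"
  unfolding invertible_def by (intro exI[of _ "mat (inverse c)"]) (simp add: mat_mult_mat)

lemma invertible_inv:
  fixes M :: "'a::field^'n^'n" assumes "invertible M"
  obtains N where "M ** N = mat 1" "N ** M = mat 1" "invertible N"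
  using assms unfolding invertible_def by metis

lemma mult_vec_scale: "M *v (c *s v) = c *s (M *v (v::'a::comm_ring_1^'n))"
  by (simp add: vec_eq_iff matrix_vector_mult_def sum_distrib_left mult_ac)

lemma mult_vec_zero: "M *v 0 = (0::'a::comm_ring_1^'n)"
  by (simp add: vec_eq_iff matrix_vector_mult_def)

lemma invertible_vec_nz:
  fixes v :: "'a::field^'n" and M :: "'a^'n^'n"
  assumes "invertible M" "v \<noteq> 0" shows "M *v v \<noteq> 0"
proof
  assume "M *v v = 0"
  obtain N where "N ** M = mat 1" using invertible_inv[OF assms(1)] by metis
  then have "v = N *v (M *v v)" by (simp add: matrix_vector_mul_assoc)
  then show False using \<open>M *v v = 0\<close> assms mult_vec_zero by metis
qed

lemma GL_simps: "carrier GL = {M. invertible M}" "monoid.mult GL = (**)" "one GL = mat 1"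
  by (simp_all add: GL_def)

lemma GL_group: "group (GL :: ('a::field^'n^'n) monoid)"
proof (rule groupI)
  fix x :: "'a^'n^'n" assume "x \<in> carrier GL"
  then show "\<exists>y\<in>carrier GL. y \<otimes>\<^bsub>GL\<^esub> x = \<one>\<^bsub>GL\<^esub>"
    by (auto simp: GL_simps elim: invertible_inv)
qed (auto simp: GL_simps matrix_mul_assoc invertible_mult invertible_mat)

lemma scalar_normal: "scalar_matrices \<lhd> (GL :: ('a::field^'n^'n) monoid)"
proof -
  interpret G: group "GL :: ('a^'n^'n) monoid" by (rule GL_group)
  have sub: "subgroup scalar_matrices (GL :: ('a^'n^'n) monoid)"
  proof (rule G.subgroupI)
    fix a :: "'a^'n^'n" assume "a \<in> scalar_matrices"
    then obtain c where c: "a = mat c" "c \<noteq> 0" by (auto simp: scalar_matrices_def)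
    then have "inv\<^bsub>GL\<^esub> a = mat (inverse c)"
      by (intro G.inv_equality) (auto simp: GL_simps mat_mult_mat invertible_mat)
    then show "inv\<^bsub>GL\<^esub> a \<in> scalar_matrices" using c by (auto simp: scalar_matrices_def)
  next
    fix a b :: "'a^'n^'n" assume "a \<in> scalar_matrices" "b \<in> scalar_matrices"
    then show "a \<otimes>\<^bsub>GL\<^esub> b \<in> scalar_matrices"
      by (auto simp: GL_simps scalar_matrices_def mat_mult_mat)
  qed (auto simp: GL_simps scalar_matrices_def invertible_mat intro!: exI[of _ 1])
  show ?thesis
  proof (rule G.normalI[OF sub], rule ballI)
    fix x :: "'a^'n^'n"
    show "scalar_matrices #>\<^bsub>GL\<^esub> x = x <#\<^bsub>GL\<^esub> scalar_matrices"
      by (auto simp: r_coset_def l_coset_def GL_simps scalar_matrices_def mat_commute)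
  qed
qed

lemma PGL_group: "group (PGL :: ('a::field^'n^'n) set monoid)"
  unfolding PGL_def by (rule normal.factorgroup_is_group[OF scalar_normal])

lemma pgl_class_alt: "pgl_class M = {mat c ** M |c. c \<noteq> 0}"
  by (auto simp: pgl_class_def r_coset_def GL_simps scalar_matrices_def)

lemma PGL_carrier: "carrier PGL = pgl_class ` {M::'a::field^'n^'n. invertible M}"
  by (simp add: PGL_def carrier_FactGroup GL_simps pgl_class_def[abs_def] image_def)

lemma PGL_mult:
  fixes M N :: "'a::field^'n^'n"
  assumes "invertible M" "invertible N"
  shows "pgl_class M \<otimes>\<^bsub>PGL\<^esub> pgl_class N = pgl_class (M ** N)"
  using normal.rcos_sum[OF scalar_normal, of M N] assms
  by (simp add: PGL_def pgl_class_def GL_simps)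

lemma PGL_one: "\<one>\<^bsub>PGL\<^esub> = pgl_class (mat 1 :: 'a::field^'n^'n)"
  by (simp add: PGL_def pgl_class_alt) (simp add: scalar_matrices_def)

lemma pgl_class_refl: "M \<in> pgl_class (M::'a::field^'n^'n)"
  unfolding pgl_class_alt by (auto intro!: exI[of _ 1])

lemma pgl_class_eq_iff:
  fixes M N :: "'a::field^'n^'n"
  shows "pgl_class M = pgl_class N \<longleftrightarrow> (\<exists>c. c \<noteq> 0 \<and> M = mat c ** N)"
proof
  assume "pgl_class M = pgl_class N"
  then have "M \<in> pgl_class N" using pgl_class_refl by auto
  then show "\<exists>c. c \<noteq> 0 \<and> M = mat c ** N" unfolding pgl_class_alt by auto
next
  assume "\<exists>c. c \<noteq> 0 \<and> M = mat c ** N"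
  then obtain c where c: "c \<noteq> 0" "M = mat c ** N" by auto
  show "pgl_class M = pgl_class N"
  proof (intro equalityI subsetI)
    fix x assume "x \<in> pgl_class M"
    then obtain k where k: "k \<noteq> 0" "x = mat k ** M" unfolding pgl_class_alt by auto
    then have "x = mat (k * c) ** N" using c by (simp add: matrix_mul_assoc mat_mult_mat)
    then show "x \<in> pgl_class N" using k c unfolding pgl_class_alt by auto
  next
    fix x assume "x \<in> pgl_class N"
    then obtain k where k: "k \<noteq> 0" "x = mat k ** N" unfolding pgl_class_alt by auto
    then have "x = mat (k / c) ** M" using c by (simp add: matrix_mul_assoc mat_mult_mat)
    then show "x \<in> pgl_class M" using k c unfolding pgl_class_alt by (auto intro!: exI[of _ "k / c"])
  qed
qed

lemma pgl_class_scale: "c \<noteq> 0 \<Longrightarrow> pgl_class (mat c ** M) = pgl_class (M::'a::field^'n^'n)"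
  using pgl_class_eq_iff by auto

lemma PGL_inv:
  fixes M N :: "'a::field^'n^'n"
  assumes "M ** N = mat 1" "N ** M = mat 1"
  shows "inv\<^bsub>PGL\<^esub> (pgl_class M) = pgl_class N"
proof -
  have "invertible M" "invertible N" using assms unfolding invertible_def by auto
  then show ?thesis using assms
    by (intro group.inv_equality[OF PGL_group]) (auto simp: PGL_mult PGL_one PGL_carrier)
qed

fun mpow :: "'a::comm_ring_1^'n^'n \<Rightarrow> nat \<Rightarrow> 'a^'n^'n" where
  "mpow M 0 = mat 1" | "mpow M (Suc k) = mpow M k ** M"

lemma invertible_mpow: "invertible M \<Longrightarrow> invertible (mpow (M::'a::field^'n^'n) k)"
  by (induction k) (auto simp: invertible_mat invertible_mult)

lemma GL_pow: "M [^]\<^bsub>GL\<^esub> (k::nat) = mpow (M::'a::field^'n^'n) k"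
  by (induction k) (simp_all add: nat_pow_def GL_simps)

lemma PGL_pow: "invertible M \<Longrightarrow> pgl_class M [^]\<^bsub>PGL\<^esub> (k::nat) = pgl_class (mpow (M::'a::field^'n^'n) k)"
  by (induction k) (auto simp: nat_pow_def PGL_one PGL_mult invertible_mpow)

lemma proj_point_eq_iff: "proj_point v = proj_point w \<longleftrightarrow> (\<exists>c. c \<noteq> 0 \<and> w = c *s (v::'a::field^'n))"
proof
  assume e: "proj_point v = proj_point w"
  have "w \<in> proj_point w" unfolding proj_point_def by (auto intro!: exI[of _ 1] simp: vec_eq_iff)
  then have "w \<in> proj_point v" using e by simp
  then show "\<exists>c. c \<noteq> 0 \<and> w = c *s v" by (auto simp: proj_point_def)
next
  assume "\<exists>c. c \<noteq> 0 \<and> w = c *s v"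
  then obtain c where c: "c \<noteq> 0" "w = c *s v" by auto
  have s: "k *s w = (k * c) *s v" "k *s v = (k / c) *s w" for k
    using c by (auto simp: vec_eq_iff)
  show "proj_point v = proj_point w"
  proof (intro equalityI subsetI)
    fix x assume "x \<in> proj_point v"
    then obtain k where "k \<noteq> 0" "x = k *s v" by (auto simp: proj_point_def)
    then have "k / c \<noteq> 0" "x = (k / c) *s w" using c(1) s(2)[of k] by (simp, blast intro: trans)
    then show "x \<in> proj_point w" unfolding proj_point_def by blast
  next
    fix x assume "x \<in> proj_point w"
    then obtain k where "k \<noteq> 0" "x = k *s w" by (auto simp: proj_point_def)
    then have "k * c \<noteq> 0" "x = (k * c) *s v" using c(1) s(1)[of k] by (simp, blast intro: trans)
    then show "x \<in> proj_point v" unfolding proj_point_def by blast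
  qed
qed

lemma proj_point_self: "v \<in> proj_point (v::'a::field^'n)"
  unfolding proj_point_def by (auto intro!: exI[of _ 1] simp: vec_eq_iff)

lemma pgl_act_point: "pgl_act (pgl_class M) (proj_point v) = proj_point (M *v (v::'a::field^'n))"
proof (intro equalityI subsetI)
  fix x assume "x \<in> pgl_act (pgl_class M) (proj_point v)"
  then obtain c k where "c \<noteq> 0" "k \<noteq> 0" "x = (mat c ** M) *v (k *s v)"
    unfolding pgl_act_def pgl_class_alt proj_point_def by auto
  then show "x \<in> proj_point (M *v v)" unfolding proj_point_def
    by (auto simp: mat_mult_vec mult_vec_scale intro!: exI[of _ "c * k"] simp: vec_eq_iff)
next
  fix x assume "x \<in> proj_point (M *v v)"
  then obtain c where c: "c \<noteq> 0" "x = c *s (M *v v)" unfolding proj_point_def by auto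
  then have "x = M *v (c *s v)" by (simp add: mult_vec_scale)
  then show "x \<in> pgl_act (pgl_class M) (proj_point v)"
    using c pgl_class_refl unfolding pgl_act_def proj_point_def by auto
qed

lemma proj_space_iff: "P \<in> proj_space \<longleftrightarrow> (\<exists>v. v \<noteq> 0 \<and> P = proj_point v)"
  by (auto simp: proj_space_def)

lemma pgl_act_closed:
  "A \<in> carrier PGL \<Longrightarrow> P \<in> proj_space \<Longrightarrow> pgl_act A P \<in> (proj_space :: ('a::field^'n) set set)"
  by (auto simp: PGL_carrier proj_space_iff pgl_act_point) (metis invertible_vec_nz)

lemma pgl_act_mult:
  "A \<in> carrier PGL \<Longrightarrow> B \<in> carrier PGL \<Longrightarrow> P \<in> (proj_space :: ('a::field^'n) set set) \<Longrightarrow>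
    pgl_act (A \<otimes>\<^bsub>PGL\<^esub> B) P = pgl_act A (pgl_act B P)"
  by (auto simp: PGL_carrier proj_space_iff pgl_act_point PGL_mult matrix_vector_mul_assoc)

lemma pgl_act_one: "P \<in> (proj_space :: ('a::field^'n) set set) \<Longrightarrow> pgl_act \<one>\<^bsub>PGL\<^esub> P = P"
  by (auto simp: proj_space_iff pgl_act_point PGL_one)

section \<open>The projective line\<close>

definition v2 :: "'a \<Rightarrow> 'a \<Rightarrow> 'a::zero^2" where "v2 x y = vector [x, y]"

lemma v2_nth [simp]: "v2 x y $ 1 = x" "v2 x y $ 2 = y"
  by (simp_all add: v2_def)

lemma v2_cases: obtains x y where "v = v2 x y"
proof
  show "v = v2 (v$1) (v$2)" by (simp add: vec_eq_iff forall_2)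
qed

lemma v2_eq [simp]: "v2 x y = v2 x' y' \<longleftrightarrow> x = x' \<and> y = y'"
  by (auto simp: vec_eq_iff forall_2)

lemma v2_zero [simp]: "v2 x y = 0 \<longleftrightarrow> x = 0 \<and> y = 0"
  by (auto simp: vec_eq_iff forall_2)

lemma v2_scale [simp]: "c *s v2 x y = v2 (c * x) (c * y)"
  by (simp add: vec_eq_iff forall_2)

lemma m2_v2 [simp]: "m2 a b c d *v v2 x y = v2 (a * x + b * y) (c * x + d * (y::'a::comm_ring_1))"
  by (simp add: vec_eq_iff forall_2 matrix_vector_mult_def sum_2)

lemma m2_scale: "mat k ** m2 a b c d = m2 (k * a) (k * b) (k * c) (k * (d::'a::comm_ring_1))"
  by (simp add: vec_eq_iff forall_2 mat_mult_nth)

lemma mat_m2: "mat k = m2 k 0 0 (k::'a::comm_ring_1)"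
  by (simp add: vec_eq_iff forall_2 mat_def)

lemma invertible_m2: "invertible (m2 a b c d) \<longleftrightarrow> a * d - b * c \<noteq> (0::'a::field)"
  by (simp add: invertible_det_nz m2_det)

lemma proj_line_eq_iff:
  fixes x y :: "'a::field"
  assumes "x \<noteq> 0 \<or> y \<noteq> 0" "x' \<noteq> 0 \<or> y' \<noteq> 0"
  shows "proj_point (v2 x y) = proj_point (v2 x' y') \<longleftrightarrow> x * y' = y * x'"
proof
  assume "proj_point (v2 x y) = proj_point (v2 x' y')"
  then show "x * y' = y * x'" by (auto simp: proj_point_eq_iff)
next
  assume e: "x * y' = y * x'"
  show "proj_point (v2 x y) = proj_point (v2 x' y')"
  proof (cases "x = 0")
    case True
    then have "y \<noteq> 0" "x' = 0" using assms e by auto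
    then show ?thesis using True assms by (auto simp: proj_point_eq_iff intro!: exI[of _ "y' / y"])
  next
    case False
    then have "x' \<noteq> 0" using e assms by auto
    then show ?thesis using False e
      by (auto simp: proj_point_eq_iff field_simps intro!: exI[of _ "x' / x"])
  qed
qed

text \<open>The quadratic form on the right is the determinant of the two columns \<open>v\<close>
  and \<open>M v\<close>, which vanishes exactly when they are proportional.\<close>

lemma fixed_iff:
  fixes a b c d :: "'a::field"
  assumes "invertible (m2 a b c d)" "x \<noteq> 0 \<or> y \<noteq> 0"
  shows "pgl_act (pgl_class (m2 a b c d)) (proj_point (v2 x y)) = proj_point (v2 x y)
    \<longleftrightarrow> c * x ^ 2 + (d - a) * x * y - b * y ^ 2 = 0"
proof -
  have "m2 a b c d *v v2 x y \<noteq> 0" using assms by (intro invertible_vec_nz) auto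
  then have "a * x + b * y \<noteq> 0 \<or> c * x + d * y \<noteq> 0" by simp
  then have "pgl_act (pgl_class (m2 a b c d)) (proj_point (v2 x y)) = proj_point (v2 x y)
    \<longleftrightarrow> (a * x + b * y) * y = (c * x + d * y) * x"
    using assms by (simp add: pgl_act_point proj_line_eq_iff)
  also have "\<dots> \<longleftrightarrow> c * x ^ 2 + (d - a) * x * y - b * y ^ 2 = 0"
    by (auto simp: power2_eq_square algebra_simps)
  finally show ?thesis .
qed

lemma quadratic_two_zeros:
  fixes a b c :: "'a::{alg_closed_field, field_char_0}"
  assumes "b ^ 2 - 4 * a * c \<noteq> 0"
  obtains P Q :: "('a^2) set" where "P \<noteq> Q" "{P \<in> proj_space. \<forall>v\<in>P. a * v$1 ^ 2 + b * v$1 * v$2 + c * v$2 ^ 2 = 0} = {P, Q}"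
proof -
  let ?q = "\<lambda>v::'a^2. a * v$1 ^ 2 + b * v$1 * v$2 + c * v$2 ^ 2"
  have pt: "(\<forall>v\<in>proj_point w. ?q v = 0) \<longleftrightarrow> ?q w = 0" for w
  proof -
    have "?q (k *s w) = k ^ 2 * ?q w" for k by (simp add: power2_eq_square algebra_simps)
    then show ?thesis using proj_point_self[of w] unfolding proj_point_def by auto
  qed
  have set: "{P \<in> proj_space. \<forall>v\<in>P. ?q v = 0} = proj_point ` {w. w \<noteq> 0 \<and> ?q w = 0}"
  proof (intro equalityI subsetI)
    fix P assume "P \<in> {P \<in> proj_space. \<forall>v\<in>P. ?q v = 0}"
    then obtain w where "w \<noteq> 0" "P = proj_point w" "\<forall>v\<in>proj_point w. ?q v = 0"
      by (auto simp only: proj_space_iff mem_Collect_eq)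
    then show "P \<in> proj_point ` {w. w \<noteq> 0 \<and> ?q w = 0}" using pt[of w] by blast
  next
    fix P assume "P \<in> proj_point ` {w. w \<noteq> 0 \<and> ?q w = 0}"
    then obtain w where "w \<noteq> 0" "P = proj_point w" "?q w = 0" by blast
    then show "P \<in> {P \<in> proj_space. \<forall>v\<in>P. ?q v = 0}" using pt[of w] proj_space_iff by blast
  qed
  show thesis
  proof (cases "a = 0")
    case True
    then have b: "b \<noteq> 0" using assms by auto
    have "proj_point ` {w. w \<noteq> 0 \<and> ?q w = 0} = {proj_point (v2 1 0), proj_point (v2 (-c) b)}"
    proof (intro equalityI subsetI)
      fix P assume "P \<in> proj_point ` {w. w \<noteq> 0 \<and> ?q w = 0}"
      then obtain w where w: "P = proj_point w" "w \<noteq> 0" "?q w = 0" by auto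
      obtain x y where xy: "w = v2 x y" by (rule v2_cases)
      have "y * (b * x + c * y) = 0" using w xy True by (simp add: power2_eq_square algebra_simps)
      then consider "y = 0" | "b * x + c * y = 0" by auto
      then show "P \<in> {proj_point (v2 1 0), proj_point (v2 (-c) b)}"
      proof cases
        case 1 then have "P = proj_point (v2 1 0)" using w xy by (simp add: proj_line_eq_iff)
        then show ?thesis by simp
      next
        case 2 then have "x * b = y * (- c)" by (simp add: algebra_simps eq_neg_iff_add_eq_0)
        then have "P = proj_point (v2 (-c) b)" using w xy b by (simp add: proj_line_eq_iff)
        then show ?thesis by simp
      qed
    next
      fix P assume "P \<in> {proj_point (v2 1 0), proj_point (v2 (-c) b)}"
      then show "P \<in> proj_point ` {w. w \<noteq> 0 \<and> ?q w = 0}"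
        using True b by (auto intro!: imageI simp: power2_eq_square)
    qed
    moreover have "proj_point (v2 1 0) \<noteq> proj_point (v2 (-c) b)" using b by (simp add: proj_line_eq_iff)
    ultimately show thesis using set that by auto
  next
    case False
    obtain r where r: "r ^ 2 = b ^ 2 - 4 * a * c" using nth_root_exists[of 2 "b ^ 2 - 4 * a * c"] by auto
    have r0: "r \<noteq> 0" using r assms by auto
    have "proj_point ` {w. w \<noteq> 0 \<and> ?q w = 0} = {proj_point (v2 (r - b) (2 * a)), proj_point (v2 (- r - b) (2 * a))}"
    proof (intro equalityI subsetI)
      fix P assume "P \<in> proj_point ` {w. w \<noteq> 0 \<and> ?q w = 0}"
      then obtain w where w: "P = proj_point w" "w \<noteq> 0" "?q w = 0" by auto
      obtain x y where xy: "w = v2 x y" by (rule v2_cases)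
      have q: "a * x ^ 2 + b * x * y + c * y ^ 2 = 0" using w xy by simp
      have y: "y \<noteq> 0 \<or> x \<noteq> 0" using w xy by auto
      have "(x * (2 * a) - y * (r - b)) * (x * (2 * a) - y * (- r - b)) = 4 * a * (a * x ^ 2 + b * x * y + c * y ^ 2) + y ^ 2 * (b ^ 2 - 4 * a * c - r ^ 2)"
        by (simp add: power2_eq_square algebra_simps)
      also have "\<dots> = 0" using q r by simp
      finally have "x * (2 * a) = y * (r - b) \<or> x * (2 * a) = y * (- r - b)" by auto
      then show "P \<in> {proj_point (v2 (r - b) (2 * a)), proj_point (v2 (- r - b) (2 * a))}"
        using w xy y False by (auto simp: proj_line_eq_iff)
    next
      fix P assume "P \<in> {proj_point (v2 (r - b) (2 * a)), proj_point (v2 (- r - b) (2 * a))}"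
      then obtain s where s: "s = r \<or> s = - r" "P = proj_point (v2 (s - b) (2 * a))" by auto
      have "a * (s - b) ^ 2 + b * (s - b) * (2 * a) + c * (2 * a) ^ 2 = a * (s ^ 2 - (b ^ 2 - 4 * a * c))"
        by (simp add: power2_eq_square algebra_simps)
      also have "\<dots> = 0" using s r by auto
      finally show "P \<in> proj_point ` {w. w \<noteq> 0 \<and> ?q w = 0}"
        using s False by (auto intro!: imageI)
    qed
    moreover have "proj_point (v2 (r - b) (2 * a)) \<noteq> proj_point (v2 (- r - b) (2 * a))"
      using False r0 by (auto simp: proj_line_eq_iff)
    ultimately show thesis using set that by auto
  qed
qed

text \<open>Trace \<open>2 l\<close> and determinant \<open>l^2\<close> mean
  \<open>(M - l)^2 = 0\<close>. The binomial expansion of \<open>(l + (M - l))^(k+1)\<close>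
  therefore stops after the linear term, which leaves \<open>l^k ((k + 1) M - k l)\<close>.\<close>

lemma mpow_degenerate:
  fixes a b c d l :: "'a::comm_ring_1"
  assumes "a + d = 2 * l" "a * d - b * c = l ^ 2"
  shows "mpow (m2 a b c d) (Suc k) = m2 (l ^ k * ((of_nat k + 1) * a - of_nat k * l)) (l ^ k * (of_nat k + 1) * b)
    (l ^ k * (of_nat k + 1) * c) (l ^ k * ((of_nat k + 1) * d - of_nat k * l))"
proof (induction k)
  case 0
  then show ?case by simp
next
  case (Suc k)
  have d: "d = 2 * l - a" using assms(1) by (simp add: algebra_simps)
  have bc: "b * c = - (l ^ 2) + 2 * l * a - a ^ 2" using assms(2) d by (simp add: power2_eq_square algebra_simps)
  have bcx: "b * (c * x) = (- (l ^ 2) + 2 * l * a - a ^ 2) * x" for x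
    using bc by (simp flip: mult.assoc)
  show ?case unfolding mpow.simps(2)[of _ "Suc k"] Suc
    by (simp add: m2_mult d algebra_simps bcx power2_eq_square bc)
qed

text \<open>Elements of finite order are diagonalisable in characteristic 0. If the quadratic form
  of fixed points had discriminant zero, \<open>mpow_degenerate\<close> would make \<open>M\<close>
  scalar, because a scalar power forces \<open>(k + 1) b = (k + 1) c = 0\<close> and
  \<open>a = d\<close>. A nonzero discriminant gives two zeros.\<close>

lemma fixed_points_two:
  fixes M :: "'a::{alg_closed_field, field_char_0}^2^2"
  assumes inv: "invertible M" and ns: "pgl_class M \<noteq> \<one>\<^bsub>PGL\<^esub>"
    and fin: "pgl_class M [^]\<^bsub>PGL\<^esub> (Suc k) = \<one>\<^bsub>PGL\<^esub>"
  obtains P Q where "P \<noteq> Q" "{P \<in> proj_space. pgl_act (pgl_class M) P = P} = {P, Q}"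
proof -
  obtain a b c d where M: "M = m2 a b c d" by (rule m2_cases)
  have det: "a * d - b * c \<noteq> 0" using inv M by (simp add: invertible_m2)
  have "(d - a) ^ 2 - 4 * c * (- b) \<noteq> 0"
  proof
    assume disc: "(d - a) ^ 2 - 4 * c * (- b) = 0"
    define l where "l = (a + d) / 2"
    have 1: "a + d = 2 * l" by (simp add: l_def)
    have "4 * (a * d - b * c) = (a + d) ^ 2 - ((d - a) ^ 2 - 4 * c * (- b))" by (simp add: power2_eq_square algebra_simps)
    then have 2: "a * d - b * c = l ^ 2" using disc by (simp add: l_def field_simps power2_eq_square)
    have l0: "l \<noteq> 0" using 2 det by auto
    have "pgl_class (mpow M (Suc k)) = pgl_class (mat 1)" using fin PGL_pow[OF inv] PGL_one by metis
    then obtain s where "mpow M (Suc k) = mat s ** mat 1" unfolding pgl_class_eq_iff by blast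
    then have s: "mpow M (Suc k) = mat s" by (simp only: matrix_mul_rid)
    then have "m2 (l ^ k * ((of_nat k + 1) * a - of_nat k * l)) (l ^ k * (of_nat k + 1) * b)
      (l ^ k * (of_nat k + 1) * c) (l ^ k * ((of_nat k + 1) * d - of_nat k * l)) = m2 s 0 0 s"
      using mpow_degenerate[OF 1 2, of k] M unfolding s mat_m2 by (simp only: s[unfolded M] mat_m2)
    moreover have n0: "of_nat k + 1 \<noteq> (0::'a)" using of_nat_neq_0[of k, where 'a='a] by (simp add: add.commute)
    ultimately have "b = 0" "c = 0" "l ^ k * ((of_nat k + 1) * a - of_nat k * l) = l ^ k * ((of_nat k + 1) * d - of_nat k * l)"
      using l0 by auto
    then have "b = 0" "c = 0" "a = d" using l0 n0 by auto
    then have "M = mat a ** mat 1" "a \<noteq> 0" using M det by (auto simp: mat_m2 m2_mult)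
    then have "pgl_class M = \<one>\<^bsub>PGL\<^esub>" unfolding PGL_one pgl_class_eq_iff by auto
    then show False using ns by simp
  qed
  then obtain P Q :: "('a^2) set" where PQ: "P \<noteq> Q" "{P \<in> proj_space. \<forall>v\<in>P. c * v$1 ^ 2 + (d - a) * v$1 * v$2 + (- b) * v$2 ^ 2 = 0} = {P, Q}"
    by (rule quadratic_two_zeros)
  have fx: "pgl_act (pgl_class M) P = P \<longleftrightarrow> (\<forall>v\<in>P. c * v$1 ^ 2 + (d - a) * v$1 * v$2 + (- b) * v$2 ^ 2 = 0)"
    if P: "P \<in> proj_space" for P
  proof -
    obtain v where v: "v \<noteq> 0" "P = proj_point v" using P by (auto simp: proj_space_iff)
    obtain x y where xy: "v = v2 x y" by (rule v2_cases)
    have "(\<forall>v\<in>P. c * v$1 ^ 2 + (d - a) * v$1 * v$2 + (- b) * v$2 ^ 2 = 0) \<longleftrightarrow> c * x ^ 2 + (d - a) * x * y + (- b) * y ^ 2 = 0" (is "?l = ?r")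
    proof
      assume ?l then have "c * v$1 ^ 2 + (d - a) * v$1 * v$2 + (- b) * v$2 ^ 2 = 0"
        using proj_point_self[of v] v by blast
      then show ?r by (simp add: xy)
    next
      assume r: ?r
      show ?l
      proof
        fix w assume "w \<in> P"
        then obtain k where "w = v2 (k * x) (k * y)" using v xy by (auto simp: proj_point_def)
        then have "c * w$1 ^ 2 + (d - a) * w$1 * w$2 + (- b) * w$2 ^ 2 = k ^ 2 * (c * x ^ 2 + (d - a) * x * y + (- b) * y ^ 2)"
          by (simp add: power2_eq_square algebra_simps)
        then show "c * w$1 ^ 2 + (d - a) * w$1 * w$2 + (- b) * w$2 ^ 2 = 0" using r by simp
      qed
    qed
    then show ?thesis using fixed_iff[of a b c d x y] inv M v xy by simp
  qed
  have "{P \<in> proj_space. pgl_act (pgl_class M) P = P} = {P, Q}"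
    unfolding PQ(2)[symmetric] by (rule Collect_cong, rule conj_cong[OF refl], rule fx)
  with PQ(1) show thesis by (rule that)
qed

lemma PGL2_two_point_action:
  fixes H :: "('a::{alg_closed_field, field_char_0}^2^2) set set"
  assumes sub: "subgroup H PGL" and fin: "finite H"
  shows "two_point_action (PGL\<lparr>carrier := H\<rparr>) proj_space pgl_act"
proof -
  interpret P: group "PGL :: ('a^2^2) set monoid" by (rule PGL_group)
  interpret S: subgroup H "PGL :: ('a^2^2) set monoid" by (rule sub)
  interpret G: group "PGL\<lparr>carrier := H\<rparr>" by (rule S.subgroup_is_group[OF PGL_group])
  show ?thesis
  proof
    fix g assume g: "g \<in> carrier (PGL\<lparr>carrier := H\<rparr>)" and n1: "g \<noteq> \<one>\<^bsub>PGL\<lparr>carrier := H\<rparr>\<^esub>"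
    then have gP: "g \<in> carrier PGL" "g \<in> H" using S.subset by auto
    obtain M where M: "invertible M" "g = pgl_class M" using gP by (auto simp: PGL_carrier)
    have "g [^]\<^bsub>PGL\<lparr>carrier := H\<rparr>\<^esub> card H = \<one>\<^bsub>PGL\<lparr>carrier := H\<rparr>\<^esub>"
      using G.pow_order_eq_1[of g] g by (simp add: Coset.order_def)
    then have "g [^]\<^bsub>PGL\<^esub> card H = \<one>\<^bsub>PGL\<^esub>" by (simp add: nat_pow_def)
    moreover obtain k where "card H = Suc k" using fin gP by (cases "card H") auto
    ultimately have "pgl_class M [^]\<^bsub>PGL\<^esub> Suc k = \<one>\<^bsub>PGL\<^esub>" "pgl_class M \<noteq> \<one>\<^bsub>PGL\<^esub>"
      using n1 M by (simp_all del: nat_pow_Suc)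
    then obtain P Q where "P \<noteq> Q" "{P \<in> proj_space. pgl_act g P = P} = {P, Q}"
      unfolding M(2) by - (rule fixed_points_two[OF M(1)])
    then show "card {x \<in> proj_space. pgl_act g x = x} = 2" by simp
  qed (use fin S.subset in \<open>auto simp: pgl_act_closed pgl_act_mult pgl_act_one\<close>)
qed

text \<open>Three pairwise independent eigenvectors in a plane: expressing the third in terms of the
  other two forces all eigenvalues to agree. \<open>?D\<close>, \<open>?A\<close>, \<open>?B\<close>
  are the determinants of Cramer's rule in that expression.\<close>

lemma three_fixed_points:
  fixes M :: "'a::{alg_closed_field, field_char_0}^2^2"
  assumes inv: "invertible M" and fx: "\<And>P. P \<in> S \<Longrightarrow> pgl_act (pgl_class M) P = P"
    and S: "S \<subseteq> proj_space" "finite S" "card S \<ge> 3"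
  shows "pgl_class M = \<one>\<^bsub>PGL\<^esub>"
proof -
  obtain a b c d where M: "M = m2 a b c d" by (rule m2_cases)
  obtain P Q R where PQR: "P \<in> S" "Q \<in> S" "R \<in> S" "P \<noteq> Q" "Q \<noteq> R" "P \<noteq> R"
  proof -
    obtain T where "T \<subseteq> S" "card T = 3" using S by (meson obtain_subset_with_card_n)
    then obtain P Q R where "{P, Q, R} \<subseteq> S" "P \<noteq> Q" "Q \<noteq> R" "P \<noteq> R" unfolding card_3_iff by blast
    then show thesis by (intro that[of P Q R]) simp_all
  qed
  obtain p where p: "p \<noteq> 0" "P = proj_point p" using PQR S(1) by (metis proj_space_iff subsetD)
  obtain q where q: "q \<noteq> 0" "Q = proj_point q" using PQR S(1) by (metis proj_space_iff subsetD)
  obtain r where r: "r \<noteq> 0" "R = proj_point r" using PQR S(1) by (metis proj_space_iff subsetD)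
  have ev: "\<exists>k. M *v v = k *s v" if "proj_point v \<in> S" for v
  proof -
    have "proj_point v = proj_point (M *v v)" using fx[OF that] by (simp only: pgl_act_point)
    then show ?thesis unfolding proj_point_eq_iff by blast
  qed
  obtain k1 where k1: "M *v p = k1 *s p" using ev PQR p by auto
  obtain k2 where k2: "M *v q = k2 *s q" using ev PQR q by auto
  obtain k3 where k3: "M *v r = k3 *s r" using ev PQR r by auto
  obtain p1 p2 where p12: "p = v2 p1 p2" by (rule v2_cases)
  obtain q1 q2 where q12: "q = v2 q1 q2" by (rule v2_cases)
  obtain r1 r2 where r12: "r = v2 r1 r2" by (rule v2_cases)
  have n1: "p1 * q2 \<noteq> p2 * q1" using PQR p q p12 q12 by (simp add: proj_line_eq_iff)
  have n2: "p1 * r2 \<noteq> p2 * r1" using PQR p r p12 r12 by (simp add: proj_line_eq_iff)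
  have n3: "q1 * r2 \<noteq> q2 * r1" using PQR r q r12 q12 by (simp add: proj_line_eq_iff)
  let ?D = "p1 * q2 - p2 * q1" and ?A = "r1 * q2 - r2 * q1" and ?B = "p1 * r2 - p2 * r1"
  have D: "?D \<noteq> 0" "?A \<noteq> 0" "?B \<noteq> 0" using n1 n2 n3 by (auto simp: mult.commute)
  have e1: "a * p1 + b * p2 = k1 * p1" "c * p1 + d * p2 = k1 * p2" using k1 M p12 by auto
  have e2: "a * q1 + b * q2 = k2 * q1" "c * q1 + d * q2 = k2 * q2" using k2 M q12 by auto
  have e3: "a * r1 + b * r2 = k3 * r1" "c * r1 + d * r2 = k3 * r2" using k3 M r12 by auto
  have r1: "?D * r1 = ?A * p1 + ?B * q1" "?D * r2 = ?A * p2 + ?B * q2" by (simp_all add: algebra_simps)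
  have "?D * (k3 * r1) = ?A * (k1 * p1) + ?B * (k2 * q1)"
    unfolding e1[symmetric] e2[symmetric] e3[symmetric] by (simp add: algebra_simps)
  moreover have "?D * (k3 * r2) = ?A * (k1 * p2) + ?B * (k2 * q2)"
    unfolding e1[symmetric] e2[symmetric] e3[symmetric] by (simp add: algebra_simps)
  moreover have "?D * (k3 * r1) = k3 * (?A * p1 + ?B * q1)" "?D * (k3 * r2) = k3 * (?A * p2 + ?B * q2)"
    using r1 by (simp_all only: mult.left_commute[of ?D] r1)
  ultimately have f: "?A * (k1 - k3) * p1 + ?B * (k2 - k3) * q1 = 0" "?A * (k1 - k3) * p2 + ?B * (k2 - k3) * q2 = 0"
    by (simp_all add: algebra_simps)
  have "?A * (k1 - k3) * ?D = (?A * (k1 - k3) * p1 + ?B * (k2 - k3) * q1) * q2 - (?A * (k1 - k3) * p2 + ?B * (k2 - k3) * q2) * q1"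
    by (simp add: algebra_simps)
  then have k13: "k1 = k3" using f D by simp
  then have k23: "k2 = k3" using f D p12 q q12 by auto
  have "(a - k3) * ?D = (a * p1 + b * p2 - k3 * p1) * q2 - (a * q1 + b * q2 - k3 * q1) * p2"
    "b * ?D = p1 * (a * q1 + b * q2 - k3 * q1) - q1 * (a * p1 + b * p2 - k3 * p1)"
    "c * ?D = (c * p1 + d * p2 - k3 * p2) * q2 - (c * q1 + d * q2 - k3 * q2) * p2"
    "(d - k3) * ?D = p1 * (c * q1 + d * q2 - k3 * q2) - q1 * (c * p1 + d * p2 - k3 * p2)"
    by (simp_all add: algebra_simps)
  then have "a = k3" "b = 0" "c = 0" "d = k3" using e1 e2 k13 k23 D by auto
  then have "M = mat k3 ** mat 1" "k3 \<noteq> 0" using M inv by (auto simp: mat_m2 m2_mult invertible_m2)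
  then show ?thesis unfolding PGL_one pgl_class_eq_iff by auto
qed

section \<open>Binary forms\<close>

text \<open>Forms are taken as functions, which loses nothing over an infinite field: substitution
  becomes composition and equality is pointwise. The degree is an argument, so the zero function is
  a form of every degree.\<close>

inductive bform :: "nat \<Rightarrow> ('a::field^2 \<Rightarrow> 'a) \<Rightarrow> bool" where
  const: "bform 0 (\<lambda>v. c)"
| x: "bform d F \<Longrightarrow> bform (Suc d) (\<lambda>v. v$1 * F v)"
| y: "bform d F \<Longrightarrow> bform (Suc d) (\<lambda>v. v$2 * F v)"
| add: "bform d F \<Longrightarrow> bform d G \<Longrightarrow> bform d (\<lambda>v. F v + G v)"

lemma bform_scale: "bform d F \<Longrightarrow> bform d (\<lambda>v. c * F v)"
proof (induction rule: bform.induct)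
  case (x d F)
  show ?case using bform.x[OF x.IH] by (simp add: mult.left_commute)
next
  case (y d F)
  show ?case using bform.y[OF y.IH] by (simp add: mult.left_commute)
next
  case (add d F G)
  show ?case using bform.add[OF add.IH] by (simp add: distrib_left)
qed (rule bform.const)

lemma bform_ex: "\<exists>F. bform d F"
  by (induction d) (auto intro: bform.intros)

lemma bform_zero: "bform d (\<lambda>v. 0)"
  using bform_ex[of d] bform_scale[of d _ 0] by auto

lemma bform_diff: "bform d F \<Longrightarrow> bform d G \<Longrightarrow> bform d (\<lambda>v. F v - G v)"
  using bform.add[OF _ bform_scale[of d G "-1"]] by simp

lemma bform_mult: "bform d F \<Longrightarrow> bform e G \<Longrightarrow> bform (d + e) (\<lambda>v. F v * G v)"
proof (induction rule: bform.induct)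
  case (x d F)
  show ?case using bform.x[OF x.IH[OF x.prems]] by (simp add: mult.assoc)
next
  case (y d F)
  show ?case using bform.y[OF y.IH[OF y.prems]] by (simp add: mult.assoc)
next
  case (add d F G)
  show ?case using bform.add[OF add.IH(1)[OF add.prems] add.IH(2)[OF add.prems]] by (simp add: distrib_right)
qed (simp add: bform_scale)

lemma bform_power: "bform d F \<Longrightarrow> bform (n * d) (\<lambda>v. F v ^ n)"
  by (induction n) (auto intro: bform.const dest: bform_mult)

lemma bform_sum: "(\<And>k. k \<in> A \<Longrightarrow> bform d (F k)) \<Longrightarrow> bform d (\<lambda>v. \<Sum>k\<in>A. F k v)"
  by (induction A rule: infinite_finite_induct) (auto intro: bform_zero bform.add)

lemma bform_prod: "finite A \<Longrightarrow> (\<And>k. k \<in> A \<Longrightarrow> bform d (F k)) \<Longrightarrow> bform (card A * d) (\<lambda>v. \<Prod>k\<in>A. F k v)"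
  by (induction A rule: finite_induct) (auto intro: bform.const dest: bform_mult)

lemma bform_X: "bform 1 (\<lambda>v. v$1)" and bform_Y: "bform 1 (\<lambda>v. v$2)"
  using bform.x[OF bform.const[of 1]] bform.y[OF bform.const[of 1]] by simp_all

lemma bform_monom: "bform (a + b) (\<lambda>v. c * v$1 ^ a * v$2 ^ b)"
  using bform_mult[OF bform_scale[OF bform_power[OF bform_X, of a], of c] bform_power[OF bform_Y, of b]]
  by simp

lemma bform_comp: "bform d F \<Longrightarrow> bform d (\<lambda>v. F (M *v v))"
proof (induction rule: bform.induct)
  case (x d F)
  have "bform (1 + d) (\<lambda>v. (M$1$1 * v$1 + M$1$2 * v$2) * F (M *v v))"
    by (intro bform_mult bform.add bform_scale bform_X bform_Y x.IH)
  then show ?case by (simp add: matrix_vector_mult_def sum_2)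
next
  case (y d F)
  have "bform (1 + d) (\<lambda>v. (M$2$1 * v$1 + M$2$2 * v$2) * F (M *v v))"
    by (intro bform_mult bform.add bform_scale bform_X bform_Y y.IH)
  then show ?case by (simp add: matrix_vector_mult_def sum_2)
next
  case (add d F G)
  show ?case by (rule bform.add[OF add.IH])
qed (rule bform.const)

lemma bform_homog: "bform d F \<Longrightarrow> F (c *s v) = c ^ d * F v"
  by (induction rule: bform.induct) (auto simp: algebra_simps)

lemma bform_coeffs: "bform d F \<Longrightarrow> \<exists>p. \<forall>v. F v = (\<Sum>k\<le>d. p k * v$1 ^ k * v$2 ^ (d - k))"
proof (induction rule: bform.induct)
  case (const c)
  show ?case by (intro exI[of _ "\<lambda>_. c"]) simp
next
  case (x d F)
  then obtain p where p: "\<And>v. F v = (\<Sum>k\<le>d. p k * v$1 ^ k * v$2 ^ (d - k))" by auto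
  let ?q = "\<lambda>k. if k = 0 then 0 else p (k - 1)"
  have "v$1 * F v = (\<Sum>k\<le>Suc d. ?q k * v$1 ^ k * v$2 ^ (Suc d - k))" for v
    unfolding sum.atMost_Suc_shift p by (simp add: sum_distrib_left mult_ac)
  then show ?case by (intro exI[of _ ?q] allI)
next
  case (y d F)
  then obtain p where p: "\<And>v. F v = (\<Sum>k\<le>d. p k * v$1 ^ k * v$2 ^ (d - k))" by auto
  let ?q = "\<lambda>k. if k = Suc d then 0 else p k"
  have "v$2 * F v = (\<Sum>k\<le>Suc d. ?q k * v$1 ^ k * v$2 ^ (Suc d - k))" for v
    unfolding p sum_distrib_left sum.atMost_Suc by (auto intro!: sum.cong simp: Suc_diff_le mult_ac)
  then show ?case by (intro exI[of _ ?q] allI)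
next
  case (add d F G)
  then obtain p q where "\<And>v. F v = (\<Sum>k\<le>d. p k * v$1 ^ k * v$2 ^ (d - k))"
    "\<And>v. G v = (\<Sum>k\<le>d. q k * v$1 ^ k * v$2 ^ (d - k))" by auto
  then show ?case by (intro exI[of _ "\<lambda>k. p k + q k"]) (simp add: distrib_right sum.distrib)
qed

definition zeros :: "('a::field^2 \<Rightarrow> 'a) \<Rightarrow> ('a^2) set set" where
  "zeros F = {P \<in> proj_space. \<forall>v\<in>P. F v = 0}"

lemma zeros_point: "bform d F \<Longrightarrow> proj_point v \<in> zeros F \<longleftrightarrow> proj_point v \<in> proj_space \<and> F v = 0"
  unfolding zeros_def using proj_point_self[of v]
  by (auto simp: proj_point_def bform_homog)

lemma zeros_v2: "bform d F \<Longrightarrow> x \<noteq> 0 \<or> y \<noteq> 0 \<Longrightarrow> proj_point (v2 x y) \<in> zeros F \<longleftrightarrow> F (v2 x y) = 0"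
  by (subst zeros_point) (auto simp: proj_space_def)

lemma zeros_sub: "zeros F \<subseteq> proj_space"
  by (auto simp: zeros_def)

lemma zeros_cases:
  assumes "bform d F" "P \<in> zeros F"
  obtains v where "v \<noteq> 0" "P = proj_point v" "F v = 0"
  using assms zeros_point[OF assms(1)] by (metis (no_types, lifting) proj_space_iff subsetD zeros_sub)

text \<open>Setting \<open>y = 1\<close> gives a polynomial of degree at most \<open>d\<close>. The
  point (1:0) is a further zero only if the coefficient of degree \<open>d\<close> vanishes, and in
  that case one affine root fewer is possible.\<close>

lemma bform_zeros:
  assumes F: "bform d F" and nz: "F w \<noteq> 0"
  shows "finite (zeros F)" "card (zeros F) \<le> d"
proof -
  obtain p where p: "\<And>v. F v = (\<Sum>k\<le>d. p k * v$1 ^ k * v$2 ^ (d - k))" using bform_coeffs[OF F] by auto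
  define q where "q = (\<Sum>k\<le>d. monom (p k) k)"
  have ev: "poly q x = F (v2 x 1)" for x by (simp add: q_def p poly_sum poly_monom)
  have cf: "coeff q k = (if k \<le> d then p k else 0)" for k
    by (simp add: q_def coeff_sum)
  have deg: "degree q \<le> d" by (rule degree_le) (simp add: cf)
  have q0: "q \<noteq> 0"
  proof
    assume "q = 0"
    then have "p k = 0" if "k \<le> d" for k using cf[of k] that by simp
    then show False using nz p by simp
  qed
  have Fd: "F (v2 1 0) = p d"
  proof -
    have "F (v2 1 0) = (\<Sum>k\<in>{d}. p k * 1 ^ k * 0 ^ (d - k))"
      unfolding p v2_nth by (rule sum.mono_neutral_right) auto
    then show ?thesis by simp
  qed
  define A where "A = (\<lambda>x. proj_point (v2 x 1)) ` {x. poly q x = 0}"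
  define B :: "('a^2) set set" where "B = (if p d = 0 then {proj_point (v2 1 0)} else {})"
  have sub: "zeros F \<subseteq> A \<union> B"
  proof
    fix P assume "P \<in> zeros F"
    then obtain v where v: "v \<noteq> 0" "P = proj_point v" "F v = 0" by (rule zeros_cases[OF F])
    obtain x y where xy: "v = v2 x y" by (rule v2_cases)
    show "P \<in> A \<union> B"
    proof (cases "y = 0")
      case True
      then have "P = proj_point (v2 1 0)" using v xy by (simp add: proj_line_eq_iff)
      moreover have "F (v2 1 0) = 0"
        using v xy True bform_homog[OF F, of x "v2 1 0"] by simp
      ultimately show ?thesis using Fd by (simp add: B_def)
    next
      case False
      then have P: "P = proj_point (v2 (x / y) 1)" using v xy by (simp add: proj_line_eq_iff)
      have "F (v2 (x / y) 1) = 0"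
        using v xy False bform_homog[OF F, of y "v2 (x / y) 1"] by simp
      then show ?thesis unfolding A_def P by (auto simp: ev)
    qed
  qed
  have fr: "finite {x. poly q x = 0}" using q0 by (rule poly_roots_finite)
  then have fin: "finite (A \<union> B)" by (simp add: A_def B_def)
  then show "finite (zeros F)" using sub by (rule finite_subset[rotated])
  have cA: "card A \<le> degree q"
    unfolding A_def using card_image_le[OF fr] card_poly_roots_bound[OF q0] by (rule order_trans)
  have "card (zeros F) \<le> card (A \<union> B)" using sub fin by (rule card_mono[rotated])
  also have "\<dots> \<le> card A + card B" by (rule card_Un_le)
  also have "\<dots> \<le> d"
  proof (cases "p d = 0")
    case True
    then have "coeff q d = 0" by (simp add: cf)
    then have "degree q \<noteq> d" using q0 leading_coeff_0_iff by blast
    then show ?thesis using deg cA by (simp add: B_def)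
  next
    case False then show ?thesis using deg cA by (simp add: B_def)
  qed
  finally show "card (zeros F) \<le> d" .
qed

text \<open>The linear combination of \<open>F\<close> and \<open>G\<close> that vanishes at a
  chosen point off the zeros of \<open>F\<close> also vanishes at the zeros of \<open>F\<close>.
  With \<open>d + 1\<close> zeros in all it is identically zero.\<close>

lemma bform_proportional:
  assumes F: "bform d F" and G: "bform d G" and d: "d > 0" and card: "card (zeros F) \<ge> d"
    and z: "zeros F \<subseteq> zeros G" and nF: "F w \<noteq> 0"
  obtains c where "\<And>v. G v = c * F v"
proof -
  have w0: "w \<noteq> 0" using nF d bform_homog[OF F, of 0 0] by (auto simp: zero_power)
  have wn: "proj_point w \<notin> zeros F" using nF zeros_point[OF F] by auto
  define H where "H = (\<lambda>v. F w * G v - G w * F v)"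
  have H: "bform d H" unfolding H_def by (intro bform_diff bform_scale F G)
  have "insert (proj_point w) (zeros F) \<subseteq> zeros H"
  proof
    fix P assume P: "P \<in> insert (proj_point w) (zeros F)"
    show "P \<in> zeros H"
    proof (cases "P = proj_point w")
      case True then show ?thesis using w0 unfolding True by (subst zeros_point[OF H]) (auto simp: H_def proj_space_def)
    next
      case False
      then have "P \<in> zeros F" using P by simp
      then obtain v where "v \<noteq> 0" "P = proj_point v" "F v = 0" by (rule zeros_cases[OF F])
      moreover have "G v = 0" using \<open>P \<in> zeros F\<close> z calculation zeros_point[OF G] by auto
      ultimately show ?thesis unfolding \<open>P = proj_point v\<close>
        by (subst zeros_point[OF H]) (auto simp: H_def proj_space_def)
    qed
  qed
  have "H v = 0" for v
  proof (rule ccontr)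
    assume "H v \<noteq> 0"
    note Z = bform_zeros[OF H this]
    have "card (insert (proj_point w) (zeros F)) \<le> d"
      using card_mono[OF Z(1) \<open>insert (proj_point w) (zeros F) \<subseteq> zeros H\<close>] Z(2) by simp
    then show False using card wn bform_zeros(1)[OF F nF] by simp
  qed
  then have "G v = (G w / F w) * F v" for v using nF by (simp add: H_def field_simps)
  then show thesis by (rule that)
qed

lemma zeros_invariant:
  assumes F: "bform d F" and M: "invertible M" and inv: "\<And>v. F (M *v v) = c * F v" "c \<noteq> 0"
  shows "pgl_act (pgl_class M) ` zeros F = zeros F"
proof -
  obtain N where N: "M ** N = mat 1" "N ** M = mat 1" "invertible N" by (rule invertible_inv[OF M])
  show ?thesis
  proof (intro equalityI subsetI)
    fix P assume "P \<in> pgl_act (pgl_class M) ` zeros F"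
    then obtain v where v: "v \<noteq> 0" "P = pgl_act (pgl_class M) (proj_point v)" "F v = 0"
      by (auto elim!: zeros_cases[OF F])
    show "P \<in> zeros F" unfolding v(2) pgl_act_point
      using v M invertible_vec_nz[OF M v(1)] inv by (subst zeros_point[OF F]) (auto simp: proj_space_def)
  next
    fix P assume "P \<in> zeros F"
    then obtain v where v: "v \<noteq> 0" "P = proj_point v" "F v = 0" by (rule zeros_cases[OF F])
    have "F (N *v v) = 0" using inv(1)[of "N *v v"] inv(2) v by (simp add: matrix_vector_mul_assoc N)
    then have "proj_point (N *v v) \<in> zeros F"
      using invertible_vec_nz[OF N(3) v(1)] by (subst zeros_point[OF F]) (auto simp: proj_space_def)
    moreover have "P = pgl_act (pgl_class M) (proj_point (N *v v))"
      by (simp add: pgl_act_point v matrix_vector_mul_assoc N)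
    ultimately show "P \<in> pgl_act (pgl_class M) ` zeros F" by blast
  qed
qed

definition stab :: "('a::field^2 \<Rightarrow> 'a) \<Rightarrow> ('a^2^2) set set" where
  "stab F = {pgl_class M |M. invertible M \<and> (\<exists>c. c \<noteq> 0 \<and> (\<forall>v. F (M *v v) = c * F v))}"

lemma stab_subgroup: "subgroup (stab F) PGL"
proof (rule group.subgroupI[OF PGL_group])
  show "stab F \<subseteq> carrier PGL" by (auto simp: stab_def PGL_carrier)
  have "pgl_class (mat 1) \<in> stab F" unfolding stab_def mem_Collect_eq
    by (rule exI[of _ "mat 1"]) (simp add: invertible_mat exI[of _ "1::'a"])
  then show "stab F \<noteq> {}" by auto
next
  fix a assume "a \<in> stab F"
  then obtain M c where M: "a = pgl_class M" "invertible M" "c \<noteq> 0" "\<And>v. F (M *v v) = c * F v"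
    by (auto simp: stab_def)
  obtain N where N: "M ** N = mat 1" "N ** M = mat 1" "invertible N" by (rule invertible_inv[OF M(2)])
  have "F (N *v v) = inverse c * F v" for v
    using M(4)[of "N *v v"] M(3) by (simp add: matrix_vector_mul_assoc N)
  then show "inv\<^bsub>PGL\<^esub> a \<in> stab F" unfolding M(1) PGL_inv[OF N(1,2)] stab_def
    using N M by (auto intro!: exI[of _ N] exI[of _ "inverse c"])
next
  fix a b assume "a \<in> stab F" "b \<in> stab F"
  then obtain M c N e where "a = pgl_class M" "invertible M" "c \<noteq> 0" "\<And>v. F (M *v v) = c * F v"
     "b = pgl_class N" "invertible N" "e \<noteq> 0" "\<And>v. F (N *v v) = e * F v"
    by (auto simp: stab_def)
  then show "a \<otimes>\<^bsub>PGL\<^esub> b \<in> stab F" unfolding stab_def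
    by (auto simp: PGL_mult invertible_mult simp flip: matrix_vector_mul_assoc
      intro!: exI[of _ "M ** N"] exI[of _ "c * e"])
qed

lemma stab_zeros: "bform d F \<Longrightarrow> A \<in> stab F \<Longrightarrow> pgl_act A ` zeros F = zeros F"
  unfolding stab_def using zeros_invariant by blast

text \<open>The stabiliser permutes the finitely many zeros, and faithfully so, since a class fixing
  three points of the line is trivial.\<close>

lemma finite_stab:
  fixes F :: "'a::{alg_closed_field, field_char_0}^2 \<Rightarrow> 'a"
  assumes F: "bform d F" and fin: "finite (zeros F)" and three: "card (zeros F) \<ge> 3"
  shows "finite (stab F)"
proof -
  interpret P: group "PGL :: ('a^2^2) set monoid" by (rule PGL_group)
  interpret S: subgroup "stab F" "PGL :: ('a^2^2) set monoid" by (rule stab_subgroup)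
  let ?r = "\<lambda>A. restrict (pgl_act A) (zeros F)"
  have "inj_on ?r (stab F)"
  proof (rule inj_onI)
    fix A B assume A: "A \<in> stab F" and B: "B \<in> stab F" and e: "?r A = ?r B"
    have AP: "A \<in> carrier PGL" "B \<in> carrier PGL" using A B S.subset by auto
    let ?C = "inv\<^bsub>PGL\<^esub> B \<otimes>\<^bsub>PGL\<^esub> A"
    have CP: "?C \<in> carrier PGL" using AP by simp
    then obtain M where M: "invertible M" "?C = pgl_class M" by (auto simp: PGL_carrier)
    have fx: "pgl_act (pgl_class M) P = P" if "P \<in> zeros F" for P
    proof -
      have P: "P \<in> proj_space" using that zeros_sub by auto
      have "pgl_act A P = pgl_act B P" using fun_cong[OF e, of P] that by simp
      then have "pgl_act ?C P = pgl_act (inv\<^bsub>PGL\<^esub> B) (pgl_act B P)"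
        using AP P by (simp add: pgl_act_mult)
      also have "\<dots> = pgl_act (inv\<^bsub>PGL\<^esub> B \<otimes>\<^bsub>PGL\<^esub> B) P" using AP P by (simp only: pgl_act_mult P.inv_closed)
      also have "\<dots> = P" using AP P by (simp add: pgl_act_one)
      finally show ?thesis using M by simp
    qed
    have "?C = \<one>\<^bsub>PGL\<^esub>" unfolding M(2) by (rule three_fixed_points[OF M(1) fx zeros_sub fin three])
    then show "A = B" using AP P.inv_solve_left[of "\<one>\<^bsub>PGL\<^esub>" B A] by simp
  qed
  moreover have "?r ` stab F \<subseteq> (zeros F \<rightarrow>\<^sub>E zeros F)"
  proof -
    have "pgl_act A x \<in> zeros F" if "A \<in> stab F" "x \<in> zeros F" for A x
      using stab_zeros[OF F that(1)] that(2) by blast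
    then show ?thesis by auto
  qed
  moreover have "finite (zeros F \<rightarrow>\<^sub>E zeros F)" using fin by (intro finite_PiE)
  ultimately show ?thesis by (meson finite_imageD finite_subset)
qed

section \<open>The Klein forms\<close>

text \<open>\<open>f12\<close>, \<open>f20\<close> and \<open>f30\<close> are Klein's forms of the
  icosahedron, belonging to the vertices, the centres of faces and the midpoints of edges. They
  agree with Klein's up to signs and the substitution in \<open>quarter_turn\<close>, which is how
  \<open>i\<close> gets into the coefficients.\<close>

definition f12 :: "'a::field \<Rightarrow> 'a^2 \<Rightarrow> 'a" where
  "f12 i v = v$1 * v$2 * (v$1 ^ 10 + (- 11 * i) * (v$1 * v$2) ^ 5 + v$2 ^ 10)"
definition f20 :: "'a::field \<Rightarrow> 'a^2 \<Rightarrow> 'a" where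
  "f20 i v = (v$1 ^ 20 + v$2 ^ 20) + (228 * i) * (v$1 * v$2) ^ 5 * (v$1 ^ 10 + v$2 ^ 10) + (- 494) * (v$1 * v$2) ^ 10"
definition f30 :: "'a::field \<Rightarrow> 'a^2 \<Rightarrow> 'a" where
  "f30 i v = (v$1 ^ 30 - v$2 ^ 30) + (- 522 * i) * (v$1 * v$2) ^ 5 * (v$1 ^ 20 - v$2 ^ 20)
     + 10005 * (v$1 * v$2) ^ 10 * (v$1 ^ 10 - v$2 ^ 10)"
definition f60 :: "'a::field \<Rightarrow> 'a \<Rightarrow> 'a^2 \<Rightarrow> 'a" where
  "f60 i a v = v$1 ^ 60 + v$2 ^ 60 + a * (v$1 * v$2) ^ 30
     + (\<Sum>k=1..5. e60 i a k * (v$1 * v$2) ^ (5 * k) * (v$1 ^ (60 - 10 * k) + v$2 ^ (60 - 10 * k)))"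

lemma bform_Xn: "bform n (\<lambda>v. v$1 ^ n)" and bform_Yn: "bform n (\<lambda>v. v$2 ^ n)"
  and bform_XYn: "bform (2 * n) (\<lambda>v. (v$1 * v$2) ^ n)"
  using bform_power[OF bform_X, of n] bform_power[OF bform_Y, of n] bform_power[OF bform_mult[OF bform_X bform_Y], of n]
  by (simp_all add: mult_2_right mult_2)

lemma bform_f12: "bform 12 (f12 i)"
proof -
  have "bform 12 (\<lambda>v. (v$1 * v$2) * ((v$1 ^ 10 + (- 11 * i) * (v$1 * v$2) ^ 5) + v$2 ^ 10))"
    using bform_mult[OF bform_mult[OF bform_X bform_Y] bform.add[OF bform.add[OF bform_Xn[of 10]
      bform_scale[OF bform_XYn[of 5, simplified], of "-11 * i"]] bform_Yn[of 10]]] by simp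
  then show ?thesis by (simp add: f12_def[abs_def])
qed

lemma bform_f20: "bform 20 (f20 i)"
proof -
  have "bform 20 (\<lambda>v. ((228 * i) * (v$1 * v$2) ^ 5) * (v$1 ^ 10 + v$2 ^ 10))"
    using bform_mult[OF bform_scale[OF bform_XYn[of 5], of "228 * i"] bform.add[OF bform_Xn[of 10] bform_Yn[of 10]]] by simp
  moreover have "bform 20 (\<lambda>v. (- 494) * (v$1 * v$2) ^ 10)"
    using bform_scale[OF bform_XYn[of 10], of "-494"] by simp
  ultimately show ?thesis unfolding f20_def[abs_def]
    by (intro bform.add bform_Xn bform_Yn)
qed

lemma bform_f30: "bform 30 (f30 i)"
proof -
  have "bform 30 (\<lambda>v. ((- 522 * i) * (v$1 * v$2) ^ 5) * (v$1 ^ 20 - v$2 ^ 20))"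
    using bform_mult[OF bform_scale[OF bform_XYn[of 5], of "- 522 * i"] bform_diff[OF bform_Xn[of 20] bform_Yn[of 20]]] by simp
  moreover have "bform 30 (\<lambda>v. (10005 * (v$1 * v$2) ^ 10) * (v$1 ^ 10 - v$2 ^ 10))"
    using bform_mult[OF bform_scale[OF bform_XYn[of 10], of 10005] bform_diff[OF bform_Xn[of 10] bform_Yn[of 10]]] by simp
  ultimately show ?thesis unfolding f30_def[abs_def]
    by (intro bform.add bform_diff bform_Xn bform_Yn)
qed

lemma bform_f60: "bform 60 (f60 i a)"
proof -
  have "bform 60 (\<lambda>v. (e60 i a k * (v$1 * v$2) ^ (5 * k)) * (v$1 ^ (60 - 10 * k) + v$2 ^ (60 - 10 * k)))"
    if "k \<in> {1..5}" for k
  proof -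
    have "2 * (5 * k) + (60 - 10 * k) = 60" using that by auto
    then show ?thesis
      using bform_mult[OF bform_scale[OF bform_XYn[of "5 * k"], of "e60 i a k"] bform.add[OF bform_Xn[of "60 - 10 * k"] bform_Yn[of "60 - 10 * k"]]]
      by simp
  qed
  then have "bform 60 (\<lambda>v. \<Sum>k=1..5. (e60 i a k * (v$1 * v$2) ^ (5 * k)) * (v$1 ^ (60 - 10 * k) + v$2 ^ (60 - 10 * k)))"
    by (rule bform_sum)
  moreover have "bform 60 (\<lambda>v. a * (v$1 * v$2) ^ 30)"
    using bform_scale[OF bform_XYn[of 30], of a] by simp
  ultimately show ?thesis unfolding f60_def[abs_def]
    by (intro bform.add bform_Xn bform_Yn)
qed

lemma sum_1_5: "(\<Sum>k=1..5. h k) = h 1 + h 2 + h 3 + h 4 + h (5::nat)"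
  by (simp add: eval_nat_numeral atLeastAtMostSuc_conv add_ac)

text \<open>The pencil of invariants of degree 60 is spanned by the cube of the form of degree 20 and the
  fifth power of the form of degree 12; the squares of the forms of degree 30 belong to it too.\<close>

lemma f60_pencil:
  fixes i a :: "'a::field_char_0"
  assumes i: "i ^ 2 = - 1"
  shows "f60 i a v = f20 i v ^ 3 + (a - 33211924) * (i / 134761) * f12 i v ^ 5"
proof -
  \<comment> \<open>Every exponent in the identity is a multiple of 5, the factor \<open>XY\<close>
    of \<open>f12\<close> being raised to the fifth power. In \<open>A\<close> and \<open>B\<close>
    the degree drops from 60 to 12, within reach of polynomial algebra modulo
    \<open>i^2 = -1\<close>.\<close>
  define A B where "A = v$1 ^ 5" "B = v$2 ^ 5"
  have p: "v$1 ^ 60 = A ^ 12" "v$2 ^ 60 = B ^ 12" "v$1 ^ 50 = A ^ 10" "v$2 ^ 50 = B ^ 10"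
    "v$1 ^ 40 = A ^ 8" "v$2 ^ 40 = B ^ 8" "v$1 ^ 30 = A ^ 6" "v$2 ^ 30 = B ^ 6"
    "v$1 ^ 20 = A ^ 4" "v$2 ^ 20 = B ^ 4" "v$1 ^ 10 = A ^ 2" "v$2 ^ 10 = B ^ 2"
    "(v$1 * v$2) ^ 30 = (A * B) ^ 6" "(v$1 * v$2) ^ 25 = (A * B) ^ 5" "(v$1 * v$2) ^ 20 = (A * B) ^ 4"
    "(v$1 * v$2) ^ 15 = (A * B) ^ 3" "(v$1 * v$2) ^ 10 = (A * B) ^ 2" "(v$1 * v$2) ^ 5 = A * B"
    by (simp_all add: A_B_def power_mult_distrib flip: power_mult)
  have e: "134761 * f60 i a v = 134761 * (A ^ 12 + B ^ 12 + a * (A * B) ^ 6)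
     + i * (58964600 + a) * (A * B) * (A ^ 10 + B ^ 10)
     - 11 * (2094783554 - 5 * a) * (A * B) ^ 2 * (A ^ 8 + B ^ 8)
     - 5 * i * (329638533728 + 241 * a) * (A * B) ^ 3 * (A ^ 6 + B ^ 6)
     + 11 * 35 * (28242591823 - 34 * a) * (A * B) ^ 4 * (A ^ 4 + B ^ 4)
     + 3 * i * (5100249334348 + 23195 * a) * (A * B) ^ 5 * (A ^ 2 + B ^ 2)"
  proof -
    \<comment> \<open>The reciprocal becomes an unknown with the single relation
      \<open>134761 * r = 1\<close>. Since 134761 = 11 * 12251, the fractions over 12251 acquire the
      factors 11 and 385 = 11 * 35.\<close>
    define r where "r = 1 / (134761 :: 'a)"
    have r: "134761 * r = 1" by (simp add: r_def)
    have q: "i / 134761 = i * r" "- 1 / 12251 = - 11 * r" "- 5 * i / 134761 = - 5 * i * r"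
      "35 / 12251 = 385 * r" "3 * i / 134761 = 3 * i * r" by (simp_all add: r_def)
    have "f60 i a v = v$1 ^ 60 + v$2 ^ 60 + a * (v$1 * v$2) ^ 30
      + (i / 134761 * (58964600 + a) * (v$1 * v$2) ^ 5 * (v$1 ^ 50 + v$2 ^ 50)
       + - 1 / 12251 * (2094783554 - 5 * a) * (v$1 * v$2) ^ 10 * (v$1 ^ 40 + v$2 ^ 40)
       + - 5 * i / 134761 * (329638533728 + 241 * a) * (v$1 * v$2) ^ 15 * (v$1 ^ 30 + v$2 ^ 30)
       + 35 / 12251 * (28242591823 - 34 * a) * (v$1 * v$2) ^ 20 * (v$1 ^ 20 + v$2 ^ 20)
       + 3 * i / 134761 * (5100249334348 + 23195 * a) * (v$1 * v$2) ^ 25 * (v$1 ^ 10 + v$2 ^ 10))"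
      unfolding f60_def sum_1_5 e60_def by simp
    then have "f60 i a v = A ^ 12 + B ^ 12 + a * (A * B) ^ 6
      + (i * r * (58964600 + a) * (A * B) * (A ^ 10 + B ^ 10)
       + - 11 * r * (2094783554 - 5 * a) * (A * B) ^ 2 * (A ^ 8 + B ^ 8)
       + - 5 * i * r * (329638533728 + 241 * a) * (A * B) ^ 3 * (A ^ 6 + B ^ 6)
       + 385 * r * (28242591823 - 34 * a) * (A * B) ^ 4 * (A ^ 4 + B ^ 4)
       + 3 * i * r * (5100249334348 + 23195 * a) * (A * B) ^ 5 * (A ^ 2 + B ^ 2))"
      unfolding p q .
    then show ?thesis using r by Groebner_Basis.algebra
  qed
  have "f12 i v = (v$1 * v$2) * (A ^ 2 - 11 * i * A * B + B ^ 2)"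
    unfolding f12_def p by (simp add: mult.assoc)
  then have "f12 i v ^ 5 = (v$1 * v$2) ^ 5 * (A ^ 2 - 11 * i * A * B + B ^ 2) ^ 5"
    by (simp only: power_mult_distrib[of "v$1 * v$2"])
  then have f12: "f12 i v ^ 5 = A * B * (A ^ 2 - 11 * i * A * B + B ^ 2) ^ 5"
    unfolding p .
  have f20: "f20 i v = (A ^ 4 + B ^ 4) + 228 * i * (A * B) * (A ^ 2 + B ^ 2) - 494 * (A * B) ^ 2"
    unfolding f20_def p by simp
  have "134761 * (f20 i v ^ 3) + (a - 33211924) * i * f12 i v ^ 5 = 134761 * f60 i a v"
    unfolding e f12 f20 using i by Groebner_Basis.algebra
  then show ?thesis by (simp add: field_simps)
qed

text \<open>The product of the three factors is 33211924, so the second term of the pencil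
  vanishes.\<close>

lemma f60_f20: "i ^ 2 = - 1 \<Longrightarrow> f60 i (2 ^ 2 * 19 * 436999) v = f20 i v ^ 3" for i :: "'a::field_char_0"
  by (simp add: f60_pencil)

text \<open>Klein's relation \<open>f20^3 - 1728 i f12^5 = f30^2\<close> between the invariants. The
  parameter is determined by 1728, as
  \<open>-(2^2 * 9377 * 5323) - 33211924 = -1728 * 134761\<close>.\<close>

lemma f60_f30:
  fixes i :: "'a::field_char_0"
  assumes i: "i ^ 2 = - 1"
  shows "f60 i (- (2 ^ 2 * 9377 * 5323)) v = f30 i v ^ 2"
proof -
  define A B where "A = v$1 ^ 5" "B = v$2 ^ 5"
  have p: "v$1 ^ 30 = A ^ 6" "v$2 ^ 30 = B ^ 6"
    "v$1 ^ 20 = A ^ 4" "v$2 ^ 20 = B ^ 4" "v$1 ^ 10 = A ^ 2" "v$2 ^ 10 = B ^ 2"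
    "(v$1 * v$2) ^ 10 = (A * B) ^ 2" "(v$1 * v$2) ^ 5 = A * B"
    by (simp_all add: A_B_def power_mult_distrib flip: power_mult)
  have "f12 i v = (v$1 * v$2) * (A ^ 2 - 11 * i * A * B + B ^ 2)"
    unfolding f12_def p by (simp add: mult.assoc)
  then have "f12 i v ^ 5 = (v$1 * v$2) ^ 5 * (A ^ 2 - 11 * i * A * B + B ^ 2) ^ 5"
    by (simp only: power_mult_distrib[of "v$1 * v$2"])
  then have f12: "f12 i v ^ 5 = A * B * (A ^ 2 - 11 * i * A * B + B ^ 2) ^ 5"
    unfolding p .
  have f20: "f20 i v = (A ^ 4 + B ^ 4) + 228 * i * (A * B) * (A ^ 2 + B ^ 2) - 494 * (A * B) ^ 2"
    unfolding f20_def p by simp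
  have f30: "f30 i v = (A ^ 6 - B ^ 6) - 522 * i * (A * B) * (A ^ 4 - B ^ 4) + 10005 * (A * B) ^ 2 * (A ^ 2 - B ^ 2)"
    unfolding f30_def p by simp
  have "f20 i v ^ 3 - 1728 * i * f12 i v ^ 5 = f30 i v ^ 2"
    unfolding f12 f20 f30 using i by Groebner_Basis.algebra
  moreover have "(- (2 ^ 2 * 9377 * 5323) - 33211924) * (i / 134761) = - (1728 * i)" by simp
  ultimately show ?thesis unfolding f60_pencil[OF i] by simp
qed

text \<open>The substitution \<open>x -> (x + p) / (p x - 1)\<close> is an involution of the
  icosahedral group in an affine coordinate, with \<open>p\<close> in the role of
  \<open>\<psi>\<close>. In the single variable \<open>x\<close>, modulo the quadratic relation for
  \<open>p\<close>, invariance is an ideal membership. \<open>klein_infinity\<close> holds its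
  values at the point at infinity.\<close>

lemma klein_affine:
  fixes x p :: "'a::idom"
  assumes p: "p ^ 2 = 1 - p"
  shows "(x + p) * (p * x - 1) * ((x + p) ^ 10 - 11 * ((x + p) * (p * x - 1)) ^ 5 - (p * x - 1) ^ 10)
      = (p - 2) ^ 6 * (x * (x ^ 10 - 11 * x ^ 5 - 1))"
    "(x + p) ^ 20 + (p * x - 1) ^ 20 + 228 * ((x + p) * (p * x - 1)) ^ 5 * ((x + p) ^ 10 - (p * x - 1) ^ 10)
       + 494 * ((x + p) * (p * x - 1)) ^ 10
      = (p - 2) ^ 10 * (x ^ 20 + 1 + 228 * x ^ 5 * (x ^ 10 - 1) + 494 * x ^ 10)"
    "(x + p) ^ 30 + (p * x - 1) ^ 30 - 522 * ((x + p) * (p * x - 1)) ^ 5 * ((x + p) ^ 20 - (p * x - 1) ^ 20)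
       - 10005 * ((x + p) * (p * x - 1)) ^ 10 * ((x + p) ^ 10 + (p * x - 1) ^ 10)
      = (p - 2) ^ 15 * (x ^ 30 + 1 - 522 * x ^ 5 * (x ^ 20 - 1) - 10005 * x ^ 10 * (x ^ 10 + 1))"
  subgoal using p by Groebner_Basis.algebra
  subgoal using p by Groebner_Basis.algebra
  subgoal using p by Groebner_Basis.algebra
  done

lemma klein_infinity:
  fixes p :: "'a::idom"
  assumes p: "p ^ 2 = 1 - p"
  shows "p * (1 - 11 * p ^ 5 - p ^ 10) = 0"
    "1 + p ^ 20 + 228 * p ^ 5 * (1 - p ^ 10) + 494 * p ^ 10 = (p - 2) ^ 10"
    "1 + p ^ 30 - 522 * p ^ 5 * (1 - p ^ 20) - 10005 * p ^ 10 * (1 + p ^ 10) = (p - 2) ^ 15"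
  subgoal using p by Groebner_Basis.algebra
  subgoal using p by Groebner_Basis.algebra
  subgoal using p by Groebner_Basis.algebra
  done

text \<open>Homogenises \<open>klein_affine\<close> by \<open>x = w z\<close>, with
  \<open>klein_infinity\<close> for \<open>z = 0\<close>. The substitution has determinant
  \<open>- 1 - p^2 = p - 2\<close>, whose power on the right is half the degree of the form.\<close>

lemma klein_real:
  fixes x z p :: "'a::field"
  assumes p: "p ^ 2 = 1 - p"
  shows "(x + p * z) * (p * x - z) * ((x + p * z) ^ 10 - 11 * ((x + p * z) * (p * x - z)) ^ 5 - (p * x - z) ^ 10)
      = (p - 2) ^ 6 * (x * z * (x ^ 10 - 11 * (x * z) ^ 5 - z ^ 10))" (is "?L1 x z = ?R1 x z")
    "(x + p * z) ^ 20 + (p * x - z) ^ 20 + 228 * ((x + p * z) * (p * x - z)) ^ 5 * ((x + p * z) ^ 10 - (p * x - z) ^ 10)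
       + 494 * ((x + p * z) * (p * x - z)) ^ 10
      = (p - 2) ^ 10 * (x ^ 20 + z ^ 20 + 228 * (x * z) ^ 5 * (x ^ 10 - z ^ 10) + 494 * (x * z) ^ 10)" (is "?L2 x z = ?R2 x z")
    "(x + p * z) ^ 30 + (p * x - z) ^ 30 - 522 * ((x + p * z) * (p * x - z)) ^ 5 * ((x + p * z) ^ 20 - (p * x - z) ^ 20)
       - 10005 * ((x + p * z) * (p * x - z)) ^ 10 * ((x + p * z) ^ 10 + (p * x - z) ^ 10)
      = (p - 2) ^ 15 * (x ^ 30 + z ^ 30 - 522 * (x * z) ^ 5 * (x ^ 20 - z ^ 20) - 10005 * (x * z) ^ 10 * (x ^ 10 + z ^ 10))" (is "?L3 x z = ?R3 x z")
proof -
  have "?L1 x z = ?R1 x z \<and> ?L2 x z = ?R2 x z \<and> ?L3 x z = ?R3 x z"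
  proof (cases "z = 0")
    case True
    have 1: "?L1 x 0 = x ^ 12 * (p * (1 - 11 * p ^ 5 - p ^ 10))" by Groebner_Basis.algebra
    have 2: "?L2 x 0 = x ^ 20 * (1 + p ^ 20 + 228 * p ^ 5 * (1 - p ^ 10) + 494 * p ^ 10)"
      by Groebner_Basis.algebra
    have 3: "?L3 x 0 = x ^ 30 * (1 + p ^ 30 - 522 * p ^ 5 * (1 - p ^ 20) - 10005 * p ^ 10 * (1 + p ^ 10))"
      by Groebner_Basis.algebra
    show ?thesis unfolding True 1 2 3 klein_infinity[OF p] by (simp add: power_0_left)
  next
    case False
    define w where "w = x / z"
    have x: "x = w * z" using False by (simp add: w_def)
    have f: "x + p * z = z * (w + p)" "p * x - z = z * (p * w - 1)" "x * z = z ^ 2 * w"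
      "z * (w + p) * (z * (p * w - 1)) = z ^ 2 * ((w + p) * (p * w - 1))"
      by (simp_all add: x algebra_simps power2_eq_square)
    have h: "(z * u) ^ n = z ^ n * u ^ n" "(z ^ 2 * u) ^ 5 = z ^ 10 * u ^ 5" "(z ^ 2 * u) ^ 10 = z ^ 20 * u ^ 10" for u n
      by (simp_all add: power_mult_distrib flip: power_mult)
    have xn: "x ^ n = z ^ n * w ^ n" for n by (simp add: x power_mult_distrib mult.commute)
    note K = klein_affine[OF p, of w]
    have 1: "?L1 x z = z ^ 12 * ((w + p) * (p * w - 1) * ((w + p) ^ 10 - 11 * ((w + p) * (p * w - 1)) ^ 5 - (p * w - 1) ^ 10))"
      unfolding f h xn by Groebner_Basis.algebra
    have r1: "?R1 x z = z ^ 12 * ((p - 2) ^ 6 * (w * (w ^ 10 - 11 * w ^ 5 - 1)))"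
      unfolding f h xn by Groebner_Basis.algebra
    have 2: "?L2 x z = z ^ 20 * ((w + p) ^ 20 + (p * w - 1) ^ 20 + 228 * ((w + p) * (p * w - 1)) ^ 5 * ((w + p) ^ 10 - (p * w - 1) ^ 10)
       + 494 * ((w + p) * (p * w - 1)) ^ 10)"
      unfolding f h xn by Groebner_Basis.algebra
    have r2: "?R2 x z = z ^ 20 * ((p - 2) ^ 10 * (w ^ 20 + 1 + 228 * w ^ 5 * (w ^ 10 - 1) + 494 * w ^ 10))"
      unfolding f h xn by Groebner_Basis.algebra
    have 3: "?L3 x z = z ^ 30 * ((w + p) ^ 30 + (p * w - 1) ^ 30 - 522 * ((w + p) * (p * w - 1)) ^ 5 * ((w + p) ^ 20 - (p * w - 1) ^ 20)
       - 10005 * ((w + p) * (p * w - 1)) ^ 10 * ((w + p) ^ 10 + (p * w - 1) ^ 10))"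
      unfolding f h xn by Groebner_Basis.algebra
    have r3: "?R3 x z = z ^ 30 * ((p - 2) ^ 15 * (w ^ 30 + 1 - 522 * w ^ 5 * (w ^ 20 - 1) - 10005 * w ^ 10 * (w ^ 10 + 1)))"
      unfolding f h xn by Groebner_Basis.algebra
    show ?thesis unfolding 1 2 3 r1 r2 r3 K by simp
  qed
  then show "?L1 x z = ?R1 x z" "?L2 x z = ?R2 x z" "?L3 x z = ?R3 x z" by blast+
qed

text \<open>A quarter turn in the second variable makes the coefficients of the forms rational integers.\<close>

lemma quarter_turn:
  fixes i :: "'a::field"
  assumes i: "i ^ 2 = - 1"
  shows "f12 i (v2 x (- i * z)) = - i * (x * z * (x ^ 10 - 11 * (x * z) ^ 5 - z ^ 10))"
    "f20 i (v2 x (- i * z)) = x ^ 20 + z ^ 20 + 228 * (x * z) ^ 5 * (x ^ 10 - z ^ 10) + 494 * (x * z) ^ 10"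
    "f30 i (v2 x (- i * z)) = x ^ 30 + z ^ 30 - 522 * (x * z) ^ 5 * (x ^ 20 - z ^ 20) - 10005 * (x * z) ^ 10 * (x ^ 10 + z ^ 10)"
proof -
  have i4: "i ^ 4 = 1"
  proof -
    have "i ^ 4 = (i ^ 2) ^ 2" by (simp flip: power_mult)
    then show ?thesis using i by simp
  qed
  have red: "i ^ 5 = i" "i ^ 10 = - 1" "i ^ 20 = 1" "i ^ 30 = - 1"
  proof -
    have "i ^ 5 = i ^ 4 * i" "i ^ 10 = (i ^ 4) ^ 2 * i ^ 2" "i ^ 20 = (i ^ 4) ^ 5" "i ^ 30 = (i ^ 4) ^ 7 * i ^ 2"
      by (simp_all add: eval_nat_numeral)
    then show "i ^ 5 = i" "i ^ 10 = - 1" "i ^ 20 = 1" "i ^ 30 = - 1" using i4 i by simp_all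
  qed
  have ii: "i * i = - 1" "i * (i * y) = - y" for y
    using i by (simp_all add: power2_eq_square flip: mult.assoc)
  have p: "(- i * z) ^ 10 = - (z ^ 10)" "(- i * z) ^ 20 = z ^ 20" "(- i * z) ^ 30 = - (z ^ 30)"
    "(x * (- i * z)) ^ 5 = - i * (x * z) ^ 5" "(x * (- i * z)) ^ 10 = - ((x * z) ^ 10)"
    by (simp_all add: power_mult_distrib red)
  show "f12 i (v2 x (- i * z)) = - i * (x * z * (x ^ 10 - 11 * (x * z) ^ 5 - z ^ 10))"
    "f20 i (v2 x (- i * z)) = x ^ 20 + z ^ 20 + 228 * (x * z) ^ 5 * (x ^ 10 - z ^ 10) + 494 * (x * z) ^ 10"
    "f30 i (v2 x (- i * z)) = x ^ 30 + z ^ 30 - 522 * (x * z) ^ 5 * (x ^ 20 - z ^ 20) - 10005 * (x * z) ^ 10 * (x ^ 10 + z ^ 10)"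
    unfolding f12_def f20_def f30_def v2_nth p by (simp_all add: ii algebra_simps)
qed

text \<open>The multiplier is a power of the determinant \<open>k^2 (p - 2)\<close> of the matrix.
  For \<open>k = \<kappa>\<close> this determinant is 1, and the forms are strictly
  invariant.\<close>

lemma klein_forms_W:
  fixes i p k :: "'a::field"
  assumes i: "i ^ 2 = - 1" and p: "p ^ 2 = 1 - p"
  shows "f12 i (m2 k (k * i * p) (- k * i * p) (- k) *v v) = (k ^ 2 * (p - 2)) ^ 6 * f12 i v"
    "f20 i (m2 k (k * i * p) (- k * i * p) (- k) *v v) = (k ^ 2 * (p - 2)) ^ 10 * f20 i v"
    "f30 i (m2 k (k * i * p) (- k * i * p) (- k) *v v) = (k ^ 2 * (p - 2)) ^ 15 * f30 i v"
proof -
  obtain x y where v: "v = v2 x y" by (rule v2_cases)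
  define z where "z = i * y"
  have y: "y = - i * z" using i by (simp add: z_def power2_eq_square flip: mult.assoc)
  have ii: "i * (i * u) = - u" for u
    using i by (simp add: power2_eq_square flip: mult.assoc)
  have Mv: "m2 k (k * i * p) (- k * i * p) (- k) *v v = k *s v2 (x + p * z) (- i * (p * x - z))"
    by (simp add: v y ii algebra_simps)
  note K = klein_real[OF p, of x z] and Q = quarter_turn[OF i]
  show "f12 i (m2 k (k * i * p) (- k * i * p) (- k) *v v) = (k ^ 2 * (p - 2)) ^ 6 * f12 i v"
    unfolding Mv bform_homog[OF bform_f12] unfolding v y unfolding Q K by (simp add: power_mult_distrib mult_ac flip: power_mult)
  show "f20 i (m2 k (k * i * p) (- k * i * p) (- k) *v v) = (k ^ 2 * (p - 2)) ^ 10 * f20 i v"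
    unfolding Mv bform_homog[OF bform_f20] unfolding v y unfolding Q K by (simp add: power_mult_distrib mult_ac flip: power_mult)
  show "f30 i (m2 k (k * i * p) (- k * i * p) (- k) *v v) = (k ^ 2 * (p - 2)) ^ 15 * f30 i v"
    unfolding Mv bform_homog[OF bform_f30] unfolding v y unfolding Q K by (simp add: power_mult_distrib mult_ac flip: power_mult)
qed

section \<open>The binary icosahedral group\<close>

text \<open>Obtained by solving \<open>R2\<close> for \<open>T\<close>. As \<open>Z\<close> becomes
  scalar in GL_2, a subgroup of PGL_2 containing the classes of \<open>D\<close> and
  \<open>W\<close> also contains that of \<open>T\<close>.\<close>

lemma (in bruhat) T_word: "T = Z \<otimes> (D [^] (2::nat) \<otimes> W \<otimes> D [^] (3::nat) \<otimes> W \<otimes> D [^] (2::nat) \<otimes> W)"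
proof -
  have U: "U 2 = D [^] (2::nat)" "U 3 = D [^] (3::nat)" by (simp_all add: U_def)
  have "U 2 \<otimes> (W \<otimes> (U 3 \<otimes> W \<otimes> U 2 \<otimes> W)) = U 2 \<otimes> (W \<otimes> (W \<otimes> U 3 \<otimes> T))"
    using R2 by (simp add: U)
  also have "\<dots> = (U 2 \<otimes> Z) \<otimes> U 3 \<otimes> T" by (simp add: m_assoc flip: WW)
  also have "\<dots> = Z \<otimes> ((U 2 \<otimes> U 3) \<otimes> T)" by (simp add: m_assoc flip: ZU)
  also have "\<dots> = Z \<otimes> T" by (simp add: U_add)
  finally have "Z \<otimes> (U 2 \<otimes> (W \<otimes> (U 3 \<otimes> W \<otimes> U 2 \<otimes> W))) = Z \<otimes> Z \<otimes> T" by (simp add: m_assoc)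
  then show ?thesis by (simp add: ZZ U m_assoc)
qed

lemma hom_restrict_carrier:
  "h \<in> hom G H \<Longrightarrow> h ` carrier G \<subseteq> K \<Longrightarrow> h \<in> hom G (H\<lparr>carrier := K\<rparr>)"
  by (auto simp: hom_def)

lemma hom_image_card:
  assumes G: "group G" and H: "group H" and h: "h \<in> hom G H" and fin: "finite (carrier G)"
  shows "card (h ` carrier G) * card (kernel G H h) = Coset.order G"
proof -
  interpret h: group_hom G H h using G H h by (simp add: group_hom_def group_hom_axioms_def)
  have sub: "subgroup (h ` carrier G) H" by (rule h.img_is_subgroup)
  let ?H = "H\<lparr>carrier := h ` carrier G\<rparr>"
  have H': "group ?H" by (rule subgroup.subgroup_is_group[OF sub H])
  interpret h': group_hom G ?H h
    using G H' h by (auto simp: group_hom_def group_hom_axioms_def hom_def)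
  have ker: "kernel G ?H h = kernel G H h" by (simp add: kernel_def)
  have "(\<lambda>S. the_elem (h ` S)) \<in> iso (G Mod kernel G ?H h) ?H"
    by (rule h'.FactGroup_iso_set) simp
  then have "card (carrier (G Mod kernel G H h)) = card (h ` carrier G)"
    unfolding ker by (auto simp: iso_def dest: bij_betw_same_card)
  moreover have "card (rcosets\<^bsub>G\<^esub> (kernel G H h)) * card (kernel G H h) = Coset.order G"
    using group.lagrange[OF G h.subgroup_kernel] by (simp add: mult.commute)
  ultimately show ?thesis by (simp add: FactGroup_def)
qed

text \<open>Intended for the two surjections from SL_2(F_5), onto the icosahedral group and onto the
  alternating group, which share the kernel consisting of 1 and -1.\<close>

lemma surj_same_kernel_iso:
  assumes G: "group G" and h: "h \<in> hom G H" "group H" "h ` carrier G = carrier H"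
    and k: "k \<in> hom G K" "group K" "k ` carrier G = carrier K"
    and ker: "kernel G H h = kernel G K k"
  shows "H \<cong> K"
proof -
  interpret h: group_hom G H h using G h by (simp add: group_hom_def group_hom_axioms_def)
  interpret k: group_hom G K k using G k by (simp add: group_hom_def group_hom_axioms_def)
  have "G Mod kernel G H h \<cong> H" by (rule h.FactGroup_iso[OF h(3)])
  moreover have "group (G Mod kernel G H h)" by (rule normal.factorgroup_is_group[OF h.normal_kernel])
  ultimately have "H \<cong> G Mod kernel G H h" by (simp add: group.iso_sym)
  moreover have "G Mod kernel G K k \<cong> K" by (rule k.FactGroup_iso[OF k(3)])
  ultimately show ?thesis unfolding ker by (rule iso_trans)
qed

lemma finite_SL2: "finite (carrier SL2_F5)"
  by (rule finite_subset[OF subset_UNIV]) (rule finite)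

section \<open>The alternating group on five letters as a quotient of SL_2(F_5)\<close>

text \<open>Permutations assembled from pairs of transpositions are visibly even; the 5-cycle
  \<open>p5\<close> is written in this way too.\<close>

definition swap2 :: "nat \<Rightarrow> nat \<Rightarrow> nat \<Rightarrow> nat \<Rightarrow> nat \<Rightarrow> nat" where
  "swap2 a b c d = Transposition.transpose a b \<circ> Transposition.transpose c d"

lemma swap2_alt: "{a, b, c, d} \<subseteq> {1..5} \<Longrightarrow> a \<noteq> b \<Longrightarrow> c \<noteq> d \<Longrightarrow> swap2 a b c d \<in> carrier (alt_group 5)"
  by (auto simp: swap2_def alt_group_carrier evenperm_comp evenperm_swap permutation_swap_id
      intro!: permutes_compose permutes_swap_id)

definition p5 :: "nat \<Rightarrow> nat" where "p5 = swap2 1 5 1 4 \<circ> swap2 1 3 1 2"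

lemma alt_comp: "p \<in> carrier (alt_group n) \<Longrightarrow> q \<in> carrier (alt_group n) \<Longrightarrow> p \<circ> q \<in> carrier (alt_group n)"
  using group.is_monoid[OF alt_group_is_group] monoid.m_closed[of "alt_group n" p q]
  by (simp add: alt_group_mult)

lemma p5_alt: "p5 \<in> carrier (alt_group 5)"
  unfolding p5_def by (intro alt_comp swap2_alt) auto

lemma p5_apply: "p5 n = (if n = 1 then 2 else if n = 2 then 3 else if n = 3 then 4 else if n = 4 then 5 else if n = 5 then 1 else n)"
  by (simp add: p5_def swap2_def Transposition.transpose_def)

lemma swap2_apply:
  "distinct [a, b, c, d] \<Longrightarrow> swap2 a b c d n = (if n = a then b else if n = b then a else if n = c then d else if n = d then c else n)"
  by (auto simp: swap2_def Transposition.transpose_def)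

lemma alt_pow: "p [^]\<^bsub>alt_group n\<^esub> k = p ^^ k" for k :: nat
  by (induction k) (simp_all add: nat_pow_def alt_group_one alt_group_mult funpow_swap1 fun_eq_iff flip: id_def)

lemma p5_powers: "p5 ^^ 2 = p5 \<circ> p5" "p5 ^^ 3 = p5 \<circ> p5 \<circ> p5" "p5 ^^ 4 = p5 \<circ> p5 \<circ> p5 \<circ> p5"
  "p5 ^^ 5 = p5 \<circ> p5 \<circ> p5 \<circ> p5 \<circ> p5"
  by (simp_all add: eval_nat_numeral fun_eq_iff)

lemma fun5_eqI:
  fixes f g :: "nat \<Rightarrow> 'b"
  assumes "f 1 = g 1" "f 2 = g 2" "f 3 = g 3" "f 4 = g 4" "f 5 = g 5"
    and "\<And>n. n \<noteq> 1 \<Longrightarrow> n \<noteq> 2 \<Longrightarrow> n \<noteq> 3 \<Longrightarrow> n \<noteq> 4 \<Longrightarrow> n \<noteq> 5 \<Longrightarrow> f n = g n"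
  shows "f = g"
  using assms by (metis ext)

text \<open>Double transpositions, both fixing the point 5, chosen to satisfy the relations of
  \<open>bruhat\<close> together with the 5-cycle \<open>p5\<close> and trivial
  \<open>Z\<close>.\<close>

definition pT :: "nat \<Rightarrow> nat" where "pT = swap2 1 4 2 3"
definition pW :: "nat \<Rightarrow> nat" where "pW = swap2 1 2 3 4"

lemma pT_apply: "pT n = (if n = 1 then 4 else if n = 4 then 1 else if n = 2 then 3 else if n = 3 then 2 else n)"
  and pW_apply: "pW n = (if n = 1 then 2 else if n = 2 then 1 else if n = 3 then 4 else if n = 4 then 3 else n)"
  by (simp_all add: pT_def pW_def swap2_apply)

lemma pT_alt: "pT \<in> carrier (alt_group 5)" and pW_alt: "pW \<in> carrier (alt_group 5)"
  unfolding pT_def pW_def by (intro swap2_alt; simp)+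

interpretation alt: bruhat "alt_group 5" p5 "pT" "pW" id
proof (intro bruhat.intro bruhat_axioms.intro alt_group_is_group)
  show "p5 \<in> carrier (alt_group 5)" "pT \<in> carrier (alt_group 5)" "pW \<in> carrier (alt_group 5)"
    by (rule p5_alt pT_alt pW_alt)+
  show "id \<in> carrier (alt_group 5)" by (simp add: alt_group_carrier permutes_id)
qed (simp_all only: alt_pow alt_group_mult alt_group_one p5_powers,
  (rule fun5_eqI; simp add: p5_apply pT_apply pW_apply)+)

text \<open>Nontrivial powers of the 5-cycle move the point 5, while \<open>pT\<close> and
  \<open>pW\<close> fix it. Evaluating a trivial product at 5 therefore removes the unipotent
  factors, and what is left is decided on a few other points.\<close>

lemma alt_kernel: "kernel SL2_F5 (alt_group 5) alt.hom2 = {m2 1 0 0 1, m2 (-1) 0 0 (-1)}"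
proof (intro equalityI subsetI)
  fix g :: "5^2^2" assume "g \<in> {m2 1 0 0 1, m2 (-1) 0 0 (-1)}"
  then show "g \<in> kernel SL2_F5 (alt_group 5) alt.hom2"
    by (auto simp: kernel_def SL2_carrier alt.hom2_m2 alt.H_def alt_group_mult alt_group_one)
next
  have pos5: "alt.U t 5 = 5 \<Longrightarrow> t = 0" for t
  proof -
    have "\<forall>t. alt.U t 5 = 5 \<longrightarrow> t = 0"
      unfolding forall_5 by (simp add: alt.U_def alt_pow p5_powers p5_apply)
    then show "alt.U t 5 = 5 \<Longrightarrow> t = 0" by blast
  qed
  have H5: "a \<noteq> 0 \<Longrightarrow> alt.H a 5 = 5" for a
    by (auto simp: alt.H_def alt_group_mult alt_group_one pT_apply pW_apply)
  fix g assume g: "g \<in> kernel SL2_F5 (alt_group 5) alt.hom2"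
  obtain a b c d where m: "g = m2 a b c d" by (rule m2_cases)
  have det: "a * d - b * c = 1" and k: "alt.hom2 (m2 a b c d) = \<one>\<^bsub>alt_group 5\<^esub>"
    using g m by (auto simp: kernel_def SL2_carrier)
  show "g \<in> {m2 1 0 0 1, m2 (-1) 0 0 (-1)}"
  proof (cases "c = 0")
    case True
    then have a: "a \<noteq> 0" using det by auto
    have e: "alt.U (a * b) \<circ> alt.H a = id" using k True by (simp add: alt.hom2_m2 alt_group_mult alt_group_one)
    from fun_cong[OF e, of 5] have "a * b = 0" using H5[OF a] pos5 by simp
    then have b: "b = 0" using a by (simp add: mult5_eq_0)
    have h: "alt.H a = id" using e \<open>a * b = 0\<close> by (simp add: alt.U_def alt_group_one)
    have "\<forall>a d. alt.H a = id \<longrightarrow> a * d = 1 \<longrightarrow> (a = 1 \<and> d = 1) \<or> (a = 4 \<and> d = 4)"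
      unfolding forall_5 by (auto simp: alt.H_def alt_group_mult dest!: fun_cong[of _ _ 1] simp: pT_apply pW_apply)
    then show ?thesis using h det True b m by auto
  next
    case False
    let ?W = pW
    define x y where "x = a * c ^ 3" "y = c ^ 3 * d"
    have e: "alt.U x \<otimes>\<^bsub>alt_group 5\<^esub> ?W \<otimes>\<^bsub>alt_group 5\<^esub> alt.H c \<otimes>\<^bsub>alt_group 5\<^esub> alt.U y = \<one>\<^bsub>alt_group 5\<^esub>"
      using k False by (simp add: alt.hom2_m2 x_y_def)
    \<comment> \<open>With the unipotent factors moved to the right-hand side, an element fixing 5
      equals a power of the 5-cycle.\<close>
    have "?W \<otimes>\<^bsub>alt_group 5\<^esub> alt.H c = alt.U (- x) \<otimes>\<^bsub>alt_group 5\<^esub> (alt.U x \<otimes>\<^bsub>alt_group 5\<^esub> ?W \<otimes>\<^bsub>alt_group 5\<^esub> alt.H c \<otimes>\<^bsub>alt_group 5\<^esub> alt.U y) \<otimes>\<^bsub>alt_group 5\<^esub> alt.U (- y)"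
    proof -
      have 1: "alt.U (- x) \<otimes>\<^bsub>alt_group 5\<^esub> (alt.U x \<otimes>\<^bsub>alt_group 5\<^esub> u) = u" "alt.U y \<otimes>\<^bsub>alt_group 5\<^esub> alt.U (- y) = \<one>\<^bsub>alt_group 5\<^esub>"
        if "u \<in> carrier (alt_group 5)" for u
        using that by (simp_all add: alt.U_add flip: alt.m_assoc)
      show ?thesis by (simp add: alt.m_assoc 1(1) 1(2)[OF alt.U_closed[of 0]])
    qed
    then have "?W \<otimes>\<^bsub>alt_group 5\<^esub> alt.H c = alt.U (- x) \<otimes>\<^bsub>alt_group 5\<^esub> alt.U (- y)" unfolding e by simp
    then have "?W \<otimes>\<^bsub>alt_group 5\<^esub> alt.H c = alt.U (- x + - y)" by (simp only: alt.U_add)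
    then have wh: "?W \<circ> alt.H c = alt.U (- x - y)" by (simp add: alt_group_mult)
    from fun_cong[OF this, of 5] have "alt.U (- x - y) 5 = 5" using H5[OF False] by (simp add: pW_apply)
    then have "- x - y = 0" by (rule pos5)
    then have "?W \<circ> alt.H c = id" using wh by (simp add: alt.U_def alt_group_one)
    from fun_cong[OF this, of 1] have "?W (alt.H c 1) = 1" by simp
    moreover have "alt.H c 1 = 1 \<or> alt.H c 1 = 4"
      unfolding alt.H_def alt_group_mult alt_group_one by (simp add: pT_apply)
    ultimately have "pW 1 = 1 \<or> pW 4 = 1" by metis
    then show ?thesis by (simp add: pW_apply)
  qed
qed

section \<open>The lift of the icosahedral group to GL_2\<close>

lemma pow4_pow5:
  fixes z :: "'a::idom"
  assumes "z = z ^ 4" "z ^ 5 = 1" shows "z = 1"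
proof -
  have "z * z = z * z ^ 4" using assms(1) by simp
  also have "\<dots> = 1" using assms(2) by (simp add: eval_nat_numeral)
  finally have "z * z = 1" .
  then have "z ^ 4 = 1" by (simp add: eval_nat_numeral)
  then show ?thesis using assms(1) by simp
qed

lemma dvd_5: "m dvd (5::nat) \<Longrightarrow> m \<noteq> 1 \<Longrightarrow> m = 5"
proof -
  assume d: "m dvd 5" "m \<noteq> 1"
  then have "m \<le> 5" by (intro dvd_imp_le) auto
  then have "m = 0 \<or> m = 1 \<or> m = 2 \<or> m = 3 \<or> m = 4 \<or> m = 5" by linarith
  then show "m = 5" using d by auto
qed

text \<open>\<open>\<eta>\<close> is a primitive fifth root of unity and \<open>\<kappa>\<close> the
  reciprocal of \<open>\<eta> - \<eta>^4\<close>. Both conditions are polynomial equations, so that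
  matrix identities can be decided by algebra modulo them.\<close>

locale icosa =
  fixes i \<eta> \<kappa> :: "'a::{alg_closed_field, field_char_0}"
  assumes i2: "i ^ 2 = - 1" and eta: "1 + \<eta> + \<eta> ^ 2 + \<eta> ^ 3 + \<eta> ^ 4 = 0" and kap: "\<kappa> * (\<eta> - \<eta> ^ 4) = 1"
begin

definition "\<psi> = \<eta> ^ 2 + \<eta> ^ 3"
definition Dm :: "'a^2^2" where "Dm = m2 \<eta> 0 0 (\<eta> ^ 4)"
definition Tm :: "'a^2^2" where "Tm = m2 0 (- i) (- i) 0"
definition Zm :: "'a^2^2" where "Zm = mat (-1)"
definition Wm :: "'a^2^2" where "Wm = m2 \<kappa> (\<kappa> * i * \<psi>) (- \<kappa> * i * \<psi>) (- \<kappa>)"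

lemma psi: "\<psi> ^ 2 = 1 - \<psi>"
  unfolding \<psi>_def using eta by Groebner_Basis.algebra

lemma eta5: "\<eta> ^ 5 = 1"
  using eta by Groebner_Basis.algebra

text \<open>Because \<open>(\<eta> - \<eta>^4)^2 = \<eta>^2 - 2 + \<eta>^3\<close>. This normalises
  \<open>Wm\<close> to determinant 1.\<close>

lemma kap2: "\<kappa> ^ 2 * (\<psi> - 2) = 1"
  unfolding \<psi>_def using eta kap by Groebner_Basis.algebra

lemma nz: "i \<noteq> 0" "\<eta> \<noteq> 0" "\<kappa> \<noteq> 0" "\<psi> \<noteq> 0"
  using i2 eta kap psi by auto

lemma eta_ne: "0 < k \<Longrightarrow> k < 5 \<Longrightarrow> \<eta> ^ k \<noteq> 1"
proof
  assume k: "0 < k" "k < 5" and e: "\<eta> ^ k = 1"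
  then have "k = 1 \<or> k = 2 \<or> k = 3 \<or> k = 4" by linarith
  then have "\<eta> = 1"
  proof (elim disjE)
    assume "k = 2" then have "\<eta> ^ 2 = 1" using e by simp
    then show ?thesis using eta5 by Groebner_Basis.algebra
  next
    assume "k = 3" then have "\<eta> ^ 3 = 1" using e by simp
    then show ?thesis using eta5 by Groebner_Basis.algebra
  next
    assume "k = 4" then have "\<eta> ^ 4 = 1" using e by simp
    then show ?thesis using eta5 by Groebner_Basis.algebra
  qed (use e in simp)
  then show False using eta by simp
qed

lemma e45: "(\<eta> ^ 4) ^ 5 = 1"
  using eta5 by Groebner_Basis.algebra

lemma mpow_1: "mpow M (Suc 0) = M"
  by simp

lemma mpow_D: "mpow Dm n = m2 (\<eta> ^ n) 0 0 ((\<eta> ^ 4) ^ n)"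
  by (induction n) (simp_all add: Dm_def m2_mult m2_one mult.commute)

lemma inv_D: "invertible Dm" and inv_T: "invertible Tm" and inv_W: "invertible Wm"
proof -
  show "invertible Dm" using nz by (simp add: Dm_def invertible_m2)
  show "invertible Tm" using nz by (simp add: Tm_def invertible_m2)
  have "\<kappa> * - \<kappa> - \<kappa> * i * \<psi> * (- \<kappa> * i * \<psi>) = 1"
    using kap2 psi i2 by Groebner_Basis.algebra
  then show "invertible Wm" by (simp add: Wm_def invertible_m2)
qed

text \<open>The lift of the element of order five is chosen with order 5 in GL_2, not 10, since it
  is to be the image of a unipotent matrix. Each relation then splits into four equations between
  matrix entries.\<close>

sublocale br: bruhat GL Dm Tm Wm Zm
proof (intro bruhat.intro bruhat_axioms.intro GL_group)
  note simps = Zm_def GL_pow mpow_D GL_simps Tm_def Wm_def mat_m2 m2_mult m2_one m2_eq mult_zero_left mult_zero_right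
    add_0_left add_0_right mult_1_left mult_1_right \<psi>_def
  show "Dm \<in> carrier GL" "Tm \<in> carrier GL" "Wm \<in> carrier GL" "Zm \<in> carrier GL"
    by (simp_all add: GL_simps inv_D inv_T inv_W invertible_mat Zm_def)
  have D1: "Dm = m2 \<eta> 0 0 (\<eta> ^ 4)" by (rule Dm_def)
  show "Dm [^]\<^bsub>GL\<^esub> (5::nat) = \<one>\<^bsub>GL\<^esub>" unfolding simps using eta5 e45 by simp
  show "Tm \<otimes>\<^bsub>GL\<^esub> Tm = Zm" unfolding simps using i2 by (simp add: power2_eq_square)
  show "Wm \<otimes>\<^bsub>GL\<^esub> Wm = Zm" unfolding simps
    by (intro conjI) (rule refl mult.commute | (use eta kap i2 in Groebner_Basis.algebra))+
  show "Zm \<otimes>\<^bsub>GL\<^esub> Zm = \<one>\<^bsub>GL\<^esub>" unfolding simps by simp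
  show "Tm \<otimes>\<^bsub>GL\<^esub> Dm = Dm [^]\<^bsub>GL\<^esub> (4::nat) \<otimes>\<^bsub>GL\<^esub> Tm" unfolding simps unfolding D1 simps
    by (intro conjI) (rule refl mult.commute | (use eta kap i2 in Groebner_Basis.algebra))+
  show "Tm \<otimes>\<^bsub>GL\<^esub> Wm = Wm \<otimes>\<^bsub>GL\<^esub> (Zm \<otimes>\<^bsub>GL\<^esub> Tm)" unfolding simps
    by (intro conjI) (rule refl mult.commute | (use eta kap i2 in Groebner_Basis.algebra))+
  show "Dm \<otimes>\<^bsub>GL\<^esub> Wm \<otimes>\<^bsub>GL\<^esub> Dm \<otimes>\<^bsub>GL\<^esub> Wm = Wm \<otimes>\<^bsub>GL\<^esub> Dm [^]\<^bsub>GL\<^esub> (4::nat)" unfolding simps unfolding D1 simps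
    by (intro conjI) (rule refl mult.commute | (use eta kap i2 in Groebner_Basis.algebra))+
  show "Dm [^]\<^bsub>GL\<^esub> (3::nat) \<otimes>\<^bsub>GL\<^esub> Wm \<otimes>\<^bsub>GL\<^esub> Dm [^]\<^bsub>GL\<^esub> (2::nat) \<otimes>\<^bsub>GL\<^esub> Wm = Wm \<otimes>\<^bsub>GL\<^esub> Dm [^]\<^bsub>GL\<^esub> (3::nat) \<otimes>\<^bsub>GL\<^esub> Tm" unfolding simps unfolding D1 simps
    by (intro conjI) (rule refl mult.commute | (use eta kap i2 in Groebner_Basis.algebra))+
  show "Dm [^]\<^bsub>GL\<^esub> (2::nat) \<otimes>\<^bsub>GL\<^esub> Wm \<otimes>\<^bsub>GL\<^esub> Dm [^]\<^bsub>GL\<^esub> (3::nat) \<otimes>\<^bsub>GL\<^esub> Wm = Wm \<otimes>\<^bsub>GL\<^esub> Dm [^]\<^bsub>GL\<^esub> (2::nat) \<otimes>\<^bsub>GL\<^esub> (Zm \<otimes>\<^bsub>GL\<^esub> Tm)" unfolding simps unfolding D1 simps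
    by (intro conjI) (rule refl mult.commute | (use eta kap i2 in Groebner_Basis.algebra))+
  show "Dm [^]\<^bsub>GL\<^esub> (4::nat) \<otimes>\<^bsub>GL\<^esub> Wm \<otimes>\<^bsub>GL\<^esub> Dm [^]\<^bsub>GL\<^esub> (4::nat) \<otimes>\<^bsub>GL\<^esub> Wm = Wm \<otimes>\<^bsub>GL\<^esub> Dm \<otimes>\<^bsub>GL\<^esub> Zm" unfolding simps unfolding D1 simps
    by (intro conjI) (rule refl mult.commute | (use eta kap i2 in Groebner_Basis.algebra))+
qed

abbreviation "rep \<equiv> br.hom2"

lemma rep_invertible: "invertible (rep g)"
  using br.hom2_closed[of g] by (simp add: GL_simps)

lemma rep_mult: "g \<in> carrier SL2_F5 \<Longrightarrow> h \<in> carrier SL2_F5 \<Longrightarrow> rep (g ** h) = rep g ** rep h"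
  using br.hom2_hom by (auto simp: hom_def SL2_mult GL_simps)

lemma rep_one: "rep (m2 1 0 0 1) = mat 1" and rep_minus: "rep (m2 (-1) 0 0 (-1)) = mat (-1)"
  by (simp_all add: br.hom2_m2 br.H_def GL_simps Zm_def[symmetric])

lemma H_eq: "br.H a = (if a = 1 then m2 1 0 0 1 else if a = 2 then m2 0 (- i) (- i) 0
    else if a = 3 then m2 0 i i 0 else m2 (-1) 0 0 (-1))"
  unfolding br.H_def GL_simps unfolding Zm_def Tm_def by (auto simp: m2_mult mat_m2)

lemma rep_m2: "rep (m2 a b c d) = (if c = 0 then br.U (a * b) ** br.H a
    else br.U (a * c ^ 3) ** Wm ** br.H c ** br.U (c ^ 3 * d))"
  by (simp add: br.hom2_m2 GL_simps)

lemma U_eq: "br.U t = m2 (\<eta> ^ e5 t) 0 0 ((\<eta> ^ 4) ^ e5 t)"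
  by (simp add: br.U_def GL_pow mpow_D)

text \<open>In the big cell \<open>W h(c)\<close> has a nonzero entry off the diagonal, and
  multiplying by powers of the diagonal matrix \<open>Dm\<close> cannot remove it. In the small cell
  the shape of the matrix leaves \<open>a = 1\<close> or \<open>a = 4\<close>, and equal diagonal
  entries mean that a power of \<open>\<eta>\<close> equals its own fourth power, hence is
  1.\<close>

lemma rep_scalar:
  assumes g: "g \<in> carrier SL2_F5" and s: "rep g = mat s"
  shows "g = m2 1 0 0 1 \<or> g = m2 (-1) 0 0 (-1)"
proof -
  obtain a b c d where m: "g = m2 a b c d" by (rule m2_cases)
  have det: "a * d - b * c = 1" using g m by (simp add: SL2_carrier)
  show ?thesis
  proof (cases "c = 0")
    case True
    have k: "br.U (a * b) ** br.H a = m2 s 0 0 s" using s True unfolding m rep_m2 mat_m2 by simp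
    have "\<forall>a d::5. a * d = 1 \<longrightarrow> a \<noteq> 2 \<longrightarrow> a \<noteq> 3 \<longrightarrow> (a = 1 \<and> d = 1) \<or> (a = 4 \<and> d = 4)"
      unfolding forall_5 by simp
    moreover have "a \<noteq> 2" "a \<noteq> 3"
      using k nz by (auto simp: H_eq U_eq m2_mult)
    ultimately have a: "(a = 1 \<and> d = 1) \<or> (a = 4 \<and> d = 4)" using det True by auto
    have "b = 0"
    proof (rule ccontr)
      assume "b \<noteq> 0"
      then have n: "a * b \<noteq> 0" using a by (auto simp: mult5_eq_0)
      have "\<eta> ^ e5 (a * b) = (\<eta> ^ 4) ^ e5 (a * b)"
        using k a by (auto simp: H_eq U_eq m2_mult)
      then have "\<eta> ^ e5 (a * b) = (\<eta> ^ e5 (a * b)) ^ 4" by (metis mult.commute power_mult)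
      moreover have "(\<eta> ^ e5 (a * b)) ^ 5 = 1" using eta5 by (metis mult.commute power_mult power_one)
      ultimately have "\<eta> ^ e5 (a * b) = 1" by (rule pow4_pow5)
      moreover have "0 < e5 (a * b)" "e5 (a * b) < 5" using n by (auto simp: e5_def)
      ultimately show False using eta_ne by blast
    qed
    then show ?thesis using a m True by auto
  next
    case False
    define M where "M = Wm ** br.H c"
    have off: "M$1$2 \<noteq> 0"
      using nz False unfolding M_def by (auto simp: H_eq Wm_def m2_mult)
    have "br.U (a * c ^ 3) ** M ** br.U (c ^ 3 * d) = mat s"
      using s False unfolding m rep_m2 by (simp add: M_def matrix_mul_assoc)
    then have "(br.U (a * c ^ 3) ** M ** br.U (c ^ 3 * d))$1$2 = 0" by (simp add: mat_def)
    moreover obtain p q r s' where "M = m2 p q r s'" by (rule m2_cases)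
    ultimately show ?thesis using off nz by (auto simp: U_eq m2_mult)
  qed
qed

lemma rep_inj: "inj_on rep (carrier SL2_F5)"
proof -
  interpret h: group_hom SL2_F5 GL rep
    using SL2_group GL_group br.hom2_hom by (simp add: group_hom_def group_hom_axioms_def)
  have "kernel SL2_F5 GL rep \<subseteq> {\<one>\<^bsub>SL2_F5\<^esub>}"
  proof
    fix g assume g: "g \<in> kernel SL2_F5 GL rep"
    then have "g = m2 1 0 0 1 \<or> g = m2 (-1) 0 0 (-1)"
      using rep_scalar[of g 1] by (auto simp: kernel_def GL_simps)
    moreover have "rep (m2 (-1) 0 0 (-1)) \<noteq> mat 1" unfolding rep_minus by (simp add: mat_m2)
    ultimately show "g \<in> {\<one>\<^bsub>SL2_F5\<^esub>}" using g by (auto simp: kernel_def GL_simps SL2_one)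
  qed
  then have "kernel SL2_F5 GL rep = {\<one>\<^bsub>SL2_F5\<^esub>}" using h.hom_one by (auto simp: kernel_def)
  then show ?thesis using h.inj_iff_trivial_ker by simp
qed

definition cl :: "5^2^2 \<Rightarrow> ('a^2^2) set" where "cl g = pgl_class (rep g)"
definition IG :: "('a^2^2) set set" where "IG = cl ` carrier SL2_F5"

lemma cl_hom: "cl \<in> hom SL2_F5 PGL"
  using rep_mult rep_invertible
  by (auto intro!: homI simp: cl_def PGL_carrier PGL_mult SL2_mult)

lemma cl_kernel: "kernel SL2_F5 PGL cl = {m2 1 0 0 1, m2 (-1) 0 0 (-1)}"
proof (intro equalityI subsetI)
  fix g assume "g \<in> kernel SL2_F5 PGL cl"
  then have g: "g \<in> carrier SL2_F5" "pgl_class (rep g) = pgl_class (mat 1)"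
    by (auto simp: kernel_def cl_def PGL_one)
  then obtain c where "rep g = mat c ** mat 1" unfolding pgl_class_eq_iff by auto
  then have "rep g = mat c" by (simp only: matrix_mul_rid)
  then show "g \<in> {m2 1 0 0 1, m2 (-1) 0 0 (-1)}" using rep_scalar g by auto
next
  fix g assume g: "g \<in> {m2 1 0 0 1, m2 (-1) 0 0 (-1::5)}"
  have "pgl_class (mat (-1) :: 'a^2^2) = pgl_class (mat 1)"
    unfolding pgl_class_eq_iff by (intro exI[of _ "-1"]) (simp add: matrix_mul_rid)
  then have "cl (m2 (-1) 0 0 (-1)) = \<one>\<^bsub>PGL\<^esub>" by (simp only: cl_def rep_minus PGL_one)
  moreover have "cl (m2 1 0 0 1) = \<one>\<^bsub>PGL\<^esub>" by (simp only: cl_def rep_one PGL_one)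
  ultimately have "cl g = \<one>\<^bsub>PGL\<^esub>" using g by (elim insertE emptyE) (simp_all only:)
  then show "g \<in> kernel SL2_F5 PGL cl" using g by (auto simp: kernel_def SL2_carrier)
qed

lemma IG_subgroup: "subgroup IG PGL"
proof -
  interpret h: group_hom SL2_F5 PGL cl
    using SL2_group PGL_group cl_hom by (simp add: group_hom_def group_hom_axioms_def)
  show ?thesis unfolding IG_def by (rule h.img_is_subgroup)
qed

lemma finite_IG: "finite IG"
  unfolding IG_def by (rule finite_imageI[OF finite_SL2])

lemma cl_gens: "cl (m2 1 1 0 1) = pgl_class Dm" "cl (m2 0 (-1) 1 0) = pgl_class Wm" "cl (m2 2 0 0 3) = pgl_class Tm"
  by (simp_all add: cl_def rep_m2 br.H_def br.U_def GL_simps GL_pow mpow_1)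

lemma gens_IG: "pgl_class Dm \<in> IG" "pgl_class Wm \<in> IG" "pgl_class Tm \<in> IG"
  unfolding cl_gens[symmetric] IG_def by (auto simp: SL2_carrier)

text \<open>By the Bruhat form \<open>IG\<close> is generated by the classes of \<open>Dm\<close>,
  \<open>Tm\<close>, \<open>Wm\<close> and the scalar \<open>Zm\<close>, and \<open>T_word\<close>
  disposes of \<open>Tm\<close>.\<close>

lemma IG_least:
  assumes H: "subgroup H PGL" and D: "pgl_class Dm \<in> H" and W: "pgl_class Wm \<in> H"
  shows "IG \<subseteq> H"
proof -
  interpret H: subgroup H PGL by (rule H)
  have m: "pgl_class (M ** N) \<in> H" if "pgl_class M \<in> H" "pgl_class N \<in> H" "invertible M" "invertible N" for M N
    using H.m_closed[OF that(1,2)] PGL_mult[OF that(3,4)] by simp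
  have one: "pgl_class (mat 1) \<in> H" using H.one_closed by (simp add: PGL_one)
  have neg: "pgl_class (Zm ** M) \<in> H" if "pgl_class M \<in> H" for M
    using that pgl_class_scale[of "-1" M] by (simp add: Zm_def)
  have neg1: "pgl_class Zm \<in> H" using neg[OF one] by (simp add: matrix_mul_rid)
  have pw: "pgl_class (mpow Dm n) \<in> H" for n
    by (induction n) (auto intro!: m one D simp: invertible_mpow inv_D)
  have U: "pgl_class (br.U t) \<in> H" for t using pw by (simp add: br.U_def GL_pow)
  have T: "pgl_class Tm \<in> H"
    by (subst br.T_word, unfold GL_simps GL_pow)
      (intro neg m pw W invertible_mult invertible_mpow inv_D inv_W)
  have Hh: "pgl_class (br.H a) \<in> H" for a
    using one T neg[OF T] neg1 by (simp add: br.H_def GL_simps)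
  have inv: "invertible (br.U t)" "invertible (br.H t)" for t
    using br.U_closed[of t] br.H_closed[of t] by (simp_all add: GL_simps)
  show ?thesis
  proof
    fix A assume "A \<in> IG"
    then obtain g where "A = pgl_class (rep g)" by (auto simp: IG_def cl_def)
    moreover have "pgl_class (rep g) \<in> H"
      unfolding br.hom2_def GL_simps by (auto intro!: m U Hh W inv inv_W invertible_mult)
    ultimately show "A \<in> H" by simp
  qed
qed

lemma f_D: "f12 i (Dm *v v) = f12 i v" "f20 i (Dm *v v) = f20 i v" "f30 i (Dm *v v) = f30 i v"
proof -
  have e4: "(\<eta> ^ 4) ^ n = \<eta> ^ (4 * n)" for n by (simp add: power_mult)
  have e5: "\<eta> ^ (5 * n) = 1" for n by (simp add: power_mult eta5)
  have p: "\<eta> ^ 5 = 1" "\<eta> ^ 10 = 1" "\<eta> ^ 20 = 1" "\<eta> ^ 30 = 1" "\<eta> ^ 40 = 1" "\<eta> ^ 80 = 1" "\<eta> ^ 120 = 1"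
    using e5[of 1] e5[of 2] e5[of 4] e5[of 6] e5[of 8] e5[of 16] e5[of 24] by simp_all
  obtain x y where v: "v = v2 x y" by (rule v2_cases)
  have xy: "\<eta> * x * (\<eta> ^ 4 * y) = x * y" using eta5 by Groebner_Basis.algebra
  have q: "(\<eta> * x) ^ n = \<eta> ^ n * x ^ n" "(\<eta> ^ 4 * y) ^ n = \<eta> ^ (4 * n) * y ^ n" for n
    by (simp_all add: power_mult_distrib e4)
  have dv: "Dm *v v = v2 (\<eta> * x) (\<eta> ^ 4 * y)" by (simp add: Dm_def v)
  show "f12 i (Dm *v v) = f12 i v" "f20 i (Dm *v v) = f20 i v" "f30 i (Dm *v v) = f30 i v"
    unfolding dv f12_def f20_def f30_def v2_nth xy q unfolding v by (simp_all add: p)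
qed

lemma f_T: "f12 i (Tm *v v) = f12 i v" "f20 i (Tm *v v) = f20 i v" "f30 i (Tm *v v) = f30 i v"
proof -
  obtain x y where v: "v = v2 x y" by (rule v2_cases)
  have tv: "Tm *v v = v2 (- i * y) (- i * x)" by (simp add: Tm_def v)
  show "f12 i (Tm *v v) = f12 i v" unfolding tv f12_def v2_nth unfolding v v2_nth
    using i2 by Groebner_Basis.algebra
  show "f20 i (Tm *v v) = f20 i v" unfolding tv f20_def v2_nth unfolding v v2_nth
    using i2 by Groebner_Basis.algebra
  show "f30 i (Tm *v v) = f30 i v" unfolding tv f30_def v2_nth unfolding v v2_nth
    using i2 by Groebner_Basis.algebra
qed

lemma f_W: "f12 i (Wm *v v) = f12 i v" "f20 i (Wm *v v) = f20 i v" "f30 i (Wm *v v) = f30 i v"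
  unfolding Wm_def using klein_forms_W[OF i2 psi, of \<kappa> v] by (simp_all add: kap2)

text \<open>Invariance under \<open>Zm\<close> comes from \<open>Tm\<close>, whose square it
  is.\<close>

lemma rep_invariant:
  assumes D: "\<And>v. F (Dm *v v) = F v" and T: "\<And>v. F (Tm *v v) = F v" and W: "\<And>v. F (Wm *v v) = F v"
  shows "F (rep g *v v) = F v"
proof -
  have Z: "F (Zm *v v) = F v" for v
    using T[of "Tm *v v"] T[of v] br.TT by (simp add: matrix_vector_mul_assoc GL_simps)
  have pw: "F (mpow Dm n *v v) = F v" for n v
    by (induction n arbitrary: v) (simp_all add: D flip: matrix_vector_mul_assoc)
  have U: "F (br.U t *v v) = F v" for t v by (simp add: br.U_def GL_pow pw)
  have H: "F (br.H t *v v) = F v" for t v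
    by (simp add: br.H_def GL_simps T Z flip: matrix_vector_mul_assoc)
  show ?thesis unfolding br.hom2_def GL_simps
    by (simp add: U H W flip: matrix_vector_mul_assoc)
qed

lemma f_rep: "f12 i (rep g *v v) = f12 i v" "f20 i (rep g *v v) = f20 i v" "f30 i (rep g *v v) = f30 i v"
  "f60 i a (rep g *v v) = f60 i a v"
  by (rule rep_invariant; simp add: f_D f_T f_W f60_pencil[OF i2])+

text \<open>Supplies the hypotheses of \<open>icosahedral_orbits\<close> for an arbitrary finite
  group \<open>H\<close> containing the two classes. On an orbit of at most two points the square of
  \<open>Dm\<close> would act trivially; it fixes only (1:0) and (0:1), and \<open>Wm\<close> moves
  these elsewhere because all its entries are nonzero. The stabiliser of (1:0) contains the class of
  \<open>Dm\<close>, of order five.\<close>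

lemma icosahedral_action:
  assumes sub: "subgroup H PGL" and fin: "finite H" and D: "pgl_class Dm \<in> H" and W: "pgl_class Wm \<in> H"
  shows "two_point_action (PGL\<lparr>carrier := H\<rparr>) proj_space pgl_act"
    "P \<in> proj_space \<Longrightarrow> card (two_point_action.orb (PGL\<lparr>carrier := H\<rparr>) pgl_act P) > 2"
    "5 dvd card (two_point_action.stb (PGL\<lparr>carrier := H\<rparr>) pgl_act (proj_point (v2 1 0)))"
proof -
  show act: "two_point_action (PGL\<lparr>carrier := H\<rparr>) proj_space pgl_act"
    by (rule PGL2_two_point_action[OF sub fin])
  interpret a: two_point_action "PGL\<lparr>carrier := H\<rparr>" proj_space pgl_act by (rule act)
  interpret H: subgroup H PGL by (rule sub)
  interpret P: group "PGL :: ('a^2^2) set monoid" by (rule PGL_group)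
  have D2: "pgl_class (mpow Dm 2) \<in> H"
    using H.m_closed[OF D D] by (simp add: PGL_mult inv_D eval_nat_numeral)
  have fixD2: "x = 0 \<or> y = 0" if nz': "x \<noteq> 0 \<or> y \<noteq> 0" and fx: "pgl_act (pgl_class (mpow Dm 2)) (proj_point (v2 x y)) = proj_point (v2 x y)" for x y
  proof (rule ccontr)
    assume n: "\<not> (x = 0 \<or> y = 0)"
    have "((\<eta> ^ 4) ^ 2 - \<eta> ^ 2) * x * y = 0"
      using fx nz' fixed_iff[of "\<eta> ^ 2" 0 0 "(\<eta> ^ 4) ^ 2" x y] nz
      by (simp add: mpow_D invertible_m2)
    then have "(\<eta> ^ 4) ^ 2 = \<eta> ^ 2" using n by simp
    then have "\<eta> = 1" using eta5 by Groebner_Basis.algebra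
    then show False using eta_ne[of 1] by simp
  qed
  show "card (a.orb P) > 2" if P: "P \<in> proj_space"
  proof (rule ccontr)
    assume "\<not> card (a.orb P) > 2"
    then have small: "card (a.orb P) \<le> 2" by simp
    have DP: "pgl_class Dm \<in> carrier PGL" using D H.subset by auto
    have fx: "pgl_act (pgl_class (mpow Dm 2)) Q = Q" if Q: "Q \<in> a.orb P" for Q
    proof -
      have Qs: "Q \<in> proj_space" using Q a.orb_sub[OF P] by auto
      have inj: "inj_on (pgl_act (pgl_class Dm)) (a.orb P)"
      proof (rule inj_on_inverseI)
        fix R assume "R \<in> a.orb P"
        then have "R \<in> proj_space" using a.orb_sub[OF P] by auto
        then show "pgl_act (inv\<^bsub>PGL\<lparr>carrier := H\<rparr>\<^esub> pgl_class Dm) (pgl_act (pgl_class Dm) R) = R"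
          using D by (intro a.act_inv) auto
      qed
      have img: "pgl_act (pgl_class Dm) ` a.orb P \<subseteq> a.orb P"
      proof
        fix R assume "R \<in> pgl_act (pgl_class Dm) ` a.orb P"
        then obtain h where h: "h \<in> H" "R = pgl_act (pgl_class Dm) (pgl_act h P)" by (auto simp: a.orb_def)
        then have "R = pgl_act (pgl_class Dm \<otimes>\<^bsub>PGL\<^esub> h) P"
          using DP P H.subset by (simp add: pgl_act_mult subset_iff)
        then show "R \<in> a.orb P" using h D by (auto simp: a.orb_def)
      qed
      have "pgl_act (pgl_class Dm) (pgl_act (pgl_class Dm) Q) = Q"
        by (rule card_le_two_fixed[OF inj img a.fin_orb small Q])
      moreover have "pgl_class (mpow Dm 2) = pgl_class Dm \<otimes>\<^bsub>PGL\<^esub> pgl_class Dm"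
        by (simp add: PGL_mult inv_D eval_nat_numeral)
      ultimately show ?thesis using pgl_act_mult[OF DP DP Qs] by simp
    qed
    obtain x y where xy: "P = proj_point (v2 x y)" "x \<noteq> 0 \<or> y \<noteq> 0"
      using P by (metis proj_space_iff v2_cases v2_zero)
    have "x = 0 \<or> y = 0" using fixD2[OF xy(2)] fx[OF a.orb_refl[OF P]] xy(1) by simp
    \<comment> \<open>The image of \<open>P\<close> under \<open>Wm\<close> lies in the same small
      orbit and must have a vanishing coordinate as well.\<close>
    moreover have "\<kappa> * x + \<kappa> * i * \<psi> * y = 0 \<or> - \<kappa> * i * \<psi> * x - \<kappa> * y = 0"
    proof (rule fixD2)
      have W': "Wm *v v2 x y = v2 (\<kappa> * x + \<kappa> * i * \<psi> * y) (- \<kappa> * i * \<psi> * x - \<kappa> * y)"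
        by (simp add: Wm_def)
      show "\<kappa> * x + \<kappa> * i * \<psi> * y \<noteq> 0 \<or> - \<kappa> * i * \<psi> * x - \<kappa> * y \<noteq> 0"
        using invertible_vec_nz[OF inv_W, of "v2 x y"] xy(2) unfolding W' by auto
      have "pgl_act (pgl_class Wm) P \<in> a.orb P" using W by (auto simp: a.orb_def)
      from fx[OF this] show "pgl_act (pgl_class (mpow Dm 2)) (proj_point (v2 (\<kappa> * x + \<kappa> * i * \<psi> * y) (- \<kappa> * i * \<psi> * x - \<kappa> * y)))
          = proj_point (v2 (\<kappa> * x + \<kappa> * i * \<psi> * y) (- \<kappa> * i * \<psi> * x - \<kappa> * y))"
        by (simp add: xy(1) pgl_act_point W')
    qed
    ultimately show False using nz xy(2) by auto
  qed
  let ?y = "proj_point (v2 1 0) :: ('a^2) set"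
  have yP: "?y \<in> proj_space" by (auto simp: proj_space_def)
  have st: "subgroup (a.stb ?y) (PGL\<lparr>carrier := H\<rparr>)"
  proof (rule a.subgroupI)
    show "a.stb ?y \<subseteq> carrier (PGL\<lparr>carrier := H\<rparr>)" by (auto simp: a.stb_def)
    show "a.stb ?y \<noteq> {}" using a.one_stb[OF yP] by auto
    fix g assume g: "g \<in> a.stb ?y"
    then show "inv\<^bsub>PGL\<lparr>carrier := H\<rparr>\<^esub> g \<in> a.stb ?y"
      using a.act_inv[of g ?y] a.inv_closed[of g] yP by (simp add: a.stb_def)
    fix h assume "h \<in> a.stb ?y"
    then show "g \<otimes>\<^bsub>PGL\<lparr>carrier := H\<rparr>\<^esub> h \<in> a.stb ?y"
      using g yP H.subset by (auto simp: a.stb_def pgl_act_mult)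
  qed
  let ?S = "PGL\<lparr>carrier := a.stb ?y\<rparr>"
  have S: "group ?S" using subgroup.subgroup_is_group[OF st a.group_axioms] by simp
  have Dst: "pgl_class Dm \<in> a.stb ?y" using D nz
    by (auto simp: a.stb_def pgl_act_point Dm_def proj_line_eq_iff)
  have d5: "pgl_class Dm [^]\<^bsub>?S\<^esub> (5::nat) = \<one>\<^bsub>?S\<^esub>"
  proof -
    have "mpow Dm 5 = mat 1" using br.D5 by (simp add: GL_pow GL_simps)
    then have "pgl_class Dm [^]\<^bsub>PGL\<^esub> (5::nat) = \<one>\<^bsub>PGL\<^esub>" using PGL_pow[OF inv_D, of 5] by (simp add: PGL_one)
    then show ?thesis by (simp add: nat_pow_def)
  qed
  have d1: "pgl_class Dm \<noteq> \<one>\<^bsub>?S\<^esub>"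
  proof
    assume "pgl_class Dm = \<one>\<^bsub>?S\<^esub>"
    then obtain c where "Dm = mat c ** mat 1" by (auto simp: PGL_one pgl_class_eq_iff)
    then have "Dm$1$1 = c" "Dm$2$2 = c" by (simp_all add: mat_m2 m2_mult)
    then have "\<eta> - \<eta> ^ 4 = 0" unfolding Dm_def m2_nth by (metis diff_self)
    then show False using kap by simp
  qed
  have "group.ord ?S (pgl_class Dm) dvd 5"
    using group.pow_eq_id[OF S, of "pgl_class Dm" 5] d5 Dst by simp
  moreover have "group.ord ?S (pgl_class Dm) \<noteq> 1"
    using group.pow_eq_id[OF S, of "pgl_class Dm" 1] d1 Dst group.is_monoid[OF S]
    P.l_one[of "pgl_class Dm"] inv_D by (auto simp: PGL_carrier)
  ultimately have "group.ord ?S (pgl_class Dm) = 5" by (rule dvd_5)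
  then show "5 dvd card (a.stb ?y)"
    using group.ord_dvd_group_order[OF S, of "pgl_class Dm"] Dst by (simp add: Coset.order_def)
qed

lemma card_60:
  assumes "subgroup H PGL" "finite H" "pgl_class Dm \<in> H" "pgl_class Wm \<in> H"
  shows "card H = 60"
proof -
  note A = icosahedral_action[OF assms]
  have y: "proj_point (v2 1 0) \<in> (proj_space :: ('a^2) set set)" by (auto simp: proj_space_def)
  show ?thesis using two_point_action.icosahedral_orbits[OF A(1) A(2) y A(3)] by auto
qed

lemma card_IG: "card IG = 60"
  by (rule card_60[OF IG_subgroup finite_IG gens_IG(1,2)])

text \<open>\<open>card_60\<close> gives \<open>H\<close> the same order as its subgroup
  \<open>IG\<close>; this is the maximality of the icosahedral group among finite subgroups.\<close>

lemma IG_unique: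
  assumes "subgroup H PGL" "finite H" "pgl_class Dm \<in> H" "pgl_class Wm \<in> H"
  shows "H = IG"
  using IG_least[OF assms(1,3,4)] card_60[OF assms] card_IG assms(2) by (metis card_subset_eq)

text \<open>Read off from the geometric count of \<open>IG\<close> and the kernel of order two, not
  by enumeration of matrices.\<close>

lemma card_SL2: "Coset.order SL2_F5 = 120"
proof -
  have "card (cl ` carrier SL2_F5) * card (kernel SL2_F5 PGL cl) = Coset.order SL2_F5"
    by (rule hom_image_card[OF SL2_group PGL_group cl_hom finite_SL2])
  moreover have "card {m2 1 0 0 1, m2 (-1) 0 0 (-1::5)} = 2" by simp
  ultimately show ?thesis using card_IG by (simp only: cl_kernel IG_def)
qed

text \<open>Again by counting: the image has 120 / 2 elements, which is the order of the alternating
  group.\<close>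

lemma alt_surj: "alt.hom2 ` carrier SL2_F5 = carrier (alt_group 5)"
proof (rule card_subset_eq)
  have c: "2 * card (carrier (alt_group 5)) = fact 5" by (rule alt_group_card_carrier) simp
  then have c60: "card (carrier (alt_group 5)) = 60" by (simp add: eval_nat_numeral)
  show "finite (carrier (alt_group 5))" using c60 by (intro card_ge_0_finite) simp
  show "alt.hom2 ` carrier SL2_F5 \<subseteq> carrier (alt_group 5)" using alt.hom2_closed by auto
  have "card (alt.hom2 ` carrier SL2_F5) * card (kernel SL2_F5 (alt_group 5) alt.hom2) = Coset.order SL2_F5"
    by (rule hom_image_card[OF SL2_group alt_group_is_group alt.hom2_hom finite_SL2])
  moreover have "card {m2 1 0 0 1, m2 (-1) 0 0 (-1::5)} = 2" by simp
  ultimately show "card (alt.hom2 ` carrier SL2_F5) = card (carrier (alt_group 5))"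
    using card_SL2 by (simp only: alt_kernel c60)
qed

lemma IG_iso: "PGL\<lparr>carrier := IG\<rparr> \<cong> alt_group 5"
proof (rule surj_same_kernel_iso[OF SL2_group])
  show "cl \<in> hom SL2_F5 (PGL\<lparr>carrier := IG\<rparr>)" by (rule hom_restrict_carrier[OF cl_hom]) (simp add: IG_def)
  show "group (PGL\<lparr>carrier := IG\<rparr>)" by (rule subgroup.subgroup_is_group[OF IG_subgroup PGL_group])
  show "cl ` carrier SL2_F5 = carrier (PGL\<lparr>carrier := IG\<rparr>)" by (simp add: IG_def)
  have "kernel SL2_F5 (PGL\<lparr>carrier := IG\<rparr>) cl = kernel SL2_F5 PGL cl" by (simp add: kernel_def)
  then show "kernel SL2_F5 (PGL\<lparr>carrier := IG\<rparr>) cl = kernel SL2_F5 (alt_group 5) alt.hom2"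
    by (simp only: cl_kernel alt_kernel)
qed (rule alt.hom2_hom alt_group_is_group alt_surj)+

end

section \<open>Forms with icosahedral zeros\<close>

lemma infinite_proj_line: "infinite (proj_space :: ('a::field_char_0^2) set set)"
proof
  assume f: "finite (proj_space :: ('a^2) set set)"
  have "inj (\<lambda>x::'a. proj_point (v2 x 1))" by (rule injI) (simp add: proj_line_eq_iff)
  moreover have "range (\<lambda>x::'a. proj_point (v2 x 1)) \<subseteq> proj_space" by (auto simp: proj_space_def)
  ultimately have "finite (UNIV :: 'a set)" using f by (meson finite_imageD finite_subset)
  then show False using infinite_UNIV_char_0 by blast
qed

lemma bform_has_zero:
  fixes F :: "'a::alg_closed_field^2 \<Rightarrow> 'a"
  assumes F: "bform d F" and d: "d > 0"
  shows "zeros F \<noteq> {}"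
proof -
  obtain p where p: "\<And>v. F v = (\<Sum>k\<le>d. p k * v$1 ^ k * v$2 ^ (d - k))" using bform_coeffs[OF F] by auto
  show ?thesis
  proof (cases "p d = 0")
    case True
    have "F (v2 1 0) = (\<Sum>k\<in>{d}. p k * 1 ^ k * 0 ^ (d - k))"
      unfolding p v2_nth by (rule sum.mono_neutral_right) auto
    then have "F (v2 1 0) = 0" using True by simp
    then have "proj_point (v2 1 0) \<in> zeros F" by (simp add: zeros_v2[OF F])
    then show ?thesis by auto
  next
    case False
    then obtain x where "(\<Sum>k\<le>d. p k * x ^ k) = 0" using alg_closed[of d p] d by auto
    then have "F (v2 x 1) = 0" by (simp add: p)
    then have "proj_point (v2 x 1) \<in> zeros F" by (simp add: zeros_v2[OF F])
    then show ?thesis by auto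
  qed
qed

definition ico_form :: "'a::field \<Rightarrow> nat \<Rightarrow> nat \<Rightarrow> nat \<Rightarrow> nat \<Rightarrow> (nat \<Rightarrow> 'a) \<Rightarrow> 'a^2 \<Rightarrow> 'a" where
  "ico_form i e1 e2 e3 t a v = f12 i v ^ e1 * f20 i v ^ e2 * f30 i v ^ e3 * (\<Prod>k=1..t. f60 i (a k) v)"

lemma bform_ico: "bform (12 * e1 + 20 * e2 + 30 * e3 + 60 * t) (ico_form i e1 e2 e3 t a)"
proof -
  have 1: "bform (e1 * 12 + e2 * 20 + e3 * 30) (\<lambda>v. f12 i v ^ e1 * f20 i v ^ e2 * f30 i v ^ e3)"
    by (intro bform_mult bform_power bform_f12 bform_f20 bform_f30)
  have 2: "bform (card {1..t} * 60) (\<lambda>v. \<Prod>k=1..t. f60 i (a k) v)"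
    by (intro bform_prod bform_f60) simp
  show ?thesis using bform_mult[OF 1 2] by (simp add: ico_form_def[abs_def] mult.commute)
qed

lemma f_10: "f20 i (v2 1 0) = 1" "f30 i (v2 1 0) = 1" "f60 i a (v2 1 0) = 1" "f12 i (v2 1 0) = 0"
  unfolding f12_def f20_def f30_def f60_def sum_1_5 by simp_all

context icosa
begin

lemma f12_nz: "f12 i (v2 1 1) \<noteq> 0"
proof
  assume "f12 i (v2 1 1) = 0"
  then have "2 = 11 * i" by (simp add: f12_def algebra_simps)
  then have "(11 * i) ^ 2 = 2 ^ 2" by (simp only:)
  then show False by (simp add: power_mult_distrib i2)
qed

lemma f20_11: "f20 i (v2 1 1) \<noteq> 0"
proof
  assume "f20 i (v2 1 1) = 0"
  then have "(492::'a) = 456 * i" by (simp add: f20_def algebra_simps)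
  then have "(456 * i) ^ 2 = 492 ^ 2" by (simp only:)
  then show False by (simp add: power_mult_distrib i2)
qed

lemma f30_11: "f30 i (v2 1 1) = 0"
  by (simp add: f30_def)

text \<open>Finitely many nonzero forms have finitely many zeros on an infinite projective
  line.\<close>

lemma exists_common_nonzero:
  obtains w where "f12 i w \<noteq> 0" "f20 i w \<noteq> 0" "f30 i w \<noteq> 0" "\<And>k. k \<in> {1..t::nat} \<Longrightarrow> f60 i (a k) w \<noteq> 0"
proof -
  have fin: "finite (zeros (f12 i))" "finite (zeros (f20 i))" "finite (zeros (f30 i))" "finite (zeros (f60 i b))" for b
    using bform_zeros(1)[OF bform_f12 f12_nz] bform_zeros(1)[OF bform_f20, of i "v2 1 0"]
      bform_zeros(1)[OF bform_f30, of i "v2 1 0"] bform_zeros(1)[OF bform_f60, of i b "v2 1 0"] by (simp_all add: f_10)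
  let ?S = "zeros (f12 i) \<union> zeros (f20 i) \<union> zeros (f30 i) \<union> (\<Union>k\<in>{1..t}. zeros (f60 i (a k)))"
  have "finite ?S" using fin by simp
  then have "\<not> proj_space \<subseteq> ?S" using infinite_proj_line finite_subset by blast
  then obtain P where P: "P \<in> proj_space" "P \<notin> ?S" by blast
  then obtain w where w: "w \<noteq> 0" "P = proj_point w" by (auto simp: proj_space_iff)
  show thesis
  proof (rule that[of w])
    show "f12 i w \<noteq> 0" "f20 i w \<noteq> 0" "f30 i w \<noteq> 0"
      using P w zeros_point[OF bform_f12, of w i] zeros_point[OF bform_f20, of w i] zeros_point[OF bform_f30, of w i] by auto
    fix k assume "k \<in> {1..t}"
    then show "f60 i (a k) w \<noteq> 0" using P w zeros_point[OF bform_f60, of w i "a k"] by auto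
  qed
qed

lemma ico_nonzero: "\<exists>w. ico_form i e1 e2 e3 t a w \<noteq> 0"
proof -
  obtain w where "f12 i w \<noteq> 0" "f20 i w \<noteq> 0" "f30 i w \<noteq> 0" "\<And>k. k \<in> {1..t} \<Longrightarrow> f60 i (a k) w \<noteq> 0"
    using exists_common_nonzero[of t a] by metis
  then show ?thesis by (intro exI[of _ w]) (simp add: ico_form_def)
qed

lemma ico_rep: "ico_form i e1 e2 e3 t a (rep g *v v) = ico_form i e1 e2 e3 t a v"
  by (simp add: ico_form_def f_rep)

definition orb :: "('a^2) set \<Rightarrow> ('a^2) set set" where "orb P = (\<lambda>A. pgl_act A P) ` IG"

lemma action: "two_point_action (PGL\<lparr>carrier := IG\<rparr>) proj_space pgl_act"
  by (rule PGL2_two_point_action[OF IG_subgroup finite_IG])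

lemma orb_alt: "two_point_action.orb (PGL\<lparr>carrier := IG\<rparr>) pgl_act P = orb P"
  by (simp add: two_point_action.orb_def[OF action] orb_def)

lemma orbits:
  obtains P12 P20 P30 where "P12 \<in> proj_space" "P20 \<in> proj_space" "P30 \<in> proj_space"
    "card (orb P12) = 12" "card (orb P20) = 20" "card (orb P30) = 30"
    "\<And>P. P \<in> proj_space \<Longrightarrow> card (orb P) = 60 \<or> orb P = orb P12 \<or> orb P = orb P20 \<or> orb P = orb P30"
proof -
  note A = icosahedral_action[OF IG_subgroup finite_IG gens_IG(1,2)]
  have y: "proj_point (v2 1 0) \<in> (proj_space :: ('a^2) set set)" by (auto simp: proj_space_def)
  show thesis
    by (rule two_point_action.icosahedral_orbits[OF A(1) A(2) y A(3)])
      (auto simp: orb_alt intro: that)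
qed

lemma orb_refl: "P \<in> proj_space \<Longrightarrow> P \<in> orb P"
  using two_point_action.orb_refl[OF action] by (simp add: orb_alt)

lemma orb_cong: "P \<in> proj_space \<Longrightarrow> Q \<in> orb P \<Longrightarrow> orb Q = orb P"
  using two_point_action.orb_cong[OF action] by (simp add: orb_alt)

lemma orb_sub: "P \<in> proj_space \<Longrightarrow> orb P \<subseteq> proj_space"
  using two_point_action.orb_sub[OF action] by (simp add: orb_alt)

lemma finite_orb: "finite (orb P)"
  by (simp add: orb_def finite_IG)

lemma orb_zeros:
  assumes F: "bform d F" and inv: "\<And>g v. F (rep g *v v) = F v" and P: "P \<in> zeros F"
  shows "orb P \<subseteq> zeros F"
proof
  fix Q assume "Q \<in> orb P"
  then obtain g where g: "Q = pgl_act (pgl_class (rep g)) P" by (auto simp: orb_def IG_def cl_def)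
  have "pgl_act (pgl_class (rep g)) ` zeros F = zeros F"
    by (rule zeros_invariant[OF F rep_invertible, of _ 1]) (simp_all add: inv)
  then show "Q \<in> zeros F" using P g by blast
qed

abbreviation "Pinf \<equiv> proj_point (v2 1 0) :: ('a^2) set"
abbreviation "Pone \<equiv> proj_point (v2 1 1) :: ('a^2) set"

lemma points: "Pinf \<in> proj_space" "Pone \<in> proj_space"
  by (auto simp: proj_space_def)

text \<open>Zero sets are matched with orbits by size. Zeros of \<open>f12\<close> have orbits of at
  most 12 points. Zeros of \<open>f20\<close> have orbits of at most 20 points, but not the orbit of
  12, which contains (1:0) where \<open>f20\<close> is 1. The point (1:1) is a zero of
  \<open>f30\<close> and not of \<open>f20\<close>, which leaves the orbit of 30 points for it, and
  the degree leaves no room for other zeros of \<open>f30\<close>.\<close>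

theorem orbit_forms:
  "card (zeros (f12 i)) = 12" "card (zeros (f20 i)) = 20" "card (zeros (f30 i)) = 30"
  "\<And>P. P \<in> zeros (f12 i) \<Longrightarrow> orb P = zeros (f12 i)"
  "\<And>P. P \<in> zeros (f20 i) \<Longrightarrow> orb P = zeros (f20 i)"
  "\<And>P. P \<in> zeros (f30 i) \<Longrightarrow> orb P = zeros (f30 i)"
  "\<And>P. P \<in> proj_space \<Longrightarrow> P \<notin> zeros (f12 i) \<Longrightarrow> P \<notin> zeros (f20 i) \<Longrightarrow> P \<notin> zeros (f30 i) \<Longrightarrow>
      \<exists>a. zeros (f60 i a) = orb P \<and> card (orb P) = 60"
proof -
  obtain P12 P20 P30 where P: "P12 \<in> proj_space" "P20 \<in> proj_space" "P30 \<in> proj_space"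
    "card (orb P12) = 12" "card (orb P20) = 20" "card (orb P30) = 30"
    and all: "\<And>P. P \<in> proj_space \<Longrightarrow> card (orb P) = 60 \<or> orb P = orb P12 \<or> orb P = orb P20 \<or> orb P = orb P30"
    using orbits by blast
  have Z12: "finite (zeros (f12 i))" "card (zeros (f12 i)) \<le> 12"
    using bform_zeros[OF bform_f12 f12_nz] by simp_all
  have Z20: "finite (zeros (f20 i))" "card (zeros (f20 i)) \<le> 20"
    using bform_zeros[OF bform_f20, of i "v2 1 0"] by (simp_all add: f_10)
  have Z30: "finite (zeros (f30 i))" "card (zeros (f30 i)) \<le> 30"
    using bform_zeros[OF bform_f30, of i "v2 1 0"] by (simp_all add: f_10)
  have Z60: "finite (zeros (f60 i a))" "card (zeros (f60 i a)) \<le> 60" for a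
    using bform_zeros[OF bform_f60, of i a "v2 1 0"] by (simp_all add: f_10)
  have s12: "orb Q \<subseteq> zeros (f12 i)" if "Q \<in> zeros (f12 i)" for Q by (rule orb_zeros[OF bform_f12 f_rep(1) that])
  have s20: "orb Q \<subseteq> zeros (f20 i)" if "Q \<in> zeros (f20 i)" for Q by (rule orb_zeros[OF bform_f20 f_rep(2) that])
  have s30: "orb Q \<subseteq> zeros (f30 i)" if "Q \<in> zeros (f30 i)" for Q by (rule orb_zeros[OF bform_f30 f_rep(3) that])
  have in12: "Pinf \<in> zeros (f12 i)" by (simp add: zeros_v2[OF bform_f12] f_10)
  have o12: "orb Q = zeros (f12 i) \<and> orb Q = orb P12 \<and> card (zeros (f12 i)) = 12" if Q: "Q \<in> zeros (f12 i)" for Q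
  proof -
    have c: "card (orb Q) \<le> 12" using card_mono[OF Z12(1) s12[OF Q]] Z12(2) by simp
    have "Q \<in> proj_space" using Q zeros_sub by blast
    moreover have "orb Q \<noteq> orb P20"
    proof
      assume "orb Q = orb P20" show False using c unfolding \<open>orb Q = orb P20\<close> P(5) by simp
    qed
    moreover have "orb Q \<noteq> orb P30"
    proof
      assume "orb Q = orb P30" show False using c unfolding \<open>orb Q = orb P30\<close> P(6) by simp
    qed
    moreover have "card (orb Q) \<noteq> 60" using c by linarith
    ultimately have o: "orb Q = orb P12" using all by blast
    have c: "card (zeros (f12 i)) = 12" using card_mono[OF Z12(1) s12[OF Q]] Z12(2) unfolding o P(4) by simp
    have "orb Q = zeros (f12 i)" by (rule card_subset_eq[OF Z12(1) s12[OF Q]]) (simp only: o P(4) c)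
    then show ?thesis using o c by simp
  qed
  have o20: "orb Q = zeros (f20 i) \<and> orb Q = orb P20 \<and> card (zeros (f20 i)) = 20" if Q: "Q \<in> zeros (f20 i)" for Q
  proof -
    have c: "card (orb Q) \<le> 20" using card_mono[OF Z20(1) s20[OF Q]] Z20(2) by simp
    have "orb Q \<noteq> orb P12"
    proof
      assume "orb Q = orb P12"
      then have "orb Q = orb Pinf" using o12[OF in12] by metis
      then have "Pinf \<in> zeros (f20 i)" using s20[OF Q] orb_refl[OF points(1)] by auto
      then show False by (simp add: zeros_v2[OF bform_f20] f_10)
    qed
    have "Q \<in> proj_space" using Q zeros_sub by blast
    moreover have "orb Q \<noteq> orb P30"
    proof
      assume "orb Q = orb P30" show False using c unfolding \<open>orb Q = orb P30\<close> P(6) by simp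
    qed
    moreover have "card (orb Q) \<noteq> 60" using c by linarith
    ultimately have o: "orb Q = orb P20" using all \<open>orb Q \<noteq> orb P12\<close> by blast
    have c: "card (zeros (f20 i)) = 20" using card_mono[OF Z20(1) s20[OF Q]] Z20(2) unfolding o P(5) by simp
    have "orb Q = zeros (f20 i)" by (rule card_subset_eq[OF Z20(1) s20[OF Q]]) (simp only: o P(5) c)
    then show ?thesis using o c by simp
  qed
  obtain Q20 where Q20: "Q20 \<in> zeros (f20 i)" using bform_has_zero[OF bform_f20, of i] by auto
  have in30: "Pone \<in> zeros (f30 i)" by (simp add: zeros_v2[OF bform_f30] f30_11)
  have n20: "Pone \<notin> zeros (f20 i)" using f20_11 by (simp add: zeros_v2[OF bform_f20])
  have not12: "orb Q \<noteq> orb P12" if Q: "Q \<in> zeros (f30 i)" for Q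
  proof
    assume "orb Q = orb P12"
    then have "orb Q = orb Pinf" using o12[OF in12] by metis
    then have "Pinf \<in> zeros (f30 i)" using s30[OF Q] orb_refl[OF points(1)] by auto
    then show False by (simp add: zeros_v2[OF bform_f30] f_10)
  qed
  have one: "orb Pone = orb P30"
  proof -
    have c: "card (orb Pone) \<le> 30" using card_mono[OF Z30(1) s30[OF in30]] Z30(2) by simp
    have "orb Pone \<noteq> orb P20" using o20[OF Q20] n20 orb_refl[OF points(2)] by metis
    moreover have "card (orb Pone) \<noteq> 60" using c by linarith
    ultimately show ?thesis using all[OF points(2)] not12[OF in30] by blast
  qed
  have c30: "card (zeros (f30 i)) = 30" using card_mono[OF Z30(1) s30[OF in30]] Z30(2) P one by simp
  have z30: "orb Pone = zeros (f30 i)" using card_subset_eq[OF Z30(1) s30[OF in30]] one P c30 by simp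
  show "card (zeros (f12 i)) = 12" "card (zeros (f20 i)) = 20" "card (zeros (f30 i)) = 30"
    using o12[OF in12] o20[OF Q20] c30 by auto
  show "\<And>P. P \<in> zeros (f12 i) \<Longrightarrow> orb P = zeros (f12 i)" "\<And>P. P \<in> zeros (f20 i) \<Longrightarrow> orb P = zeros (f20 i)"
    using o12 o20 by auto
  show o30: "orb P = zeros (f30 i)" if "P \<in> zeros (f30 i)" for P
    using orb_cong[OF points(2), of P] z30 that by simp
  fix Q :: "('a^2) set" assume Q: "Q \<in> proj_space" "Q \<notin> zeros (f12 i)" "Q \<notin> zeros (f20 i)" "Q \<notin> zeros (f30 i)"
  have c60: "card (orb Q) = 60"
    using all[OF Q(1)] orb_refl[OF Q(1)] Q o12[OF in12] o20[OF Q20] z30 one by metis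
  obtain w where w: "w \<noteq> 0" "Q = proj_point w" using Q by (auto simp: proj_space_iff)
  have "f12 i w \<noteq> 0" using Q w zeros_point[OF bform_f12, of w i] by auto
  \<comment> \<open>The member of the pencil that passes through the point, found by solving
    \<open>f60_pencil\<close> for the parameter; \<open>f12\<close> does not vanish there.\<close>
  define a where "a = 33211924 - f20 i w ^ 3 * 134761 / (i * f12 i w ^ 5)"
  have "f60 i a w = 0"
    unfolding f60_pencil[OF i2] a_def using \<open>f12 i w \<noteq> 0\<close> nz by (simp add: field_simps)
  then have "Q \<in> zeros (f60 i a)" using Q w zeros_point[OF bform_f60, of w i a] by simp
  then have s: "orb Q \<subseteq> zeros (f60 i a)" by (rule orb_zeros[OF bform_f60 f_rep(4)])
  then have "orb Q = zeros (f60 i a)"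
    using card_mono[OF Z60(1) s] Z60(2)[of a] c60 by (intro card_subset_eq[OF Z60(1) s]) simp
  then show "\<exists>a. zeros (f60 i a) = orb Q \<and> card (orb Q) = 60" using c60 by auto
qed

text \<open>Two members of the pencil are powers and have a short orbit as zero set; these
  parameters must not occur for a regular orbit.\<close>

lemma zeros_f60_special: "zeros (f60 i (2 ^ 2 * 19 * 436999)) = zeros (f20 i)" 
  "zeros (f60 i (- (2 ^ 2 * 9377 * 5323))) = zeros (f30 i)"
  unfolding zeros_def f60_f20[OF i2] f60_f30[OF i2] by simp_all

text \<open>An invariant zero set contains each exceptional orbit entirely or not at all, and
  otherwise consists of regular orbits, each the zero set of one \<open>f60\<close>. As there are
  exactly \<open>d\<close> zeros, the degrees of the corresponding factors add up to
  \<open>d\<close>; the product vanishes wherever \<open>F\<close> does and is then proportional to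
  \<open>F\<close>.\<close>

theorem ico_decomposition:
  assumes F: "bform d F" and d: "d > 0" and c: "card (zeros F) = d" and nz: "F w \<noteq> 0"
    and inv: "\<And>A. A \<in> IG \<Longrightarrow> pgl_act A ` zeros F = zeros F"
  obtains e1 e2 e3 t a k where "A5_parameters d e1 e2 e3 t a" "k \<noteq> 0"
    "\<And>v. F v = k * ico_form i e1 e2 e3 t a v"
proof -
  let ?Z = "zeros F"
  have fZ: "finite ?Z" by (rule bform_zeros(1)[OF F nz])
  have sub: "?Z \<subseteq> proj_space" by (rule zeros_sub)
  have oZ: "orb P \<subseteq> ?Z" if "P \<in> ?Z" for P using inv that by (auto simp: orb_def)
  define e where "e G = (if zeros (G i) \<subseteq> ?Z then 1 else 0 :: nat)" for G :: "'a \<Rightarrow> 'a^2 \<Rightarrow> 'a"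
  define S where "S G = (if zeros (G i) \<subseteq> ?Z then zeros (G i) else {})" for G :: "'a \<Rightarrow> 'a^2 \<Rightarrow> 'a"
  have SI: "P \<in> S f12" if "P \<in> ?Z" "P \<in> zeros (f12 i)" for P
    using that oZ[of P] orbit_forms(4)[of P] by (auto simp: S_def)
  have SI2: "P \<in> S f20" if "P \<in> ?Z" "P \<in> zeros (f20 i)" for P
    using that oZ[of P] orbit_forms(5)[of P] by (auto simp: S_def)
  have SI3: "P \<in> S f30" if "P \<in> ?Z" "P \<in> zeros (f30 i)" for P
    using that oZ[of P] orbit_forms(6)[of P] by (auto simp: S_def)
  define R where "R = ?Z - (zeros (f12 i) \<union> zeros (f20 i) \<union> zeros (f30 i))"
  define Os where "Os = orb ` R"
  have fO: "finite Os" by (simp add: Os_def R_def fZ)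
  obtain h where h: "bij_betw h {1..card Os} Os" using ex_bij_betw_nat_finite_1[OF fO] by auto
  have ex: "\<exists>a. zeros (f60 i a) = Q \<and> card Q = 60" if "Q \<in> Os" for Q
  proof -
    obtain P where "P \<in> R" "Q = orb P" using \<open>Q \<in> Os\<close> by (auto simp: Os_def)
    then show ?thesis using orbit_forms(7)[of P] sub by (auto simp: R_def)
  qed
  \<comment> \<open>One parameter for each regular orbit, along the enumeration \<open>h\<close>.
    Injectivity of \<open>h\<close> makes the parameters distinct.\<close>
  define a where "a k = (SOME a. zeros (f60 i a) = h k)" for k
  have a: "zeros (f60 i (a k)) = h k" "card (h k) = 60" if k: "k \<in> {1..card Os}" for k
  proof -
    have "h k \<in> Os" using h k by (auto simp: bij_betw_def)
    from ex[OF this] show "zeros (f60 i (a k)) = h k" "card (h k) = 60" unfolding a_def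
      by (metis (mono_tags, lifting) someI_ex, blast)
  qed
  let ?G = "ico_form i (e f12) (e f20) (e f30) (card Os) a"
  let ?d = "12 * e f12 + 20 * e f20 + 30 * e f30 + 60 * card Os"
  have OOZ: "\<Union>Os = R"
  proof
    show "R \<subseteq> \<Union>Os" using orb_refl sub by (auto simp: Os_def R_def)
    show "\<Union>Os \<subseteq> R"
    proof
      fix P assume "P \<in> \<Union>Os"
      then obtain Q where Q: "Q \<in> R" "P \<in> orb Q" by (auto simp: Os_def)
      have Qs: "Q \<in> proj_space" using Q sub by (auto simp: R_def)
      have PZ: "P \<in> ?Z" using Q oZ[of Q] by (auto simp: R_def)
      have "orb P = orb Q" by (rule orb_cong[OF Qs Q(2)])
      then have "Q \<in> orb P" using orb_refl[OF Qs] by simp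
      then have "P \<notin> zeros (f12 i)" "P \<notin> zeros (f20 i)" "P \<notin> zeros (f30 i)"
        using orbit_forms(4-6)[of P] Q(1) by (auto simp: R_def)
      then show "P \<in> R" using PZ by (simp add: R_def)
    qed
  qed
  have disj12: "zeros (f12 i) \<inter> zeros (f20 i) = {}" "zeros (f12 i) \<inter> zeros (f30 i) = {}" "zeros (f20 i) \<inter> zeros (f30 i) = {}"
  proof -
    have ne: "zeros (f12 i) \<noteq> zeros (f20 i)" "zeros (f12 i) \<noteq> zeros (f30 i)" "zeros (f20 i) \<noteq> zeros (f30 i)"
      using orbit_forms(1-3) by auto
    have "P \<notin> zeros (f20 i)" if "P \<in> zeros (f12 i)" for P
      using orbit_forms(4)[OF that] orbit_forms(5)[of P] ne by metis
    moreover have "P \<notin> zeros (f30 i)" if "P \<in> zeros (f12 i)" for P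
      using orbit_forms(4)[OF that] orbit_forms(6)[of P] ne by metis
    moreover have "P \<notin> zeros (f30 i)" if "P \<in> zeros (f20 i)" for P
      using orbit_forms(5)[OF that] orbit_forms(6)[of P] ne by metis
    ultimately show "zeros (f12 i) \<inter> zeros (f20 i) = {}" "zeros (f12 i) \<inter> zeros (f30 i) = {}" "zeros (f20 i) \<inter> zeros (f30 i) = {}" by auto
  qed
  have Z: "?Z = S f12 \<union> (S f20 \<union> (S f30 \<union> R))"
  proof -
    have "S f12 \<subseteq> ?Z" "S f20 \<subseteq> ?Z" "S f30 \<subseteq> ?Z" by (simp_all add: S_def)
    then show ?thesis using SI SI2 SI3 unfolding R_def by blast
  qed
  have Ssub: "S f12 \<subseteq> zeros (f12 i)" "S f20 \<subseteq> zeros (f20 i)" "S f30 \<subseteq> zeros (f30 i)"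
    by (auto simp: S_def)
  have cS: "card (S f12) = 12 * e f12" "card (S f20) = 20 * e f20" "card (S f30) = 30 * e f30"
    using orbit_forms(1-3) by (auto simp: S_def e_def)
  have cR: "card R = 60 * card Os"
  proof -
    have "card (\<Union>Os) = (\<Sum>Q\<in>Os. card Q)"
    proof (rule card_Union_disjoint)
      show "pairwise disjnt Os"
      proof (rule pairwiseI)
        fix A B assume AB: "A \<in> Os" "B \<in> Os" "A \<noteq> B"
        then obtain P Q where PQ: "A = orb P" "B = orb Q" "P \<in> proj_space" "Q \<in> proj_space"
          using sub by (auto simp: Os_def R_def)
        show "disjnt A B" unfolding disjnt_def
        proof (rule equals0I)
          fix T assume "T \<in> A \<inter> B"
          then show False using orb_cong[OF PQ(3), of T] orb_cong[OF PQ(4), of T] PQ AB by auto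
        qed
      qed
      show "\<And>A. A \<in> Os \<Longrightarrow> finite A" using finite_orb by (auto simp: Os_def)
    qed
    also have "\<dots> = (\<Sum>Q\<in>Os. 60)" by (rule sum.cong) (use ex in auto)
    finally show ?thesis using OOZ by simp
  qed
  have fin: "finite (S f12)" "finite (S f20)" "finite (S f30)" "finite R"
    using fZ by (auto simp: S_def R_def intro: finite_subset)
  have "card ?Z = card (S f12) + (card (S f20) + (card (S f30) + card R))"
  proof -
    have "S f12 \<inter> (S f20 \<union> (S f30 \<union> R)) = {}" "S f20 \<inter> (S f30 \<union> R) = {}" "S f30 \<inter> R = {}"
      using Ssub disj12 by (auto simp: R_def)
    then show ?thesis using fin by (subst Z) (simp add: card_Un_disjoint)
  qed
  then have deq: "d = ?d" using c cS cR by simp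
  have G: "bform d ?G" unfolding deq by (rule bform_ico)
  have "?Z \<subseteq> zeros ?G"
  proof
    fix P assume P: "P \<in> ?Z"
    then obtain v where v: "v \<noteq> 0" "P = proj_point v" "F v = 0" by (rule zeros_cases[OF F])
    have Ps: "P \<in> proj_space" using P sub by auto
    have vz: "bform m Q \<Longrightarrow> P \<in> zeros Q \<Longrightarrow> Q v = 0" for m Q using zeros_point[of m Q v] v by auto
    have "?G v = 0"
      using P unfolding Z
    proof (elim UnE)
      assume "P \<in> S f12"
      then show ?thesis using vz[OF bform_f12, of i] by (auto simp: S_def e_def ico_form_def split: if_splits)
    next
      assume "P \<in> S f20"
      then show ?thesis using vz[OF bform_f20, of i] by (auto simp: S_def e_def ico_form_def split: if_splits)
    next
      assume "P \<in> S f30"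
      then show ?thesis using vz[OF bform_f30, of i] by (auto simp: S_def e_def ico_form_def split: if_splits)
    next
      assume "P \<in> R"
      then obtain Q where "Q \<in> Os" "P \<in> Q" using OOZ by blast
      moreover have "Os = h ` {1..card Os}" using h by (simp only: bij_betw_def)
      ultimately obtain k where k: "k \<in> {1..card Os}" "P \<in> h k" by blast
      then have "f60 i (a k) v = 0" using vz[OF bform_f60, of i "a k"] a(1)[OF k(1)] by simp
      then have "(\<Prod>k=1..card Os. f60 i (a k) v) = 0" using k(1) by (intro prod_zero) auto
      then show ?thesis unfolding ico_form_def by simp
    qed
    then show "P \<in> zeros ?G" using zeros_point[OF G, of v] Ps v by simp
  qed
  then obtain k where k: "\<And>v. ?G v = k * F v"
    using bform_proportional[OF F G d _ _ nz] c by (metis order_refl)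
  have k0: "k \<noteq> 0" using ico_nonzero[of "e f12" "e f20" "e f30" "card Os" a] k by auto
  have par: "A5_parameters d (e f12) (e f20) (e f30) (card Os) a"
    unfolding A5_parameters_def
  proof (intro conjI ballI impI)
    show "e f12 \<in> {0, 1}" "e f20 \<in> {0, 1}" "e f30 \<in> {0, 1}" by (simp_all add: e_def)
    show "d = ?d" by (rule deq)
    fix k assume k: "k \<in> {1..card Os}"
    \<comment> \<open>With this value the zero set would be that of \<open>f20\<close> and have 20
      points instead of 60; the next value would give the 30 zeros of \<open>f30\<close>.\<close>
    show "a k \<noteq> 2\<^sup>2 * 19 * 436999"
    proof
      assume e: "a k = 2\<^sup>2 * 19 * 436999"
      show False using a[OF k] orbit_forms(2) zeros_f60_special(1) unfolding e by simp
    qed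
    show "a k \<noteq> - (2\<^sup>2 * 9377 * 5323)"
    proof
      assume e: "a k = - (2\<^sup>2 * 9377 * 5323)"
      show False using a[OF k] orbit_forms(3) zeros_f60_special(2) unfolding e by simp
    qed
    fix l assume l: "l \<in> {1..card Os}" "k \<noteq> l"
    show "a k \<noteq> a l" using a(1)[OF k] a(1)[OF l(1)] h k l by (metis bij_betw_inv_into_left)
  qed
  show thesis
    by (rule that[OF par, of "inverse k"]) (use k k0 in \<open>auto simp: field_simps\<close>)
qed

text \<open>The zero set contains an orbit and hence at least three points, so the stabiliser is
  finite. It contains \<open>IG\<close>, and \<open>IG_unique\<close> applies.\<close>

lemma stab_ico:
  assumes d: "12 * e1 + 20 * e2 + 30 * e3 + 60 * t > 0"
  shows "stab (ico_form i e1 e2 e3 t a) = IG"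
proof -
  let ?F = "ico_form i e1 e2 e3 t a"
  note F = bform_ico[of e1 e2 e3 t i a]
  obtain w where w: "?F w \<noteq> 0" using ico_nonzero by blast
  have st: "pgl_class (rep g) \<in> stab ?F" for g
    unfolding stab_def mem_Collect_eq
    by (rule exI[of _ "rep g"]) (simp add: rep_invertible ico_rep exI[of _ "1::'a"])
  have sub: "IG \<subseteq> stab ?F" using st by (auto simp: IG_def cl_def)
  obtain P where P: "P \<in> zeros ?F" using bform_has_zero[OF F d] by auto
  have o: "orb P \<subseteq> zeros ?F" by (rule orb_zeros[OF F ico_rep P])
  have Ps: "P \<in> proj_space" using P zeros_sub by auto
  have "3 \<le> card (orb P)"
    using icosahedral_action(2)[OF IG_subgroup finite_IG gens_IG(1,2) Ps] by (simp add: orb_alt)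
  also have "\<dots> \<le> card (zeros ?F)" by (rule card_mono[OF bform_zeros(1)[OF F w] o])
  finally have "finite (stab ?F)" by (rule finite_stab[OF F bform_zeros(1)[OF F w]])
  then show ?thesis using sub gens_IG by (intro IG_unique stab_subgroup) auto
qed

end

section \<open>Evaluation and substitution for polynomials in three variables\<close>

lemma prod_UNIV_3: "prod f (UNIV::3 set) = f 1 * f 2 * f 3"
  unfolding UNIV_3 by (simp add: mult.assoc)

definition mpm :: "('n::finite \<Rightarrow>\<^sub>0 nat) \<Rightarrow> 'a::comm_ring_1^'n \<Rightarrow> 'a" where
  "mpm m v = (\<Prod>i\<in>UNIV. (v $ i) ^ Poly_Mapping.lookup m i)"

lemma mpm_add: "mpm (m + m') v = mpm m v * mpm m' v"
  by (simp add: mpm_def lookup_add power_add prod.distrib)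

lemma mpm_zero [simp]: "mpm 0 v = 1"
  by (simp add: mpm_def)

lemma mpm_single: "mpm (Poly_Mapping.single i k) v = v $ i ^ k"
proof -
  have "mpm (Poly_Mapping.single i k) v = (\<Prod>j\<in>{i}. v $ j ^ Poly_Mapping.lookup (Poly_Mapping.single i k) j)"
    unfolding mpm_def by (rule prod.mono_neutral_right) (auto simp: lookup_single when_def)
  then show ?thesis by simp
qed

lemma mp_eval_alt:
  assumes "finite S" "Poly_Mapping.keys p \<subseteq> S"
  shows "mp_eval p v = (\<Sum>m\<in>S. Poly_Mapping.lookup p m * mpm m v)"
  unfolding mp_eval_def mpm_def using assms
  by (intro sum.mono_neutral_left) (auto simp: in_keys_iff)

lemma mp_eval_add: "mp_eval (p + q) v = mp_eval p v + mp_eval q v"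
proof -
  let ?S = "Poly_Mapping.keys p \<union> Poly_Mapping.keys q"
  have "Poly_Mapping.keys (p + q) \<subseteq> ?S" by (rule keys_add)
  then show ?thesis
    by (subst (1 2 3) mp_eval_alt[of ?S]) (auto simp: lookup_add distrib_right sum.distrib)
qed

lemma mp_eval_single: "mp_eval (Poly_Mapping.single m c) v = c * mpm m v"
  by (subst mp_eval_alt[of "{m}"]) auto

lemma mp_eval_zero [simp]: "mp_eval 0 v = 0"
  by (simp add: mp_eval_def)

lemma mp_eval_sum: "mp_eval (sum f A) v = (\<Sum>x\<in>A. mp_eval (f x) v)"
  by (induction A rule: infinite_finite_induct) (auto simp: mp_eval_add)

lemma sum_singles: "p = (\<Sum>m\<in>Poly_Mapping.keys p. Poly_Mapping.single m (Poly_Mapping.lookup p m))"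
proof (rule poly_mapping_eqI)
  fix k
  show "Poly_Mapping.lookup p k = Poly_Mapping.lookup (\<Sum>m\<in>Poly_Mapping.keys p. Poly_Mapping.single m (Poly_Mapping.lookup p m)) k"
    unfolding lookup_sum lookup_single when_def by (auto simp: in_keys_iff)
qed

lemma mp_eval_mult: "mp_eval (p * q) v = mp_eval p v * mp_eval q v"
proof -
  have "p * q = (\<Sum>m\<in>Poly_Mapping.keys p. \<Sum>n\<in>Poly_Mapping.keys q.
      Poly_Mapping.single m (Poly_Mapping.lookup p m) * Poly_Mapping.single n (Poly_Mapping.lookup q n))"
    by (subst (1) sum_singles[of p], subst (1) sum_singles[of q]) (simp add: sum_product)
  also have "mp_eval \<dots> v = (\<Sum>m\<in>Poly_Mapping.keys p. \<Sum>n\<in>Poly_Mapping.keys q.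
      (Poly_Mapping.lookup p m * mpm m v) * (Poly_Mapping.lookup q n * mpm n v))"
    by (simp add: mp_eval_sum mult_single mp_eval_single mpm_add mult_ac)
  also have "\<dots> = mp_eval p v * mp_eval q v"
    by (simp add: mp_eval_def mpm_def sum_product)
  finally show ?thesis .
qed

lemma mp_eval_Const [simp]: "mp_eval (Const c) v = c"
  by (simp add: Const_def mp_eval_single)

lemma mp_eval_Var [simp]: "mp_eval (Var i) v = v $ i"
  by (simp add: Var_def mp_eval_single mpm_single)

lemma Const_one: "Const 1 = 1"
  by (simp add: Const_def)

lemma mp_eval_one [simp]: "mp_eval 1 v = 1"
  using mp_eval_Const[of 1 v] by (simp add: Const_one)

lemma mp_eval_uminus: "mp_eval (- p) v = - mp_eval p v"
  using mp_eval_add[of p "- p" v] by (simp add: eq_neg_iff_add_eq_0 add.commute)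

lemma mp_eval_diff: "mp_eval (p - q) v = mp_eval p v - mp_eval q v"
  using mp_eval_add[of p "- q" v] by (simp add: mp_eval_uminus)

lemma mp_eval_power: "mp_eval (p ^ n) v = mp_eval p v ^ n"
  by (induction n) (auto simp: mp_eval_mult)

lemma mp_eval_prod: "mp_eval (prod f A) v = (\<Prod>x\<in>A. mp_eval (f x) v)"
  by (induction A rule: infinite_finite_induct) (auto simp: mp_eval_mult)

lemmas mp_eval_simps = mp_eval_add mp_eval_mult mp_eval_diff mp_eval_uminus mp_eval_power mp_eval_sum mp_eval_prod

text \<open>Uniqueness of digits in base \<open>N\<close>; it recovers the three exponents from the
  exponent of \<open>t\<close> after the substitution below.\<close>

lemma base_digits:
  fixes a b c :: nat
  assumes "a < N" "b < N" "a' < N" "b' < N" "a + N * b + N ^ 2 * c = a' + N * b' + N ^ 2 * c'"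
  shows "a = a' \<and> b = b' \<and> c = c'"
proof -
  have N: "N > 0" using assms by auto
  have e: "a + N * (b + N * c) = a' + N * (b' + N * c')"
    using assms(5) by (simp add: power2_eq_square algebra_simps)
  have "(a + N * (b + N * c)) mod N = a" "(a' + N * (b' + N * c')) mod N = a'" using assms by simp_all
  then have 1: "a = a'" using e by simp
  then have 2: "b + N * c = b' + N * c'" using e N by simp
  have "(b + N * c) mod N = b" "(b' + N * c') mod N = b'" using assms by simp_all
  then have "b = b'" using 2 by simp
  then show ?thesis using 1 2 N by simp
qed

text \<open>Kronecker substitution: \<open>x = t\<close>, \<open>y = t\<^sup>N\<close>, \<open>z = t\<close> to the power \<open>N\<^sup>2\<close>.\<close>

lemma mp_eval_inj_0:
  fixes p :: "(3, 'a::field_char_0) mpoly"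
  assumes "\<And>v. mp_eval p v = 0"
  shows "p = 0"
proof (rule ccontr)
  assume "p \<noteq> 0"
  define K where "K = Poly_Mapping.keys p"
  have fK: "finite K" by (simp add: K_def)
  \<comment> \<open>Larger than every exponent in \<open>p\<close>, so different monomials become
    different powers of \<open>t\<close>.\<close>
  define N where "N = Suc (Max ((\<lambda>(m, i). Poly_Mapping.lookup m i) ` (K \<times> (UNIV :: 3 set))))"
  have lt: "Poly_Mapping.lookup m i < N" if "m \<in> K" for m i
  proof -
    have "Poly_Mapping.lookup m i \<le> Max ((\<lambda>(m, i). Poly_Mapping.lookup m i) ` (K \<times> (UNIV :: 3 set)))"
      using that fK by (intro Max_ge) force+
    then show ?thesis by (simp add: N_def)
  qed
  define e where "e m = Poly_Mapping.lookup m 1 + N * Poly_Mapping.lookup m 2 + N ^ 2 * Poly_Mapping.lookup m (3::3)" for m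
  have inj: "inj_on e K"
  proof (rule inj_onI)
    fix m m' assume m: "m \<in> K" "m' \<in> K" "e m = e m'"
    then have "Poly_Mapping.lookup m 1 = Poly_Mapping.lookup m' 1 \<and> Poly_Mapping.lookup m 2 = Poly_Mapping.lookup m' 2 \<and> Poly_Mapping.lookup m 3 = Poly_Mapping.lookup m' 3"
      by (intro base_digits[of _ N]) (auto simp: lt e_def)
    then have "\<forall>i. Poly_Mapping.lookup m i = Poly_Mapping.lookup m' i" unfolding forall_3 by simp
    then show "m = m'" by (intro poly_mapping_eqI) simp
  qed
  define q where "q = (\<Sum>m\<in>K. monom (Poly_Mapping.lookup p m) (e m))"
  have "poly q t = 0" for t
  proof -
    have "mp_eval p (vector [t, t ^ N, t ^ N ^ 2]) = poly q t"
      unfolding mp_eval_def prod_UNIV_3 q_def poly_sum poly_monom K_def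
      by (intro sum.cong) (auto simp: e_def power_add power_mult)
    then show ?thesis using assms by simp
  qed
  then have q: "q = 0" using poly_all_0_iff_0 by blast
  have "Poly_Mapping.lookup p m = 0" if "m \<in> K" for m
  proof -
    have "coeff q (e m) = (\<Sum>m'\<in>K. if m' = m then Poly_Mapping.lookup p m' else 0)"
      unfolding q_def coeff_sum coeff_monom using inj that by (intro sum.cong) (auto dest: inj_onD)
    then show ?thesis using that fK q by simp
  qed
  then have "Poly_Mapping.lookup p m = 0" for m unfolding K_def in_keys_iff by blast
  then have "p = 0" by (intro poly_mapping_eqI) simp
  then show False using \<open>p \<noteq> 0\<close> by simp
qed

lemma mp_eval_inj:
  fixes p q :: "(3, 'a::field_char_0) mpoly"
  assumes "\<And>v. mp_eval p v = mp_eval q v" shows "p = q"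
  using mp_eval_inj_0[of "p - q"] assms by (simp add: mp_eval_diff)

definition mp_subst :: "'a::comm_ring_1^3^3 \<Rightarrow> (3, 'a) mpoly \<Rightarrow> (3, 'a) mpoly" where
  "mp_subst A p = (\<Sum>m\<in>Poly_Mapping.keys p. Const (Poly_Mapping.lookup p m) *
      (\<Prod>i\<in>UNIV. (\<Sum>j\<in>UNIV. Const (A $ i $ j) * Var j) ^ Poly_Mapping.lookup m i))"

lemma mp_eval_subst: "mp_eval (mp_subst A p) v = mp_eval p (A *v v)"
  unfolding mp_subst_def mp_eval_simps mp_eval_def[of p] by (simp add: mp_eval_simps matrix_vector_mult_def)

text \<open>In characteristic 0 polynomials are determined by their values, by
  \<open>mp_eval_inj\<close>, so each rule for substitution is checked pointwise.\<close>

lemma mp_subst_hom: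
  fixes p q :: "(3, 'a::field_char_0) mpoly"
  shows "mp_subst A (p + q) = mp_subst A p + mp_subst A q" "mp_subst A (p * q) = mp_subst A p * mp_subst A q"
    "mp_subst A (p - q) = mp_subst A p - mp_subst A q"
    "mp_subst A 0 = (0 :: (3, 'a) mpoly)" "mp_subst A 1 = (1 :: (3, 'a) mpoly)" "mp_subst A (Const c) = (Const c :: (3, 'a) mpoly)"
  by (rule mp_eval_inj; simp add: mp_eval_subst mp_eval_simps)+

lemma mp_subst_inverse:
  fixes p :: "(3, 'a::field_char_0) mpoly"
  assumes "A ** B = mat 1"
  shows "mp_subst B (mp_subst A p) = p"
  by (rule mp_eval_inj) (simp add: mp_eval_subst matrix_vector_mul_assoc assms)

lemma homogeneous_eval: "homogeneous d p \<Longrightarrow> mp_eval p (c *s v) = c ^ d * mp_eval p v"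
proof -
  assume h: "homogeneous d p"
  have "mpm m (c *s v) = c ^ (\<Sum>i\<in>UNIV. Poly_Mapping.lookup m i) * mpm m v" for m
    by (simp add: mpm_def power_mult_distrib prod.distrib power_sum)
  then have "Poly_Mapping.lookup p m * mpm m (c *s v) = c ^ d * (Poly_Mapping.lookup p m * mpm m v)"
    if "m \<in> Poly_Mapping.keys p" for m using h that by (simp add: homogeneous_def mult.left_commute)
  then show ?thesis by (simp add: mp_eval_alt[OF finite_keys order.refl] sum_distrib_left)
qed

text \<open>A single scaling factor is enough because the powers of 2 are distinct in characteristic
  0. The auxiliary \<open>q\<close> is the polynomial \<open>p(2 v) - 2^d p(v)\<close>, with its
  coefficients written out. Homogeneity thereby becomes a statement about values and passes easily
  through substitutions.\<close>

lemma homogeneous_iff: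
  fixes p :: "(3, 'a::field_char_0) mpoly"
  shows "homogeneous d p \<longleftrightarrow> (\<forall>v. mp_eval p (2 *s v) = 2 ^ d * mp_eval p v)"
proof
  assume e: "\<forall>v. mp_eval p (2 *s v) = 2 ^ d * mp_eval p v"
  define q where "q = (\<Sum>m\<in>Poly_Mapping.keys p. Poly_Mapping.single m
     ((2 ^ (\<Sum>i\<in>UNIV. Poly_Mapping.lookup m i) - 2 ^ d) * Poly_Mapping.lookup p m))"
  have "mp_eval q v = 0" for v
  proof -
    have "mp_eval q v = (\<Sum>m\<in>Poly_Mapping.keys p. Poly_Mapping.lookup p m * mpm m (2 *s v) - 2 ^ d * (Poly_Mapping.lookup p m * mpm m v))"
      unfolding q_def mp_eval_sum mp_eval_single
      by (simp add: mpm_def power_mult_distrib prod.distrib power_sum algebra_simps)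
    also have "\<dots> = mp_eval p (2 *s v) - 2 ^ d * mp_eval p v"
      by (simp add: mp_eval_alt[OF finite_keys order.refl] sum_subtractf sum_distrib_left)
    finally show ?thesis using e by simp
  qed
  then have q: "q = 0" by (rule mp_eval_inj_0)
  show "homogeneous d p" unfolding homogeneous_def
  proof
    fix m assume m: "m \<in> Poly_Mapping.keys p"
    have "Poly_Mapping.lookup q m = (2 ^ (\<Sum>i\<in>UNIV. Poly_Mapping.lookup m i) - 2 ^ d) * Poly_Mapping.lookup p m"
      unfolding q_def lookup_sum lookup_single when_def using m by simp
    then have "(2::'a) ^ (\<Sum>i\<in>UNIV. Poly_Mapping.lookup m i) = 2 ^ d" using q m by (simp add: in_keys_iff)
    then have "of_nat (2 ^ (\<Sum>i\<in>UNIV. Poly_Mapping.lookup m i)) = (of_nat (2 ^ d) :: 'a)" by simp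
    then have "(2::nat) ^ (\<Sum>i\<in>UNIV. Poly_Mapping.lookup m i) = 2 ^ d" by (simp only: of_nat_eq_iff)
    then show "(\<Sum>i\<in>UNIV. Poly_Mapping.lookup m i) = d" by simp
  qed
qed (simp add: homogeneous_eval)

lemma homogeneous_subst:
  fixes p :: "(3, 'a::field_char_0) mpoly"
  shows "homogeneous d p \<Longrightarrow> homogeneous d (mp_subst A p)"
  unfolding homogeneous_iff by (simp add: mp_eval_subst mult_vec_scale)

section \<open>Galois extensions and isomorphisms\<close>

lemma generate_field_iso_sub:
  assumes E: "field E" and E': "field E'" and h: "h \<in> ring_iso E E'" and S: "S \<subseteq> carrier E"
    and x: "x \<in> generate_field E S"
  shows "h x \<in> generate_field E' (h ` S)"
proof -
  interpret E: field E by (rule E)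
  interpret E': field E' by (rule E')
  have hom: "h \<in> ring_hom E E'" using h by (simp add: ring_iso_def)
  interpret H: ring_hom_ring E E' h by (rule ring_hom_ringI2[OF E.ring_axioms E'.ring_axioms hom])
  have inj: "inj_on h (carrier E)" using h by (auto simp: ring_iso_def bij_betw_def)
  show ?thesis using x
  proof (induction rule: generate_field.induct)
    case one then show ?case using generate_field.one[of E'] by simp
  next
    case (incl s) then show ?case by (auto intro: generate_field.incl)
  next
    case (a_inv s)
    have "s \<in> carrier E" using E.generate_field_in_carrier[OF S a_inv.hyps] .
    then show ?case using generate_field.a_inv[OF a_inv.IH] by simp
  next
    case (m_inv s)
    have s: "s \<in> carrier E" using E.generate_field_in_carrier[OF S m_inv.hyps(1)] .
    have nz: "h s \<noteq> \<zero>\<^bsub>E'\<^esub>"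
      using inj_onD[OF inj _ s E.zero_closed] m_inv.hyps by auto
    have ic: "inv\<^bsub>E\<^esub> s \<in> carrier E" using s m_inv.hyps E.field_Units by auto
    have "h (inv\<^bsub>E\<^esub> s) \<otimes>\<^bsub>E'\<^esub> h s = \<one>\<^bsub>E'\<^esub>"
    proof -
      have "inv\<^bsub>E\<^esub> s \<otimes>\<^bsub>E\<^esub> s = \<one>\<^bsub>E\<^esub>" using s m_inv.hyps E.field_Units by auto
      then have "h (inv\<^bsub>E\<^esub> s \<otimes>\<^bsub>E\<^esub> s) = \<one>\<^bsub>E'\<^esub>" by simp
      then show ?thesis using s ic by simp
    qed
    then have "inv\<^bsub>E'\<^esub> (h s) = h (inv\<^bsub>E\<^esub> s)"
      using s ic by (intro E'.comm_inv_char) (auto simp: E'.m_comm)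
    then show ?case using generate_field.m_inv[OF m_inv.IH nz] by simp
  next
    case (eng_add s t)
    then have "s \<in> carrier E" "t \<in> carrier E" using E.generate_field_in_carrier[OF S] by auto
    then show ?case using generate_field.eng_add[OF eng_add.IH] by simp
  next
    case (eng_mult s t)
    then have "s \<in> carrier E" "t \<in> carrier E" using E.generate_field_in_carrier[OF S] by auto
    then show ?case using generate_field.eng_mult[OF eng_mult.IH] by simp
  qed
qed

lemma generate_field_iso:
  assumes E: "field E" and E': "field E'" and h: "h \<in> ring_iso E E'" and S: "S \<subseteq> carrier E"
  shows "h ` generate_field E S = generate_field E' (h ` S)"
proof
  show "h ` generate_field E S \<subseteq> generate_field E' (h ` S)"
    using generate_field_iso_sub[OF assms] by auto
  interpret E: field E by (rule E)
  interpret E': field E' by (rule E')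
  let ?g = "inv_into (carrier E) h"
  have g: "?g \<in> ring_iso E' E" by (rule ring_iso_set_sym[OF E.ring_axioms h])
  have bij: "bij_betw h (carrier E) (carrier E')" using h by (simp add: ring_iso_def)
  have S': "h ` S \<subseteq> carrier E'" using bij S by (auto simp: bij_betw_def)
  have gS: "?g ` h ` S = S"
    using bij S by (auto simp: bij_betw_def image_image subset_iff inv_into_f_f) 
  show "generate_field E' (h ` S) \<subseteq> h ` generate_field E S"
  proof
    fix x assume x: "x \<in> generate_field E' (h ` S)"
    have "?g x \<in> generate_field E S" using generate_field_iso_sub[OF E' E g S' x] gS by simp
    moreover have "x \<in> carrier E'" using E'.generate_field_in_carrier[OF S' x] .
    then have "h (?g x) = x" using bij by (auto simp: bij_betw_def f_inv_into_f)
    ultimately show "x \<in> h ` generate_field E S" by force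
  qed
qed

text \<open>Transport of structure: an automorphism \<open>s\<close> of \<open>E\<close> over
  \<open>F\<close> corresponds to its conjugate by \<open>h\<close>. For finite dimension the
  argument runs backwards, since the inverse of \<open>h\<close> would carry infinite dimension over
  to \<open>E\<close>.\<close>

lemma galois_extension_iso:
  assumes gal: "galois_extension E F" and E': "field E'" and h: "h \<in> ring_iso E E'"
  shows "galois_extension E' (h ` F)"
proof -
  have E: "field E" and F: "subfield F E" and fd: "ring.finite_dimension E F (carrier E)"
    and fx: "{x \<in> carrier E. \<forall>s\<in>ring_iso E E. (\<forall>y\<in>F. s y = y) \<longrightarrow> s x = x} = F"
    using gal by (auto simp: galois_extension_def)
  interpret E: field E by (rule E)
  interpret E': field E' by (rule E')
  have hom: "h \<in> ring_hom E E'" using h by (simp add: ring_iso_def)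
  interpret H: ring_hom_ring E E' h by (rule ring_hom_ringI2[OF E.ring_axioms E'.ring_axioms hom])
  have bij: "bij_betw h (carrier E) (carrier E')" using h by (simp add: ring_iso_def)
  let ?g = "inv_into (carrier E) h"
  have g: "?g \<in> ring_iso E' E" by (rule ring_iso_set_sym[OF E.ring_axioms h])
  have ghom: "?g \<in> ring_hom E' E" using g by (simp add: ring_iso_def)
  interpret G: ring_hom_ring E' E ?g by (rule ring_hom_ringI2[OF E'.ring_axioms E.ring_axioms ghom])
  have gh: "?g (h x) = x" if "x \<in> carrier E" for x using bij that by (auto simp: bij_betw_def)
  have hg: "h (?g x) = x" if "x \<in> carrier E'" for x using bij that by (auto simp: bij_betw_def f_inv_into_f)
  have gc: "?g x \<in> carrier E" if "x \<in> carrier E'" for x using that by simp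
  have FE: "F \<subseteq> carrier E" using subfieldE(3)[OF F] .
  have one: "\<one>\<^bsub>E'\<^esub> \<noteq> \<zero>\<^bsub>E'\<^esub>" by simp
  have sub: "subfield (h ` F) E'" using H.img_is_subfield(2)[OF F one] .
  have "(\<lambda>x. ?g (h x)) ` F = (\<lambda>x. x) ` F" using gh FE by (intro image_cong) auto
  then have gF: "?g ` h ` F = F" by (simp only: image_image image_ident)
  have "ring.finite_dimension E' (h ` F) (carrier E')"
  proof (rule ccontr)
    assume "\<not> ?thesis"
    moreover have "inj_on ?g (carrier E')" using bij by (metis bij_betw_imp_inj_on bij_betw_inv_into)
    moreover have "subalgebra (h ` F) (carrier E') E'"
      by (rule E'.carrier_is_subalgebra) (rule subfieldE(3)[OF sub])
    ultimately have "\<not> ring.finite_dimension E (?g ` h ` F) (?g ` carrier E')"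
      using G.infinite_dimension_hom[OF sub E.one_not_zero] by blast
    moreover have "?g ` carrier E' = carrier E" using g by (auto simp: ring_iso_def bij_betw_def)
    ultimately show False using fd gF by simp
  qed
  moreover have "{x \<in> carrier E'. \<forall>s\<in>ring_iso E' E'. (\<forall>y\<in>h ` F. s y = y) \<longrightarrow> s x = x} = h ` F"
  proof (intro equalityI subsetI)
    fix x assume x: "x \<in> {x \<in> carrier E'. \<forall>s\<in>ring_iso E' E'. (\<forall>y\<in>h ` F. s y = y) \<longrightarrow> s x = x}"
    have "?g x \<in> {x \<in> carrier E. \<forall>s\<in>ring_iso E E. (\<forall>y\<in>F. s y = y) \<longrightarrow> s x = x}"
    proof (safe)
      show "?g x \<in> carrier E" using x gc by auto
      fix s assume s: "s \<in> ring_iso E E" "\<forall>y\<in>F. s y = y"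
      have "h \<circ> s \<circ> ?g \<in> ring_iso E' E'"
        using ring_iso_set_trans[OF g ring_iso_set_trans[OF s(1) h]] by (simp add: comp_assoc)
      moreover have "\<forall>y\<in>h ` F. (h \<circ> s \<circ> ?g) y = y" using s(2) gh FE by auto
      ultimately have "(h \<circ> s \<circ> ?g) x = x" using x by blast
      then have "h (s (?g x)) = x" by simp
      moreover have "s (?g x) \<in> carrier E" using s(1) gc x by (auto simp: ring_iso_def bij_betw_def)
      ultimately show "s (?g x) = ?g x" using gh by metis
    qed
    then have "?g x \<in> F" unfolding fx .
    then show "x \<in> h ` F" using hg x by force
  next
    fix x assume "x \<in> h ` F"
    then obtain y where y: "y \<in> F" "x = h y" by auto
    then show "x \<in> {x \<in> carrier E'. \<forall>s\<in>ring_iso E' E'. (\<forall>y\<in>h ` F. s y = y) \<longrightarrow> s x = x}"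
      using FE by auto
  qed
  ultimately show ?thesis using E' sub unfolding galois_extension_def by blast
qed

section \<open>Transport of outer Galois points\<close>

definition sub2 :: "'a::comm_ring_1^3^3 \<Rightarrow> (3, 'a) mpoly \<times> (3, 'a) mpoly \<Rightarrow> (3, 'a) mpoly \<times> (3, 'a) mpoly" where
  "sub2 B = (\<lambda>(g, h). (mp_subst B g, mp_subst B h))"

text \<open>The matrix \<open>A\<close> maps the curve of \<open>f\<close> onto that of
  \<open>f'\<close>, and functions are pulled back along its inverse \<open>B\<close>. Classes of
  fractions are sets of pairs, so the isomorphism of function fields is simply the elementwise image
  under \<open>sub2 B\<close>.\<close>

locale form_transport =
  fixes A B :: "'a::field_char_0^3^3" and f f' :: "(3, 'a) mpoly" and c :: 'a
  assumes AB: "A ** B = mat 1" "B ** A = mat 1" and c: "c \<noteq> 0"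
    and ff: "mp_subst B f = Const c * f'"
begin

abbreviation "S \<equiv> mp_subst B"
abbreviation "T \<equiv> mp_subst A"

lemma TS [simp]: "T (S p) = p" and ST [simp]: "S (T p) = p"
  using mp_subst_inverse[OF AB(2)] mp_subst_inverse[OF AB(1)] by auto

lemma f'_eq: "f' = Const (inverse c) * S f"
proof -
  have "Const (inverse c) * Const c = (1 :: (3, 'a) mpoly)"
    using c by (simp add: Const_def mult_single flip: single_one)
  then show ?thesis unfolding ff by (simp flip: mult.assoc)
qed

lemma dvd_iff: "f' dvd S p \<longleftrightarrow> f dvd p"
proof
  assume "f dvd p"
  then obtain q where "p = f * q" by auto
  then have "S p = f' * (Const c * S q)" by (simp add: mp_subst_hom ff mult_ac)
  then show "f' dvd S p" by auto
next
  assume "f' dvd S p"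
  then obtain q where "S p = f' * q" by auto
  then have "S p = S f * (Const (inverse c) * q)" unfolding f'_eq by (simp add: mult_ac)
  then have "T (S p) = f * T (Const (inverse c) * q)" by (simp add: mp_subst_hom)
  then show "f dvd p" by simp
qed

lemma hom_iff: "homogeneous n (S p) \<longleftrightarrow> homogeneous n p"
  using homogeneous_subst[of n p B] homogeneous_subst[of n "S p" A] by auto

lemma pairs_iff: "sub2 B x \<in> frac_pairs f' \<longleftrightarrow> x \<in> frac_pairs f"
  by (cases x) (simp add: sub2_def frac_pairs_def hom_iff dvd_iff)

lemma rel_iff: "(sub2 B x, sub2 B y) \<in> frac_rel f' \<longleftrightarrow> (x, y) \<in> frac_rel f"
  using pairs_iff[of x] pairs_iff[of y]
  by (cases x; cases y) (simp add: sub2_def frac_rel_def dvd_iff flip: mp_subst_hom)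

lemma sub2_surj: "\<exists>y. x = sub2 B y"
  by (rule exI[of _ "(T (fst x), T (snd x))"]) (simp add: sub2_def)

lemma sub2_inj: "inj (sub2 B)"
  by (rule injI) (auto simp: sub2_def split: prod.splits dest: arg_cong[of _ _ T])

lemma class_map: "sub2 B ` (frac_rel f `` {x}) = frac_rel f' `` {sub2 B x}"
proof (intro equalityI subsetI)
  fix y assume "y \<in> frac_rel f' `` {sub2 B x}"
  moreover obtain z where "y = sub2 B z" using sub2_surj by blast
  ultimately show "y \<in> sub2 B ` (frac_rel f `` {x})" using rel_iff by auto
qed (auto simp: rel_iff)

lemma frac_map: "sub2 B ` ff_frac f g h = ff_frac f' (S g) (S h)"
  unfolding ff_frac_def class_map by (simp add: sub2_def)

lemma carrier_map: "(`) (sub2 B) ` carrier (function_field f) = carrier (function_field f')"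
proof -
  have "(`) (sub2 B) ` (frac_pairs f // frac_rel f) = frac_pairs f' // frac_rel f'"
  proof (intro equalityI subsetI)
    fix Q assume "Q \<in> (`) (sub2 B) ` (frac_pairs f // frac_rel f)"
    then obtain x where "x \<in> frac_pairs f" "Q = sub2 B ` (frac_rel f `` {x})" by (auto simp: quotient_def)
    moreover from this have "sub2 B x \<in> frac_pairs f'" by (simp only: pairs_iff)
    ultimately show "Q \<in> frac_pairs f' // frac_rel f'" unfolding class_map by (simp only: quotientI)
  next
    fix Q assume "Q \<in> frac_pairs f' // frac_rel f'"
    then obtain y where y: "y \<in> frac_pairs f'" "Q = frac_rel f' `` {y}" by (auto simp: quotient_def)
    obtain x where x: "y = sub2 B x" using sub2_surj by blast
    then have "x \<in> frac_pairs f" "Q = sub2 B ` (frac_rel f `` {x})" using y pairs_iff class_map by auto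
    then show "Q \<in> (`) (sub2 B) ` (frac_pairs f // frac_rel f)" by (auto intro: quotientI)
  qed
  then show ?thesis by (simp add: function_field_def)
qed

lemma mult_map: "sub2 B ` (K \<otimes>\<^bsub>function_field f\<^esub> L) = sub2 B ` K \<otimes>\<^bsub>function_field f'\<^esub> sub2 B ` L"
  unfolding function_field_def ring.simps monoid.simps
  by (simp add: image_UN frac_map mp_subst_hom split_def) (simp add: sub2_def split_def)

lemma add_map: "sub2 B ` (K \<oplus>\<^bsub>function_field f\<^esub> L) = sub2 B ` K \<oplus>\<^bsub>function_field f'\<^esub> sub2 B ` L"
  unfolding function_field_def ring.simps monoid.simps
  by (simp add: image_UN frac_map mp_subst_hom split_def) (simp add: sub2_def split_def)

lemma one_map: "sub2 B ` \<one>\<^bsub>function_field f\<^esub> = \<one>\<^bsub>function_field f'\<^esub>"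
  and zero_map: "sub2 B ` \<zero>\<^bsub>function_field f\<^esub> = \<zero>\<^bsub>function_field f'\<^esub>"
  by (simp_all add: function_field_def frac_map mp_subst_hom)

lemma ff_iso: "(`) (sub2 B) \<in> ring_iso (function_field f) (function_field f')"
proof -
  have "inj ((`) (sub2 B))" using sub2_inj by (auto intro!: injI dest: inj_image_eq_iff)
  then have "bij_betw ((`) (sub2 B)) (carrier (function_field f)) (carrier (function_field f'))"
    using carrier_map by (auto simp: bij_betw_def intro: inj_on_subset)
  moreover have "(`) (sub2 B) \<in> ring_hom (function_field f) (function_field f')"
    using carrier_map by (intro ring_hom_memI) (auto simp: mult_map add_map one_map)
  ultimately show ?thesis by (simp add: ring_iso_def)
qed

lemma field_map: "field (function_field f) \<Longrightarrow> field (function_field f')"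
  using field.ring_iso_imp_img_field[OF _ ff_iso] zero_map by (simp add: function_field_def)

lemma ff_frac_carrier: "(g, h) \<in> frac_pairs f \<Longrightarrow> ff_frac f g h \<in> carrier (function_field f)"
  by (auto simp: function_field_def ff_frac_def intro: quotientI)

text \<open>It is enough to match the generators: constants are unchanged by substitution, and a
  linear form vanishes at \<open>P\<close> exactly if its transform vanishes at the image of
  \<open>P\<close>.\<close>

lemma projection_map:
  assumes E: "field (function_field f)"
  shows "(`) (sub2 B) ` projection_subfield f P = projection_subfield f' (pgl_act (pgl_class A) P)"
proof -
  interpret E: field "function_field f" by (rule E)
  \<comment> \<open>If \<open>f\<close> were a unit, no denominator would be admissible and the
    function field would have an empty carrier. Excluding this makes the constants, as fractions
    over 1, elements of the field.\<close>
  have n1: "\<not> f dvd 1"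
  proof
    assume "f dvd 1"
    then have "frac_pairs f = {}" by (auto simp: frac_pairs_def dvd_trans[OF _ one_dvd])
    then have "carrier (function_field f) = {}" by (simp add: function_field_def quotient_def)
    then show False using E.one_closed by simp
  qed
  let ?G1 = "{ff_frac f (Const c) 1 |c. True}"
  let ?G2 = "{ff_frac f l l' |l l'. homogeneous 1 l \<and> homogeneous 1 l' \<and> \<not> f dvd l' \<and>
           (\<forall>v\<in>P. mp_eval l v = 0 \<and> mp_eval l' v = 0)}"
  let ?H1 = "{ff_frac f' (Const c) 1 |c. True}"
  let ?H2 = "{ff_frac f' l l' |l l'. homogeneous 1 l \<and> homogeneous 1 l' \<and> \<not> f' dvd l' \<and>
           (\<forall>v\<in>pgl_act (pgl_class A) P. mp_eval l v = 0 \<and> mp_eval l' v = 0)}"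
  have hc: "homogeneous 0 (Const k :: (3, 'a) mpoly)" "homogeneous 0 (1 :: (3, 'a) mpoly)" for k
    by (simp_all add: homogeneous_iff)
  have sub: "?G1 \<union> ?G2 \<subseteq> carrier (function_field f)"
  proof (rule Un_least)
    have "(Const k, 1) \<in> frac_pairs f" for k using n1 hc unfolding frac_pairs_def by blast
    then show "?G1 \<subseteq> carrier (function_field f)" using ff_frac_carrier by blast
    show "?G2 \<subseteq> carrier (function_field f)"
      by (auto intro!: ff_frac_carrier simp: frac_pairs_def)
  qed
  have "(`) (sub2 B) ` ?G1 = ?H1"
  proof (intro equalityI subsetI)
    fix x assume "x \<in> ?H1"
    then obtain k where "x = ff_frac f' (Const k) 1" by auto
    then have "x = sub2 B ` ff_frac f (Const k) 1" by (simp add: frac_map mp_subst_hom)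
    then show "x \<in> (`) (sub2 B) ` ?G1" by auto
  qed (auto simp: frac_map mp_subst_hom)
  have van: "(\<forall>v\<in>pgl_act (pgl_class A) P. mp_eval (S l) v = 0) \<longleftrightarrow> (\<forall>v\<in>P. mp_eval l v = 0)"
    if h: "homogeneous 1 l" for l
  proof
    assume l: "\<forall>v\<in>pgl_act (pgl_class A) P. mp_eval (S l) v = 0"
    show "\<forall>v\<in>P. mp_eval l v = 0"
    proof
      fix v assume "v \<in> P"
      then have "A *v v \<in> pgl_act (pgl_class A) P" using pgl_class_refl[of A] by (auto simp: pgl_act_def)
      then have "mp_eval (S l) (A *v v) = 0" using l by blast
      then show "mp_eval l v = 0" by (simp add: mp_eval_subst matrix_vector_mul_assoc AB)
    qed
  next
    assume l: "\<forall>v\<in>P. mp_eval l v = 0"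
    show "\<forall>v\<in>pgl_act (pgl_class A) P. mp_eval (S l) v = 0"
    proof
      fix v assume "v \<in> pgl_act (pgl_class A) P"
      then obtain k w where w: "w \<in> P" "v = (mat k ** A) *v w" by (auto simp: pgl_act_def pgl_class_alt)
      then have "mp_eval (S l) v = mp_eval l (k *s w)"
        by (simp add: mp_eval_subst mat_mult_vec mult_vec_scale matrix_vector_mul_assoc AB)
      then show "mp_eval (S l) v = 0" using homogeneous_eval[OF h, of k w] l w by simp
    qed
  qed
  have "(`) (sub2 B) ` ?G2 = ?H2"
  proof (intro equalityI subsetI)
    fix x assume "x \<in> (`) (sub2 B) ` ?G2"
    then obtain l l' where "x = sub2 B ` ff_frac f l l'" "homogeneous 1 l" "homogeneous 1 l'" "\<not> f dvd l'"
      "\<forall>v\<in>P. mp_eval l v = 0 \<and> mp_eval l' v = 0" by auto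
    then have "x = ff_frac f' (S l) (S l')" "homogeneous 1 (S l)" "homogeneous 1 (S l')" "\<not> f' dvd S l'"
      "\<forall>v\<in>pgl_act (pgl_class A) P. mp_eval (S l) v = 0 \<and> mp_eval (S l') v = 0"
      using van[of l] van[of l'] by (auto simp: frac_map hom_iff dvd_iff)
    then show "x \<in> ?H2" by blast
  next
    fix x assume "x \<in> ?H2"
    then obtain m m' where m: "x = ff_frac f' m m'" "homogeneous 1 m" "homogeneous 1 m'" "\<not> f' dvd m'"
      "\<forall>v\<in>pgl_act (pgl_class A) P. mp_eval m v = 0 \<and> mp_eval m' v = 0" by auto
    define l l' where "l = T m" "l' = T m'"
    have mm: "m = S l" "m' = S l'" by (simp_all add: l_l'_def)
    have "x = sub2 B ` ff_frac f l l'" "homogeneous 1 l" "homogeneous 1 l'" "\<not> f dvd l'"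
      using m unfolding mm by (auto simp: frac_map hom_iff dvd_iff)
    moreover from this have "\<forall>v\<in>P. mp_eval l v = 0 \<and> mp_eval l' v = 0"
      using m(5) van[of l] van[of l'] unfolding mm by blast
    ultimately show "x \<in> (`) (sub2 B) ` ?G2" by blast
  qed
  with \<open>(`) (sub2 B) ` ?G1 = ?H1\<close> show ?thesis
    unfolding projection_subfield_def generate_field_iso[OF E field_map[OF E] ff_iso sub] image_Un by simp
qed

lemma zero_iff: "mp_eval f' (A *v v) = 0 \<longleftrightarrow> mp_eval f v = 0"
proof -
  have "mp_eval (mp_subst B f) (A *v v) = mp_eval f v" by (simp add: mp_eval_subst matrix_vector_mul_assoc AB)
  then have "mp_eval f v = c * mp_eval f' (A *v v)" unfolding ff by (simp add: mp_eval_mult)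
  then show ?thesis using c by simp
qed

lemma invertible_A: "invertible A"
  using AB unfolding invertible_def by auto

lemma outer_galois_map:
  assumes P: "P \<in> outer_galois_points f" and hom: "homogeneous d f" "homogeneous d f'"
  shows "pgl_act (pgl_class A) P \<in> outer_galois_points f'"
proof -
  have Ps: "P \<in> proj_space" "P \<notin> plane_curve f" and g: "galois_extension (function_field f) (projection_subfield f P)"
    using P by (auto simp: outer_galois_points_def)
  have E: "field (function_field f)" using g by (simp add: galois_extension_def)
  have "galois_extension (function_field f') (projection_subfield f' (pgl_act (pgl_class A) P))"
    using galois_extension_iso[OF g field_map[OF E] ff_iso] unfolding projection_map[OF E] .
  moreover have "pgl_act (pgl_class A) P \<in> proj_space"
    using Ps by (intro pgl_act_closed) (auto simp: PGL_carrier invertible_A)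
  moreover have "pgl_act (pgl_class A) P \<notin> plane_curve f'"
  proof
    obtain v where v: "v \<noteq> 0" "P = proj_point v" using Ps by (auto simp: proj_space_iff)
    assume "pgl_act (pgl_class A) P \<in> plane_curve f'"
    then have "mp_eval f' (A *v v) = 0"
      unfolding v(2) pgl_act_point by (auto simp: plane_curve_def proj_point_self)
    then have "mp_eval f v = 0" by (simp add: zero_iff)
    then have "P \<in> plane_curve f" using v Ps homogeneous_eval[OF hom(1)]
      by (auto simp: plane_curve_def proj_point_def)
    then show False using Ps by simp
  qed
  ultimately show ?thesis by (simp add: outer_galois_points_def)
qed

end

section \<open>Forms in Z and a binary form\<close>

definition v3 :: "'a \<Rightarrow> 'a \<Rightarrow> 'a \<Rightarrow> 'a::zero^3" where "v3 x y z = vector [x, y, z]"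

lemma v3_nth [simp]: "v3 x y z $ 1 = x" "v3 x y z $ 2 = y" "v3 x y z $ 3 = z"
  by (simp_all add: v3_def)

lemma v3_eta: "v3 (v$1) (v$2) (v$3) = v"
  by (simp add: vec_eq_iff forall_3)

lemma v3_zero: "v3 x y z = 0 \<longleftrightarrow> x = 0 \<and> y = 0 \<and> z = 0"
  by (simp add: vec_eq_iff forall_3)

text \<open>The bridge between polynomials in three variables and the functional notion
  \<open>bform\<close>.\<close>

definition bfun :: "(3, 'a::comm_ring_1) mpoly \<Rightarrow> 'a^2 \<Rightarrow> 'a" where
  "bfun L w = mp_eval L (v3 (w$1) (w$2) 0)"

lemma mpm_3: "mpm m v = v$1 ^ Poly_Mapping.lookup m 1 * v$2 ^ Poly_Mapping.lookup m 2 * v$3 ^ Poly_Mapping.lookup m (3::3)"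
  by (simp add: mpm_def prod_UNIV_3)

lemma binary_form_keys:
  assumes "binary_form d L" "m \<in> Poly_Mapping.keys L"
  shows "Poly_Mapping.lookup m 3 = 0" "Poly_Mapping.lookup m 1 + Poly_Mapping.lookup m 2 = d"
  using assms by (auto simp: binary_form_def homogeneous_def sum_3)

lemma eval_keys: "mp_eval L v = (\<Sum>m\<in>Poly_Mapping.keys L. Poly_Mapping.lookup L m * mpm m v)"
  by (rule mp_eval_alt) simp_all

lemma binary_eval: "binary_form d L \<Longrightarrow> mp_eval L v = bfun L (v2 (v$1) (v$2))"
  unfolding bfun_def eval_keys by (rule sum.cong) (auto simp: mpm_3 binary_form_keys)

lemma bfun_sum: "binary_form d L \<Longrightarrow> bfun L v =
    (\<Sum>m\<in>Poly_Mapping.keys L. Poly_Mapping.lookup L m * v$1 ^ Poly_Mapping.lookup m 1 * v$2 ^ Poly_Mapping.lookup m 2)"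
  unfolding bfun_def eval_keys by (rule sum.cong) (auto simp: mpm_3 binary_form_keys mult.assoc)

lemma bform_bfun:
  fixes L :: "(3, 'a::field) mpoly"
  assumes L: "binary_form d L" shows "bform d (bfun L)"
proof -
  have "bform d (\<lambda>v. \<Sum>m\<in>Poly_Mapping.keys L. Poly_Mapping.lookup L m * v$1 ^ Poly_Mapping.lookup m 1 * v$2 ^ Poly_Mapping.lookup m 2)"
  proof (rule bform_sum)
    fix m assume m: "m \<in> Poly_Mapping.keys L"
    show "bform d (\<lambda>v. Poly_Mapping.lookup L m * v$1 ^ Poly_Mapping.lookup m 1 * v$2 ^ Poly_Mapping.lookup m 2)"
      using bform_monom[of "Poly_Mapping.lookup m 1" "Poly_Mapping.lookup m 2"] binary_form_keys(2)[OF L m] by simp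
  qed
  moreover have "bfun L = (\<lambda>v. \<Sum>m\<in>Poly_Mapping.keys L. Poly_Mapping.lookup L m * v$1 ^ Poly_Mapping.lookup m 1 * v$2 ^ Poly_Mapping.lookup m 2)"
    using bfun_sum[OF L] by auto
  ultimately show ?thesis by simp
qed

lemma curve_form_eval: "binary_form d L \<Longrightarrow> mp_eval (pZ ^ d + L) v = v$3 ^ d + bfun L (v2 (v$1) (v$2))"
  by (simp add: mp_eval_simps binary_eval)

lemma curve_form_homogeneous:
  fixes L :: "(3, 'a::field_char_0) mpoly"
  shows "binary_form d L \<Longrightarrow> homogeneous d (pZ ^ d + L)"
proof -
  assume L: "binary_form d L"
  have "bfun L (v2 (2 * x) (2 * y)) = 2 ^ d * bfun L (v2 x y)" for x y
    using bform_homog[OF bform_bfun[OF L], of 2 "v2 x y"] by simp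
  then show ?thesis unfolding homogeneous_iff by (simp add: curve_form_eval[OF L] power_mult_distrib distrib_left)
qed

lemma card_roots_squarefree:
  fixes p :: "'a::{alg_closed_field, field_char_0} poly"
  assumes "p \<noteq> 0" "\<And>x. poly p x = 0 \<Longrightarrow> poly (pderiv p) x \<noteq> 0"
  shows "card {x. poly p x = 0} = degree p"
  using assms
proof (induction "degree p" arbitrary: p)
  case 0
  then obtain a where "p = [:a:]" by (metis degree_eq_zeroE)
  then show ?case using 0 by simp
next
  case (Suc n)
  obtain x where x: "poly p x = 0" using alg_closed_imp_poly_has_root[of p] Suc.hyps(2) by auto
  then obtain q where q: "p = [:- x, 1:] * q" by (metis dvdE poly_eq_0_iff_dvd)
  have q0: "q \<noteq> 0" using q Suc.prems by auto
  have dq: "degree p = Suc (degree q)" unfolding q using q0 by (subst degree_mult_eq) auto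
  have dp: "poly (pderiv p) y = poly q y + (y - x) * poly (pderiv q) y" for y
    unfolding q pderiv_mult by (simp add: pderiv_pCons algebra_simps)
  have qx: "poly q x \<noteq> 0" using Suc.prems(2)[OF x] by (simp add: dp)
  have "card {y. poly q y = 0} = degree q"
  proof (rule Suc.hyps(1)[OF _ q0])
    show "n = degree q" using dq Suc.hyps(2) by simp
    fix y assume "poly q y = 0"
    moreover from this have "poly p y = 0" by (simp add: q)
    ultimately show "poly (pderiv q) y \<noteq> 0" using Suc.prems(2)[of y] dp[of y] by auto
  qed
  moreover have "{y. poly p y = 0} = insert x {y. poly q y = 0}" by (auto simp: q)
  ultimately show ?case using qx dq poly_roots_finite[OF q0] by simp
qed

text \<open>An elementary replacement for the Nullstellensatz. For fixed \<open>x\<close>,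
  \<open>y\<close> with \<open>L(x, y) \<noteq> 0\<close> the polynomial
  \<open>z^d + L(x, y)\<close> has \<open>d\<close> distinct roots, and \<open>g(x, y, z)\<close>,
  of degree at most \<open>d\<close> in \<open>z\<close>, vanishes at all of them. The two are thus
  proportional, and the factor is the coefficient of \<open>z^d\<close> in \<open>g\<close>, that is
  \<open>g(0, 0, 1)\<close>. Multiplication by \<open>L\<close> takes care of the remaining
  \<open>x\<close>, \<open>y\<close>, as there are no zero divisors.\<close>

lemma form_multiple:
  fixes g L :: "(3, 'a::{alg_closed_field, field_char_0}) mpoly"
  assumes L: "binary_form d L" and d: "d > 0" and nz: "bfun L w \<noteq> 0" and g: "homogeneous d g"
    and van: "\<And>v. mp_eval (pZ ^ d + L) v = 0 \<Longrightarrow> mp_eval g v = 0"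
  shows "g = Const (mp_eval g (v3 0 0 1)) * (pZ ^ d + L)"
proof -
  let ?F = "bfun L" and ?c = "mp_eval g (v3 0 0 1)"
  have main: "mp_eval g (v3 x y z) = ?c * (z ^ d + ?F (v2 x y))" if F: "?F (v2 x y) \<noteq> 0" for x y z
  proof -
    define G where "G = (\<Sum>m\<in>Poly_Mapping.keys g. monom (Poly_Mapping.lookup g m * x ^ Poly_Mapping.lookup m 1 * y ^ Poly_Mapping.lookup m 2) (Poly_Mapping.lookup m 3))"
    have Gz: "poly G z = mp_eval g (v3 x y z)" for z
      unfolding G_def eval_keys by (simp add: poly_sum poly_monom mpm_3 mult.assoc)
    have dg: "Poly_Mapping.lookup m 1 + Poly_Mapping.lookup m 2 + Poly_Mapping.lookup m 3 = d" if "m \<in> Poly_Mapping.keys g" for m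
      using g that by (simp add: homogeneous_def sum_3)
    have degG: "degree G \<le> d" unfolding G_def
      by (rule degree_sum_le) (use dg in \<open>auto intro!: order.trans[OF degree_monom_le]\<close>, fastforce)
    have cG: "coeff G d = ?c" unfolding G_def eval_keys coeff_sum coeff_monom mpm_3 v3_nth
    proof (rule sum.cong)
      fix m assume m: "m \<in> Poly_Mapping.keys g"
      show "(if Poly_Mapping.lookup m 3 = d then Poly_Mapping.lookup g m * x ^ Poly_Mapping.lookup m 1 * y ^ Poly_Mapping.lookup m 2 else 0) =
         Poly_Mapping.lookup g m * (0 ^ Poly_Mapping.lookup m 1 * 0 ^ Poly_Mapping.lookup m 2 * 1 ^ Poly_Mapping.lookup m 3)"
        using dg[OF m] by (auto simp: power_0_left)
    qed simp
    define Q where "Q = monom 1 d + [:?F (v2 x y):]"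
    have Qz: "poly Q z = z ^ d + ?F (v2 x y)" for z by (simp add: Q_def poly_monom)
    have degQ: "degree Q = d" unfolding Q_def using d by (subst degree_add_eq_left) (auto simp: degree_monom_eq)
    have cQ: "coeff Q d = 1" using d by (simp add: Q_def coeff_pCons split: nat.splits)
    have dQ: "pderiv Q = monom (of_nat d) (d - 1)" by (simp add: Q_def pderiv_add pderiv_monom pderiv_pCons)
    have cardQ: "card {z. poly Q z = 0} = d"
    proof (subst card_roots_squarefree)
      show "Q \<noteq> 0" using cQ by auto
      fix z assume "poly Q z = 0"
      then have "z \<noteq> 0" using F d by (auto simp: Qz power_0_left)
      then show "poly (pderiv Q) z \<noteq> 0" using d by (simp add: dQ poly_monom)
    qed (rule degQ)
    define R where "R = G - smult ?c Q"
    have "R = 0"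
    proof (rule ccontr)
      assume R: "R \<noteq> 0"
      have "degree R \<le> d" unfolding R_def using degG degQ by (intro degree_diff_le) auto
      moreover have "coeff R d = 0" by (simp add: R_def cG cQ)
      ultimately have lt: "degree R < d" using R leading_coeff_0_iff le_neq_implies_less by blast
      have "{z. poly Q z = 0} \<subseteq> {z. poly R z = 0}"
      proof
        fix z assume z: "z \<in> {z. poly Q z = 0}"
        then have "mp_eval g (v3 x y z) = 0" by (intro van) (simp add: curve_form_eval[OF L] Qz)
        then show "z \<in> {z. poly R z = 0}" using z by (simp add: R_def Gz)
      qed
      then have "d \<le> card {z. poly R z = 0}" unfolding cardQ[symmetric] by (rule card_mono[OF poly_roots_finite[OF R]])
      also have "\<dots> \<le> degree R" by (rule card_poly_roots_bound[OF R])
      finally show False using lt by simp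
    qed
    then have "poly G z = ?c * poly Q z" by (simp add: R_def)
    then show ?thesis by (simp add: Gz Qz)
  qed
  have "(g - Const ?c * (pZ ^ d + L)) * L = 0"
  proof (rule mp_eval_inj_0)
    fix v :: "'a^3"
    show "mp_eval ((g - Const ?c * (pZ ^ d + L)) * L) v = 0"
      using main[of "v$1" "v$2" "v$3"]
      by (cases "?F (v2 (v$1) (v$2)) = 0")
        (simp_all add: mp_eval_mult mp_eval_diff curve_form_eval[OF L] binary_eval[OF L] v3_eta)
  qed
  moreover have "L \<noteq> 0" using nz by (auto simp: bfun_def)
  ultimately show ?thesis by simp
qed

lemma curve_form_zero:
  fixes L :: "(3, 'a::field_char_0) mpoly"
  assumes L: "binary_form d L" and d: "d > 0" shows "mp_eval (pZ ^ d + L) 0 = 0"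
  using homogeneous_eval[OF curve_form_homogeneous[OF L], of 0 0] d by (simp add: power_0_left)

lemma plane_curve_point:
  fixes f :: "(3, 'a::field) mpoly"
  assumes "homogeneous d f" "v \<noteq> 0"
  shows "proj_point v \<in> plane_curve f \<longleftrightarrow> mp_eval f v = 0"
  using assms proj_point_self[of v] by (auto simp: plane_curve_def proj_space_def proj_point_def homogeneous_eval)

lemma plane_curve_sub: "plane_curve f \<subseteq> proj_space"
  by (auto simp: plane_curve_def)

text \<open>Equality of point sets is upgraded to proportionality of forms by
  \<open>form_multiple\<close>. The factor is nonzero because the target form takes the value 1 at
  (0, 0, 1).\<close>

lemma curve_map_forms:
  fixes L L' :: "(3, 'a::{alg_closed_field, field_char_0}) mpoly"
  assumes L: "binary_form d L" and L': "binary_form d L'" and d: "d > 0" and nz: "bfun L w \<noteq> 0"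
    and A: "invertible A" and map: "pgl_act (pgl_class A) ` plane_curve (pZ ^ d + L) = plane_curve (pZ ^ d + L')"
  obtains c where "c \<noteq> 0" "\<And>v. mp_eval (pZ ^ d + L') (A *v v) = c * mp_eval (pZ ^ d + L) v"
proof -
  let ?f = "pZ ^ d + L" and ?f' = "pZ ^ d + L'"
  let ?g = "mp_subst A ?f'"
  have hf: "homogeneous d ?f" and hf': "homogeneous d ?f'" using L L' by (simp_all add: curve_form_homogeneous)
  have van: "mp_eval ?g v = 0" if "mp_eval ?f v = 0" for v
  proof (cases "v = 0")
    case True then show ?thesis using curve_form_zero[OF L' d] by (simp add: mp_eval_subst mult_vec_zero)
  next
    case False
    then have "proj_point v \<in> plane_curve ?f" using that plane_curve_point[OF hf] by simp
    then have "proj_point (A *v v) \<in> plane_curve ?f'" using map pgl_act_point by (metis image_eqI)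
    then show ?thesis using plane_curve_point[OF hf' invertible_vec_nz[OF A False]] by (simp add: mp_eval_subst)
  qed
  define c where "c = mp_eval ?g (v3 0 0 1)"
  have g: "?g = Const c * ?f" unfolding c_def by (rule form_multiple[OF L d nz homogeneous_subst[OF hf'] van])
  have ev: "mp_eval ?f' (A *v v) = c * mp_eval ?f v" for v
    using arg_cong[OF g, of "\<lambda>p. mp_eval p v"] by (simp add: mp_eval_subst mp_eval_mult)
  obtain B where B: "A ** B = mat 1" using invertible_inv[OF A] by metis
  have "c \<noteq> 0"
  proof
    assume "c = 0"
    then have "mp_eval ?f' (A *v (B *v v3 0 0 1)) = 0" by (simp only: ev mult_zero_left)
    then have "mp_eval ?f' (v3 0 0 1) = 0" by (simp add: matrix_vector_mul_assoc B)
    moreover have "bfun L' (v2 0 0) = 0" using bform_homog[OF bform_bfun[OF L'], of 0 "v2 0 0"] d by (simp add: power_0_left)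
    ultimately show False by (simp add: curve_form_eval[OF L'])
  qed
  then show thesis using ev by (rule that)
qed

lemma forms_map_curve:
  fixes f f' :: "(3, 'a::field) mpoly"
  assumes f: "homogeneous d f" and f': "homogeneous d f'" and A: "invertible A" and c: "c \<noteq> 0"
    and ev: "\<And>v. mp_eval f' (A *v v) = c * mp_eval f v"
  shows "pgl_act (pgl_class A) ` plane_curve f = plane_curve f'"
proof -
  obtain B where B: "A ** B = mat 1" "B ** A = mat 1" "invertible B" by (rule invertible_inv[OF A])
  show ?thesis
  proof (intro equalityI subsetI)
    fix P assume "P \<in> pgl_act (pgl_class A) ` plane_curve f"
    then obtain Q where Q: "Q \<in> plane_curve f" "P = pgl_act (pgl_class A) Q" by auto
    then obtain v where v: "v \<noteq> 0" "Q = proj_point v" using plane_curve_sub by (metis proj_space_iff subsetD)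
    have "mp_eval f v = 0" using Q v plane_curve_point[OF f v(1)] by simp
    then show "P \<in> plane_curve f'" unfolding Q(2) v(2) pgl_act_point
      using plane_curve_point[OF f' invertible_vec_nz[OF A v(1)]] ev by simp
  next
    fix P assume P: "P \<in> plane_curve f'"
    then obtain v where v: "v \<noteq> 0" "P = proj_point v" using plane_curve_sub by (metis proj_space_iff subsetD)
    have Bv: "B *v v \<noteq> 0" by (rule invertible_vec_nz[OF B(3) v(1)])
    have "mp_eval f' v = 0" using P v plane_curve_point[OF f' v(1)] by simp
    then have "mp_eval f (B *v v) = 0" using ev[of "B *v v"] c by (simp add: matrix_vector_mul_assoc B)
    then have "proj_point (B *v v) \<in> plane_curve f" using plane_curve_point[OF f Bv] by simp
    moreover have "P = pgl_act (pgl_class A) (proj_point (B *v v))"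
      by (simp add: v pgl_act_point matrix_vector_mul_assoc B)
    ultimately show "P \<in> pgl_act (pgl_class A) ` plane_curve f" by blast
  qed
qed

lemma outer_galois_curve_map:
  fixes L L' :: "(3, 'a::{alg_closed_field, field_char_0}) mpoly"
  assumes L: "binary_form d L" and L': "binary_form d L'" and A: "invertible A" and c: "c \<noteq> 0"
    and ev: "\<And>v. mp_eval (pZ ^ d + L') (A *v v) = c * mp_eval (pZ ^ d + L) v"
    and P: "P \<in> outer_galois_points (pZ ^ d + L)"
  shows "pgl_act (pgl_class A) P \<in> outer_galois_points (pZ ^ d + L')"
proof -
  obtain B where B: "A ** B = mat 1" "B ** A = mat 1" by (rule invertible_inv[OF A])
  have "mp_subst B (pZ ^ d + L) = Const (inverse c) * (pZ ^ d + L')"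
  proof (rule mp_eval_inj)
    fix v :: "'a^3"
    show "mp_eval (mp_subst B (pZ ^ d + L)) v = mp_eval (Const (inverse c) * (pZ ^ d + L')) v"
      using ev[of "B *v v"] c unfolding mp_eval_subst mp_eval_mult mp_eval_Const
      by (simp add: matrix_vector_mul_assoc B)
  qed
  then interpret form_transport A B "pZ ^ d + L" "pZ ^ d + L'" "inverse c"
    using B c by unfold_locales auto
  show ?thesis by (rule outer_galois_map[OF P curve_form_homogeneous[OF L] curve_form_homogeneous[OF L']])
qed

section \<open>Smoothness\<close>

lemma mp_eval_pderiv: "mp_eval (mp_pderiv i p) v =
    (\<Sum>m\<in>Poly_Mapping.keys p. of_nat (Poly_Mapping.lookup m i) * Poly_Mapping.lookup p m * mpm (m - Poly_Mapping.single i 1) v)"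
  by (simp add: mp_pderiv_def mp_eval_sum mp_eval_single)

lemma mp_eval_pderiv_add: "mp_eval (mp_pderiv i (p + q)) v = mp_eval (mp_pderiv i p) v + mp_eval (mp_pderiv i q) v"
proof -
  let ?S = "Poly_Mapping.keys p \<union> Poly_Mapping.keys q"
  let ?t = "\<lambda>r m. of_nat (Poly_Mapping.lookup m i) * Poly_Mapping.lookup r m * mpm (m - Poly_Mapping.single i 1) v"
  have *: "mp_eval (mp_pderiv i r) v = (\<Sum>m\<in>?S. ?t r m)" if "Poly_Mapping.keys r \<subseteq> ?S" for r
    unfolding mp_eval_pderiv using that by (intro sum.mono_neutral_left) (auto simp: in_keys_iff)
  have "Poly_Mapping.keys (p + q) \<subseteq> ?S" by (rule keys_add)
  then have "mp_eval (mp_pderiv i (p + q)) v = (\<Sum>m\<in>?S. ?t (p + q) m)" by (rule *)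
  also have "\<dots> = (\<Sum>m\<in>?S. ?t p m) + (\<Sum>m\<in>?S. ?t q m)"
    by (simp add: lookup_add algebra_simps sum.distrib)
  also have "\<dots> = mp_eval (mp_pderiv i p) v + mp_eval (mp_pderiv i q) v" using *[of p] *[of q] by simp
  finally show ?thesis .
qed

lemma Var_power: "Var i ^ n = Poly_Mapping.single (Poly_Mapping.single i n) 1"
  by (induction n) (simp_all add: Var_def mult_single add.commute flip: single_add)

lemma pderiv_Z_power: "mp_eval (mp_pderiv i (pZ ^ d)) v = (if i = 3 then of_nat d * v$3 ^ (d - 1) else 0)"
proof -
  have "mp_eval (mp_pderiv i (pZ ^ d)) v = of_nat (Poly_Mapping.lookup (Poly_Mapping.single 3 d) i) * mpm (Poly_Mapping.single 3 d - Poly_Mapping.single i 1) v"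
    unfolding Var_power mp_eval_pderiv by simp
  moreover have "Poly_Mapping.single (3::3) d - Poly_Mapping.single 3 1 = Poly_Mapping.single 3 (d - 1)"
    by (simp flip: single_diff)
  ultimately show ?thesis by (auto simp: lookup_single when_def mpm_single)
qed

lemma mpm_diff: "mpm (m - Poly_Mapping.single i 1) v =
   (\<Prod>j\<in>UNIV. v$j ^ (Poly_Mapping.lookup m j - (if i = j then 1 else 0)))"
  by (simp only: mpm_def lookup_minus lookup_single when_def)

lemma pderiv_sum: "pderiv (\<Sum>x\<in>A. f x) = (\<Sum>x\<in>A. pderiv (f x))"
  by (induction A rule: infinite_finite_induct) (simp_all add: pderiv_add)

text \<open>A multiple zero of the binary form gives a singular point with \<open>Z = 0\<close>,
  where the derivative in \<open>Z\<close> vanishes by \<open>d \<ge> 2\<close>. Affine zeros are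
  tested through \<open>q(x) = L(x, 1)\<close>, the point (1:0) through the two top
  coefficients.\<close>

lemma smooth_binary:
  fixes L :: "(3, 'a::{alg_closed_field, field_char_0}) mpoly"
  assumes L: "binary_form d L" and d: "d \<ge> 2" and smooth: "smooth_form (pZ ^ d + L)"
  shows "card (zeros (bfun L)) = d" "\<exists>w. bfun L w \<noteq> 0"
proof -
  let ?F = "bfun L" and ?K = "Poly_Mapping.keys L" and ?c = "Poly_Mapping.lookup L"
  note keys = binary_form_keys[OF L]
  define q where "q = (\<Sum>m\<in>?K. monom (?c m) (Poly_Mapping.lookup m 1))"
  have qx: "poly q x = ?F (v2 x 1)" for x
    by (simp add: q_def poly_sum poly_monom bfun_sum[OF L])
  have cq: "coeff q k = (\<Sum>m\<in>?K. if Poly_Mapping.lookup m 1 = k then ?c m else 0)" for k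
    by (simp add: q_def coeff_sum)
  have dq: "poly (pderiv q) x = (\<Sum>m\<in>?K. of_nat (Poly_Mapping.lookup m 1) * ?c m * x ^ (Poly_Mapping.lookup m 1 - 1))" for x
    unfolding q_def pderiv_sum by (simp add: poly_sum pderiv_monom poly_monom mult.assoc)
  have d3: "mp_eval (mp_pderiv 3 (pZ ^ d + L)) v = 0" if "v$3 = 0" for v
    using that d keys(1) by (simp add: mp_eval_pderiv_add pderiv_Z_power mp_eval_pderiv[of 3 L] power_0_left)
  have d1: "mp_eval (mp_pderiv 1 (pZ ^ d + L)) (v3 x y 0) =
     (\<Sum>m\<in>?K. of_nat (Poly_Mapping.lookup m 1) * ?c m * (x ^ (Poly_Mapping.lookup m 1 - 1) * y ^ Poly_Mapping.lookup m 2))" for x y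
    unfolding mp_eval_pderiv_add pderiv_Z_power mp_eval_pderiv[of 1 L] mpm_diff prod_UNIV_3
    by (simp, rule sum.cong) (auto simp: keys)
  have d2: "mp_eval (mp_pderiv 2 (pZ ^ d + L)) (v3 x y 0) =
     (\<Sum>m\<in>?K. of_nat (Poly_Mapping.lookup m 2) * ?c m * (x ^ Poly_Mapping.lookup m 1 * y ^ (Poly_Mapping.lookup m 2 - 1)))" for x y
    unfolding mp_eval_pderiv_add pderiv_Z_power mp_eval_pderiv[of 2 L] mpm_diff prod_UNIV_3
    by (simp, rule sum.cong) (auto simp: keys)
  have sm: False if xy: "x \<noteq> 0 \<or> y \<noteq> 0" and F0: "?F (v2 x y) = 0"
    and 1: "mp_eval (mp_pderiv 1 (pZ ^ d + L)) (v3 x y 0) = 0" and 2: "mp_eval (mp_pderiv 2 (pZ ^ d + L)) (v3 x y 0) = 0" for x y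
  proof -
    have "mp_eval (pZ ^ d + L) (v3 x y 0) = 0" using F0 d by (simp add: curve_form_eval[OF L] power_0_left)
    moreover have "v3 x y 0 \<noteq> 0" using xy by (auto simp: v3_zero)
    ultimately have "\<exists>i. mp_eval (mp_pderiv i (pZ ^ d + L)) (v3 x y 0) \<noteq> 0"
      using smooth by (simp add: smooth_form_def)
    moreover have "\<forall>i. mp_eval (mp_pderiv i (pZ ^ d + L)) (v3 x y 0) = 0"
      unfolding forall_3 using 1 2 d3[of "v3 x y 0"] by simp
    ultimately show False by blast
  qed
  have sq: "poly (pderiv q) x \<noteq> 0" if r: "poly q x = 0" for x
  proof
    assume p: "poly (pderiv q) x = 0"
    have s1: "mp_eval (mp_pderiv 1 (pZ ^ d + L)) (v3 x 1 0) = 0" using p unfolding d1 dq by simp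
    \<comment> \<open>Euler's relation \<open>x L_x + y L_y = d L\<close> at \<open>y = 1\<close>:
      at a double root of \<open>q\<close> the derivative in \<open>Y\<close> vanishes along with
      that in \<open>X\<close>.\<close>
    have "mp_eval (mp_pderiv 2 (pZ ^ d + L)) (v3 x 1 0) + x * poly (pderiv q) x = of_nat d * poly q x"
      unfolding d2 dq qx bfun_sum[OF L] sum_distrib_left sum.distrib[symmetric]
    proof (rule sum.cong)
      fix m assume m: "m \<in> ?K"
      have "x * (of_nat (Poly_Mapping.lookup m 1) * ?c m * x ^ (Poly_Mapping.lookup m 1 - 1)) = of_nat (Poly_Mapping.lookup m 1) * ?c m * x ^ Poly_Mapping.lookup m 1"
        by (cases "Poly_Mapping.lookup m 1") auto
      moreover have "of_nat d = (of_nat (Poly_Mapping.lookup m 1) + of_nat (Poly_Mapping.lookup m 2) :: 'a)"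
        using keys(2)[OF m] by (metis of_nat_add)
      ultimately show "of_nat (Poly_Mapping.lookup m 2) * ?c m * (x ^ Poly_Mapping.lookup m 1 * 1 ^ (Poly_Mapping.lookup m 2 - 1)) +
         x * (of_nat (Poly_Mapping.lookup m 1) * ?c m * x ^ (Poly_Mapping.lookup m 1 - 1)) =
         of_nat d * (?c m * v2 x 1 $ 1 ^ Poly_Mapping.lookup m 1 * v2 x 1 $ 2 ^ Poly_Mapping.lookup m 2)"
        by (simp add: algebra_simps)
    qed simp
    then have s2: "mp_eval (mp_pderiv 2 (pZ ^ d + L)) (v3 x 1 0) = 0" using p r by simp
    show False by (rule sm[of x 1]) (use s1 s2 r qx in auto)
  qed
  have q0: "q \<noteq> 0" using sq[of 0] by auto
  then obtain x0 where "poly q x0 \<noteq> 0" using poly_all_0_iff_0 by blast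
  then show "\<exists>w. ?F w \<noteq> 0" using qx by metis
  have F10: "?F (v2 1 0) = coeff q d"
    unfolding bfun_sum[OF L] cq
  proof (rule sum.cong)
    fix m assume m: "m \<in> ?K"
    show "?c m * v2 1 0 $ 1 ^ Poly_Mapping.lookup m 1 * v2 1 0 $ 2 ^ Poly_Mapping.lookup m 2 = (if Poly_Mapping.lookup m 1 = d then ?c m else 0)"
      using keys(2)[OF m] by (auto simp: power_0_left)
  qed simp
  have deg: "degree q \<le> d"
  proof (rule degree_le, intro allI impI)
    fix k assume "d < k"
    then show "coeff q k = 0" unfolding cq using keys(2) by (intro sum.neutral) fastforce
  qed
  \<comment> \<open>At (1:0) the partial derivatives are \<open>d\<close> times the coefficient of
    \<open>x^d\<close> and the coefficient of \<open>x^(d-1) y\<close>. Hence (1:0), if it is a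
    zero, accounts for exactly the one root that is missing from \<open>q\<close>.\<close>
  have inf: "coeff q (d - 1) \<noteq> 0" if 0: "coeff q d = 0"
  proof
    assume c1: "coeff q (d - 1) = 0"
    have "mp_eval (mp_pderiv 1 (pZ ^ d + L)) (v3 1 0 0) = of_nat d * coeff q d"
      unfolding d1 cq sum_distrib_left
    proof (rule sum.cong)
      fix m assume m: "m \<in> ?K"
      show "of_nat (Poly_Mapping.lookup m 1) * ?c m * (1 ^ (Poly_Mapping.lookup m 1 - 1) * 0 ^ Poly_Mapping.lookup m 2) =
         of_nat d * (if Poly_Mapping.lookup m 1 = d then ?c m else 0)"
        using keys(2)[OF m] by (auto simp: power_0_left)
    qed simp
    moreover have "mp_eval (mp_pderiv 2 (pZ ^ d + L)) (v3 1 0 0) = coeff q (d - 1)"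
      unfolding d2 cq
    proof (rule sum.cong)
      fix m assume m: "m \<in> ?K"
      show "of_nat (Poly_Mapping.lookup m 2) * ?c m * (1 ^ Poly_Mapping.lookup m 1 * 0 ^ (Poly_Mapping.lookup m 2 - 1)) =
         (if Poly_Mapping.lookup m 1 = d - 1 then ?c m else 0)"
        using keys(2)[OF m] d by (cases "Poly_Mapping.lookup m 2") (auto simp: power_0_left)
    qed simp
    ultimately show False using sm[of 1 0] 0 c1 F10 by simp
  qed
  have cr: "card {x. poly q x = 0} = degree q" by (rule card_roots_squarefree[OF q0 sq])
  define R where "R = (\<lambda>x. proj_point (v2 x 1)) ` {x. poly q x = 0}"
  have cR: "card R = degree q" unfolding R_def cr[symmetric]
    by (rule card_image) (auto intro!: inj_onI simp: proj_line_eq_iff)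
  have fR: "finite R" unfolding R_def using poly_roots_finite[OF q0] by simp
  have nR: "proj_point (v2 1 0) \<notin> R" by (auto simp: R_def proj_line_eq_iff)
  note bF = bform_bfun[OF L]
  have z: "P \<in> zeros ?F \<longleftrightarrow> P \<in> R \<or> (P = proj_point (v2 1 0) \<and> coeff q d = 0)" for P
  proof
    assume "P \<in> zeros ?F"
    then obtain v where v: "v \<noteq> 0" "P = proj_point v" "?F v = 0" by (rule zeros_cases[OF bF])
    obtain x y where xy: "v = v2 x y" by (rule v2_cases)
    show "P \<in> R \<or> (P = proj_point (v2 1 0) \<and> coeff q d = 0)"
    proof (cases "y = 0")
      case True
      then have "P = proj_point (v2 1 0)" using v xy by (simp add: proj_line_eq_iff)
      moreover have "?F (v2 1 0) = 0" using v xy True bform_homog[OF bF, of x "v2 1 0"] by simp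
      ultimately show ?thesis using F10 by simp
    next
      case False
      then have "P = proj_point (v2 (x / y) 1)" using v xy by (simp add: proj_line_eq_iff)
      moreover have "?F (v2 (x / y) 1) = 0" using v xy False bform_homog[OF bF, of y "v2 (x / y) 1"] by simp
      ultimately show ?thesis unfolding R_def using qx by auto
    qed
  next
    assume "P \<in> R \<or> (P = proj_point (v2 1 0) \<and> coeff q d = 0)"
    then show "P \<in> zeros ?F"
      using F10 qx by (auto simp: R_def zeros_v2[OF bF])
  qed
  show "card (zeros ?F) = d"
  proof (cases "coeff q d = 0")
    case True
    then have "degree q \<noteq> d" using q0 leading_coeff_0_iff by metis
    moreover have "d - 1 \<le> degree q" using inf[OF True] by (rule le_degree)
    ultimately have "degree q = d - 1" using deg by linarith
    moreover have "zeros ?F = insert (proj_point (v2 1 0)) R" using z True by auto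
    ultimately show ?thesis using cR fR nR d by simp
  next
    case False
    then have "degree q = d" using deg le_degree by (metis le_antisym)
    moreover have "zeros ?F = R" using z False by auto
    ultimately show ?thesis using cR by simp
  qed
qed

section \<open>Automorphisms as block matrices\<close>

definition blk :: "'a::zero^2^2 \<Rightarrow> 'a \<Rightarrow> 'a^3^3" where
  "blk M w = vector [vector [M$1$1, M$1$2, 0], vector [M$2$1, M$2$2, 0], vector [0, 0, w]]"

lemma blk_nth [simp]: "blk M w $ 1 $ 1 = M$1$1" "blk M w $ 1 $ 2 = M$1$2" "blk M w $ 1 $ 3 = 0"
  "blk M w $ 2 $ 1 = M$2$1" "blk M w $ 2 $ 2 = M$2$2" "blk M w $ 2 $ 3 = 0"
  "blk M w $ 3 $ 1 = 0" "blk M w $ 3 $ 2 = 0" "blk M w $ 3 $ 3 = w"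
  by (simp_all add: blk_def)

lemma blk_mult: "blk M w ** blk N u = blk (M ** N) (w * (u::'a::comm_ring_1))"
  by (simp add: vec_eq_iff forall_3 matrix_matrix_mult_def sum_3 sum_2)

lemma blk_scale: "mat c ** blk M w = blk (mat c ** M) (c * (w::'a::comm_ring_1))"
  by (simp add: vec_eq_iff forall_3 mat_mult_nth)

lemma blk_eq: "blk M w = blk N u \<longleftrightarrow> M = N \<and> w = (u::'a::zero)"
  by (auto simp: vec_eq_iff forall_3 forall_2)

lemma blk_vec: "blk M w *v v = v3 ((M *v v2 (v$1) (v$2))$1) ((M *v v2 (v$1) (v$2))$2) (w * (v$3::'a::comm_ring_1))"
  by (simp add: vec_eq_iff forall_3 matrix_vector_mult_def sum_3 sum_2)

lemma invertible_blk: "invertible (blk M w) \<longleftrightarrow> invertible M \<and> w \<noteq> (0::'a::field)"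
proof -
  have "det (blk M w) = det M * w" by (simp add: det_3 det_2 algebra_simps)
  then show ?thesis by (simp add: invertible_det_nz)
qed

lemma blk_class_eq:
  fixes M N :: "'a::field^2^2"
  shows "pgl_class (blk M 1) = pgl_class (blk N 1) \<longleftrightarrow> M = N"
  unfolding pgl_class_eq_iff blk_scale by (auto simp: blk_eq matrix_mul_lid)

lemma blk_class: "w \<noteq> 0 \<Longrightarrow> pgl_class (blk M w) = pgl_class (blk (mat (inverse w) ** M) (1::'a::field))"
  using pgl_class_scale[of "inverse w" "blk M w"] by (simp add: blk_scale)

lemma blk_form:
  fixes L L' :: "(3, 'a::field) mpoly"
  assumes "binary_form d L'"
  shows "mp_eval (pZ ^ d + L') (blk M w *v v) = (w * v$3) ^ d + bfun L' (M *v v2 (v$1) (v$2))"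
proof -
  obtain x y where "M *v v2 (v$1) (v$2) = v2 x y" by (rule v2_cases)
  then show ?thesis by (simp add: curve_form_eval[OF assms] blk_vec)
qed

abbreviation (input) eZ :: "'a::zero_neq_one^3" where "eZ \<equiv> vector [0, 0, 1]"

lemma eZ_v3: "eZ = v3 0 0 1"
  by (simp add: v3_def)

text \<open>Fixing (0:0:1) clears the last column above the corner. For the last row fix
  \<open>x\<close>, \<open>y\<close> and compare polynomials in \<open>z\<close>:
  \<open>(l + w z)^d\<close> and \<open>c z^d\<close> differ by a constant, so their derivatives
  agree, and at \<open>z = - l / w\<close> this gives \<open>l = 0\<close>. Here
  \<open>d \<ge> 2\<close> enters.\<close>

lemma block_structure:
  fixes L L' :: "(3, 'a::{alg_closed_field, field_char_0}) mpoly"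
  assumes L: "binary_form d L" and L': "binary_form d L'" and d: "d \<ge> 2" and A: "invertible A" and c: "c \<noteq> 0"
    and ev: "\<And>v. mp_eval (pZ ^ d + L') (A *v v) = c * mp_eval (pZ ^ d + L) v"
    and fx: "pgl_act (pgl_class A) (proj_point eZ) = proj_point eZ"
  obtains M w where "A = blk M w" "invertible M" "w \<noteq> 0" "\<And>u. bfun L' (M *v u) = w ^ d * bfun L u"
proof -
  obtain k where k: "k \<noteq> 0" "eZ = k *s (A *v eZ)" using fx unfolding pgl_act_point proj_point_eq_iff by blast
  have Ae: "A *v eZ = v3 (A$1$3) (A$2$3) (A$3$3)"
    by (simp add: vec_eq_iff forall_3 matrix_vector_mult_def sum_3 eZ_v3)
  have A3: "A$1$3 = 0" "A$2$3 = 0" "A$3$3 \<noteq> 0"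
    using k unfolding Ae unfolding eZ_v3 by (auto simp: vec_eq_iff forall_3)
  define M where "M = m2 (A$1$1) (A$1$2) (A$2$1) (A$2$2)"
  define w where "w = A$3$3"
  have w: "w \<noteq> 0" using A3 by (simp add: w_def)
  have Av: "A *v v3 x y z = v3 ((M *v v2 x y)$1) ((M *v v2 x y)$2) (A$3$1 * x + A$3$2 * y + w * z)" for x y z
    by (simp add: vec_eq_iff forall_3 matrix_vector_mult_def sum_3 sum_2 M_def w_def A3)
  have id: "(A$3$1 * x + A$3$2 * y + w * z) ^ d + bfun L' (M *v v2 x y) = c * (z ^ d + bfun L (v2 x y))" for x y z
  proof -
    obtain p q where pq: "M *v v2 x y = v2 p q" by (rule v2_cases)
    show ?thesis using ev[of "v3 x y z"] by (simp add: Av pq curve_form_eval[OF L] curve_form_eval[OF L'])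
  qed
  have l0: "A$3$1 * x + A$3$2 * y = 0" for x y
  proof -
    define l where "l = A$3$1 * x + A$3$2 * y"
    define p where "p = [:l, w:] ^ d + [:bfun L' (M *v v2 x y):] - smult c (monom 1 d + [:bfun L (v2 x y):])"
    have "poly p z = 0" for z using id[of x y z] by (simp add: p_def l_def poly_monom algebra_simps)
    then have "p = 0" using poly_all_0_iff_0 by blast
    then have "pderiv p = 0" by simp
    moreover obtain n where n: "d = Suc (Suc n)" using d by (metis Suc_le_D numeral_2_eq_2 Suc_le_mono)
    moreover have "pderiv p = smult (of_nat d) ([:l, w:] ^ (d - 1)) * [:w:] - smult c (monom (of_nat d) (d - 1))"
      unfolding p_def n by (simp only: pderiv_add pderiv_diff pderiv_power_Suc pderiv_smult pderiv_monom)
        (simp add: pderiv_pCons)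
    ultimately have "poly (smult (of_nat d) ([:l, w:] ^ (d - 1)) * [:w:] - smult c (monom (of_nat d) (d - 1))) (- l / w) = 0" by simp
    then have "c * (of_nat d * (- l / w) ^ (d - 1)) = 0" using w n by (simp add: poly_monom)
    then have "(- l / w) ^ (d - 1) = 0" using c n by (simp del: of_nat_Suc)
    then have "l = 0" using w by simp
    then show ?thesis by (simp add: l_def)
  qed
  have A31: "A$3$1 = 0" "A$3$2 = 0" using l0[of 1 0] l0[of 0 1] by auto
  have Ab: "A = blk M w" by (simp add: vec_eq_iff forall_3 M_def w_def A3 A31)
  have cw: "c = w ^ d" using id[of 0 0 1] id[of 0 0 0] A31 d by (simp add: power_0_left algebra_simps)
  show thesis
  proof (rule that[OF Ab])
    show "invertible M" "w \<noteq> 0" using A w unfolding Ab by (simp_all add: invertible_blk)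
    fix u :: "'a^2"
    obtain x y where u: "u = v2 x y" by (rule v2_cases)
    show "bfun L' (M *v u) = w ^ d * bfun L u" using id[of x y 0] A31 d cw by (simp add: u power_0_left)
  qed
qed

text \<open>A block class in PGL_3 has exactly one representative with corner entry 1. For an
  automorphism of the curve the 2 by 2 block of this representative preserves the binary form
  strictly, so the automorphism group is a subgroup of GL_2 and no quotient is involved.\<close>

definition Gam :: "('a::field^2 \<Rightarrow> 'a) \<Rightarrow> ('a^2^2) set" where
  "Gam F = {M. invertible M \<and> (\<forall>u. F (M *v u) = F u)}"

lemma Aut_carrier:
  fixes L :: "(3, 'a::{alg_closed_field, field_char_0}) mpoly"
  assumes L: "binary_form d L" and d: "d \<ge> 2" and nz: "bfun L w \<noteq> 0"
    and gal: "outer_galois_points (pZ ^ d + L) = {proj_point eZ}"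
  shows "carrier (Aut (pZ ^ d + L)) = (\<lambda>M. pgl_class (blk M 1)) ` Gam (bfun L)"
proof (intro equalityI subsetI)
  let ?f = "pZ ^ d + L"
  note hf = curve_form_homogeneous[OF L]
  fix Q assume "Q \<in> carrier (Aut ?f)"
  then obtain A where A: "Q = pgl_class A" "invertible A" "pgl_act (pgl_class A) ` plane_curve ?f = plane_curve ?f"
    by (auto simp: Aut_def PGL_carrier)
  obtain c where c: "c \<noteq> 0" "\<And>v. mp_eval ?f (A *v v) = c * mp_eval ?f v"
    using curve_map_forms[OF L L _ nz A(2,3)] d by auto
  have "pgl_act (pgl_class A) (proj_point eZ) \<in> outer_galois_points ?f"
    by (rule outer_galois_curve_map[OF L L A(2) c]) (simp add: gal)
  then have fx: "pgl_act (pgl_class A) (proj_point eZ) = proj_point eZ" by (simp add: gal)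
  obtain M w where M: "A = blk M w" "invertible M" "w \<noteq> 0" "\<And>u. bfun L (M *v u) = w ^ d * bfun L u"
    using block_structure[OF L L d A(2) c fx] by metis
  let ?N = "mat (inverse w) ** M"
  have "bfun L (?N *v u) = bfun L u" for u
    using M(3,4) bform_homog[OF bform_bfun[OF L]] by (simp add: mat_mult_vec field_simps)
  moreover have "invertible ?N" using M(2,3) by (simp add: invertible_mult invertible_mat)
  ultimately have "?N \<in> Gam (bfun L)" by (simp add: Gam_def)
  moreover have "Q = pgl_class (blk ?N 1)" unfolding A(1) M(1) by (rule blk_class[OF M(3)])
  ultimately show "Q \<in> (\<lambda>M. pgl_class (blk M 1)) ` Gam (bfun L)" by blast
next
  let ?f = "pZ ^ d + L"
  fix Q assume "Q \<in> (\<lambda>M. pgl_class (blk M 1)) ` Gam (bfun L)"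
  then obtain M where M: "Q = pgl_class (blk M 1)" "invertible M" "\<And>u. bfun L (M *v u) = bfun L u"
    by (auto simp: Gam_def)
  have inv: "invertible (blk M 1)" using M by (simp add: invertible_blk)
  have "pgl_act (pgl_class (blk M 1)) ` plane_curve ?f = plane_curve ?f"
  proof (rule forms_map_curve[OF curve_form_homogeneous[OF L] curve_form_homogeneous[OF L] inv, of 1])
    show "mp_eval ?f (blk M 1 *v v) = 1 * mp_eval ?f v" for v
      unfolding blk_form[OF L] by (simp add: M curve_form_eval[OF L])
  qed simp
  then show "Q \<in> carrier (Aut ?f)" using inv by (auto simp: Aut_def PGL_carrier M(1))
qed

lemma Aut_iso:
  fixes L :: "(3, 'a::{alg_closed_field, field_char_0}) mpoly"
  assumes "carrier (Aut f) = (\<lambda>M. pgl_class (blk M 1)) ` Gam F"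
  shows "(\<lambda>M. pgl_class (blk M 1)) \<in> iso (GL\<lparr>carrier := Gam F\<rparr>) (Aut f)"
proof -
  have "inj_on (\<lambda>M. pgl_class (blk M 1)) (Gam F)" by (rule inj_onI) (simp add: blk_class_eq)
  moreover have "(\<lambda>M. pgl_class (blk M 1)) \<in> hom (GL\<lparr>carrier := Gam F\<rparr>) (Aut f)"
    using assms by (intro homI) (auto simp: Aut_def GL_simps Gam_def PGL_mult invertible_blk blk_mult)
  ultimately show ?thesis using assms by (simp add: iso_def bij_betw_def)
qed

lemma Lambda_blk:
  fixes M :: "'a::field^2^2" assumes "invertible M"
  shows "Lambda (pgl_class (blk M 1)) = pgl_class M"
proof -
  have ul: "upper_left_block (blk N u) = N" for N :: "'a^2^2" and u
    by (simp add: upper_left_block_def vec_eq_iff forall_2)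
  have "pgl_class (blk M 1) \<in> PBD21" unfolding PBD21_def
    using assms by (auto intro!: exI[of _ "blk M 1"] simp: invertible_blk)
  then have "Lambda (pgl_class (blk M 1)) = upper_left_block ` pgl_class (blk M 1)" by (simp add: Lambda_def)
  also have "\<dots> = pgl_class M"
    unfolding pgl_class_alt blk_scale by (auto simp: ul image_iff) (metis ul)
  finally show ?thesis .
qed

text \<open>A multiplier is removed by rescaling with a \<open>d\<close>-th root of its inverse,
  which exists in an algebraically closed field.\<close>

lemma Gam_stab:
  fixes F :: "'a::alg_closed_field^2 \<Rightarrow> 'a"
  assumes F: "bform d F" and d: "d > 0"
  shows "pgl_class ` Gam F = stab F"
proof (intro equalityI subsetI)
  fix Q assume "Q \<in> pgl_class ` Gam F"
  then obtain M where "Q = pgl_class M" "invertible M" "\<And>u. F (M *v u) = F u" by (auto simp: Gam_def)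
  then show "Q \<in> stab F" unfolding stab_def mem_Collect_eq
    by (intro exI[of _ M]) (simp add: exI[of _ "1::'a"])
next
  fix Q assume "Q \<in> stab F"
  then obtain M c where M: "Q = pgl_class M" "invertible M" "c \<noteq> 0" "\<And>v. F (M *v v) = c * F v" by (auto simp: stab_def)
  obtain r where r: "r ^ d = inverse c" using nth_root_exists[OF d, of "inverse c"] by auto
  have r0: "r \<noteq> 0" using r M(3) d by (auto simp: power_0_left)
  have "F ((mat r ** M) *v v) = F v" for v
    using M(3,4) r bform_homog[OF F] by (simp add: mat_mult_vec)
  then have "mat r ** M \<in> Gam F" using r0 M by (simp add: Gam_def invertible_mult invertible_mat)
  moreover have "Q = pgl_class (mat r ** M)" using pgl_class_scale[OF r0, of M] M(1) by simp
  ultimately show "Q \<in> pgl_class ` Gam F" by blast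
qed

lemma Aut_red_eq:
  fixes L :: "(3, 'a::{alg_closed_field, field_char_0}) mpoly"
  assumes L: "binary_form d L" and d: "d \<ge> 2" and nz: "bfun L w \<noteq> 0"
    and gal: "outer_galois_points (pZ ^ d + L) = {proj_point eZ}"
  shows "Aut_red (pZ ^ d + L) = PGL\<lparr>carrier := stab (bfun L)\<rparr>"
proof -
  have "Lambda ` carrier (Aut (pZ ^ d + L)) = pgl_class ` Gam (bfun L)"
    unfolding Aut_carrier[OF assms] image_image by (rule image_cong) (auto simp: Gam_def Lambda_blk)
  also have "\<dots> = stab (bfun L)" using d by (intro Gam_stab[OF bform_bfun[OF L]]) simp
  finally show ?thesis by (simp add: Aut_red_def)
qed

section \<open>Central products of the binary icosahedral group with cyclic groups\<close>

lemma group_hom_eq_iff: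
  assumes "group G" "group H" "h \<in> hom G H" "x \<in> carrier G" "y \<in> carrier G"
  shows "h x = h y \<longleftrightarrow> x \<otimes>\<^bsub>G\<^esub> inv\<^bsub>G\<^esub> y \<in> kernel G H h"
proof -
  interpret h: group_hom G H h using assms by (simp add: group_hom_def group_hom_axioms_def)
  have "h (x \<otimes>\<^bsub>G\<^esub> inv\<^bsub>G\<^esub> y) = h x \<otimes>\<^bsub>H\<^esub> inv\<^bsub>H\<^esub> h y" using assms by simp
  then have "x \<otimes>\<^bsub>G\<^esub> inv\<^bsub>G\<^esub> y \<in> kernel G H h \<longleftrightarrow> h x \<otimes>\<^bsub>H\<^esub> inv\<^bsub>H\<^esub> h y = \<one>\<^bsub>H\<^esub>"
    using assms by (simp add: kernel_def)
  also have "\<dots> \<longleftrightarrow> h x = h y"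
    using assms h.H.inv_solve_right[of "\<one>\<^bsub>H\<^esub>" "h x" "h y"] by (metis h.H.inv_solve_right h.H.l_one h.H.one_closed h.hom_closed)
  finally show ?thesis by simp
qed

text \<open>Failure to split refers to a particular projection; a section of the transported
  projection is therefore carried back to the original group.\<close>

lemma group_extension_iso:
  assumes ext: "group_extension E N Q \<iota> \<pi>" and h: "h \<in> iso E E'" and E': "group E'"
  shows "group_extension E' N Q (h \<circ> \<iota>) (\<pi> \<circ> inv_into (carrier E) h)"
    and "central_map E N \<iota> \<Longrightarrow> central_map E' N (h \<circ> \<iota>)"
    and "has_section E' Q (\<pi> \<circ> inv_into (carrier E) h) \<Longrightarrow> has_section E Q \<pi>"
proof -
  have E: "group E" and \<iota>: "\<iota> \<in> mon N E" and \<pi>: "\<pi> \<in> epi E Q" and ker: "kernel E Q \<pi> = \<iota> ` carrier N"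
    and NQ: "group N" "group Q"
    using ext by (auto simp: group_extension_def)
  let ?g = "inv_into (carrier E) h"
  have g: "?g \<in> iso E' E" by (rule group.iso_set_sym[OF E h])
  have bij: "bij_betw h (carrier E) (carrier E')" using h by (simp add: iso_def)
  have gh: "?g (h x) = x" if "x \<in> carrier E" for x using bij that by (auto simp: bij_betw_def)
  have hg: "h (?g x) = x" if "x \<in> carrier E'" for x using bij that by (auto simp: bij_betw_def f_inv_into_f)
  have hc: "h x \<in> carrier E'" if "x \<in> carrier E" for x using bij that by (auto simp: bij_betw_def)
  have gc: "?g x \<in> carrier E" if "x \<in> carrier E'" for x using bij that by (auto simp: bij_betw_def inv_into_into)
  have hm: "h (x \<otimes>\<^bsub>E\<^esub> y) = h x \<otimes>\<^bsub>E'\<^esub> h y" if "x \<in> carrier E" "y \<in> carrier E" for x y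
    using h that by (auto simp: iso_def hom_def)
  have \<iota>c: "\<iota> n \<in> carrier E" if "n \<in> carrier N" for n using \<iota> that by (auto simp: mon_def hom_def)
  have "h \<circ> \<iota> \<in> mon N E'" using mon_compose[OF \<iota>, of h E'] h iso_iff_mon_epi by auto
  moreover have "\<pi> \<circ> ?g \<in> epi E' Q" using epi_compose[OF _ \<pi>, of ?g E'] g iso_iff_mon_epi by auto
  moreover have "kernel E' Q (\<pi> \<circ> ?g) = (h \<circ> \<iota>) ` carrier N"
  proof (intro equalityI subsetI)
    fix x assume x: "x \<in> kernel E' Q (\<pi> \<circ> ?g)"
    then have "?g x \<in> kernel E Q \<pi>" using gc by (auto simp: kernel_def)
    then obtain n where "n \<in> carrier N" "?g x = \<iota> n" using ker by auto
    moreover have "x = h (?g x)" using hg x by (simp add: kernel_def)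
    ultimately show "x \<in> (h \<circ> \<iota>) ` carrier N" by auto
  next
    fix x assume "x \<in> (h \<circ> \<iota>) ` carrier N"
    then obtain n where n: "n \<in> carrier N" "x = h (\<iota> n)" by auto
    then have "\<iota> n \<in> kernel E Q \<pi>" using ker by auto
    then show "x \<in> kernel E' Q (\<pi> \<circ> ?g)" using n \<iota>c hc gh by (simp add: kernel_def)
  qed
  ultimately show "group_extension E' N Q (h \<circ> \<iota>) (\<pi> \<circ> ?g)" using NQ E' by (simp add: group_extension_def)
  show "central_map E' N (h \<circ> \<iota>)" if c: "central_map E N \<iota>"
    unfolding central_map_def
  proof (intro ballI)
    fix n x assume n: "n \<in> carrier N" and x: "x \<in> carrier E'"
    have "\<iota> n \<otimes>\<^bsub>E\<^esub> ?g x = ?g x \<otimes>\<^bsub>E\<^esub> \<iota> n" using c n gc[OF x] by (auto simp: central_map_def)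
    then have "h (\<iota> n \<otimes>\<^bsub>E\<^esub> ?g x) = h (?g x \<otimes>\<^bsub>E\<^esub> \<iota> n)" by simp
    then show "(h \<circ> \<iota>) n \<otimes>\<^bsub>E'\<^esub> x = x \<otimes>\<^bsub>E'\<^esub> (h \<circ> \<iota>) n" using hm \<iota>c[OF n] gc[OF x] hg[OF x] by simp
  qed
  show "has_section E Q \<pi>" if s: "has_section E' Q (\<pi> \<circ> ?g)"
  proof -
    obtain s where s: "s \<in> hom Q E'" "\<And>q. q \<in> carrier Q \<Longrightarrow> \<pi> (?g (s q)) = q"
      using s by (auto simp: has_section_def)
    have "?g \<circ> s \<in> hom Q E" using s(1) g by (auto simp: iso_def intro: hom_compose)
    then show ?thesis using s(2) unfolding has_section_def by (auto intro!: bexI[of _ "?g \<circ> s"])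
  qed
qed

lemma central_extension_iso:
  assumes "is_central_extension E N Q" "h \<in> iso E E'" "group E'" shows "is_central_extension E' N Q"
  using assms group_extension_iso[OF _ assms(2,3)] unfolding is_central_extension_def by blast

lemma nonsplit_central_extension_iso:
  assumes "is_nonsplit_central_extension E N Q" "h \<in> iso E E'" "group E'" shows "is_nonsplit_central_extension E' N Q"
  using assms group_extension_iso[OF _ assms(2,3)] unfolding is_nonsplit_central_extension_def by blast

lemma nonsplit_extension_iso:
  assumes "is_nonsplit_extension E N Q" "h \<in> iso E E'" "group E'" shows "is_nonsplit_extension E' N Q"
  using assms group_extension_iso[OF _ assms(2,3)] unfolding is_nonsplit_extension_def by blast

text \<open>By the theorem of Cayley and Hamilton, the trace of a counterexample would be a square root of 2
  modulo 5.\<close>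

lemma SL2_F5_fourth_power:
  assumes g: "g \<in> carrier SL2_F5" shows "(g ** g) ** (g ** g) \<noteq> m2 (-1) 0 0 (-1)"
proof
  obtain a b c d where m: "g = m2 a b c d" by (rule m2_cases)
  have det: "a * d - b * c = 1" using g m by (simp add: SL2_carrier)
  define t where "t = a + d"
  define T where "T = t * t - 2"
  \<comment> \<open>Cayley and Hamilton for determinant 1: \<open>g^2 = t g - 1\<close>, and in
    \<open>ch2\<close> the same for the square, \<open>g^4 = T g^2 - 1\<close>, with
    \<open>T\<close> its trace.\<close>
  have ch: "g ** g = m2 (t * a - 1) (t * b) (t * c) (t * d - 1)"
    unfolding m m2_mult t_def det[symmetric] by (simp add: algebra_simps)
  have bc: "b * c = a * d - 1" using det by (simp add: algebra_simps)
  have ch2: "m2 (t * a - 1) (t * b) (t * c) (t * d - 1) ** m2 (t * a - 1) (t * b) (t * c) (t * d - 1) =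
     m2 (T * (t * a - 1) - 1) (T * (t * b)) (T * (t * c)) (T * (t * d - 1) - 1)"
  proof -
    have "(t * a - 1) * (t * a - 1) + t * b * (t * c) = (t * a - 1) * (t * a - 1) + t * t * (b * c)" by (simp add: algebra_simps)
    also have "\<dots> = T * (t * a - 1) - 1" unfolding bc by (simp add: T_def t_def algebra_simps)
    finally have 1: "(t * a - 1) * (t * a - 1) + t * b * (t * c) = T * (t * a - 1) - 1" .
    have "t * c * (t * b) + (t * d - 1) * (t * d - 1) = t * t * (b * c) + (t * d - 1) * (t * d - 1)" by (simp add: algebra_simps)
    also have "\<dots> = T * (t * d - 1) - 1" unfolding bc by (simp add: T_def t_def algebra_simps)
    finally have 2: "t * c * (t * b) + (t * d - 1) * (t * d - 1) = T * (t * d - 1) - 1" .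
    show ?thesis unfolding m2_mult m2_eq 1 2 by (simp add: T_def t_def algebra_simps)
  qed
  assume "(g ** g) ** (g ** g) = m2 (-1) 0 0 (-1)"
  then have "T * (t * a - 1) - 1 = -1" "T * (t * d - 1) - 1 = -1" unfolding ch ch2 m2_eq by blast+
  then have "T * (t * a - 1) = 0" "T * (t * d - 1) = 0" by (metis add_diff_cancel diff_add_cancel uminus_add_conv_diff add.left_neutral)+
  \<comment> \<open>The two diagonal equations add up to \<open>T\<close> times the trace of the
    square, that is \<open>T^2 = 0\<close>.\<close>
  then have "T * (t * a - 1) + T * (t * d - 1) = 0" by simp
  then have "T * T = 0" by (simp add: T_def t_def algebra_simps)
  then have "t * t = 2" by (simp add: mult5_eq_0 T_def)
  moreover have "\<forall>t::5. t * t \<noteq> 2" unfolding forall_5 by simp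
  ultimately show False by blast
qed

text \<open>To be used with \<open>n\<close> the degree of the curve and with \<open>n\<close> its
  2-part. Evenness puts -1 among the powers of \<open>z\<close>.\<close>

locale icosa_ext = icosa +
  fixes z :: 'a and n :: nat
  assumes n: "n > 0" "even n" and z: "primitive_root_of_unity n z"
begin

lemma zn: "z ^ n = 1"
  using z by (simp add: primitive_root_of_unity_def)

lemma z_nz: "z \<noteq> 0"
  using zn n by (auto simp: power_0_left)

lemma z_mod: "z ^ (k mod n) = z ^ k"
proof -
  have "z ^ k = z ^ (n * (k div n) + k mod n)" by simp
  also have "\<dots> = z ^ (k mod n)" by (simp only: power_add power_mult zn power_one mult_1_left)
  finally show ?thesis by simp
qed

lemma z_eq_1: "z ^ k = 1 \<longleftrightarrow> n dvd k"
proof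
  assume "z ^ k = 1"
  then have "z ^ (k mod n) = 1" by (simp add: z_mod)
  moreover have "k mod n < n" using n by simp
  ultimately have "k mod n = 0" using z unfolding primitive_root_of_unity_def by (metis neq0_conv)
  then show "n dvd k" by auto
qed (auto simp: zn power_mult)

lemma z_eq: "z ^ k = z ^ l \<longleftrightarrow> k mod n = l mod n"
proof -
  have "z ^ k = z ^ l \<Longrightarrow> k \<le> l \<Longrightarrow> k mod n = l mod n" for k l
  proof -
    assume e: "z ^ k = z ^ l" and le: "k \<le> l"
    have "z ^ l = z ^ k * z ^ (l - k)" using le by (simp flip: power_add)
    then have "z ^ k * z ^ (l - k) = z ^ k * 1" using e by simp
    then have "z ^ (l - k) = 1" using z_nz by simp
    then show "k mod n = l mod n" using le z_eq_1 by (metis mod_eq_dvd_iff_nat)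
  qed
  then have "z ^ k = z ^ l \<Longrightarrow> k mod n = l mod n" by (metis nle_le)
  moreover have "k mod n = l mod n \<Longrightarrow> z ^ k = z ^ l" by (metis z_mod)
  ultimately show ?thesis by blast
qed

lemma z_half: "z ^ (n div 2) = - 1"
proof -
  have "(z ^ (n div 2)) ^ 2 = 1" using n zn by (simp flip: power_mult)
  then have "z ^ (n div 2) = 1 \<or> z ^ (n div 2) = - 1" by (simp add: power2_eq_1_iff)
  moreover have "z ^ (n div 2) \<noteq> 1"
    using n z_eq_1[of "n div 2"] by (auto dest!: dvd_imp_le)
  ultimately show ?thesis by blast
qed

text \<open>The carrier of \<open>integer_mod_group\<close> consists of the integers from 0 to
  \<open>n - 1\<close>, hence integer exponents.\<close>

definition zp :: "int \<Rightarrow> 'a" where "zp k = z ^ nat k"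

lemma zp_nz: "zp k \<noteq> 0"
  using z_nz by (simp add: zp_def)

lemma zp_0 [simp]: "zp 0 = 1"
  by (simp add: zp_def)

abbreviation "C \<equiv> integer_mod_group n"

lemma C_carrier: "carrier C = {0..<int n}"
  using n by (simp add: carrier_integer_mod_group)

lemma zp_add: "k \<in> carrier C \<Longrightarrow> l \<in> carrier C \<Longrightarrow> zp ((k + l) mod int n) = zp k * zp l"
proof -
  assume "k \<in> carrier C" "l \<in> carrier C"
  then have "nat ((k + l) mod int n) = (nat k + nat l) mod n"
    by (simp add: C_carrier nat_mod_distrib nat_add_distrib)
  then show ?thesis by (simp add: zp_def z_mod power_add)
qed

lemma zp_inj: "k \<in> carrier C \<Longrightarrow> l \<in> carrier C \<Longrightarrow> zp k = zp l \<longleftrightarrow> k = l"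
proof -
  assume k: "k \<in> carrier C" "l \<in> carrier C"
  then have "nat k mod n = nat k" "nat l mod n = nat l" by (auto simp: C_carrier)
  then show ?thesis using k by (auto simp: zp_def z_eq C_carrier)
qed

lemma zp_surj: "\<exists>k\<in>carrier C. z ^ m = zp k"
  using n by (intro bexI[of _ "int (m mod n)"]) (simp_all add: zp_def z_mod C_carrier)

text \<open>The image \<open>EE\<close> of \<open>Th\<close> is the group of products of scalar
  \<open>n\<close>-th roots of unity with the lift of the icosahedral group.\<close>

definition Th :: "int \<times> (5^2^2) \<Rightarrow> 'a^2^2" where "Th = (\<lambda>(k, g). mat (zp k) ** rep g)"
definition EE :: "('a^2^2) monoid" where "EE = GL\<lparr>carrier := Th ` (carrier C \<times> carrier SL2_F5)\<rparr>"

lemma scalar_mult: "(mat a ** M) ** (mat b ** N) = mat (a * b) ** (M ** (N :: 'a^2^2))"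
proof -
  have "(mat a ** M) ** (mat b ** N) = mat a ** (M ** mat b) ** N" by (simp add: matrix_mul_assoc)
  also have "\<dots> = mat a ** (mat b ** M) ** N" by (simp add: mat_commute)
  finally show ?thesis by (simp add: matrix_mul_assoc mat_mult_mat)
qed

lemma Th_hom: "Th \<in> hom (C \<times>\<times> SL2_F5) GL"
proof (rule homI)
  fix x y assume "x \<in> carrier (C \<times>\<times> SL2_F5)" "y \<in> carrier (C \<times>\<times> SL2_F5)"
  then show "Th (x \<otimes>\<^bsub>C \<times>\<times> SL2_F5\<^esub> y) = Th x \<otimes>\<^bsub>GL\<^esub> Th y"
    by (cases x; cases y) (simp add: Th_def GL_simps scalar_mult SL2_mult rep_mult zp_add)
next
  fix x assume "x \<in> carrier (C \<times>\<times> SL2_F5)"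
  then show "Th x \<in> carrier GL"
    by (cases x) (auto simp: Th_def GL_simps zp_nz intro!: invertible_mult invertible_mat rep_invertible)
qed

lemma CS_group: "group (C \<times>\<times> SL2_F5)"
  by (intro DirProd_group group_integer_mod_group SL2_group)

lemma EE_subgroup: "subgroup (carrier EE) GL"
proof -
  interpret t: group_hom "C \<times>\<times> SL2_F5" GL Th
    using CS_group GL_group Th_hom by (simp add: group_hom_def group_hom_axioms_def)
  show ?thesis using t.img_is_subgroup by (simp add: EE_def)
qed

lemma EE_group: "group EE"
  using subgroup.subgroup_is_group[OF EE_subgroup GL_group] by (simp add: EE_def)

lemma EE_simps: "monoid.mult EE = (**)" "one EE = mat 1" "carrier EE = Th ` (carrier C \<times> carrier SL2_F5)"
  by (simp_all add: EE_def GL_simps)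

lemma EE_cases: assumes "M \<in> carrier EE"
  obtains k g where "k \<in> carrier C" "g \<in> carrier SL2_F5" "M = mat (zp k) ** rep g"
  using assms by (auto simp: EE_simps Th_def)

lemma EE_I: "g \<in> carrier SL2_F5 \<Longrightarrow> mat (z ^ m) ** rep g \<in> carrier EE"
  using zp_surj[of m] by (auto simp: EE_simps Th_def intro!: image_eqI)

lemma EE_I1: "g \<in> carrier SL2_F5 \<Longrightarrow> rep g \<in> carrier EE"
  using EE_I[of g 0] by (simp add: matrix_mul_lid)

lemma Th_EE: "Th \<in> hom (C \<times>\<times> SL2_F5) EE"
  unfolding EE_def by (rule hom_restrict_carrier[OF Th_hom]) simp

lemma neg_one: "mat (- 1 :: 5) = m2 (-1) 0 0 (-1)" "mat (1 :: 5) = m2 1 0 0 1"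
  by (simp_all only: mat_m2)

lemma neg_carrier: "m2 (-1) 0 0 (-1) \<in> carrier SL2_F5" "m2 1 0 0 1 \<in> carrier SL2_F5"
  by (simp_all add: SL2_carrier)

lemma half: "int (n div 2) \<in> carrier C" "zp (int (n div 2)) = - 1"
  using n by (auto simp: C_carrier zp_def z_half intro!: div_less_dividend)

text \<open>Scalars and lift meet in 1 and -1 only, by \<open>rep_scalar\<close>, and -1 is the
  power \<open>z^(n/2)\<close>.\<close>

lemma Th_kernel: "kernel (C \<times>\<times> SL2_F5) EE Th = {(0, mat 1), (int (n div 2), mat (-1))}"
proof (intro equalityI subsetI)
  fix x assume x: "x \<in> kernel (C \<times>\<times> SL2_F5) EE Th"
  obtain k g where kg: "x = (k, g)" by (cases x)
  have k: "k \<in> carrier C" and g: "g \<in> carrier SL2_F5" and e: "mat (zp k) ** rep g = mat 1"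
    using x by (auto simp: kg kernel_def Th_def EE_simps)
  have "rep g = mat (inverse (zp k)) ** (mat (zp k) ** rep g)"
    using zp_nz by (simp add: matrix_mul_assoc mat_mult_mat matrix_mul_lid)
  then have "rep g = mat (inverse (zp k))" unfolding e by (simp only: matrix_mul_rid)
  then have "g = m2 1 0 0 1 \<or> g = m2 (-1) 0 0 (-1)" by (rule rep_scalar[OF g])
  then show "x \<in> {(0, mat 1), (int (n div 2), mat (-1))}"
  proof
    assume g1: "g = m2 1 0 0 1"
    then have "mat (zp k) = (mat 1 :: 'a^2^2)" using e by (simp only: rep_one matrix_mul_rid)
    then have "zp k = zp 0" by (simp add: mat_m2)
    then have "k = 0" using zp_inj[OF k, of 0] n by (simp add: C_carrier)
    then show ?thesis using kg g1 neg_one by simp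
  next
    assume g1: "g = m2 (-1) 0 0 (-1)"
    then have "mat (zp k * - 1) = (mat 1 :: 'a^2^2)" using e by (simp only: rep_minus mat_mult_mat)
    then have "zp k = - 1" by (simp add: mat_m2 eq_neg_iff_add_eq_0 add_eq_0_iff minus_equation_iff)
    then have "zp k = zp (int (n div 2))" by (simp only: half)
    then have "k = int (n div 2)" using zp_inj[OF k half(1)] by simp
    then show ?thesis using kg g1 neg_one by (simp only:) simp
  qed
next
  fix x :: "int \<times> (5^2^2)" assume x: "x \<in> {(0, mat 1), (int (n div 2), mat (-1))}"
  have "Th (0, m2 1 0 0 1) = mat 1" by (simp only: Th_def prod.case zp_0 rep_one matrix_mul_lid)
  moreover have "Th (int (n div 2), m2 (-1) 0 0 (-1)) = mat 1"
    by (simp only: Th_def prod.case half rep_minus mat_mult_mat) simp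
  moreover have "(0, m2 1 0 0 1) \<in> carrier (C \<times>\<times> SL2_F5)" "(int (n div 2), m2 (-1) 0 0 (-1)) \<in> carrier (C \<times>\<times> SL2_F5)"
    using half(1) by (simp_all add: SL2_carrier)
  ultimately show "x \<in> kernel (C \<times>\<times> SL2_F5) EE Th"
    using x unfolding neg_one kernel_def EE_simps(2) by blast
qed

lemma cl_alt: "g \<in> carrier SL2_F5 \<Longrightarrow> h \<in> carrier SL2_F5 \<Longrightarrow> cl g = cl h \<longleftrightarrow> alt.hom2 g = alt.hom2 h"
  using group_hom_eq_iff[OF SL2_group PGL_group cl_hom] group_hom_eq_iff[OF SL2_group alt_group_is_group alt.hom2_hom]
  by (simp only: cl_kernel alt_kernel)

text \<open>The factorisation of an element as a scalar times \<open>rep g\<close> is unique up to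
  the sign of \<open>g\<close>, which \<open>alt.hom2\<close> does not see; \<open>pr_eq\<close>
  shows that the choice has no influence.\<close>

definition pr :: "'a^2^2 \<Rightarrow> nat \<Rightarrow> nat" where
  "pr M = alt.hom2 (SOME g. g \<in> carrier SL2_F5 \<and> (\<exists>c. M = mat c ** rep g))"

lemma pr_eq:
  assumes g: "g \<in> carrier SL2_F5" and c: "c \<noteq> 0"
  shows "pr (mat c ** rep g) = alt.hom2 g"
proof -
  define h where "h = (SOME h. h \<in> carrier SL2_F5 \<and> (\<exists>d. mat c ** rep g = mat d ** rep h))"
  have "h \<in> carrier SL2_F5 \<and> (\<exists>d. mat c ** rep g = mat d ** rep h)"
    unfolding h_def by (rule someI[of _ g]) (use g in auto)
  then obtain d where h: "h \<in> carrier SL2_F5" and d: "mat c ** rep g = mat d ** rep h" by auto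
  have "d \<noteq> 0"
  proof
    assume "d = 0"
    then have "mat c ** rep g = 0" using d by (simp add: vec_eq_iff mat_mult_nth)
    then have "rep g = 0" using c by (simp add: vec_eq_iff mat_mult_nth)
    then have "rep g *v axis 1 1 = 0" by (simp only: matrix_vector_mult_0)
    then show False using invertible_vec_nz[OF rep_invertible, of "axis 1 1" g] by (simp add: axis_eq_0_iff)
  qed
  then have "cl g = cl h" using pgl_class_scale[OF c, of "rep g"] pgl_class_scale[of d "rep h"] d by (simp add: cl_def)
  then show ?thesis using cl_alt[OF g h] by (simp add: pr_def h_def)
qed

lemma pr_hom: "pr \<in> hom EE (alt_group 5)"
proof (rule homI)
  fix M assume "M \<in> carrier EE"
  then show "pr M \<in> carrier (alt_group 5)" by (rule EE_cases) (simp add: pr_eq zp_nz)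
next
  fix M N assume "M \<in> carrier EE" "N \<in> carrier EE"
  then obtain k g l h where "k \<in> carrier C" "g \<in> carrier SL2_F5" "M = mat (zp k) ** rep g"
    "l \<in> carrier C" "h \<in> carrier SL2_F5" "N = mat (zp l) ** rep h"
    by (metis EE_cases)
  moreover have "alt.hom2 (g ** h) = alt.hom2 g \<otimes>\<^bsub>alt_group 5\<^esub> alt.hom2 h"
    using alt.hom2_hom calculation by (auto simp: hom_def SL2_mult)
  ultimately show "pr (M \<otimes>\<^bsub>EE\<^esub> N) = pr M \<otimes>\<^bsub>alt_group 5\<^esub> pr N"
    by (simp add: EE_simps scalar_mult zp_nz pr_eq br.SL2_mult_closed flip: rep_mult)
qed

lemma pr_surj: "pr ` carrier EE = carrier (alt_group 5)"
proof
  show "pr ` carrier EE \<subseteq> carrier (alt_group 5)" using pr_hom by (auto simp: hom_def)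
  show "carrier (alt_group 5) \<subseteq> pr ` carrier EE"
  proof
    fix p assume "p \<in> carrier (alt_group 5)"
    then obtain g where g: "g \<in> carrier SL2_F5" "p = alt.hom2 g" using alt_surj by auto
    then have "p = pr (rep g)" using pr_eq[OF g(1), of 1] by (simp add: matrix_mul_lid)
    then show "p \<in> pr ` carrier EE" using EE_I1[OF g(1)] by blast
  qed
qed

definition sc :: "int \<Rightarrow> 'a^2^2" where "sc k = mat (zp k)"

lemma central_ext: "group_extension EE C (alt_group 5) sc pr" "central_map EE C sc"
proof -
  have sc_Th: "sc k = Th (k, m2 1 0 0 1)" for k by (simp only: sc_def Th_def prod.case rep_one matrix_mul_rid)
  have sc_EE: "sc k \<in> carrier EE" if "k \<in> carrier C" for k
    using that neg_carrier unfolding sc_Th EE_simps by blast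
  have "sc \<in> mon C EE" unfolding mon_def
  proof (intro CollectI conjI homI inj_onI)
    fix k l assume "k \<in> carrier C" "l \<in> carrier C"
    then show "sc (k \<otimes>\<^bsub>C\<^esub> l) = sc k \<otimes>\<^bsub>EE\<^esub> sc l" by (simp add: sc_def zp_add EE_simps mat_mult_mat)
    show "sc k = sc l \<Longrightarrow> k = l" using \<open>k \<in> carrier C\<close> \<open>l \<in> carrier C\<close> zp_inj by (simp add: sc_def mat_m2)
  qed (rule sc_EE)
  moreover have "kernel EE (alt_group 5) pr = sc ` carrier C"
  proof (intro equalityI subsetI)
    fix M assume M: "M \<in> kernel EE (alt_group 5) pr"
    then obtain k g where k: "k \<in> carrier C" "g \<in> carrier SL2_F5" "M = mat (zp k) ** rep g"
      by (auto simp: kernel_def elim: EE_cases)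
    then have "alt.hom2 g = \<one>\<^bsub>alt_group 5\<^esub>" using M by (simp add: kernel_def pr_eq zp_nz)
    then have "g \<in> kernel SL2_F5 (alt_group 5) alt.hom2" using k by (simp add: kernel_def)
    then have "g = m2 1 0 0 1 \<or> g = m2 (-1) 0 0 (-1)" unfolding alt_kernel by blast
    then show "M \<in> sc ` carrier C"
    proof
      assume g: "g = m2 1 0 0 1"
      have "M = sc k" unfolding k(3) g by (simp only: rep_one matrix_mul_rid sc_def)
      then show ?thesis using k by blast
    next
      assume g: "g = m2 (-1) 0 0 (-1)"
      have "M = mat (zp k * z ^ (n div 2))" unfolding k(3) g by (simp only: rep_minus mat_mult_mat z_half)
      then have "M = mat (z ^ (nat k + n div 2))" by (simp add: zp_def power_add)
      then show ?thesis using zp_surj[of "nat k + n div 2"] by (auto simp: sc_def)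
    qed
  next
    fix M assume "M \<in> sc ` carrier C"
    then obtain k where k: "k \<in> carrier C" "M = sc k" by auto
    have "pr (mat (zp k) ** rep (m2 1 0 0 1)) = alt.hom2 (m2 1 0 0 1)" by (rule pr_eq[OF neg_carrier(2) zp_nz])
    then have "pr (sc k) = alt.hom2 (m2 1 0 0 1)" by (simp only: rep_one matrix_mul_rid sc_def)
    moreover have "m2 1 0 0 1 \<in> kernel SL2_F5 (alt_group 5) alt.hom2" unfolding alt_kernel by blast
    ultimately show "M \<in> kernel EE (alt_group 5) pr" using k sc_EE by (simp add: kernel_def)
  qed
  ultimately show "group_extension EE C (alt_group 5) sc pr"
    using EE_group alt_group_is_group pr_hom pr_surj by (simp add: group_extension_def epi_def)
  show "central_map EE C sc" unfolding central_map_def by (simp add: EE_simps sc_def mat_commute)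
qed

lemma alt_gens: "alt.hom2 (m2 2 0 0 3) = pT" "alt.hom2 (m2 0 (-1) 1 0) = pW"
  by (simp_all add: alt.hom2_m2 alt.H_def alt_group_mult alt_group_one alt.U_def)

lemma rep_gens: "rep (m2 2 0 0 3) = Tm" "rep (m2 0 (-1) 1 0) = Wm"
  by (simp_all add: rep_m2 br.H_def br.U_def GL_simps GL_pow)

lemma gens_carrier: "m2 2 0 0 3 \<in> carrier SL2_F5" "m2 0 (-1) 1 0 \<in> carrier SL2_F5"
  by (simp_all add: SL2_carrier)

lemma lift:
  assumes M: "M \<in> carrier EE" and e: "pr M = alt.hom2 h" and h: "h \<in> carrier SL2_F5"
  shows "\<exists>c. c \<noteq> 0 \<and> M = mat c ** rep h"
proof -
  obtain k g where k: "k \<in> carrier C" "g \<in> carrier SL2_F5" "M = mat (zp k) ** rep g" using M by (rule EE_cases)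
  then have "alt.hom2 g = alt.hom2 h" using e by (simp add: pr_eq zp_nz)
  then have "cl g = cl h" using cl_alt[OF k(2) h] by simp
  then obtain c where "c \<noteq> 0" "rep g = mat c ** rep h" unfolding cl_def pgl_class_eq_iff by auto
  then show ?thesis using k zp_nz by (auto simp: matrix_mul_assoc mat_mult_mat intro!: exI[of _ "zp k * c"])
qed

text \<open>The two commuting involutions \<open>pT\<close> and \<open>pW\<close> only have anticommuting lifts.\<close>

lemma no_section: "\<not> has_section EE (alt_group 5) pr"
proof
  assume "has_section EE (alt_group 5) pr"
  then obtain s where s: "s \<in> hom (alt_group 5) EE" "\<And>q. q \<in> carrier (alt_group 5) \<Longrightarrow> pr (s q) = q"
    by (auto simp: has_section_def)
  have sc: "s q \<in> carrier EE" if "q \<in> carrier (alt_group 5)" for q using s(1) that by (auto simp: hom_def)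
  obtain c where c: "c \<noteq> 0" "s pT = mat c ** Tm"
    using lift[OF sc[OF pT_alt], of "m2 2 0 0 3"] s(2)[OF pT_alt] alt_gens gens_carrier rep_gens by metis
  obtain d where d: "d \<noteq> 0" "s pW = mat d ** Wm"
    using lift[OF sc[OF pW_alt], of "m2 0 (-1) 1 0"] s(2)[OF pW_alt] alt_gens gens_carrier rep_gens by metis
  have comm: "pT \<circ> pW = pW \<circ> pT" by (rule fun5_eqI; simp add: pT_apply pW_apply)
  have "s (pT \<circ> pW) = s pT ** s pW" "s (pW \<circ> pT) = s pW ** s pT"
    using s(1) pT_alt pW_alt by (auto simp: hom_def alt_group_mult EE_simps)
  then have "mat (c * d) ** (Tm ** Wm) = mat (d * c) ** (Wm ** Tm)" using c d comm by (simp add: scalar_mult)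
  then have "mat (c * d) ** (Tm ** Wm) = mat (c * d) ** (Wm ** Tm)" by (simp add: mult.commute)
  moreover have "Tm ** Wm = mat (-1) ** (Wm ** Tm)"
    using br.TW unfolding GL_simps Zm_def by (metis mat_commute matrix_mul_assoc)
  ultimately have "mat (- (c * d)) ** (Wm ** Tm) = mat (c * d) ** (Wm ** Tm)"
    by (simp add: matrix_mul_assoc mat_mult_mat)
  then have "(mat (- (c * d)) ** (Wm ** Tm)) $ 1 $ 1 = (mat (c * d) ** (Wm ** Tm)) $ 1 $ 1" by simp
  moreover have "(Wm ** Tm) $ 1 $ 1 \<noteq> 0" using nz by (simp add: Wm_def Tm_def m2_mult)
  ultimately have "- (c * d) = c * d" unfolding mat_mult_nth by simp
  then show False using c d by (simp add: neg_equal_iff_equal equal_neg_zero)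
qed

lemma EE_central: "is_central_extension EE (integer_mod_group n) (alt_group 5)"
  using central_ext by (auto simp: is_central_extension_def)

lemma EE_nonsplit_central: "is_nonsplit_central_extension EE (integer_mod_group n) (alt_group 5)"
  using central_ext no_section by (auto simp: is_nonsplit_central_extension_def)

text \<open>The scalars are then 1 and -1, which already belong to the lift.\<close>

lemma EE_2: assumes "n = 2" shows "EE \<cong> SL2_F5"
proof -
  have z1: "z = - 1" using z_half assms by simp
  have "carrier EE = rep ` carrier SL2_F5"
  proof (intro equalityI subsetI)
    fix M assume "M \<in> carrier EE"
    then obtain k g where k: "k \<in> carrier C" "g \<in> carrier SL2_F5" "M = mat (zp k) ** rep g" by (rule EE_cases)
    have "(- 1 :: 'a) ^ nat k = 1 \<or> (- 1 :: 'a) ^ nat k = - 1" by (simp add: minus_one_power_iff)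
    then have "zp k = 1 \<or> zp k = - 1" using z1 zp_def[of k] by metis
    then show "M \<in> rep ` carrier SL2_F5"
    proof
      assume "zp k = 1" then show ?thesis using k by (simp add: matrix_mul_lid)
    next
      assume "zp k = - 1"
      then have "M = rep (m2 (-1) 0 0 (-1) ** g)" using k rep_mult[OF neg_carrier(1) k(2)] rep_minus by simp
      then show ?thesis using br.SL2_mult_closed[OF neg_carrier(1) k(2)] by blast
    qed
  qed (auto intro: EE_I1)
  then have "rep \<in> iso SL2_F5 EE"
    using rep_inj by (auto simp: iso_def bij_betw_def EE_simps SL2_mult rep_mult intro!: homI)
  then show ?thesis using group.iso_sym[OF SL2_group] unfolding is_iso_def by blast
qed

text \<open>The subgroup divided out in the amalgam is the kernel of \<open>Th\<close> with the
  factors interchanged, as \<open>n / 2 = 2^(e - 1)\<close>.\<close>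

lemma EE_amalgam: assumes "n = 2 ^ e" "e > 0" shows "EE \<cong> SL2_F5_amalgam e"
proof -
  let ?S = "SL2_F5 \<times>\<times> C"
  let ?t = "\<lambda>(g, k). Th (k, g)"
  have S: "group ?S" by (intro DirProd_group group_integer_mod_group SL2_group)
  have t: "?t \<in> hom ?S EE"
    using Th_EE by (auto simp: hom_def Pi_iff)
  interpret t: group_hom ?S EE ?t using S EE_group t by (simp add: group_hom_def group_hom_axioms_def)
  have h: "int (n div 2) = 2 ^ (e - 1)" using assms by (cases e) auto
  have ker: "kernel ?S EE ?t = {(mat 1, 0), (mat (-1), 2 ^ (e - 1))}"
  proof -
    have "(g, k) \<in> kernel ?S EE ?t \<longleftrightarrow> (k, g) \<in> kernel (C \<times>\<times> SL2_F5) EE Th" for g k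
      by (auto simp: kernel_def)
    then show ?thesis unfolding Th_kernel h by auto
  qed
  have "(?S Mod kernel ?S EE ?t) \<cong> EE"
  proof (rule t.FactGroup_iso)
    show "?t ` carrier ?S = carrier EE" by (auto simp: EE_simps image_iff) 
  qed
  moreover have "group (?S Mod kernel ?S EE ?t)" by (rule normal.factorgroup_is_group[OF t.normal_kernel])
  ultimately show ?thesis unfolding ker SL2_F5_amalgam_def assms(1)[symmetric] by (simp add: group.iso_sym)
qed

end

lemma mult_scalar: "N ** (mat c ** M) = mat c ** (N ** (M :: 'a::comm_ring_1^'n^'n))"
  by (metis mat_commute matrix_mul_assoc)

text \<open>The map \<open>c\<close> is conjugation by \<open>u\<close> seen through the embedding
  \<open>r\<close>. That it is an automorphism of \<open>N\<close> and its own inverse follows from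
  the conjugation rule, injectivity of \<open>r\<close> and \<open>u u = 1\<close>.\<close>

lemma semidirect_by_involution:
  assumes E: "group E" and N: "group N" and r: "r \<in> hom N E" and inj: "inj_on r (carrier N)"
    and u: "u \<in> carrier E" "u \<otimes>\<^bsub>E\<^esub> u = \<one>\<^bsub>E\<^esub>" "u \<notin> r ` carrier N"
    and c: "\<And>x. x \<in> carrier N \<Longrightarrow> c x \<in> carrier N" "\<And>x. x \<in> carrier N \<Longrightarrow> u \<otimes>\<^bsub>E\<^esub> r x = r (c x) \<otimes>\<^bsub>E\<^esub> u"
    and surj: "\<And>y. y \<in> carrier E \<Longrightarrow> \<exists>x\<in>carrier N. y = r x \<or> y = r x \<otimes>\<^bsub>E\<^esub> u"
  shows "\<exists>\<phi>\<in>hom (integer_mod_group 2) (AutoGroup N). E \<cong> semidirect_product N (integer_mod_group 2) \<phi>"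
proof -
  interpret E: group E by (rule E)
  interpret N: group N by (rule N)
  let ?C = "integer_mod_group 2"
  have C: "carrier ?C = {0, 1}" by (auto simp: carrier_integer_mod_group)
  have rc: "r x \<in> carrier E" if "x \<in> carrier N" for x using r that by (auto simp: hom_def)
  have rm: "r (x \<otimes>\<^bsub>N\<^esub> y) = r x \<otimes>\<^bsub>E\<^esub> r y" if "x \<in> carrier N" "y \<in> carrier N" for x y
    using r that by (auto simp: hom_def)
  have r_iff: "r x = r y \<longleftrightarrow> x = y" if "x \<in> carrier N" "y \<in> carrier N" for x y
    using inj that by (auto simp: inj_on_def)
  have cm: "c (x \<otimes>\<^bsub>N\<^esub> y) = c x \<otimes>\<^bsub>N\<^esub> c y" if xy: "x \<in> carrier N" "y \<in> carrier N" for x y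
  proof -
    have "r (c (x \<otimes>\<^bsub>N\<^esub> y)) \<otimes>\<^bsub>E\<^esub> u = u \<otimes>\<^bsub>E\<^esub> (r x \<otimes>\<^bsub>E\<^esub> r y)" using xy c(2)[of "x \<otimes>\<^bsub>N\<^esub> y"] rm by simp
    also have "\<dots> = r (c x) \<otimes>\<^bsub>E\<^esub> (u \<otimes>\<^bsub>E\<^esub> r y)" using xy c u rc E.m_assoc by (metis (full_types))
    also have "\<dots> = r (c x) \<otimes>\<^bsub>E\<^esub> r (c y) \<otimes>\<^bsub>E\<^esub> u" using xy c u rc by (simp add: E.m_assoc)
    also have "\<dots> = r (c x \<otimes>\<^bsub>N\<^esub> c y) \<otimes>\<^bsub>E\<^esub> u" using xy c rm by simp
    finally show ?thesis using xy c u rc r_iff by simp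
  qed
  have cc: "c (c x) = x" if x: "x \<in> carrier N" for x
  proof -
    have "r (c (c x)) \<otimes>\<^bsub>E\<^esub> u \<otimes>\<^bsub>E\<^esub> u = u \<otimes>\<^bsub>E\<^esub> r (c x) \<otimes>\<^bsub>E\<^esub> u" using x c by simp
    also have "\<dots> = u \<otimes>\<^bsub>E\<^esub> (r (c x) \<otimes>\<^bsub>E\<^esub> u)" using x c(1) u rc by (simp add: E.m_assoc)
    also have "\<dots> = u \<otimes>\<^bsub>E\<^esub> (u \<otimes>\<^bsub>E\<^esub> r x)" using x c(2) by simp
    also have "\<dots> = r x" using x c(1) u rc by (simp flip: E.m_assoc)
    finally have "r (c (c x)) = r x" using x c u rc by (simp add: E.m_assoc)
    then show ?thesis using x c r_iff by simp
  qed
  define \<phi> where "\<phi> k = (\<lambda>x\<in>carrier N. if k = (0::int) then x else c x)" for k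
  have bij: "\<phi> k \<in> Bij (carrier N)" for k
  proof -
    have "bij_betw (\<phi> k) (carrier N) (carrier N)"
      by (rule bij_betwI[of _ _ _ "\<phi> k"]) (auto simp: \<phi>_def c cc)
    then show ?thesis by (simp add: Bij_def \<phi>_def)
  qed
  have auto: "\<phi> k \<in> auto N" for k
    using bij[of k] unfolding auto_def by (auto intro!: homI simp: \<phi>_def c cm)
  have "\<phi> \<in> hom ?C (AutoGroup N)"
  proof (rule homI)
    show "\<phi> k \<in> carrier (AutoGroup N)" for k using auto by (simp add: AutoGroup_def)
    fix k l assume kl: "k \<in> carrier ?C" "l \<in> carrier ?C"
    have "\<phi> ((k + l) mod 2) = compose (carrier N) (\<phi> k) (\<phi> l)"
      using kl by (auto simp: C \<phi>_def compose_def c cc fun_eq_iff)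
    then show "\<phi> (k \<otimes>\<^bsub>?C\<^esub> l) = \<phi> k \<otimes>\<^bsub>AutoGroup N\<^esub> \<phi> l"
      using bij by (simp add: AutoGroup_def BijGroup_def)
  qed
  moreover have "E \<cong> semidirect_product N ?C \<phi>"
  proof -
    let ?S = "semidirect_product N ?C \<phi>"
    define f where "f = (\<lambda>(x, k::int). r x \<otimes>\<^bsub>E\<^esub> (if k = 0 then \<one>\<^bsub>E\<^esub> else u))"
    have Sc: "carrier ?S = carrier N \<times> {0, 1}" by (simp add: semidirect_product_def C)
    have fc: "f p \<in> carrier E" if "p \<in> carrier ?S" for p using that rc u by (auto simp: Sc f_def)
    have fm: "f (p \<otimes>\<^bsub>?S\<^esub> q) = f p \<otimes>\<^bsub>E\<^esub> f q" and pm: "p \<otimes>\<^bsub>?S\<^esub> q \<in> carrier ?S" if pq: "p \<in> carrier ?S" "q \<in> carrier ?S" for p q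
    proof -
      obtain x k y l where e: "p = (x, k)" "q = (y, l)" by (cases p; cases q)
      have x: "x \<in> carrier N" "y \<in> carrier N" and k: "k = 0 \<or> k = 1" "l = 0 \<or> l = 1" using pq by (auto simp: e Sc)
      have sm: "p \<otimes>\<^bsub>?S\<^esub> q = (x \<otimes>\<^bsub>N\<^esub> (if k = 0 then y else c y), (k + l) mod 2)"
        using x by (simp add: e semidirect_product_def \<phi>_def)
      show "p \<otimes>\<^bsub>?S\<^esub> q \<in> carrier ?S" unfolding sm Sc using x c k by auto
      have 1: "r x \<otimes>\<^bsub>E\<^esub> u \<otimes>\<^bsub>E\<^esub> r y = r x \<otimes>\<^bsub>E\<^esub> r (c y) \<otimes>\<^bsub>E\<^esub> u" using x c u rc by (simp add: E.m_assoc)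
      have 2: "r x \<otimes>\<^bsub>E\<^esub> u \<otimes>\<^bsub>E\<^esub> (r y \<otimes>\<^bsub>E\<^esub> u) = r x \<otimes>\<^bsub>E\<^esub> r (c y)"
      proof -
        have "r x \<otimes>\<^bsub>E\<^esub> u \<otimes>\<^bsub>E\<^esub> (r y \<otimes>\<^bsub>E\<^esub> u) = r x \<otimes>\<^bsub>E\<^esub> u \<otimes>\<^bsub>E\<^esub> r y \<otimes>\<^bsub>E\<^esub> u" using x u rc by (simp add: E.m_assoc)
        also have "\<dots> = r x \<otimes>\<^bsub>E\<^esub> r (c y)" unfolding 1 using x c u rc by (simp add: E.m_assoc)
        finally show ?thesis .
      qed
      show "f (p \<otimes>\<^bsub>?S\<^esub> q) = f p \<otimes>\<^bsub>E\<^esub> f q"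
        unfolding sm using x k rc c u 1 2 by (auto simp: e f_def rm E.m_assoc)
    qed
    have finj: "inj_on f (carrier ?S)"
    proof (rule inj_onI)
      fix p q assume pq: "p \<in> carrier ?S" "q \<in> carrier ?S" "f p = f q"
      obtain x k y l where e: "p = (x, k)" "q = (y, l)" by (cases p; cases q)
      have x: "x \<in> carrier N" "y \<in> carrier N" and k: "k = 0 \<or> k = 1" "l = 0 \<or> l = 1" using pq by (auto simp: e Sc)
      have no: "r x \<noteq> r y \<otimes>\<^bsub>E\<^esub> u" if x: "x \<in> carrier N" "y \<in> carrier N" for x y
      proof
        assume "r x = r y \<otimes>\<^bsub>E\<^esub> u"
        then have "r (inv\<^bsub>N\<^esub> y \<otimes>\<^bsub>N\<^esub> x) = r (inv\<^bsub>N\<^esub> y) \<otimes>\<^bsub>E\<^esub> (r y \<otimes>\<^bsub>E\<^esub> u)" using x by (simp add: rm)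
        also have "\<dots> = r (inv\<^bsub>N\<^esub> y \<otimes>\<^bsub>N\<^esub> y) \<otimes>\<^bsub>E\<^esub> u" using x u rc rm[of "inv\<^bsub>N\<^esub> y" y] by (simp add: E.m_assoc)
        also have "\<dots> = u" using x u hom_one[OF r N E] by simp
        finally show False using u(3) x by (metis N.inv_closed N.m_closed imageI)
      qed
      show "p = q" using pq(3) x k no[of x y] no[of y x] rc u r_iff by (auto simp: e f_def)
    qed
    have "f ` carrier ?S = carrier E"
    proof
      show "f ` carrier ?S \<subseteq> carrier E" using fc by blast
      show "carrier E \<subseteq> f ` carrier ?S"
      proof
        fix y assume "y \<in> carrier E"
        then obtain x where x: "x \<in> carrier N" "y = r x \<or> y = r x \<otimes>\<^bsub>E\<^esub> u" using surj by blast
        then have "y = f (x, 0) \<or> y = f (x, 1)" using rc by (simp add: f_def)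
        then show "y \<in> f ` carrier ?S" using x(1) unfolding Sc by blast
      qed
    qed
    then have fb: "bij_betw f (carrier ?S) (carrier E)" using finj by (simp add: bij_betw_def)
    let ?g = "inv_into (carrier ?S) f"
    have gb: "bij_betw ?g (carrier E) (carrier ?S)" by (rule bij_betw_inv_into[OF fb])
    have gc: "?g x \<in> carrier ?S" if "x \<in> carrier E" for x using gb that by (auto simp: bij_betw_def)
    have fg: "f (?g x) = x" if "x \<in> carrier E" for x using fb that by (auto simp: bij_betw_def f_inv_into_f)
    have gf: "?g (f p) = p" if "p \<in> carrier ?S" for p by (rule inv_into_f_f[OF finj that])
    have "?g \<in> hom E ?S"
    proof (rule homI)
      fix x y assume xy: "x \<in> carrier E" "y \<in> carrier E"
      have "?g (x \<otimes>\<^bsub>E\<^esub> y) = ?g (f (?g x \<otimes>\<^bsub>?S\<^esub> ?g y))" by (simp only: fm gc fg xy)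
      then show "?g (x \<otimes>\<^bsub>E\<^esub> y) = ?g x \<otimes>\<^bsub>?S\<^esub> ?g y" using gf[OF pm[OF gc gc]] xy by simp
    qed (rule gc)
    then show ?thesis using gb by (auto simp: is_iso_def iso_def)
  qed
  ultimately show ?thesis by blast
qed

text \<open>All generators have determinant 1. The determinant of a scalar times a lift thus gives
  the square of the scalar.\<close>

lemma (in icosa) det_rep: assumes "g \<in> carrier SL2_F5" shows "det (rep g) = 1"
proof -
  have U: "det (br.U t) = 1" for t
  proof -
    have "\<eta> ^ e5 t * (\<eta> ^ 4) ^ e5 t = (\<eta> ^ 5) ^ e5 t" by (simp flip: power_mult power_add)
    then show ?thesis using eta5 by (simp add: U_eq m2_det)
  qed
  have H: "det (br.H t) = 1" for t using i2 by (simp add: H_eq m2_det power2_eq_square)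
  have "- (\<kappa> * \<kappa>) + \<kappa> * i * \<psi> * (\<kappa> * i * \<psi>) = 1"
    using kap2 psi i2 by Groebner_Basis.algebra
  then have W: "det Wm = 1" by (simp add: Wm_def m2_det)
  obtain a b c d where "g = m2 a b c d" by (rule m2_cases)
  then show ?thesis by (simp add: rep_m2 det_mul U H W)
qed

context icosa_ext
begin

text \<open>The complement is generated by \<open>u = z rep(diag(2, 3))\<close>. Both
  \<open>z^2\<close> and the square of diag(2, 3) are -1, so \<open>u u = 1\<close>, and
  \<open>det u = z^2 = -1\<close> shows that \<open>u\<close> is outside the lift.\<close>

lemma EE_4: assumes n4: "n = 4"
  shows "\<exists>\<phi>\<in>hom (integer_mod_group 2) (AutoGroup SL2_F5). EE \<cong> semidirect_product SL2_F5 (integer_mod_group 2) \<phi>"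
proof -
  define g where "g = m2 (2::5) 0 0 3"
  define h where "h = m2 (3::5) 0 0 2"
  have gc: "g \<in> carrier SL2_F5" "h \<in> carrier SL2_F5" by (simp_all add: g_def h_def SL2_carrier)
  have gg: "g ** g = m2 (-1) 0 0 (-1)" and hg: "h ** g = m2 1 0 0 1" by (simp_all add: g_def h_def m2_mult)
  have zz: "z * z = - 1" using z_half n4 by (simp add: power2_eq_square)
  define u where "u = mat z ** rep g"
  have conj: "u ** rep x = rep (g ** x ** h) ** u" if x: "x \<in> carrier SL2_F5" for x
  proof -
    have "rep (g ** x ** h) ** rep g = rep (g ** x ** (h ** g))"
      using x gc br.SL2_mult_closed by (simp add: rep_mult[symmetric] matrix_mul_assoc)
    also have "\<dots> = rep g ** rep x" using x gc rep_mult by (simp only: hg mat_m2[symmetric] matrix_mul_rid)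
    finally have "mat z ** (rep (g ** x ** h) ** rep g) = mat z ** (rep g ** rep x)" by simp
    then show ?thesis unfolding u_def mult_scalar by (simp add: matrix_mul_assoc)
  qed
  have uu: "u ** u = mat 1"
  proof -
    have "u ** u = mat (z * z) ** rep (g ** g)" unfolding u_def scalar_mult using gc by (simp add: rep_mult)
    then show ?thesis by (simp only: gg zz rep_minus mat_mult_mat) simp
  qed
  have un: "u \<notin> rep ` carrier SL2_F5"
  proof
    assume "u \<in> rep ` carrier SL2_F5"
    then have "det u = 1" using det_rep by auto
    moreover have "det u = z * z" using det_rep[OF gc(1)] by (simp add: u_def det_mul mat_m2 m2_det)
    ultimately show False using zz by simp
  qed
  show ?thesis
  proof (rule semidirect_by_involution[OF EE_group SL2_group _ rep_inj, of u "\<lambda>x. g ** x ** h"])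
    show "rep \<in> hom SL2_F5 EE" by (rule homI) (rule EE_I1, assumption, simp add: EE_simps SL2_mult rep_mult)
    show "u \<in> carrier EE" using EE_I[OF gc(1), of 1] by (simp add: u_def)
    show "u \<otimes>\<^bsub>EE\<^esub> u = \<one>\<^bsub>EE\<^esub>" using uu by (simp add: EE_simps)
    show "u \<notin> rep ` carrier SL2_F5" by (rule un)
    show "g ** x ** h \<in> carrier SL2_F5" if "x \<in> carrier SL2_F5" for x
      using that gc br.SL2_mult_closed by simp
    show "u \<otimes>\<^bsub>EE\<^esub> rep x = rep (g ** x ** h) \<otimes>\<^bsub>EE\<^esub> u" if "x \<in> carrier SL2_F5" for x
      using conj[OF that] by (simp add: EE_simps)
    fix y assume "y \<in> carrier EE"
    then obtain k x where k: "k \<in> carrier C" "x \<in> carrier SL2_F5" "y = mat (zp k) ** rep x" by (rule EE_cases)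
    have "k \<in> {0..<4}" using k(1) n4 unfolding C_carrier by simp
    then have "k = 0 \<or> k = 1 \<or> k = 2 \<or> k = 3" by (simp, presburger)
    \<comment> \<open>Up to a sign, which is absorbed into \<open>x\<close>, the scalar is 1 or
      \<open>z\<close>.\<close>
    then consider "zp k = 1" | "zp k = - 1" | "zp k = z" | "zp k = - z"
      using zz by (auto simp: zp_def power2_eq_square power3_eq_cube)
    then have "\<exists>e\<in>{1, - 1}. zp k = e \<or> zp k = e * z" by cases auto
    then obtain e where e: "e \<in> {1, - 1}" "zp k = e \<or> zp k = e * z" by blast
    have "\<exists>x'\<in>carrier SL2_F5. mat e ** rep x = rep x'"
    proof -
      have "mat (- 1) ** rep x = rep (m2 (-1) 0 0 (-1) ** x)" using rep_mult[OF neg_carrier(1) k(2)] by (simp only: rep_minus)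
      moreover have "mat 1 ** rep x = rep x" by (rule matrix_mul_lid)
      ultimately show ?thesis using e(1) k(2) br.SL2_mult_closed[OF neg_carrier(1) k(2)] by auto
    qed
    then obtain x' where x': "x' \<in> carrier SL2_F5" "mat e ** rep x = rep x'" by blast
    show "\<exists>x\<in>carrier SL2_F5. y = rep x \<or> y = rep x \<otimes>\<^bsub>EE\<^esub> u"
    proof (cases "zp k = e")
      case True then show ?thesis using x' k by auto
    next
      case False
      then have "y = mat (z * e) ** rep x" using e k by (simp add: mult.commute)
      also have "\<dots> = mat z ** rep x'" unfolding mat_mult_mat[symmetric] x'(2)[symmetric] by (rule matrix_mul_assoc[symmetric])
      \<comment> \<open>The trivial factor \<open>h g\<close> is inserted to split off
        \<open>u\<close>.\<close>
      also have "\<dots> = mat z ** rep (x' ** h ** g)" using hg by (simp add: matrix_mul_assoc[symmetric] flip: mat_m2)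
      also have "\<dots> = mat z ** (rep (x' ** h) ** rep g)" using x' gc br.SL2_mult_closed by (simp add: rep_mult)
      also have "\<dots> = rep (x' ** h) ** u" unfolding u_def mult_scalar ..
      finally show ?thesis using br.SL2_mult_closed[OF x'(1) gc(2)] by (auto simp: EE_simps)
    qed
  qed
qed

text \<open>The quotient map of the extension with kernel the binary icosahedral group is read off the
  determinant \<open>z\<^sup>2\<^sup>k\<close>.\<close>

definition qq :: "'a^2^2 \<Rightarrow> int" where
  "qq M = (THE k. k \<in> {0..<int (n div 2)} \<and> z ^ (2 * nat k) = det M)"

lemma qq_eq:
  assumes k: "k \<in> carrier C" and g: "g \<in> carrier SL2_F5"
  shows "qq (mat (zp k) ** rep g) = k mod int (n div 2)"
proof -
  let ?h = "n div 2"
  have h: "n = 2 * ?h" "?h > 0" using n by auto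
  have d: "det (mat (zp k) ** rep g) = z ^ (2 * nat k)"
    using det_rep[OF g] by (simp add: det_mul mat_m2 m2_det zp_def power_mult power2_eq_square power_mult_distrib mult_2 power_add)
  have e: "z ^ (2 * a) = z ^ (2 * b) \<longleftrightarrow> a mod ?h = b mod ?h" for a b
  proof -
    have "(2 * a) mod n = 2 * (a mod ?h)" "(2 * b) mod n = 2 * (b mod ?h)" using h(1) by (metis mult_mod_right)+
    then show ?thesis by (simp add: z_eq)
  qed
  have k0: "0 \<le> k" using k by (simp add: C_carrier)
  show ?thesis unfolding qq_def d
  proof (rule the_equality)
    show "k mod int ?h \<in> {0..<int ?h} \<and> z ^ (2 * nat (k mod int ?h)) = z ^ (2 * nat k)"
      using h(2) k0 by (simp add: e nat_mod_distrib)
  next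
    fix l assume l: "l \<in> {0..<int ?h} \<and> z ^ (2 * nat l) = z ^ (2 * nat k)"
    then have "nat l mod ?h = nat k mod ?h" by (simp add: e)
    then have "int (nat l mod ?h) = int (nat k mod ?h)" by simp
    then show "l = k mod int ?h" using l k0 by (simp add: zmod_int)
  qed
qed

text \<open>A section would send 1 to some \<open>z^k rep g\<close> with \<open>k\<close> odd and
  trivial \<open>(n/2)\<close>-th power. As \<open>z^(k n/2) = -1\<close>, also
  \<open>g^(n/2) = -1\<close>; since 4 divides \<open>n / 2\<close>, this makes -1 a fourth power in
  SL_2(F_5), contrary to \<open>SL2_F5_fourth_power\<close>.\<close>

lemma EE_nonsplit: assumes n8: "8 dvd n"
  shows "is_nonsplit_extension EE SL2_F5 (integer_mod_group (n div 2))"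
proof -
  let ?h = "n div 2" let ?Q = "integer_mod_group (n div 2)"
  have h0: "?h > 0" using n by auto
  have hn: "int ?h dvd int n" using n by (auto elim!: evenE)
  have Qc: "carrier ?Q = {0..<int ?h}" using h0 by (simp add: carrier_integer_mod_group)
  have kC: "(k + l) mod int n \<in> carrier C" for k l using n by (simp add: C_carrier)
  have q: "qq \<in> epi EE ?Q"
  proof (unfold epi_def, intro CollectI conjI homI)
    fix M assume "M \<in> carrier EE"
    then show "qq M \<in> carrier ?Q" using h0 by (auto elim!: EE_cases simp: qq_eq Qc)
  next
    fix M N assume "M \<in> carrier EE" "N \<in> carrier EE"
    then obtain k g l h where M: "k \<in> carrier C" "g \<in> carrier SL2_F5" "M = mat (zp k) ** rep g"
      "l \<in> carrier C" "h \<in> carrier SL2_F5" "N = mat (zp l) ** rep h"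
      by (metis EE_cases)
    have "M ** N = mat (zp ((k + l) mod int n)) ** rep (g ** h)"
      using M by (simp add: scalar_mult zp_add rep_mult)
    then have "qq (M ** N) = ((k + l) mod int n) mod int ?h"
      using qq_eq[OF kC br.SL2_mult_closed[OF M(2,5)]] by simp
    also have "\<dots> = (k mod int ?h + l mod int ?h) mod int ?h" using hn by (simp add: mod_mod_cancel mod_add_eq)
    finally show "qq (M \<otimes>\<^bsub>EE\<^esub> N) = qq M \<otimes>\<^bsub>?Q\<^esub> qq N" using M h0 by (simp add: EE_simps qq_eq)
  next
    show "qq ` carrier EE = carrier ?Q"
    proof (intro equalityI subsetI)
      fix k assume "k \<in> carrier ?Q"
      then have k: "k \<in> carrier C" "k mod int ?h = k" by (auto simp: Qc C_carrier)
      have "mat (zp k) ** rep (m2 1 0 0 1) \<in> carrier EE" unfolding zp_def by (rule EE_I[OF neg_carrier(2)])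
      then show "k \<in> qq ` carrier EE" using qq_eq[OF k(1) neg_carrier(2)] k(2) by (metis imageI)
    qed (use h0 in \<open>auto elim!: EE_cases simp: qq_eq Qc\<close>)
  qed
  have r: "rep \<in> mon SL2_F5 EE" unfolding mon_def
    using rep_inj by (auto intro!: homI EE_I1) (simp add: EE_simps SL2_mult rep_mult)
  have ker: "kernel EE ?Q qq = rep ` carrier SL2_F5"
  proof (intro equalityI subsetI)
    fix M assume M: "M \<in> kernel EE ?Q qq"
    then obtain k g where k: "k \<in> carrier C" "g \<in> carrier SL2_F5" "M = mat (zp k) ** rep g"
      by (auto simp: kernel_def elim: EE_cases)
    have "int ?h dvd k" using M h0 k by (auto simp: kernel_def qq_eq)
    then obtain m where m: "k = int ?h * m" by blast
    have "m \<ge> 0" using k(1) m h0 by (auto simp: C_carrier zero_le_mult_iff)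
    then have "zp k = (- 1) ^ nat m" unfolding m zp_def by (simp add: nat_mult_distrib power_mult z_half)
    then have "zp k = 1 \<or> zp k = - 1" by (simp add: minus_one_power_iff)
    then show "M \<in> rep ` carrier SL2_F5"
    proof
      assume "zp k = 1" then show ?thesis using k by (simp add: matrix_mul_lid)
    next
      assume "zp k = - 1"
      then have "M = rep (m2 (-1) 0 0 (-1) ** g)" using k rep_mult[OF neg_carrier(1) k(2)] rep_minus by simp
      then show ?thesis using br.SL2_mult_closed[OF neg_carrier(1) k(2)] by blast
    qed
  next
    fix M assume "M \<in> rep ` carrier SL2_F5"
    then obtain g where g: "g \<in> carrier SL2_F5" "M = rep g" by auto
    have "0 \<in> carrier C" using n by (simp add: C_carrier)
    then have "qq M = 0" using qq_eq[of 0 g] g by (simp add: matrix_mul_lid)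
    then show "M \<in> kernel EE ?Q qq" using g EE_I1 h0 by (simp add: kernel_def)
  qed
  have "\<not> has_section EE ?Q qq"
  proof
    assume "has_section EE ?Q qq"
    then obtain s where s: "s \<in> hom ?Q EE" "\<And>q. q \<in> carrier ?Q \<Longrightarrow> qq (s q) = q" by (auto simp: has_section_def)
    obtain m where m: "n = 8 * m" using n8 by blast
    have m0: "m > 0" using m n by simp
    have 1: "1 \<in> carrier ?Q" using m m0 by (simp add: Qc)
    have "s 1 \<in> carrier EE" using s(1) 1 by (auto simp: hom_def)
    then obtain k g where k: "k \<in> carrier C" "g \<in> carrier SL2_F5" "s 1 = mat (zp k) ** rep g" by (rule EE_cases)
    have "k mod int ?h = 1" using s(2)[OF 1] k qq_eq by simp
    \<comment> \<open>\<open>n / 2\<close> is even, so reduction modulo \<open>n / 2\<close>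
      preserves the parity of \<open>k\<close>.\<close>
    moreover have "k mod int ?h mod 2 = k mod 2" by (rule mod_mod_cancel) (simp add: m)
    ultimately have "k mod 2 = 1" by simp
    then have odd: "odd (nat k)" using k(1) by (simp add: C_carrier even_nat_iff odd_iff_mod_2_eq_one)
    interpret h: group_hom ?Q EE s
      using s(1) EE_group by (simp add: group_hom_def group_hom_axioms_def)
    have "1 [^]\<^bsub>?Q\<^esub> ?h = \<one>\<^bsub>?Q\<^esub>" using h0 by (simp add: pow_integer_mod_group)
    then have one: "s 1 [^]\<^bsub>EE\<^esub> ?h = mat 1" using h.hom_nat_pow[OF 1, of ?h] h.hom_one by (simp only: EE_simps)
    have pw: "s 1 [^]\<^bsub>EE\<^esub> j = mat (zp k ^ j) ** rep (g [^]\<^bsub>SL2_F5\<^esub> j)" for j :: nat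
    proof (induction j)
      case 0 show ?case by (simp only: nat_pow_0 EE_simps SL2_one rep_one power_0 matrix_mul_rid)
    next
      case (Suc j)
      have "g [^]\<^bsub>SL2_F5\<^esub> j \<in> carrier SL2_F5" using k(2) group.is_monoid[OF SL2_group] by (simp add: monoid.nat_pow_closed)
      then show ?case using Suc k by (simp add: EE_simps scalar_mult SL2_mult rep_mult mult.commute)
    qed
    have "zp k ^ ?h = - 1"
    proof -
      have "zp k ^ ?h = (z ^ ?h) ^ nat k" unfolding zp_def by (metis mult.commute power_mult)
      then show ?thesis using odd by (simp add: z_half)
    qed
    then have "mat (- 1) ** rep (g [^]\<^bsub>SL2_F5\<^esub> ?h) = mat 1" using pw[of ?h] one by simp
    then have "mat (- 1) ** (mat (- 1) ** rep (g [^]\<^bsub>SL2_F5\<^esub> ?h)) = mat (- 1) ** mat 1" by (simp only:)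
    then have "rep (g [^]\<^bsub>SL2_F5\<^esub> ?h) = mat (- 1)"
      by (simp add: matrix_mul_assoc mat_mult_mat)
    moreover have hc: "g [^]\<^bsub>SL2_F5\<^esub> j \<in> carrier SL2_F5" for j :: nat using k(2) group.is_monoid[OF SL2_group] by (simp add: monoid.nat_pow_closed)
    ultimately have *: "g [^]\<^bsub>SL2_F5\<^esub> ?h = m2 (-1) 0 0 (-1)"
      using rep_inj rep_minus neg_carrier(1) by (metis inj_onD)
    define x where "x = g [^]\<^bsub>SL2_F5\<^esub> m"
    have "?h = m + m + (m + m)" using m by simp
    then have "g [^]\<^bsub>SL2_F5\<^esub> ?h = (x ** x) ** (x ** x)"
      using k(2) unfolding x_def SL2_mult[symmetric] by (simp only: monoid.nat_pow_mult[OF group.is_monoid[OF SL2_group]])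
    then show False using SL2_F5_fourth_power[of x] * hc by (simp add: x_def)
  qed
  then show ?thesis using q r ker EE_group SL2_group by (auto simp: is_nonsplit_extension_def group_extension_def)
qed

end

section \<open>Splitting off the odd part of the scalars\<close>

text \<open>The roots of unity of order \<open>m n\<close> split into those of order
  \<open>m\<close>, generated by \<open>z^n\<close>, and those of order \<open>n\<close>, generated
  by \<open>z^m\<close>. As \<open>n\<close> is even and coprime to \<open>m\<close>, only the
  second part contains -1 and interacts with the lift.\<close>

lemma (in icosa) EE_split:
  assumes a: "icosa_ext i \<eta> \<kappa> z (m * n)" and b: "icosa_ext i \<eta> \<kappa> (z ^ m) n" and co: "coprime m n" and m: "m > 0"
  shows "(\<lambda>(k, M). mat ((z ^ n) ^ nat k) ** M) \<in> iso (integer_mod_group m \<times>\<times> icosa_ext.EE i \<eta> \<kappa> (z ^ m) n) (icosa_ext.EE i \<eta> \<kappa> z (m * n))"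
proof -
  interpret a: icosa_ext i \<eta> \<kappa> z "m * n" by (rule a)
  interpret b: icosa_ext i \<eta> \<kappa> "z ^ m" n by (rule b)
  let ?f = "\<lambda>(k, M). mat ((z ^ n) ^ nat k) ** M"
  let ?C = "integer_mod_group m"
  have n: "n > 0" by (rule b.n)
  have Cc: "carrier ?C = {0..<int m}" using m by (simp add: carrier_integer_mod_group)
  have C: "group (?C \<times>\<times> b.EE)" by (intro DirProd_group group_integer_mod_group b.EE_group)
  have hom: "?f \<in> hom (?C \<times>\<times> b.EE) a.EE"
  proof (rule homI)
    fix x assume "x \<in> carrier (?C \<times>\<times> b.EE)"
    then obtain k M where x: "x = (k, M)" "M \<in> carrier b.EE" by auto
    from x(2) obtain l g where g: "g \<in> carrier SL2_F5" "M = mat (b.zp l) ** rep g" by (rule b.EE_cases)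
    have "mat ((z ^ n) ^ nat k) ** M = mat (z ^ (n * nat k + m * nat l)) ** rep g"
      using g by (simp add: b.zp_def matrix_mul_assoc mat_mult_mat power_add power_mult)
    then show "?f x \<in> carrier a.EE" using a.EE_I[OF g(1)] x by simp
  next
    fix x y assume "x \<in> carrier (?C \<times>\<times> b.EE)" "y \<in> carrier (?C \<times>\<times> b.EE)"
    then obtain k M l N where x: "x = (k, M)" "y = (l, N)" "0 \<le> k" "0 \<le> l" by (auto simp: Cc)
    have "nat ((k + l) mod int m) = (nat k + nat l) mod m" using x by (simp add: nat_mod_distrib nat_add_distrib)
    moreover have "n * ((nat k + nat l) mod m) = (n * nat k + n * nat l) mod (m * n)"
      by (simp add: mult_mod_right mult.commute[of m] distrib_left)
    ultimately have "(z ^ n) ^ nat ((k + l) mod int m) = (z ^ n) ^ nat k * (z ^ n) ^ nat l"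
      using a.z_eq by (simp flip: power_add power_mult)
    then show "?f (x \<otimes>\<^bsub>?C \<times>\<times> b.EE\<^esub> y) = ?f x \<otimes>\<^bsub>a.EE\<^esub> ?f y"
      by (simp add: x a.EE_simps b.EE_simps a.scalar_mult)
  qed
  interpret f: group_hom "?C \<times>\<times> b.EE" a.EE ?f
    using C a.EE_group hom by (simp add: group_hom_def group_hom_axioms_def)
  have "kernel (?C \<times>\<times> b.EE) a.EE ?f \<subseteq> {\<one>\<^bsub>?C \<times>\<times> b.EE\<^esub>}"
  proof
    fix x assume x: "x \<in> kernel (?C \<times>\<times> b.EE) a.EE ?f"
    then obtain k M where k: "x = (k, M)" "k \<in> carrier ?C" "M \<in> carrier b.EE" and e: "mat ((z ^ n) ^ nat k) ** M = mat 1"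
      by (auto simp: kernel_def a.EE_simps)
    from k(3) obtain l g where g: "l \<in> carrier (integer_mod_group n)" "g \<in> carrier SL2_F5" "M = mat (b.zp l) ** rep g" by (rule b.EE_cases)
    define c where "c = (z ^ n) ^ nat k * b.zp l"
    have c: "c \<noteq> 0" using a.z_nz b.zp_nz by (simp add: c_def)
    have "rep g = mat (inverse c) ** (mat c ** rep g)" using c by (simp add: matrix_mul_assoc mat_mult_mat matrix_mul_lid)
    also have "mat c ** rep g = mat 1" using e g by (simp add: matrix_mul_assoc mat_mult_mat c_def)
    finally have "rep g = mat (inverse c)" by (simp only: matrix_mul_rid)
    then have "g = m2 1 0 0 1 \<or> g = m2 (-1) 0 0 (-1)" by (rule rep_scalar[OF g(2)])
    then have "rep g = mat 1 \<or> rep g = mat (- 1)" using rep_one rep_minus by metis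
    then have "\<exists>j. M = mat ((z ^ m) ^ j)"
    proof
      assume "rep g = mat 1" then show ?thesis using g by (auto simp: b.zp_def matrix_mul_rid)
    next
      assume "rep g = mat (- 1)"
      then have "M = mat ((z ^ m) ^ (nat l + n div 2))" using g by (simp only: b.zp_def mat_mult_mat power_add b.z_half)
      then show ?thesis by blast
    qed
    then obtain j where j: "M = mat ((z ^ m) ^ j)" by blast
    have "mat (z ^ (n * nat k + m * j)) = (mat 1 :: 'a^2^2)" using e j by (simp add: mat_mult_mat power_add power_mult)
    then have "z ^ (n * nat k + m * j) = 1" by (simp add: mat_m2 m2_eq)
    then have "m * n dvd n * nat k + m * j" by (simp add: a.z_eq_1)
    then have "m dvd n * nat k" by (metis dvd_add_left_iff dvd_mult_left dvd_triv_left)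
    then have "m dvd nat k" using co by (simp add: coprime_dvd_mult_right_iff)
    moreover have "nat k < m" using k(2) by (auto simp: Cc)
    ultimately have "nat k = 0" by (auto dest: dvd_imp_le)
    then have "k = 0" "M = mat 1" using k(2) e by (auto simp: Cc matrix_mul_lid)
    then show "x \<in> {\<one>\<^bsub>?C \<times>\<times> b.EE\<^esub>}" using k by (simp add: b.EE_simps)
  qed
  moreover have "\<one>\<^bsub>?C \<times>\<times> b.EE\<^esub> \<in> kernel (?C \<times>\<times> b.EE) a.EE ?f"
    unfolding kernel_def mem_Collect_eq by (intro conjI f.hom_one f.G.one_closed)
  ultimately have "kernel (?C \<times>\<times> b.EE) a.EE ?f = {\<one>\<^bsub>?C \<times>\<times> b.EE\<^esub>}" by blast
  then have inj: "inj_on ?f (carrier (?C \<times>\<times> b.EE))" by (simp only: f.inj_iff_trivial_ker)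
  have surj: "carrier a.EE \<subseteq> ?f ` carrier (?C \<times>\<times> b.EE)"
  proof
    fix M assume "M \<in> carrier a.EE"
    then obtain k g where g: "g \<in> carrier SL2_F5" "M = mat (a.zp k) ** rep g" by (rule a.EE_cases)
    obtain c x y where "c dvd n" "c dvd m" and c: "n * x = m * y + c"
      using bezout_add_strong_nat[of n m] n by auto
    then have "c = 1" using coprime_common_divisor_nat[OF co, of c] by simp
    then have xy: "n * x = m * y + 1" using c by simp
    \<comment> \<open>Bezout gives \<open>n x - m y = 1\<close>. The exponent \<open>- m y\<close>
      is replaced by the natural number \<open>m y (n - 1)\<close>, to which it is congruent modulo
      \<open>m n\<close>.\<close>
    have "n * x + m * (y * (n - 1)) = (m * n) * y + 1" using xy n by (simp add: algebra_simps diff_mult_distrib2 diff_mult_distrib)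
    then have "z ^ (n * x + m * (y * (n - 1))) = z" by (simp add: power_add power_mult[of z "m * n"] a.zn)
    then have "a.zp k = z ^ (n * x * nat k + m * (y * (n - 1)) * nat k)"
      unfolding a.zp_def by (metis add_mult_distrib power_mult)
    also have "\<dots> = (z ^ n) ^ (x * nat k) * (z ^ m) ^ (y * (n - 1) * nat k)" by (simp add: power_add power_mult mult.assoc)
    also have "(z ^ n) ^ (x * nat k) = (z ^ n) ^ nat (int (x * nat k) mod int m)"
    proof -
      have "nat (int (x * nat k) mod int m) = (x * nat k) mod m" by (simp only: zmod_int[symmetric] nat_int)
      moreover have "n * (x * nat k) mod (m * n) = n * ((x * nat k) mod m) mod (m * n)" by (simp add: mult.commute[of m] flip: mult_mod_right)
      ultimately show ?thesis using a.z_eq by (simp flip: power_mult)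
    qed
    finally have M: "M = ?f (int (x * nat k) mod int m, mat ((z ^ m) ^ (y * (n - 1) * nat k)) ** rep g)"
      using g by (simp add: matrix_mul_assoc mat_mult_mat)
    have "int (x * nat k) mod int m \<in> carrier ?C" using m by (simp add: Cc)
    then have "(int (x * nat k) mod int m, mat ((z ^ m) ^ (y * (n - 1) * nat k)) ** rep g) \<in> carrier (?C \<times>\<times> b.EE)"
      unfolding carrier_DirProd by (rule SigmaI) (rule b.EE_I[OF g(1)])
    then show "M \<in> ?f ` carrier (?C \<times>\<times> b.EE)" unfolding M by (rule imageI)
  qed
  have "?f ` carrier (?C \<times>\<times> b.EE) = carrier a.EE" using surj f.hom_closed by blast
  then show ?thesis unfolding iso_def bij_betw_def mem_Collect_eq by (intro conjI hom inj)
qed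

section \<open>Icosahedral subgroups of the projective linear group\<close>

text \<open>The two fixed points are eigenlines and vectors spanning them form the columns of
  \<open>C\<close>. A scalar power of \<open>M\<close> has equal diagonal entries after
  conjugation.\<close>

lemma diagonalize:
  fixes M :: "'a::{alg_closed_field, field_char_0}^2^2"
  assumes M: "invertible M" and ns: "pgl_class M \<noteq> \<one>\<^bsub>PGL\<^esub>"
    and fin: "pgl_class M [^]\<^bsub>PGL\<^esub> (Suc k) = \<one>\<^bsub>PGL\<^esub>"
  obtains C \<alpha> \<beta> where "invertible C" "M ** C = C ** m2 \<alpha> 0 0 \<beta>" "\<alpha> \<noteq> 0" "\<beta> \<noteq> 0" "\<alpha> \<noteq> \<beta>" "\<alpha> ^ Suc k = \<beta> ^ Suc k"
proof -
  obtain P Q where PQ: "P \<noteq> Q" "{P \<in> proj_space. pgl_act (pgl_class M) P = P} = {P, Q}"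
    by (rule fixed_points_two[OF M ns fin])
  have ev: "\<exists>v \<alpha>. v \<noteq> 0 \<and> R = proj_point v \<and> \<alpha> \<noteq> 0 \<and> M *v v = \<alpha> *s v" if "R = P \<or> R = Q" for R
  proof -
    have "R \<in> proj_space" "pgl_act (pgl_class M) R = R" using PQ(2) that by auto
    then obtain v where v: "v \<noteq> 0" "R = proj_point v" by (auto simp: proj_space_def)
    have "proj_point v = proj_point (M *v v)" using \<open>pgl_act (pgl_class M) R = R\<close> unfolding v(2) pgl_act_point by (rule sym)
    then obtain \<alpha> where "\<alpha> \<noteq> 0" "M *v v = \<alpha> *s v" unfolding proj_point_eq_iff by blast
    then show ?thesis using v by blast
  qed
  obtain v \<alpha> w \<beta> where v: "v \<noteq> 0" "P = proj_point v" "\<alpha> \<noteq> 0" "M *v v = \<alpha> *s v"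
    and w: "w \<noteq> 0" "Q = proj_point w" "\<beta> \<noteq> 0" "M *v w = \<beta> *s w"
    using ev[of P] ev[of Q] by blast
  obtain x y where vx: "v = v2 x y" by (rule v2_cases)
  obtain x' y' where wx: "w = v2 x' y'" by (rule v2_cases)
  obtain a b c d where m: "M = m2 a b c d" by (rule m2_cases)
  define C where "C = m2 x x' y y'"
  have "x * y' \<noteq> y * x'"
  proof
    assume e: "x * y' = y * x'"
    have "proj_point (v2 x y) = proj_point (v2 x' y')"
      by (rule iffD2[OF proj_line_eq_iff]) (use v(1) w(1) e in \<open>auto simp: vx wx\<close>)
    then show False using PQ(1) v(2) w(2) by (simp only: vx wx)
  qed
  then have C: "invertible C" by (simp add: C_def invertible_m2 mult.commute)
  have MC: "M ** C = C ** m2 \<alpha> 0 0 \<beta>"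
    using v(4) w(4) by (simp add: C_def m vx wx m2_mult mult.commute)
  have ab: "\<alpha> \<noteq> \<beta>"
  proof
    assume "\<alpha> = \<beta>"
    then have e: "M ** C = mat \<alpha> ** C" using MC by (simp only: mat_m2[symmetric] mat_commute)
    obtain C' where "C ** C' = mat 1" using C by (rule invertible_inv)
    then have "M = mat \<alpha> ** mat 1" by (metis e matrix_mul_assoc matrix_mul_rid)
    then have "pgl_class M = pgl_class (mat 1)" using pgl_class_scale[OF v(3), of "mat 1"] by (simp only:)
    then show False using ns by (simp only: PGL_one)
  qed
  have pw: "mpow M n ** C = C ** m2 (\<alpha> ^ n) 0 0 (\<beta> ^ n)" for n
  proof (induction n)
    case 0 show ?case by (simp add: m2_one[symmetric])
  next
    case (Suc n)
    have "mpow M n ** M ** C = mpow M n ** (C ** m2 \<alpha> 0 0 \<beta>)" using MC by (simp flip: matrix_mul_assoc)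
    also have "\<dots> = C ** m2 (\<alpha> ^ n) 0 0 (\<beta> ^ n) ** m2 \<alpha> 0 0 \<beta>" using Suc by (simp add: matrix_mul_assoc)
    also have "\<dots> = C ** m2 (\<alpha> ^ Suc n) 0 0 (\<beta> ^ Suc n)" by (simp add: m2_mult mult.commute flip: matrix_mul_assoc)
    finally show ?case by simp
  qed
  have "pgl_class (mpow M (Suc k)) = pgl_class (mat 1)" using fin PGL_pow[OF M, of "Suc k"] by (simp only: PGL_one)
  then obtain l where l: "mpow M (Suc k) = mat l" unfolding pgl_class_eq_iff by (auto simp: matrix_mul_rid)
  have "C ** mat l = C ** m2 (\<alpha> ^ Suc k) 0 0 (\<beta> ^ Suc k)" using pw[of "Suc k"] l mat_commute by metis
  then have "mat l = m2 (\<alpha> ^ Suc k) 0 0 (\<beta> ^ Suc k)" using C invertible_inv by (metis matrix_mul_assoc matrix_mul_lid)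
  then have "\<alpha> ^ Suc k = \<beta> ^ Suc k" unfolding mat_m2 m2_eq by metis
  with C MC v(3) w(3) ab that show ?thesis by blast
qed

text \<open>By Cayley and Hamilton the square is the trace times the matrix minus a scalar; for a
  nonscalar matrix it is scalar only if the trace vanishes.\<close>

lemma square_scalar:
  assumes sq: "m2 p q r s ** m2 p q r s = mat (k::'a::field)" and ns: "\<And>c. m2 p q r s \<noteq> mat c"
  shows "s = - p"
proof (rule ccontr)
  assume "s \<noteq> - p"
  then have ps: "p + s \<noteq> 0" by (metis add.commute add_eq_0_iff)
  have e: "p * p + q * r = k" "p * q + q * s = 0" "r * p + s * r = 0" "r * q + s * s = k"
    using sq by (simp_all add: m2_mult mat_m2)
  have "q * (p + s) = 0" "r * (p + s) = 0" using e by (simp_all add: algebra_simps)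
  then have q: "q = 0" "r = 0" using ps by auto
  have "(p - s) * (p + s) = 0" using e q by (simp add: algebra_simps)
  then have "p = s" using ps by simp
  then show False using ns[of s] q by (simp add: mat_m2)
qed

text \<open>With trace \<open>t\<close> and determinant \<open>D\<close>, Cayley and Hamilton give
  \<open>M^3 = (t^2 - D) M - t D\<close>, so for nonscalar \<open>M\<close> the coefficient of
  \<open>M\<close> vanishes.\<close>

lemma cube_scalar:
  assumes cu: "m2 a b c d ** m2 a b c d ** m2 a b c d = mat (l::'a::field)" and ns: "\<And>k. m2 a b c d \<noteq> mat k"
  shows "(a + d) ^ 2 = a * d - b * c"
proof (rule ccontr)
  assume n: "(a + d) ^ 2 \<noteq> a * d - b * c"
  define u where "u = (a + d) ^ 2 - (a * d - b * c)"
  have u: "u \<noteq> 0" using n by (simp add: u_def)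
  note e = cu[unfolded m2_mult mat_m2 m2_eq]
  have "u * b = (a * a + b * c) * b + (a * b + b * d) * d" "u * c = (c * a + d * c) * a + (c * b + d * d) * c"
    "u * (a - d) = ((a * a + b * c) * a + (a * b + b * d) * c) - ((c * a + d * c) * b + (c * b + d * d) * d)"
    by (simp_all add: u_def power2_eq_square algebra_simps)
  then have "u * b = 0" "u * c = 0" "u * (a - d) = 0" using e by simp_all
  then have "b = 0" "c = 0" "a = d" using u by auto
  then show False using ns[of d] by (simp add: mat_m2)
qed

text \<open>The alternating group enters through the relations
  \<open>p5^5 = pW^2 = (p5 pW)^3 = 1\<close>. Diagonalisation brings the image of \<open>p5\<close>
  to \<open>Dm\<close>. For the image of \<open>pW\<close> the second relation makes the trace zero
  and the third fixes the product of the off-diagonal entries; the freedom left is conjugation by a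
  diagonal matrix, which adjusts their ratio to that of \<open>Wm\<close>.\<close>

theorem icosahedral_normal_form:
  fixes S :: "('a::{alg_closed_field, field_char_0}^2^2) set set"
  assumes i: "i ^ 2 = - 1" and S: "subgroup S PGL" and iso: "PGL\<lparr>carrier := S\<rparr> \<cong> alt_group 5"
  obtains \<eta> \<kappa> C M N where "icosa i \<eta> \<kappa>" "invertible C" "pgl_class M \<in> S" "pgl_class N \<in> S"
    "M ** C = C ** icosa.Dm \<eta>" "N ** C = C ** icosa.Wm i \<eta> \<kappa>"
proof -
  interpret S: subgroup S PGL by (rule S)
  have SG: "group (PGL\<lparr>carrier := S\<rparr>)" by (rule S.subgroup_is_group[OF PGL_group])
  obtain h where h: "h \<in> iso (alt_group 5) (PGL\<lparr>carrier := S\<rparr>)"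
    using group.iso_sym[OF SG iso] by (auto simp: is_iso_def)
  have hhom: "h \<in> hom (alt_group 5) PGL" using h S.subset by (auto simp: iso_def hom_def)
  have inj: "inj_on h (carrier (alt_group 5))" and im: "h ` carrier (alt_group 5) = S" using h by (auto simp: iso_def bij_betw_def)
  interpret h: group_hom "alt_group 5" PGL h
    using alt_group_is_group PGL_group hhom by (simp add: group_hom_def group_hom_axioms_def)
  have one: "\<one>\<^bsub>alt_group 5\<^esub> \<in> carrier (alt_group 5)" by simp
  have ne: "h p \<noteq> \<one>\<^bsub>PGL\<^esub>" if "p \<in> carrier (alt_group 5)" "p x \<noteq> x" for p x
  proof
    assume "h p = \<one>\<^bsub>PGL\<^esub>"
    then have "h p = h \<one>\<^bsub>alt_group 5\<^esub>" by (simp only: h.hom_one)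
    then have "p = \<one>\<^bsub>alt_group 5\<^esub>" using inj that(1) one by (simp only: inj_on_def)
    then show False using that(2) by (simp add: alt_group_one)
  qed
  have DW: "p5 \<otimes>\<^bsub>alt_group 5\<^esub> pW \<in> carrier (alt_group 5)" using p5_alt pW_alt by (rule alt.m_closed)
  obtain M0 where M0: "invertible M0" "h p5 = pgl_class M0" using h.hom_closed[OF p5_alt] by (auto simp: PGL_carrier)
  obtain N0 where N0: "invertible N0" "h pW = pgl_class N0" using h.hom_closed[OF pW_alt] by (auto simp: PGL_carrier)
  have MS: "pgl_class M0 \<in> S" "pgl_class N0 \<in> S" using im p5_alt pW_alt M0(2) N0(2) by auto
  have M1: "pgl_class M0 \<noteq> \<one>\<^bsub>PGL\<^esub>" using ne[OF p5_alt, of 1] M0(2) by (simp add: p5_apply)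
  have M5: "pgl_class M0 [^]\<^bsub>PGL\<^esub> (Suc 4) = \<one>\<^bsub>PGL\<^esub>"
    using h.hom_nat_pow[OF p5_alt, of 5] alt.D5 h.hom_one unfolding M0(2) by simp
  obtain C0 \<alpha> \<beta> where C0: "invertible C0" "M0 ** C0 = C0 ** m2 \<alpha> 0 0 \<beta>"
    and ab: "\<alpha> \<noteq> 0" "\<beta> \<noteq> 0" "\<alpha> \<noteq> \<beta>" and "\<alpha> ^ Suc 4 = \<beta> ^ Suc 4"
    by (rule diagonalize[OF M0(1) M1 M5])
  then have ab5: "\<alpha> ^ 5 = \<beta> ^ 5" by simp
  obtain C1 where C1: "C0 ** C1 = mat 1" "C1 ** C0 = mat 1" "invertible C1" using C0(1) by (rule invertible_inv)
  \<comment> \<open>Only the ratio of the eigenvalues survives in PGL_2. For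
    \<open>\<eta> = \<omega>^3\<close> the matrix diag(\<open>\<eta>\<close>,
    \<open>\<eta>^4\<close>) has this ratio, because
    \<open>\<eta>^(-3) = \<eta>^2 = \<omega>\<close>.\<close>
  define \<omega> where "\<omega> = \<alpha> / \<beta>"
  define \<eta> where "\<eta> = \<omega> ^ 3"
  define \<kappa> where "\<kappa> = inverse (\<eta> - \<eta> ^ 4)"
  have w: "\<omega> ^ 5 = 1" "\<omega> \<noteq> 1" "\<alpha> = \<omega> * \<beta>" using ab ab5 by (auto simp: \<omega>_def power_divide)
  have e5: "\<eta> ^ 5 = 1" and e2: "\<eta> ^ 2 = \<omega>" using w(1) unfolding \<eta>_def by Groebner_Basis.algebra+
  have e1: "\<eta> \<noteq> 1" using e2 w(2) by auto
  have eta: "1 + \<eta> + \<eta> ^ 2 + \<eta> ^ 3 + \<eta> ^ 4 = 0"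
  proof -
    have "(\<eta> - 1) * (1 + \<eta> + \<eta> ^ 2 + \<eta> ^ 3 + \<eta> ^ 4) = 0" using e5 by Groebner_Basis.algebra
    then show ?thesis using e1 by simp
  qed
  have "\<eta> - \<eta> ^ 4 \<noteq> 0"
  proof
    assume "\<eta> - \<eta> ^ 4 = 0"
    then have "\<eta> = 1" using e5 by Groebner_Basis.algebra
    then show False using e1 by simp
  qed
  then have kap: "\<kappa> * (\<eta> - \<eta> ^ 4) = 1" by (simp add: \<kappa>_def)
  have ico: "icosa i \<eta> \<kappa>" by (rule icosa.intro[OF i eta kap])
  then interpret I: icosa i \<eta> \<kappa> .
  define \<mu> where "\<mu> = \<eta> ^ 4 / \<beta>"
  have mu: "\<mu> \<noteq> 0" "\<mu> * \<beta> = \<eta> ^ 4" using ab(2) I.nz by (auto simp: \<mu>_def)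
  have mua: "\<mu> * \<alpha> = \<eta>" using mu(2) w(3) e2 e5 by Groebner_Basis.algebra
  define M where "M = mat \<mu> ** M0"
  have M: "pgl_class M = pgl_class M0" unfolding M_def by (rule pgl_class_scale[OF mu(1)])
  have MC: "M ** C0 = C0 ** I.Dm"
  proof -
    have "M ** C0 = mat \<mu> ** (C0 ** m2 \<alpha> 0 0 \<beta>)" using C0(2) by (simp add: M_def flip: matrix_mul_assoc)
    also have "\<dots> = C0 ** (mat \<mu> ** m2 \<alpha> 0 0 \<beta>)" by (simp only: mult_scalar)
    also have "mat \<mu> ** m2 \<alpha> 0 0 \<beta> = I.Dm" using mu mua by (simp add: m2_scale I.Dm_def)
    finally show ?thesis .
  qed
  define R where "R = C1 ** N0 ** C0"
  have NR: "N0 ** C0 = C0 ** R" by (simp add: R_def matrix_mul_assoc C1)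
  have Rinv: "invertible R" unfolding R_def using C0(1) C1(3) N0(1) by (simp add: invertible_mult)
  obtain p q r s where R: "R = m2 p q r s" by (rule m2_cases)
  have cancel: "K = mat c" if "L ** C0 = C0 ** K" "L = mat c" for L K c
  proof -
    have "C0 ** K = C0 ** mat c" using that by (simp add: mat_commute)
    then show ?thesis by (metis C1(2) matrix_mul_assoc matrix_mul_lid)
  qed
  have cancel2: "L = mat c" if "L ** C0 = C0 ** K" "K = mat c" for L K c
  proof -
    have "L ** C0 = mat c ** C0" using that by (simp add: mat_commute)
    then show ?thesis by (metis C1(1) matrix_mul_assoc matrix_mul_rid)
  qed
  have scal: "\<exists>c. L = mat c" if "pgl_class L = \<one>\<^bsub>PGL\<^esub>" for L :: "'a^2^2"
    using that unfolding PGL_one pgl_class_eq_iff by (auto simp: matrix_mul_rid)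
  have nscal: "L \<noteq> mat c" if "pgl_class L \<noteq> \<one>\<^bsub>PGL\<^esub>" "invertible L" for L :: "'a^2^2" and c
  proof
    assume L: "L = mat c"
    then have "c \<noteq> 0" using that(2) by (auto simp: mat_m2 invertible_m2)
    then have "pgl_class (mat c ** mat 1) = pgl_class (mat 1 :: 'a^2^2)" by (rule pgl_class_scale)
    then show False using that(1) L by (simp add: PGL_one matrix_mul_rid)
  qed
  have N1: "pgl_class N0 \<noteq> \<one>\<^bsub>PGL\<^esub>" using ne[OF pW_alt, of 1] N0(2) by (simp add: pW_apply)
  have "pgl_class (N0 ** N0) = h (pW \<otimes>\<^bsub>alt_group 5\<^esub> pW)" using N0 pW_alt by (simp add: PGL_mult)
  also have "pW \<otimes>\<^bsub>alt_group 5\<^esub> pW = \<one>\<^bsub>alt_group 5\<^esub>" using alt.WW by (simp add: alt_group_one)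
  finally obtain k where k: "N0 ** N0 = mat k" using scal[of "N0 ** N0"] h.hom_one by metis
  have "R ** R = mat k"
    by (rule cancel[OF _ k]) (metis NR matrix_mul_assoc)
  moreover have "R \<noteq> mat c" for c using cancel2[OF NR] nscal[OF N1 N0(1)] by metis
  ultimately have s: "s = - p" using square_scalar R by metis
  define E where "E = I.Dm ** R"
  have EC: "(M ** N0) ** C0 = C0 ** E" unfolding E_def by (metis MC NR matrix_mul_assoc)
  have Minv: "invertible M" using M0(1) mu(1) by (simp add: M_def invertible_mult invertible_mat)
  have hDW: "h (p5 \<otimes>\<^bsub>alt_group 5\<^esub> pW) = pgl_class (M ** N0)"
    using M0 N0 p5_alt pW_alt M Minv by (simp flip: PGL_mult)
  have "p5 \<circ> pW \<circ> (p5 \<circ> pW) \<circ> (p5 \<circ> pW) = id" by (rule fun5_eqI; simp add: p5_apply pW_apply)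
  then have d3: "p5 \<otimes>\<^bsub>alt_group 5\<^esub> pW \<otimes>\<^bsub>alt_group 5\<^esub> (p5 \<otimes>\<^bsub>alt_group 5\<^esub> pW) \<otimes>\<^bsub>alt_group 5\<^esub> (p5 \<otimes>\<^bsub>alt_group 5\<^esub> pW) = \<one>\<^bsub>alt_group 5\<^esub>"
    by (simp add: alt_group_mult alt_group_one)
  have MN: "invertible (M ** N0)" using Minv N0(1) by (simp add: invertible_mult)
  have "pgl_class (M ** N0 ** (M ** N0) ** (M ** N0)) = \<one>\<^bsub>PGL\<^esub>"
  proof -
    have "pgl_class (M ** N0 ** (M ** N0) ** (M ** N0)) = h (p5 \<otimes>\<^bsub>alt_group 5\<^esub> pW) \<otimes>\<^bsub>PGL\<^esub> h (p5 \<otimes>\<^bsub>alt_group 5\<^esub> pW) \<otimes>\<^bsub>PGL\<^esub> h (p5 \<otimes>\<^bsub>alt_group 5\<^esub> pW)"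
      unfolding hDW using MN by (simp add: PGL_mult invertible_mult)
    also have "\<dots> = h (p5 \<otimes>\<^bsub>alt_group 5\<^esub> pW \<otimes>\<^bsub>alt_group 5\<^esub> (p5 \<otimes>\<^bsub>alt_group 5\<^esub> pW) \<otimes>\<^bsub>alt_group 5\<^esub> (p5 \<otimes>\<^bsub>alt_group 5\<^esub> pW))"
      using DW by (simp only: h.hom_mult alt.m_closed)
    also have "\<dots> = \<one>\<^bsub>PGL\<^esub>" unfolding d3 by (rule h.hom_one)
    finally show ?thesis .
  qed
  then obtain l where l: "M ** N0 ** (M ** N0) ** (M ** N0) = mat l" using scal by blast
  have cu: "E ** E ** E = mat l" by (rule cancel[OF _ l]) (metis EC matrix_mul_assoc)
  have nsE: "E \<noteq> mat c" for c
  proof -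
    have "(p5 \<otimes>\<^bsub>alt_group 5\<^esub> pW) 5 \<noteq> 5" by (simp add: alt_group_mult p5_apply pW_apply)
    then have "pgl_class (M ** N0) \<noteq> \<one>\<^bsub>PGL\<^esub>" using ne[OF DW] hDW by metis
    then show ?thesis using cancel2[OF EC] nscal MN by metis
  qed
  have E: "E = m2 (\<eta> * p) (\<eta> * q) (\<eta> ^ 4 * r) (\<eta> ^ 4 * - p)" by (simp add: E_def R I.Dm_def m2_mult s)
  \<comment> \<open>\<open>cube_scalar\<close> for the product of order three: its trace is
    \<open>(\<eta> - \<eta>^4) p\<close> and its determinant \<open>-(p^2 + q r)\<close>. With
    \<open>\<kappa>\<close> cleared this determines \<open>q r\<close> from
    \<open>p\<close>.\<close>
  have tr: "(\<eta> * p + \<eta> ^ 4 * - p) ^ 2 = \<eta> * p * (\<eta> ^ 4 * - p) - \<eta> * q * (\<eta> ^ 4 * r)"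
    by (rule cube_scalar[where l = l], unfold E[symmetric], rule cu, rule nsE)
  then have tr2: "p ^ 2 = - (\<kappa> ^ 2 * (p ^ 2 + q * r))" using kap e5 by Groebner_Basis.algebra
  have "p * s - q * r \<noteq> 0" using Rinv unfolding R invertible_m2 .
  moreover have "p * s - q * r = - (p ^ 2 + q * r)" by (simp add: s power2_eq_square)
  ultimately have dn: "p ^ 2 + q * r \<noteq> 0" by (metis neg_equal_0_iff_equal)
  then have p0: "p \<noteq> 0" using tr2 I.nz by auto
  have qr: "\<kappa> ^ 2 * (q * r) = \<kappa> ^ 2 * I.\<psi> ^ 2 * p ^ 2"
    using tr2 I.psi I.kap2 by Groebner_Basis.algebra
  then have q0: "q \<noteq> 0" using p0 I.nz by auto
  \<comment> \<open>Chosen to turn the upper right entry into \<open>\<psi> i p\<close>, as in a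
    multiple of \<open>Wm\<close>; the lower left entry follows because the product
    \<open>q r\<close> is known.\<close>
  define \<xi> where "\<xi> = I.\<psi> * i * p / q"
  have l0: "\<xi> \<noteq> 0" using p0 q0 I.nz by (simp add: \<xi>_def)
  have lq: "\<xi> * q = I.\<psi> * i * p" using q0 by (simp add: \<xi>_def)
  have lr: "r = - (I.\<psi> * i * p * \<xi>)"
  proof -
    have "q * r = I.\<psi> ^ 2 * p ^ 2" using qr I.nz by simp
    then have "q * r = q * - (I.\<psi> * i * p * \<xi>)" using lq i by Groebner_Basis.algebra
    then show ?thesis using q0 by (metis mult_left_cancel)
  qed
  define N where "N = mat (\<kappa> / p) ** N0"
  have kp: "\<kappa> / p \<noteq> 0" using p0 I.nz by simp
  have N: "pgl_class N = pgl_class N0" unfolding N_def by (rule pgl_class_scale[OF kp])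
  define C where "C = C0 ** m2 1 0 0 \<xi>"
  have "invertible C" using C0(1) l0 by (simp add: C_def invertible_mult invertible_m2)
  moreover have "M ** C = C ** I.Dm"
  proof -
    have "I.Dm ** m2 1 0 0 \<xi> = m2 1 0 0 \<xi> ** I.Dm" by (simp add: I.Dm_def m2_mult mult.commute)
    then show ?thesis unfolding C_def by (metis MC matrix_mul_assoc)
  qed
  moreover have "N ** C = C ** I.Wm"
  proof -
    have "mat (\<kappa> / p) ** (R ** m2 1 0 0 \<xi>) = m2 1 0 0 \<xi> ** I.Wm"
    proof -
      have 1: "q * \<xi> = I.\<psi> * i * p" using lq by (simp add: mult.commute)
      have "\<kappa> / p * (q * \<xi>) = \<kappa> * i * I.\<psi>" unfolding 1 using p0 by (simp add: field_simps)
      moreover have "\<kappa> / p * r = \<xi> * (- \<kappa> * i * I.\<psi>)" unfolding lr using p0 by (simp add: field_simps)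
      moreover have "\<kappa> / p * (- p * \<xi>) = \<xi> * - \<kappa>" using p0 by (simp add: field_simps)
      ultimately show ?thesis using p0 by (simp add: R s I.Wm_def m2_mult m2_scale)
    qed
    moreover have "N ** C = C0 ** (mat (\<kappa> / p) ** (R ** m2 1 0 0 \<xi>))"
      unfolding N_def C_def mult_scalar by (metis NR matrix_mul_assoc)
    ultimately show ?thesis by (simp add: C_def matrix_mul_assoc)
  qed
  ultimately show ?thesis using that ico MS M N by metis
qed

section \<open>The invariant forms as polynomials\<close>

lemma bfun_A5: "bfun (A5_form i n1 n2 n3 t a) = ico_form i n1 n2 n3 t (a :: nat \<Rightarrow> 'a::field)"
proof -
  have "bfun (G12 (- 11 * i)) v = f12 i v" "bfun (G20 (228 * i) (- 494)) v = f20 i v" "bfun (G30 (- 522 * i) 10005) v = f30 i v"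
    "bfun (G60 i b) v = f60 i b v" for v b
    by (simp_all add: bfun_def G12_def G20_def G30_def G60_def f12_def f20_def f30_def f60_def
        mp_eval_add mp_eval_mult mp_eval_power mp_eval_diff mp_eval_sum)
  then show ?thesis
    by (simp add: fun_eq_iff bfun_def A5_form_def ico_form_def mp_eval_mult mp_eval_power mp_eval_prod)
qed

lemma binary_form_add: "binary_form d p \<Longrightarrow> binary_form d q \<Longrightarrow> binary_form d (p + q)"
  using keys_add[of p q] unfolding binary_form_def homogeneous_def by blast

lemma binary_form_diff: "binary_form d p \<Longrightarrow> binary_form d q \<Longrightarrow> binary_form d (p - q)"
  for p q :: "(3, 'a::comm_ring_1) mpoly"
  using keys_diff[of p q] unfolding binary_form_def homogeneous_def by blast

lemma binary_form_mult:
  fixes p q :: "(3, 'a::comm_ring_1) mpoly"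
  assumes "binary_form d p" "binary_form e q" shows "binary_form (d + e) (p * q)"
  unfolding binary_form_def homogeneous_def
proof (intro conjI ballI)
  fix m assume "m \<in> Poly_Mapping.keys (p * q)"
  then obtain a b where "m = a + b" "a \<in> Poly_Mapping.keys p" "b \<in> Poly_Mapping.keys q"
    using keys_mult[of p q] by blast
  then show "(\<Sum>i\<in>UNIV. Poly_Mapping.lookup m i) = d + e" "Poly_Mapping.lookup m 3 = 0"
    using assms unfolding binary_form_def homogeneous_def by (simp_all add: lookup_add sum.distrib)
qed

lemma binary_form_mult_eq:
  fixes p q :: "(3, 'a::comm_ring_1) mpoly"
  shows "binary_form d p \<Longrightarrow> binary_form e q \<Longrightarrow> n = d + e \<Longrightarrow> binary_form n (p * q)"
  using binary_form_mult by blast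

lemma binary_form_Const: "binary_form 0 (Const c)"
  by (auto simp: binary_form_def homogeneous_def Const_def)

lemma binary_form_one: "binary_form 0 (1 :: (3, 'a::comm_ring_1) mpoly)"
  using binary_form_Const[of "1::'a"] by (simp add: Const_one)

lemma binary_form_Var: "binary_form 1 pX" "binary_form 1 pY"
  by (simp_all add: binary_form_def homogeneous_def Var_def sum_3 lookup_single when_def)

lemma binary_form_power: "binary_form d p \<Longrightarrow> binary_form (n * d) (p ^ n)"
  for p :: "(3, 'a::comm_ring_1) mpoly"
  by (induction n) (auto simp: binary_form_one intro: binary_form_mult)

lemma binary_form_prod:
  fixes p :: "'b \<Rightarrow> (3, 'a::comm_ring_1) mpoly"
  shows "finite A \<Longrightarrow> (\<And>k. k \<in> A \<Longrightarrow> binary_form d (p k)) \<Longrightarrow> binary_form (card A * d) (\<Prod>k\<in>A. p k)"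
  by (induction A rule: finite_induct) (auto simp: binary_form_one intro: binary_form_mult)

lemma binary_form_sum:
  fixes p :: "'b \<Rightarrow> (3, 'a::comm_ring_1) mpoly"
  shows "(\<And>k. k \<in> A \<Longrightarrow> binary_form d (p k)) \<Longrightarrow> binary_form d (\<Sum>k\<in>A. p k)"
proof (induction A rule: infinite_finite_induct)
  case (insert x A)
  then show ?case by (auto intro: binary_form_add)
qed (simp_all add: binary_form_def homogeneous_def)

lemma binary_form_A5:
  fixes i :: "'a::field"
  shows "binary_form (12 * n1 + 20 * n2 + 30 * n3 + 60 * t) (A5_form i n1 n2 n3 t a)"
proof -
  have X: "binary_form n (pX ^ n :: (3, 'a) mpoly)" and Y: "binary_form n (pY ^ n :: (3, 'a) mpoly)"
    and XY: "binary_form (2 * n) ((pX * pY) ^ n :: (3, 'a) mpoly)"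
    for n :: nat
    using binary_form_power[OF binary_form_Var(1), of n] binary_form_power[OF binary_form_Var(2), of n]
      binary_form_power[OF binary_form_mult[OF binary_form_Var], of n] by (simp_all add: mult.commute numeral_2_eq_2)
  have C: "binary_form d (Const c * p)" if "binary_form d p" for d c and p :: "(3, 'a) mpoly"
    using binary_form_mult[OF binary_form_Const that] by simp
  have "binary_form 12 (G12 b)" for b :: 'a
    unfolding G12_def by (rule binary_form_mult_eq[where e = 10, OF binary_form_mult[OF binary_form_Var]])
      (intro binary_form_add X Y C XY[of 5, simplified], simp)
  moreover have "binary_form 20 (G20 b c)" for b c :: 'a
    unfolding G20_def by (intro binary_form_add X Y C XY[of 10, simplified] binary_form_mult_eq[where e = 10, OF C[OF XY[of 5]]]) simp
  moreover have "binary_form 30 (G30 b c)" for b c :: 'a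
    unfolding G30_def by (intro binary_form_add binary_form_diff X Y binary_form_mult_eq[where e = 20, OF C[OF XY[of 5]]] binary_form_mult_eq[where e = 10, OF C[OF XY[of 10]]]) simp_all
  moreover have "binary_form 60 (G60 i b)" for b
    unfolding G60_def
    by (intro binary_form_add binary_form_sum X Y C XY[of 30, simplified])
      (rule binary_form_mult_eq[OF C[OF XY] binary_form_add[OF X Y]], auto)
  ultimately have "binary_form (n1 * 12 + n2 * 20 + n3 * 30 + card {1..t} * 60) (A5_form i n1 n2 n3 t a)"
    unfolding A5_form_def by (intro binary_form_mult binary_form_power binary_form_prod) auto
  then show ?thesis by (simp add: mult.commute)
qed

lemma zeta4_square: "compatible_roots \<zeta> \<Longrightarrow> \<zeta> 4 ^ 2 = (- 1 :: 'a::field)"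
proof -
  assume "compatible_roots \<zeta>"
  then have "\<zeta> 4 ^ 4 = 1" "\<zeta> 4 ^ 2 \<noteq> 1" by (auto simp: compatible_roots_def primitive_root_of_unity_def)
  then have "(\<zeta> 4 ^ 2 - 1) * (\<zeta> 4 ^ 2 + 1) = 0" by Groebner_Basis.algebra
  then show ?thesis using \<open>\<zeta> 4 ^ 2 \<noteq> 1\<close> by (simp add: eq_neg_iff_add_eq_0)
qed

text \<open>The choice of the square root of 5 dictates the fifth root of unity:
  \<open>2 \<psi> + 1\<close> is one root for \<open>\<eta> = \<zeta> 5\<close> and the opposite one
  for its cube. The exponent \<open>k\<close> later expresses \<open>Dm\<close> as a power of the
  generator with entry \<open>\<zeta> 5\<close>.\<close>

lemma icosa_of_roots:
  fixes \<zeta> :: "nat \<Rightarrow> 'a::{alg_closed_field, field_char_0}"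
  assumes z: "compatible_roots \<zeta>" and s: "s ^ 2 = 5"
  obtains \<eta> \<kappa> k where "icosa (\<zeta> 4) \<eta> \<kappa>" "s = 2 * (\<eta> ^ 2 + \<eta> ^ 3) + 1" "\<eta> ^ 2 = \<zeta> 5 ^ k"
proof -
  have p: "primitive_root_of_unity n (\<zeta> n)" if "n > 0" for n using z that by (simp add: compatible_roots_def)
  have i: "\<zeta> 4 ^ 2 = - 1" by (rule zeta4_square[OF z])
  define \<omega> where "\<omega> = \<zeta> 5"
  have w5: "\<omega> ^ 5 = 1" and w1: "\<omega> ^ 1 \<noteq> 1" and w3: "\<omega> ^ 3 \<noteq> 1" using p[of 5] by (auto simp: primitive_root_of_unity_def \<omega>_def)
  have "(\<omega> - 1) * (1 + \<omega> + \<omega> ^ 2 + \<omega> ^ 3 + \<omega> ^ 4) = 0" using w5 by Groebner_Basis.algebra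
  then have w: "1 + \<omega> + \<omega> ^ 2 + \<omega> ^ 3 + \<omega> ^ 4 = 0" using w1 by simp
  have ex: "icosa (\<zeta> 4) \<eta> (inverse (\<eta> - \<eta> ^ 4))" if e: "1 + \<eta> + \<eta> ^ 2 + \<eta> ^ 3 + \<eta> ^ 4 = 0" for \<eta>
  proof -
    have "\<eta> - \<eta> ^ 4 \<noteq> 0"
    proof
      assume "\<eta> - \<eta> ^ 4 = 0"
      then have "(5::'a) = 0" using e by Groebner_Basis.algebra
      then show False by simp
    qed
    then show ?thesis using i e by (intro icosa.intro) simp_all
  qed
  \<comment> \<open>The quadratic Gauss sum \<open>2 (\<omega> + \<omega>^4) + 1\<close> is a square
    root of 5.\<close>
  have "(s - (2 * (\<omega> + \<omega> ^ 4) + 1)) * (s + (2 * (\<omega> + \<omega> ^ 4) + 1)) = 0" using w s by Groebner_Basis.algebra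
  then have "s - (2 * (\<omega> + \<omega> ^ 4) + 1) = 0 \<or> s + (2 * (\<omega> + \<omega> ^ 4) + 1) = 0" by (simp only: mult_eq_0_iff)
  then consider "s = 2 * (\<omega> + \<omega> ^ 4) + 1" | "s = - (2 * (\<omega> + \<omega> ^ 4) + 1)"
    unfolding eq_iff_diff_eq_0[symmetric] eq_neg_iff_add_eq_0[symmetric] by blast
  then show ?thesis
  proof cases
    case 1
    have "1 + \<omega> ^ 3 + (\<omega> ^ 3) ^ 2 + (\<omega> ^ 3) ^ 3 + (\<omega> ^ 3) ^ 4 = 0" using w by Groebner_Basis.algebra
    moreover have "s = 2 * ((\<omega> ^ 3) ^ 2 + (\<omega> ^ 3) ^ 3) + 1" using 1 w by Groebner_Basis.algebra
    moreover have "(\<omega> ^ 3) ^ 2 = \<omega> ^ 1" using w5 by Groebner_Basis.algebra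
    ultimately show ?thesis using that ex unfolding \<omega>_def by blast
  next
    case 2
    have "s = 2 * (\<omega> ^ 2 + \<omega> ^ 3) + 1" using 2 w by Groebner_Basis.algebra
    then show ?thesis using that ex[OF w] unfolding \<omega>_def by blast
  qed
qed

lemma pgl_class_hom: "pgl_class \<in> hom GL (PGL :: ('a::field^'n^'n) set monoid)"
  by (rule homI) (auto simp: GL_simps PGL_carrier PGL_mult)

lemma block_class_hom: "(\<lambda>M. pgl_class (blk M 1)) \<in> hom GL (PGL :: ('a::field^3^3) set monoid)"
proof (rule homI)
  fix M N :: "'a^2^2" assume "M \<in> carrier GL" "N \<in> carrier GL"
  then show "pgl_class (blk (M \<otimes>\<^bsub>GL\<^esub> N) 1) = pgl_class (blk M 1) \<otimes>\<^bsub>PGL\<^esub> pgl_class (blk N 1)"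
    by (simp add: GL_simps PGL_mult invertible_blk blk_mult)
qed (auto simp: GL_simps PGL_carrier invertible_blk)

lemma mpow_m2_diag: "mpow (m2 a 0 0 b) n = m2 (a ^ n) 0 0 ((b::'a::comm_ring_1) ^ n)"
  by (induction n) (simp_all add: m2_mult m2_one mult.commute)

lemma subgroup_preimage:
  assumes "group_hom G K h" "subgroup H K" shows "subgroup {x \<in> carrier G. h x \<in> H} G"
proof -
  interpret h: group_hom G K h by (rule assms)
  interpret H: subgroup H K by (rule assms)
  show ?thesis by (rule group.subgroupI[OF group_hom.axioms(1)[OF assms(1)]]) (use h.hom_one H.one_closed in auto)
qed

section \<open>The linear group preserving the normal form and its generators\<close>

context icosa_ext
begin

lemma z_roots: assumes c: "c ^ n = 1" obtains k where "c = z ^ k"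
proof -
  define p :: "'a poly" where "p = Polynomial.monom 1 n - 1"
  have "Polynomial.coeff p n = 1" using n by (simp add: p_def)
  then have p0: "p \<noteq> 0" by auto
  have "Polynomial.degree p \<le> n" unfolding p_def by (intro degree_diff_le degree_monom_le) simp_all
  then have card: "card {x. poly p x = 0} \<le> n" using card_poly_roots_bound[OF p0] by simp
  have e: "poly p x = x ^ n - 1" for x by (simp add: p_def poly_monom)
  have sub: "(\<lambda>k. z ^ k) ` {..<n} \<subseteq> {x. poly p x = 0}"
    by (auto simp: e) (metis mult.commute power_mult power_one zn)
  have "inj_on (\<lambda>k. z ^ k) {..<n}" by (rule inj_onI) (simp add: z_eq)
  then have "card ((\<lambda>k. z ^ k) ` {..<n}) = n" by (simp add: card_image)
  then have "(\<lambda>k. z ^ k) ` {..<n} = {x. poly p x = 0}"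
    using card_seteq[OF poly_roots_finite[OF p0] sub] card by simp
  then have "c \<in> (\<lambda>k. z ^ k) ` {..<n}" using c by (simp add: e)
  then show ?thesis using that by blast
qed

text \<open>The class of a matrix preserving the form lies in the stabiliser, which is
  \<open>IG\<close> by \<open>stab_ico\<close>, so the matrix is \<open>c rep g\<close>. Since
  \<open>rep g\<close> preserves the form, \<open>c^n = 1\<close>.\<close>

lemma Gam_ico:
  assumes d: "n = 12 * n1 + 20 * n2 + 30 * n3 + 60 * t"
  shows "Gam (ico_form i n1 n2 n3 t a) = carrier EE"
proof -
  let ?F = "ico_form i n1 n2 n3 t a"
  have F: "bform n ?F" unfolding d by (rule bform_ico)
  have val: "?F ((mat c ** rep g) *v v) = c ^ n * ?F v" for c g v
    by (simp add: mat_mult_vec bform_homog[OF F] ico_rep)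
  show ?thesis
  proof (intro equalityI subsetI)
    fix M assume M: "M \<in> Gam ?F"
    then have "pgl_class M \<in> stab ?F" using Gam_stab[OF F n(1)] by blast
    then have "pgl_class M \<in> IG" using stab_ico[of n1 n2 n3 t a] d n(1) by simp
    then obtain g where g: "g \<in> carrier SL2_F5" "pgl_class M = pgl_class (rep g)" by (auto simp: IG_def cl_def)
    then obtain c where c: "M = mat c ** rep g" unfolding pgl_class_eq_iff by blast
    obtain w where w: "?F w \<noteq> 0" using ico_nonzero by blast
    have "?F (M *v w) = ?F w" using M by (simp add: Gam_def)
    then have "c ^ n = 1" using w val by (simp add: c)
    then obtain k where "c = z ^ k" by (rule z_roots)
    then show "M \<in> carrier EE" using EE_I[OF g(1)] c by simp
  next
    fix M assume "M \<in> carrier EE"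
    then obtain k g where k: "k \<in> carrier C" "g \<in> carrier SL2_F5" "M = mat (zp k) ** rep g" by (rule EE_cases)
    have "zp k ^ n = 1" unfolding zp_def by (metis mult.commute power_mult power_one zn)
    then have "?F (M *v v) = ?F v" for v using val by (simp add: k)
    moreover have "invertible M" unfolding k using zp_nz by (intro invertible_mult invertible_mat rep_invertible)
    ultimately show "M \<in> Gam ?F" by (simp add: Gam_def)
  qed
qed

text \<open>Once the scalars are present, generation can be tested in PGL_2. The classes of the
  preimage \<open>H1\<close> contain those of \<open>Dm\<close> and \<open>Wm\<close>, hence
  \<open>IG\<close>, so an element of \<open>EE\<close> is \<open>b N\<close> with \<open>N\<close>
  in \<open>H1\<close>; comparing determinants gives \<open>b^n = 1\<close>, and \<open>b\<close> is
  a power of \<open>z\<close>. The inverse of \<open>z\<close> occurs because diag(1, 1, z) has this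
  scalar block after its corner is normalised. The exponent \<open>l\<close> allows for a generator
  of which \<open>Dm\<close> is a power.\<close>

lemma EE_generate:
  fixes B :: "('a^3^3) set set" and l :: nat
  defines "H \<equiv> generate PGL B"
  assumes sub: "B \<subseteq> (\<lambda>M. pgl_class (blk M 1)) ` carrier EE"
    and sc: "pgl_class (blk (mat (inverse z)) 1) \<in> H"
    and D: "invertible M" "pgl_class (blk M 1) \<in> H" "pgl_class M [^]\<^bsub>PGL\<^esub> l = pgl_class Dm"
    and W: "invertible N" "pgl_class (blk N 1) \<in> H" "pgl_class N = pgl_class Wm"
  shows "H = (\<lambda>M. pgl_class (blk M 1)) ` carrier EE"
proof -
  let ?j = "\<lambda>M::'a^2^2. pgl_class (blk M 1) :: ('a^3^3) set"
  interpret j: group_hom GL PGL ?j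
    using GL_group PGL_group block_class_hom by (simp add: group_hom_def group_hom_axioms_def)
  interpret q: group_hom GL "PGL :: ('a^2^2) set monoid" pgl_class
    using GL_group PGL_group pgl_class_hom by (simp add: group_hom_def group_hom_axioms_def)
  have jE: "subgroup (?j ` carrier EE) PGL" by (rule j.subgroup_img_is_subgroup[OF EE_subgroup])
  have HE: "H \<subseteq> ?j ` carrier EE" unfolding H_def by (rule group.generate_subgroup_incl[OF PGL_group sub jE])
  have "B \<subseteq> carrier PGL" using sub subgroup.subset[OF jE] by (rule order_trans)
  then have H: "subgroup H PGL" unfolding H_def by (rule group.generate_is_subgroup[OF PGL_group])
  define H1 where "H1 = {M \<in> carrier GL. ?j M \<in> H}"
  have H1: "subgroup H1 GL" unfolding H1_def by (rule subgroup_preimage[OF _ H]) (rule j.group_hom_axioms)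
  interpret H1: subgroup H1 GL by (rule H1)
  have H2: "subgroup (pgl_class ` H1) PGL" by (rule q.subgroup_img_is_subgroup[OF H1])
  have pw: "mpow A k \<in> H1" if "A \<in> H1" for A k
    using that H1.m_closed H1.one_closed by (induction k) (simp_all add: GL_simps)
  have "M \<in> H1" "N \<in> H1" using D W by (simp_all add: H1_def GL_simps)
  moreover have "pgl_class (mpow M l) = pgl_class Dm" using PGL_pow[OF D(1), of l] D(3) by simp
  ultimately have "pgl_class Dm \<in> pgl_class ` H1" "pgl_class Wm \<in> pgl_class ` H1"
    using pw W(3) by (metis imageI)+
  then have IG: "IG \<subseteq> pgl_class ` H1" by (rule IG_least[OF H2])
  have iz: "mat (inverse z) \<in> H1" using sc z_nz by (simp add: H1_def GL_simps invertible_mat)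
  have zH: "mat (z ^ k) \<in> H1" for k
  proof -
    have "mat (inverse z) ** mat z = (mat 1 :: 'a^2^2)" using z_nz by (simp add: mat_mult_mat)
    then have "inv\<^bsub>GL\<^esub> (mat (inverse z)) = (mat z :: 'a^2^2)"
      using z_nz by (intro group.inv_equality[OF GL_group]) (simp_all add: GL_simps invertible_mat mat_mult_mat)
    then have "mat z \<in> H1" using H1.m_inv_closed[OF iz] by simp
    moreover have "mpow (mat z) k = (mat (z ^ k) :: 'a^2^2)" by (simp add: mat_m2 mpow_m2_diag)
    ultimately show ?thesis using pw by metis
  qed
  have "?j L \<in> H" if L: "L \<in> carrier EE" for L
  proof -
    obtain k g where k: "k \<in> carrier C" "g \<in> carrier SL2_F5" "L = mat (zp k) ** rep g" using L by (rule EE_cases)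
    have "cl g \<in> pgl_class ` H1" using IG k(2) by (auto simp: IG_def)
    then obtain N where N: "N \<in> H1" "pgl_class (rep g) = pgl_class N" by (auto simp: cl_def)
    then obtain c where c: "rep g = mat c ** N" unfolding pgl_class_eq_iff by blast
    have "?j N \<in> H" using N(1) unfolding H1_def by blast
    then obtain N' where N': "N' \<in> carrier EE" "?j N = ?j N'" using HE by blast
    then have "N \<in> carrier EE" unfolding blk_class_eq by blast
    then obtain l h where h: "l \<in> carrier C" "h \<in> carrier SL2_F5" "N = mat (zp l) ** rep h" by (rule EE_cases)
    define b where "b = zp k * c"
    have LN: "L = mat b ** N" unfolding k c b_def by (simp add: matrix_mul_assoc mat_mult_mat)
    have dt: "det (mat x ** rep g) = x ^ 2" if "g \<in> carrier SL2_F5" for x g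
      using det_rep[OF that] by (simp add: det_mul mat_m2 m2_det power2_eq_square)
    have "L = mat (b * zp l) ** rep h" unfolding LN h by (simp add: matrix_mul_assoc mat_mult_mat)
    then have "(b * zp l) ^ 2 = zp k ^ 2" using dt[OF k(2), of "zp k"] dt[OF h(2), of "b * zp l"] k(3) by simp
    then have "((b * zp l) ^ 2) ^ (n div 2) = (zp k ^ 2) ^ (n div 2)" by simp
    then have "(b * zp l) ^ n = zp k ^ n" using n(2) by (simp flip: power_mult)
    moreover have one: "zp k ^ n = 1" for k unfolding zp_def by (metis mult.commute power_mult power_one zn)
    ultimately have "b ^ n * zp l ^ n = 1" by (simp only: power_mult_distrib)
    then have "b ^ n = 1" by (simp only: one mult_1_right)
    then obtain m where m: "b = z ^ m" by (rule z_roots)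
    have "mat (z ^ m) ** N \<in> H1" using H1.m_closed[OF zH[of m] N(1)] unfolding GL_simps .
    then show ?thesis unfolding LN m H1_def by blast
  qed
  then show ?thesis using HE by blast
qed

text \<open>Dividing by the corner entry \<open>w\<close> turns a block that multiplies the form by
  \<open>w^n\<close> into one that preserves it.\<close>

lemma block_generator:
  assumes d: "n = 12 * n1 + 20 * n2 + 30 * n3 + 60 * t"
    and M: "invertible M" "w \<noteq> 0" and F: "\<And>v. ico_form i n1 n2 n3 t a (M *v v) = w ^ n * ico_form i n1 n2 n3 t a v"
  shows "pgl_class (blk M w) \<in> (\<lambda>M. pgl_class (blk M 1)) ` carrier EE"
proof -
  let ?F = "ico_form i n1 n2 n3 t a"
  have "bform n ?F" unfolding d by (rule bform_ico)
  then have "?F ((mat (inverse w) ** M) *v v) = inverse w ^ n * ?F (M *v v)" for v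
    unfolding mat_mult_vec by (rule bform_homog)
  moreover have "inverse w ^ n * w ^ n = 1" using M(2) by (simp flip: power_mult_distrib)
  ultimately have "?F ((mat (inverse w) ** M) *v v) = ?F v" for v
    unfolding F by (simp flip: mult.assoc)
  then have "mat (inverse w) ** M \<in> Gam ?F" using M by (simp add: Gam_def invertible_mult invertible_mat)
  then have "mat (inverse w) ** M \<in> carrier EE" by (simp add: Gam_ico[OF d])
  then show ?thesis unfolding blk_class[OF M(2), of M] by (rule imageI)
qed

end

text \<open>Among the factors only \<open>f30\<close> is odd under the exchange of the variables.
  The corner entry \<open>\<zeta> (2 * d) ^ n3\<close> of the corresponding generator makes up for
  the sign.\<close>

lemma ico_form_swap:
  fixes i :: "'a::field_char_0"
  assumes i: "i ^ 2 = - 1"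
  shows "ico_form i n1 n2 n3 t a (m2 0 1 1 0 *v v) = (- 1) ^ n3 * ico_form i n1 n2 n3 t a v"
proof -
  obtain x y where v: "v = v2 x y" by (rule v2_cases)
  have "f12 i (v2 y x) = f12 i (v2 x y)" "f20 i (v2 y x) = f20 i (v2 x y)" "f30 i (v2 y x) = - f30 i (v2 x y)"
    by (simp_all add: f12_def f20_def f30_def mult.commute algebra_simps)
  moreover from this have "f60 i b (v2 y x) = f60 i b (v2 x y)" for b by (simp only: f60_pencil[OF i])
  ultimately show ?thesis by (simp add: v ico_form_def power_minus' power_minus[of "f30 i (v2 x y)"])
qed

text \<open>Outside the factor \<open>XY\<close> of \<open>f12\<close> all exponents of
  \<open>X\<close> are multiples of 5. The corner entry \<open>\<zeta> (5 * d) ^ n1\<close>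
  compensates for that factor.\<close>

lemma ico_form_diag:
  fixes i :: "'a::field_char_0"
  assumes i: "i ^ 2 = - 1" and w: "w ^ 5 = 1"
  shows "ico_form i n1 n2 n3 t a (m2 w 0 0 1 *v v) = w ^ n1 * ico_form i n1 n2 n3 t a v"
proof -
  obtain x y where v: "v = v2 x y" by (rule v2_cases)
  have k: "w ^ (5 * k) = 1" for k by (simp add: power_mult w)
  have p: "w ^ 10 = 1" "w ^ 20 = 1" "w ^ 30 = 1" using k[of 2] k[of 4] k[of 6] by simp_all
  have "f12 i (v2 (w * x) y) = w * f12 i (v2 x y)" "f20 i (v2 (w * x) y) = f20 i (v2 x y)" "f30 i (v2 (w * x) y) = f30 i (v2 x y)"
    by (simp_all add: f12_def f20_def f30_def power_mult_distrib p w algebra_simps)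
  moreover from this have "f60 i b (v2 (w * x) y) = f60 i b (v2 x y)" for b
    by (simp add: f60_pencil[OF i] power_mult_distrib w)
  ultimately show ?thesis by (simp add: v ico_form_def power_mult_distrib)
qed

text \<open>Here \<open>q\<close> is the square of the factor by which the block of the fourth
  generator differs from \<open>Wm\<close>, and the exponent on the left is \<open>d / 2\<close>.
  The constants are \<open>q^6\<close>, \<open>q^10\<close>, \<open>q^15\<close> and
  \<open>q^30\<close> for \<open>q = -(\<phi> + 2)\<close> and \<open>\<phi> = (1 + s) / 2\<close>:
  the sign stems from the odd exponent 15, the factor 1/2 from
  \<open>34 + 55 \<phi> = (123 + 55 s) / 2\<close>.\<close>

lemma nu_power:
  fixes s :: "'a::field_char_0"
  assumes s: "s ^ 2 = 5" and q: "q = - ((1 + s) / 2 + 2)"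
  shows "q ^ (6 * n1 + 10 * n2 + 15 * n3 + 30 * t) =
    (- 1) ^ n3 * inverse 2 ^ n2 * 5 ^ (3 * n1 + 5 * n2 + 7 * n3 + 15 * t)
          * (9 + 4 * s) ^ n1 * (123 + 55 * s) ^ n2 * (1525 + 682 * s) ^ n3 * (930249 + 416020 * s) ^ t"
proof -
  define \<phi> where "\<phi> = (1 + s) / 2"
  have s2: "s = 2 * \<phi> - 1" by (simp add: \<phi>_def field_simps)
  have "4 * (\<phi> ^ 2 - \<phi> - 1) = s ^ 2 - 5" by (simp add: s2 power2_eq_square algebra_simps)
  then have "4 * (\<phi> ^ 2 - \<phi> - 1) = 0" using s by simp
  then have "\<phi> ^ 2 - \<phi> - 1 = 0" unfolding mult_eq_0_iff by simp
  then have p: "\<phi> ^ 2 = \<phi> + 1" by (simp add: algebra_simps)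
  have q: "q = - (\<phi> + 2)" by (simp add: q \<phi>_def)
  have h: "34 + 55 * \<phi> = inverse 2 * (123 + 55 * s)" by (simp add: s2 field_simps)
  have "q ^ 6 = 125 * (9 + 4 * s)" unfolding q s2 using p by Groebner_Basis.algebra
  moreover have "q ^ 10 = 3125 * (34 + 55 * \<phi>)" unfolding q using p by Groebner_Basis.algebra
  moreover have "q ^ 15 = - 78125 * (1525 + 682 * s)" unfolding q s2 using p by Groebner_Basis.algebra
  moreover have "q ^ 30 = 30517578125 * (930249 + 416020 * s)" unfolding q s2 using p by Groebner_Basis.algebra
  moreover have "5 ^ 3 = (125::'a)" "5 ^ 5 = (3125::'a)" "5 ^ 7 = (78125::'a)" "5 ^ 15 = (30517578125::'a)" by simp_all
  ultimately have e: "q ^ 6 = 5 ^ 3 * (9 + 4 * s)" "q ^ 10 = 5 ^ 5 * (inverse 2 * (123 + 55 * s))"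
    "q ^ 15 = (- 1) * 5 ^ 7 * (1525 + 682 * s)" "q ^ 30 = 5 ^ 15 * (930249 + 416020 * s)"
    unfolding h by (simp_all only: mult_minus_left mult_1_left)
  show ?thesis unfolding power_add power_mult e power_mult_distrib by (simp only: mult_ac)
qed

section \<open>Curves with icosahedral reduced automorphism group\<close>

lemma stab_conj_iso:
  fixes F F' :: "'a::field^2 \<Rightarrow> 'a"
  assumes M: "invertible M" and c: "c \<noteq> 0" and FF: "\<And>u. F' (M *v u) = c * F u"
  shows "PGL\<lparr>carrier := stab F\<rparr> \<cong> PGL\<lparr>carrier := stab F'\<rparr>"
proof -
  interpret P: group "PGL :: ('a^2^2) set monoid" by (rule PGL_group)
  obtain N where N: "M ** N = mat 1" "N ** M = mat 1" "invertible N" using M by (rule invertible_inv)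
  let ?m = "pgl_class M"
  let ?f = "\<lambda>A. ?m \<otimes>\<^bsub>PGL\<^esub> A \<otimes>\<^bsub>PGL\<^esub> inv\<^bsub>PGL\<^esub> ?m"
  have m: "?m \<in> carrier PGL" using M by (auto simp: PGL_carrier)
  have im: "inv\<^bsub>PGL\<^esub> ?m = pgl_class N" by (rule PGL_inv[OF N(1,2)])
  have f: "?f (pgl_class A) = pgl_class (M ** A ** N)" if "invertible A" for A
    unfolding im using that M N(3) by (simp add: PGL_mult invertible_mult)
  have sub: "stab F \<subseteq> carrier PGL" by (rule subgroup.subset[OF stab_subgroup])
  have F': "F' v = c * F (N *v v)" for v using FF[of "N *v v"] by (simp add: matrix_vector_mul_assoc N)
  have "?f ` stab F = stab F'"
  proof (intro equalityI subsetI)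
    fix B assume "B \<in> ?f ` stab F"
    then obtain A k where A: "invertible A" "k \<noteq> 0" "\<And>v. F (A *v v) = k * F v" "B = ?f (pgl_class A)"
      by (auto simp: stab_def)
    have "F' ((M ** A ** N) *v v) = k * F' v" for v
    proof -
      have e: "(M ** A ** N) *v v = M *v (A *v (N *v v))" by (simp only: matrix_vector_mul_assoc matrix_mul_assoc)
      have "F' ((M ** A ** N) *v v) = c * (k * F (N *v v))" unfolding e FF A(3) ..
      also have "\<dots> = k * F' v" unfolding F'[of v] by simp
      finally show ?thesis .
    qed
    moreover have "invertible (M ** A ** N)" using M A(1) N(3) by (simp add: invertible_mult)
    ultimately show "B \<in> stab F'" using A(2) unfolding A(4) f[OF A(1)] stab_def by blast
  next
    fix B assume "B \<in> stab F'"
    then obtain A k where A: "invertible A" "k \<noteq> 0" "\<And>v. F' (A *v v) = k * F' v" "B = pgl_class A"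
      by (auto simp: stab_def)
    have "F ((N ** A ** M) *v v) = k * F v" for v
    proof -
      have e: "(N ** A ** M) *v v = N *v (A *v (M *v v))" by (simp only: matrix_vector_mul_assoc matrix_mul_assoc)
      have "c * F ((N ** A ** M) *v v) = F' (A *v (M *v v))" unfolding e F' ..
      also have "\<dots> = c * (k * F v)" unfolding A(3) FF by simp
      finally show ?thesis using c by simp
    qed
    moreover have i: "invertible (N ** A ** M)" using M A(1) N(3) by (simp add: invertible_mult)
    ultimately have s: "pgl_class (N ** A ** M) \<in> stab F" using A(2) unfolding stab_def by blast
    have "M ** (N ** A ** M) ** N = (M ** N) ** A ** (M ** N)" by (simp only: matrix_mul_assoc)
    then have "B = ?f (pgl_class (N ** A ** M))" unfolding f[OF i] A(4) by (simp add: N)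
    then show "B \<in> ?f ` stab F" using s by (rule image_eqI)
  qed
  moreover have "inj_on ?f (stab F)" using sub m by (auto intro!: inj_onI simp: subset_iff)
  moreover have "?f (A \<otimes>\<^bsub>PGL\<^esub> B) = ?f A \<otimes>\<^bsub>PGL\<^esub> ?f B" if "A \<in> stab F" "B \<in> stab F" for A B
  proof -
    have c: "A \<in> carrier PGL" "B \<in> carrier PGL" using that sub by auto
    have "?f A \<otimes>\<^bsub>PGL\<^esub> ?f B = ?m \<otimes>\<^bsub>PGL\<^esub> A \<otimes>\<^bsub>PGL\<^esub> (inv\<^bsub>PGL\<^esub> ?m \<otimes>\<^bsub>PGL\<^esub> ?m) \<otimes>\<^bsub>PGL\<^esub> B \<otimes>\<^bsub>PGL\<^esub> inv\<^bsub>PGL\<^esub> ?m"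
      using c m by (simp only: P.m_assoc P.m_closed P.inv_closed)
    also have "\<dots> = ?f (A \<otimes>\<^bsub>PGL\<^esub> B)" using c m by (simp add: P.m_assoc)
    finally show ?thesis by simp
  qed
  ultimately have "?f \<in> iso (PGL\<lparr>carrier := stab F\<rparr>) (PGL\<lparr>carrier := stab F'\<rparr>)"
    by (auto simp: iso_def hom_def bij_betw_def)
  then show ?thesis by (auto simp: is_iso_def)
qed

lemma stab_rep:
  assumes F: "bform d F" and M: "pgl_class M \<in> stab F"
  obtains c where "c \<noteq> 0" "\<And>v. F (M *v v) = c * F v"
proof -
  obtain N k where N: "pgl_class M = pgl_class N" "k \<noteq> 0" "\<And>v. F (N *v v) = k * F v" using M unfolding stab_def by blast
  obtain c where c: "c \<noteq> 0" "M = mat c ** N" using N(1) unfolding pgl_class_eq_iff by blast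
  have "F (M *v v) = (c ^ d * k) * F v" for v by (simp add: c mat_mult_vec bform_homog[OF F] N(3))
  moreover have "c ^ d * k \<noteq> 0" using c N(2) by simp
  ultimately show ?thesis using that by blast
qed

lemma card_zeros_comp:
  fixes F :: "'a::field^2 \<Rightarrow> 'a"
  assumes F: "bform d F" and M: "invertible M"
  shows "card (zeros (\<lambda>v. F (M *v v))) = card (zeros F)"
proof -
  obtain N where N: "M ** N = mat 1" "N ** M = mat 1" "invertible N" using M by (rule invertible_inv)
  have act: "pgl_act (pgl_class M) (proj_point v) = proj_point (M *v v)" for v by (rule pgl_act_point)
  have nz: "M *v v \<noteq> 0" "N *v v \<noteq> 0" if "v \<noteq> 0" for v using invertible_vec_nz M N(3) that by blast+
  have ps: "proj_point v \<in> proj_space" if "v \<noteq> 0" for v :: "'a^2" using that by (auto simp: proj_space_def)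
  note FM = bform_comp[OF F, of M]
  have "bij_betw (pgl_act (pgl_class M)) (zeros (\<lambda>v. F (M *v v))) (zeros F)"
  proof (rule bij_betw_byWitness[where f' = "pgl_act (pgl_class N)"])
    show "\<forall>P\<in>zeros (\<lambda>v. F (M *v v)). pgl_act (pgl_class N) (pgl_act (pgl_class M) P) = P"
      by (auto elim!: zeros_cases[OF FM] simp: pgl_act_point matrix_vector_mul_assoc N)
    show "\<forall>P\<in>zeros F. pgl_act (pgl_class M) (pgl_act (pgl_class N) P) = P"
      by (auto elim!: zeros_cases[OF F] simp: pgl_act_point matrix_vector_mul_assoc N)
    show "pgl_act (pgl_class M) ` zeros (\<lambda>v. F (M *v v)) \<subseteq> zeros F"
    proof (intro image_subsetI)
      fix P assume "P \<in> zeros (\<lambda>v. F (M *v v))"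
      then obtain v where "v \<noteq> 0" "P = proj_point v" "F (M *v v) = 0" by (rule zeros_cases[OF FM])
      then show "pgl_act (pgl_class M) P \<in> zeros F" using zeros_point[OF F] ps nz by (simp add: pgl_act_point)
    qed
    show "pgl_act (pgl_class N) ` zeros F \<subseteq> zeros (\<lambda>v. F (M *v v))"
    proof (intro image_subsetI)
      fix P assume "P \<in> zeros F"
      then obtain v where "v \<noteq> 0" "P = proj_point v" "F v = 0" by (rule zeros_cases[OF F])
      then show "pgl_act (pgl_class N) P \<in> zeros (\<lambda>v. F (M *v v))"
        using zeros_point[OF FM] ps nz by (simp add: pgl_act_point matrix_vector_mul_assoc N)
    qed
  qed
  then show ?thesis by (rule bij_betw_same_card)
qed

context icosa
begin

lemma gens_rep: "Dm \<in> rep ` carrier SL2_F5" "Tm \<in> rep ` carrier SL2_F5" "Wm \<in> rep ` carrier SL2_F5"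
proof -
  have "rep (m2 1 1 0 1) = Dm" "rep (m2 2 0 0 3) = Tm" "rep (m2 0 (-1) 1 0) = Wm"
    by (simp_all add: rep_m2 br.H_def br.U_def GL_simps GL_pow)
  moreover have "m2 1 1 0 1 \<in> carrier SL2_F5" "m2 2 0 0 3 \<in> carrier SL2_F5" "m2 0 (-1) 1 0 \<in> carrier SL2_F5"
    by (simp_all add: SL2_carrier)
  ultimately show "Dm \<in> rep ` carrier SL2_F5" "Tm \<in> rep ` carrier SL2_F5" "Wm \<in> rep ` carrier SL2_F5"
    by (metis imageI)+
qed

text \<open>The eigenvalues \<open>\<eta>\<close>, \<open>\<eta>^4\<close> and 1 of the first matrix
  are distinct, so it fixes the three coordinate points only, and the second matrix exchanges two of
  these.\<close>

lemma fixed_vertex: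
  fixes q :: "'a^3"
  assumes q: "q \<noteq> 0" and D: "proj_point (blk Dm 1 *v q) = proj_point q" and T: "proj_point (blk Tm 1 *v q) = proj_point q"
  shows "proj_point q = proj_point eZ"
proof -
  obtain x y w where qv: "q = v3 x y w" using v3_eta[of q] by metis
  obtain k where k: "k \<noteq> 0" "v3 x y w = k *s v3 (\<eta> * x) (\<eta> ^ 4 * y) w"
    using D unfolding proj_point_eq_iff qv by (auto simp: blk_vec Dm_def)
  obtain l where l: "l \<noteq> 0" "v3 x y w = l *s v3 (- i * y) (- i * x) w"
    using T unfolding proj_point_eq_iff qv by (auto simp: blk_vec Tm_def)
  have e: "x = k * (\<eta> * x)" "y = k * (\<eta> ^ 4 * y)" "w = k * w"
    using arg_cong[OF k(2), of "\<lambda>v. v$1"] arg_cong[OF k(2), of "\<lambda>v. v$2"] arg_cong[OF k(2), of "\<lambda>v. v$3"] by simp_all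
  have f: "x = l * (- i * y)" "y = l * (- i * x)"
    using arg_cong[OF l(2), of "\<lambda>v. v$1"] arg_cong[OF l(2), of "\<lambda>v. v$2"] by simp_all
  have "x = 0"
  proof (rule ccontr)
    assume x: "x \<noteq> 0"
    then have y: "y \<noteq> 0" using f(1) by (metis mult_zero_right)
    have "(k * \<eta>) * x = 1 * x" "(k * \<eta> ^ 4) * y = 1 * y" using e(1,2) by (simp_all only: mult.assoc mult_1_left)
    then have "k * \<eta> = 1" "k * \<eta> ^ 4 = 1" using x y by (simp_all only: mult_cancel_right) simp_all
    then have "\<eta> ^ 3 = 1" by Groebner_Basis.algebra
    then show False using eta_ne[of 3] by simp
  qed
  then have y: "y = 0" using f(2) by (metis mult_zero_right)
  then have "w \<noteq> 0" using q \<open>x = 0\<close> by (simp add: qv v3_zero)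
  then have "v3 0 0 1 = inverse w *s v3 0 0 w" by (simp add: vec_eq_iff forall_3)
  then show ?thesis unfolding qv \<open>x = 0\<close> y eZ_v3 proj_point_eq_iff using \<open>w \<noteq> 0\<close> by (intro exI[of _ "inverse w"]) simp
qed

end

text \<open>The equivalence \<open>A\<close> is not assumed to fix (0:0:1). It carries the outer
  Galois point of the given curve to the only one of the normal form, which is therefore fixed by
  every automorphism of the normal form; \<open>fixed_vertex\<close> identifies it as (0:0:1). Hence
  \<open>A\<close> is a block matrix and conjugates the two stabilisers.\<close>

lemma normal_form_imp_A5:
  fixes \<zeta> :: "nat \<Rightarrow> 'a::{alg_closed_field, field_char_0}" and L :: "(3, 'a) mpoly"
  assumes z: "compatible_roots \<zeta>" and d: "d \<ge> 4" and L: "binary_form d L" and smooth: "smooth_form (pZ ^ d + L)"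
    and gal: "outer_galois_points (pZ ^ d + L) = {proj_point eZ}"
    and par: "A5_parameters d n1 n2 n3 t a" and eq: "proj_equivalent (pZ ^ d + L) (pZ ^ d + A5_form (\<zeta> 4) n1 n2 n3 t a)"
  shows "Aut_red (pZ ^ d + L) \<cong> alt_group 5"
proof -
  define L' where "L' = A5_form (\<zeta> 4) n1 n2 n3 t a"
  obtain s :: 'a where "s ^ 2 = 5" using nth_root_exists[of 2 "5::'a"] by auto
  then obtain \<eta> \<kappa> k where "icosa (\<zeta> 4) \<eta> \<kappa>" using icosa_of_roots[OF z] by metis
  then interpret icosa "\<zeta> 4" \<eta> \<kappa> .
  have dn: "d = 12 * n1 + 20 * n2 + 30 * n3 + 60 * t" using par by (simp add: A5_parameters_def)
  have L': "binary_form d L'" unfolding dn L'_def by (rule binary_form_A5)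
  have F': "bfun L' = ico_form (\<zeta> 4) n1 n2 n3 t a" unfolding L'_def by (rule bfun_A5)
  have d2: "d \<ge> 2" "d > 0" using d by auto
  obtain w where nz: "bfun L w \<noteq> 0" using smooth_binary(2)[OF L d2(1) smooth] by blast
  obtain A where A: "invertible A" "pgl_act (pgl_class A) ` plane_curve (pZ ^ d + L) = plane_curve (pZ ^ d + L')"
    using eq unfolding proj_equivalent_def PGL_carrier L'_def by blast
  obtain c where c: "c \<noteq> 0" "\<And>v. mp_eval (pZ ^ d + L') (A *v v) = c * mp_eval (pZ ^ d + L) v"
    using curve_map_forms[OF L L' d2(2) nz A] by blast
  obtain B where B: "A ** B = mat 1" "B ** A = mat 1" "invertible B" using A(1) by (rule invertible_inv)
  have cB: "mp_eval (pZ ^ d + L) (B *v v) = inverse c * mp_eval (pZ ^ d + L') v" for v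
    using c(2)[of "B *v v"] c(1) by (simp add: matrix_vector_mul_assoc B)
  let ?q = "A *v eZ"
  have q0: "?q \<noteq> 0" by (rule invertible_vec_nz[OF A(1)]) (simp add: eZ_v3 v3_zero)
  have q: "proj_point ?q \<in> outer_galois_points (pZ ^ d + L')"
    using outer_galois_curve_map[OF L L' A(1) c, of "proj_point eZ"] gal by (simp only: pgl_act_point insert_iff simp_thms)
  have uniq: "proj_point v = proj_point ?q" if v: "proj_point v \<in> outer_galois_points (pZ ^ d + L')" for v
  proof -
    have "pgl_act (pgl_class B) (proj_point v) \<in> outer_galois_points (pZ ^ d + L)"
      using outer_galois_curve_map[OF L' L B(3) _ cB v] c(1) by simp
    then have "proj_point (B *v v) = proj_point eZ" unfolding gal pgl_act_point by (rule singletonD)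
    then have "pgl_act (pgl_class A) (proj_point (B *v v)) = pgl_act (pgl_class A) (proj_point eZ)" by (rule arg_cong)
    then show ?thesis by (simp only: pgl_act_point matrix_vector_mul_assoc B matrix_vector_mul_lid)
  qed
  have fixed: "proj_point (blk M 1 *v ?q) = proj_point ?q" if M: "M \<in> rep ` carrier SL2_F5" for M
  proof -
    have Mi: "invertible (blk M 1)" using M rep_invertible by (auto simp: invertible_blk)
    have "bfun L' (M *v u) = bfun L' u" for u using M by (auto simp: F' ico_rep)
    then have "mp_eval (pZ ^ d + L') (blk M 1 *v v) = 1 * mp_eval (pZ ^ d + L') v" for v
      using blk_form[OF L', of M 1 v] curve_form_eval[OF L', of v] by (simp only: mult_1_left)
    then have "pgl_act (pgl_class (blk M 1)) (proj_point ?q) \<in> outer_galois_points (pZ ^ d + L')"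
      by (intro outer_galois_curve_map[OF L' L' Mi one_neq_zero _ q])
    then show ?thesis unfolding pgl_act_point by (rule uniq)
  qed
  have "proj_point ?q = proj_point eZ" by (rule fixed_vertex[OF q0]) (rule fixed, rule gens_rep)+
  then have "pgl_act (pgl_class A) (proj_point eZ) = proj_point eZ" by (simp only: pgl_act_point)
  then obtain M u where M: "invertible M" "u \<noteq> 0" "\<And>v. bfun L' (M *v v) = u ^ d * bfun L v"
    using block_structure[OF L L' d2(1) A(1) c] by metis
  have "Aut_red (pZ ^ d + L) = PGL\<lparr>carrier := stab (bfun L)\<rparr>" by (rule Aut_red_eq[OF L d2(1) nz gal])
  also have "\<dots> \<cong> PGL\<lparr>carrier := stab (bfun L')\<rparr>"
    using M by (intro stab_conj_iso[where M = M and c = "u ^ d"]) simp_all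
  also have "stab (bfun L') = IG" unfolding F' by (rule stab_ico) (use dn d2 in simp)
  also have "PGL\<lparr>carrier := IG\<rparr> \<cong> alt_group 5" by (rule IG_iso)
  finally show ?thesis .
qed

text \<open>In the coordinates \<open>C\<close> supplied by \<open>icosahedral_normal_form\<close>
  the stabiliser of the form contains \<open>IG\<close>, and smoothness makes its \<open>d\<close>
  zeros distinct, as \<open>ico_decomposition\<close> requires.\<close>

lemma A5_imp_normal_form:
  fixes \<zeta> :: "nat \<Rightarrow> 'a::{alg_closed_field, field_char_0}" and L :: "(3, 'a) mpoly"
  assumes z: "compatible_roots \<zeta>" and d: "d \<ge> 4" and L: "binary_form d L" and smooth: "smooth_form (pZ ^ d + L)"
    and gal: "outer_galois_points (pZ ^ d + L) = {proj_point eZ}"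
    and iso: "Aut_red (pZ ^ d + L) \<cong> alt_group 5"
  shows "\<exists>n1 n2 n3 t a. A5_parameters d n1 n2 n3 t a \<and> proj_equivalent (pZ ^ d + L) (pZ ^ d + A5_form (\<zeta> 4) n1 n2 n3 t a)"
proof -
  let ?F = "bfun L"
  have d2: "d \<ge> 2" "d > 0" using d by auto
  obtain w where wnz: "?F w \<noteq> 0" using smooth_binary(2)[OF L d2(1) smooth] by blast
  have F: "bform d ?F" by (rule bform_bfun[OF L])
  have "PGL\<lparr>carrier := stab ?F\<rparr> \<cong> alt_group 5" using iso by (simp only: Aut_red_eq[OF L d2(1) wnz gal])
  then obtain \<eta> \<kappa> C M N where ico: "icosa (\<zeta> 4) \<eta> \<kappa>" and C: "invertible C"
    and MN: "pgl_class M \<in> stab ?F" "pgl_class N \<in> stab ?F"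
    and MC: "M ** C = C ** icosa.Dm \<eta>" "N ** C = C ** icosa.Wm (\<zeta> 4) \<eta> \<kappa>"
    by (rule icosahedral_normal_form[OF zeta4_square[OF z] stab_subgroup])
  interpret icosa "\<zeta> 4" \<eta> \<kappa> by (rule ico)
  define F1 where "F1 = (\<lambda>v. ?F (C *v v))"
  have F1: "bform d F1" unfolding F1_def by (rule bform_comp[OF F])
  have gen: "pgl_class A \<in> stab F1" if K: "pgl_class K \<in> stab ?F" "K ** C = C ** A" "invertible A" for A K
  proof -
    obtain c where c: "c \<noteq> 0" "\<And>v. ?F (K *v v) = c * ?F v" using stab_rep[OF F K(1)] by blast
    have "C *v (A *v v) = K *v (C *v v)" for v by (simp add: matrix_vector_mul_assoc K(2))
    then have "F1 (A *v v) = c * F1 v" for v by (simp add: F1_def c)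
    then show ?thesis unfolding stab_def using c(1) K(3) by blast
  qed
  have IG: "IG \<subseteq> stab F1"
    by (rule IG_least[OF stab_subgroup gen[OF MN(1) MC(1) inv_D] gen[OF MN(2) MC(2) inv_W]])
  obtain B where B: "C ** B = mat 1" "B ** C = mat 1" "invertible B" using C by (rule invertible_inv)
  have "card (zeros F1) = d" unfolding F1_def card_zeros_comp[OF F C] by (rule smooth_binary(1)[OF L d2(1) smooth])
  moreover have "F1 (B *v w) \<noteq> 0" using wnz by (simp add: F1_def matrix_vector_mul_assoc B)
  moreover have "pgl_act A ` zeros F1 = zeros F1" if "A \<in> IG" for A using stab_zeros[OF F1] IG that by blast
  ultimately obtain n1 n2 n3 t a k where par: "A5_parameters d n1 n2 n3 t a" and k: "k \<noteq> 0"
    and Fk: "\<And>v. F1 v = k * ico_form (\<zeta> 4) n1 n2 n3 t a v"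
    using ico_decomposition[OF F1 d2(2)] by blast
  define L' where "L' = A5_form (\<zeta> 4) n1 n2 n3 t a"
  have dn: "d = 12 * n1 + 20 * n2 + 30 * n3 + 60 * t" using par by (simp add: A5_parameters_def)
  have L': "binary_form d L'" unfolding dn L'_def by (rule binary_form_A5)
  have F': "bfun L' = ico_form (\<zeta> 4) n1 n2 n3 t a" unfolding L'_def by (rule bfun_A5)
  \<comment> \<open>The constant factor is absorbed by scaling \<open>X\<close> and \<open>Y\<close>
    with one of its \<open>d\<close>-th roots.\<close>
  obtain \<mu> where \<mu>: "\<mu> ^ d = k" using nth_root_exists[OF d2(2), of k] by auto
  have \<mu>0: "\<mu> \<noteq> 0" using \<mu> k d2 by (auto simp: power_0_left)
  let ?A = "blk (mat \<mu> ** B) 1"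
  have "bfun L' ((mat \<mu> ** B) *v v) = ?F v" for v
  proof -
    have "bfun L' ((mat \<mu> ** B) *v v) = k * bfun L' (B *v v)"
      by (simp add: mat_mult_vec bform_homog[OF bform_bfun[OF L']] \<mu>)
    also have "\<dots> = F1 (B *v v)" by (simp add: Fk F')
    finally show ?thesis by (simp add: F1_def matrix_vector_mul_assoc B)
  qed
  then have "mp_eval (pZ ^ d + L') (?A *v v) = 1 * mp_eval (pZ ^ d + L) v" for v
    using blk_form[OF L', of "mat \<mu> ** B" 1 v] curve_form_eval[OF L, of v] by simp
  moreover have A: "invertible ?A" using \<mu>0 B(3) by (simp add: invertible_blk invertible_mult invertible_mat)
  ultimately have "pgl_act (pgl_class ?A) ` plane_curve (pZ ^ d + L) = plane_curve (pZ ^ d + L')"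
    by (intro forms_map_curve[OF curve_form_homogeneous[OF L] curve_form_homogeneous[OF L'] _ one_neq_zero])
  then have "proj_equivalent (pZ ^ d + L) (pZ ^ d + L')" unfolding proj_equivalent_def PGL_carrier using A by blast
  then show ?thesis using par unfolding L'_def by blast
qed

lemma even_degree:
  assumes "A5_parameters d n1 n2 n3 t a" and "d = 2 ^ e * d0" "odd d0" "d > 0" shows "even d" "e > 0" "d0 > 0"
proof -
  show "even d" using assms(1) by (auto simp: A5_parameters_def)
  then show "e > 0" using assms(2,3) by (cases e) auto
  show "d0 > 0" using assms(2,4) by (cases d0) auto
qed

lemma root_of_unity_power:
  assumes z: "compatible_roots \<zeta>" and "m > 0" "n > 0" shows "\<zeta> (m * n) ^ n = (\<zeta> m :: 'a::field)"
proof -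
  have "\<zeta> (n * m) ^ n = \<zeta> m" using assms by (auto simp: compatible_roots_def)
  then show ?thesis by (simp only: mult.commute)
qed

text \<open>\<open>icosa_of_roots\<close> fits \<open>\<eta>\<close> to the given square root
  \<open>s\<close>, so that the block of the fourth generator is a multiple of \<open>Wm\<close>.
  The instance \<open>a\<close> of \<open>icosa_ext\<close>, with the root \<open>\<zeta> d\<close>,
  describes the whole group; the instance \<open>b\<close>, with its power of order
  \<open>2^e\<close>, describes \<open>G0\<close>.\<close>

lemma Aut_A5_form:
  fixes \<zeta> :: "nat \<Rightarrow> 'a::{alg_closed_field, field_char_0}" and L :: "(3, 'a) mpoly"
  assumes z: "compatible_roots \<zeta>" and d: "d \<ge> 4" and L: "binary_form d L" and smooth: "smooth_form (pZ ^ d + L)"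
    and gal: "outer_galois_points (pZ ^ d + L) = {proj_point eZ}"
    and par: "A5_parameters d n1 n2 n3 t a" and LA: "L = A5_form (\<zeta> 4) n1 n2 n3 t a"
    and s: "s ^ 2 = 5"
    and \<nu>: "\<nu> ^ d = (- 1) ^ n3 * inverse 2 ^ n2 * 5 ^ (3 * n1 + 5 * n2 + 7 * n3 + 15 * t)
          * (9 + 4 * s) ^ n1 * (123 + 55 * s) ^ n2 * (1525 + 682 * s) ^ n3
          * (930249 + 416020 * s) ^ t"
    and de: "d = 2 ^ e * d0" "odd d0"
  shows "is_central_extension (Aut (pZ ^ d + L)) (integer_mod_group d) (alt_group 5)"
    and "carrier (Aut (pZ ^ d + L)) =
        generate PGL
          {pgl_class (diag3 1 1 (\<zeta> d)),
           pgl_class (vector [vector [0, 1, 0], vector [1, 0, 0], vector [0, 0, \<zeta> (2 * d) ^ n3]]),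
           pgl_class (diag3 (\<zeta> 5) 1 (\<zeta> (5 * d) ^ n1)),
           pgl_class (vector [vector [- ((1 + s) / 2), - \<zeta> 4, 0],
                              vector [\<zeta> 4, (1 + s) / 2, 0],
                              vector [0, 0, \<nu>]])}"
    and "\<exists>G0 :: ('a ^ 3 ^ 3) set monoid.
         Aut (pZ ^ d + L) \<cong> integer_mod_group d0 \<times>\<times> G0 \<and>
         is_nonsplit_central_extension G0 (integer_mod_group (2 ^ e)) (alt_group 5) \<and>
         (e = 1 \<longrightarrow> G0 \<cong> SL2_F5) \<and>
         (e = 2 \<longrightarrow> (\<exists>\<phi>\<in>hom (integer_mod_group 2) (AutoGroup SL2_F5).
            G0 \<cong> semidirect_product SL2_F5 (integer_mod_group 2) \<phi>)) \<and>
         (e \<ge> 3 \<longrightarrow> G0 \<cong> SL2_F5_amalgam e \<and>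
            is_nonsplit_extension G0 SL2_F5 (integer_mod_group (2 ^ (e - 1))))"
proof -
  have d2: "d \<ge> 2" "d > 0" using d by auto
  note ev = even_degree[OF par de d2(2)]
  obtain \<eta> \<kappa> k where ico: "icosa (\<zeta> 4) \<eta> \<kappa>" and s\<eta>: "s = 2 * (\<eta> ^ 2 + \<eta> ^ 3) + 1" and \<eta>k: "\<eta> ^ 2 = \<zeta> 5 ^ k"
    by (rule icosa_of_roots[OF z s])
  have prim: "primitive_root_of_unity n (\<zeta> n)" if "n > 0" for n using z that by (simp add: compatible_roots_def)
  have pw: "\<zeta> n ^ n = 1" if "n > 0" for n using prim[OF that] by (simp add: primitive_root_of_unity_def)
  interpret I: icosa "\<zeta> 4" \<eta> \<kappa> by (rule ico)
  interpret a: icosa_ext "\<zeta> 4" \<eta> \<kappa> "\<zeta> d" d by unfold_locales (use d2 ev prim in auto)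
  have zd: "\<zeta> d ^ d0 = \<zeta> (2 ^ e)"
    unfolding de(1) by (rule root_of_unity_power[OF z]) (use ev in simp_all)
  interpret b: icosa_ext "\<zeta> 4" \<eta> \<kappa> "\<zeta> d ^ d0" "2 ^ e" by unfold_locales (use ev prim zd in auto)
  have dn: "d = 12 * n1 + 20 * n2 + 30 * n3 + 60 * t" using par by (simp add: A5_parameters_def)
  let ?F = "ico_form (\<zeta> 4) n1 n2 n3 t a"
  have F: "bfun L = ?F" unfolding LA by (rule bfun_A5)
  have bF: "bform d ?F" using bform_bfun[OF L] by (simp only: F)
  obtain w where wnz: "bfun L w \<noteq> 0" using smooth_binary(2)[OF L d2(1) smooth] by blast
  let ?j = "\<lambda>M::'a^2^2. pgl_class (blk M 1) :: ('a^3^3) set"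
  let ?f = "pZ ^ d + L"
  interpret j: group_hom GL PGL ?j
    using GL_group PGL_group block_class_hom by (simp add: group_hom_def group_hom_axioms_def)
  have G: "Gam (bfun L) = carrier a.EE" unfolding F by (rule a.Gam_ico[OF dn])
  have Ac: "carrier (Aut ?f) = ?j ` carrier a.EE" using Aut_carrier[OF L d2(1) wnz gal] by (simp only: G)
  have "?j \<in> iso (GL\<lparr>carrier := carrier a.EE\<rparr>) (Aut ?f)"
    using Aut_iso[OF Aut_carrier[OF L d2(1) wnz gal]] by (simp only: G)
  then have ja: "?j \<in> iso a.EE (Aut ?f)" by (simp add: a.EE_def)
  have "subgroup (?j ` carrier a.EE) PGL" by (rule j.subgroup_img_is_subgroup[OF a.EE_subgroup])
  then have "group (PGL\<lparr>carrier := ?j ` carrier a.EE\<rparr>)" by (rule subgroup.subgroup_is_group[OF _ PGL_group])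
  moreover have "Aut ?f = PGL\<lparr>carrier := ?j ` carrier a.EE\<rparr>" using Ac by (simp add: Aut_def)
  ultimately have Ag: "group (Aut ?f)" by simp
  show "is_central_extension (Aut ?f) (integer_mod_group d) (alt_group 5)"
    by (rule central_extension_iso[OF a.EE_central ja Ag])

  show "carrier (Aut (pZ ^ d + L)) =
        generate PGL
          {pgl_class (diag3 1 1 (\<zeta> d)),
           pgl_class (vector [vector [0, 1, 0], vector [1, 0, 0], vector [0, 0, \<zeta> (2 * d) ^ n3]]),
           pgl_class (diag3 (\<zeta> 5) 1 (\<zeta> (5 * d) ^ n1)),
           pgl_class (vector [vector [- ((1 + s) / 2), - \<zeta> 4, 0],
                              vector [\<zeta> 4, (1 + s) / 2, 0],
                              vector [0, 0, \<nu>]])}"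
  proof -
    define \<phi> where "\<phi> = (1 + s) / 2"
    have \<phi>: "\<phi> = I.\<psi> + 1" by (simp add: \<phi>_def s\<eta> I.\<psi>_def field_simps)
    have \<phi>\<psi>: "\<phi> * I.\<psi> = 1" unfolding \<phi> using I.psi by Groebner_Basis.algebra
    have \<phi>0: "\<phi> \<noteq> 0" using \<phi>\<psi> by auto
    \<comment> \<open>The factor with block equal to \<open>r Wm\<close>: the upper left entry
      demands \<open>r \<kappa> = - \<phi>\<close>, and \<open>kap2\<close> solves this for
      \<open>r\<close>.\<close>
    define r where "r = - \<phi> * (I.\<psi> - 2) * \<kappa>"
    have rk: "r * \<kappa> = - \<phi>" unfolding r_def using I.kap2 by Groebner_Basis.algebra
    have r0: "r \<noteq> 0" using rk \<phi>0 by auto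
    let ?S = "m2 (- \<phi>) (- \<zeta> 4) (\<zeta> 4) \<phi>"
    have S: "?S = mat r ** I.Wm"
    proof -
      have "r * (\<kappa> * \<zeta> 4 * I.\<psi>) = - \<zeta> 4" using rk \<phi>\<psi> by Groebner_Basis.algebra
      moreover have "r * (- \<kappa> * \<zeta> 4 * I.\<psi>) = \<zeta> 4" using rk \<phi>\<psi> by Groebner_Basis.algebra
      moreover have "r * - \<kappa> = \<phi>" using rk by simp
      ultimately show ?thesis by (simp add: I.Wm_def m2_scale rk)
    qed
    have r2: "r ^ 2 = - ((1 + s) / 2 + 2)"
    proof -
      have "r ^ 2 = - (\<phi> + 2)" unfolding r_def \<phi> using I.kap2 I.psi by Groebner_Basis.algebra
      then show ?thesis by (simp only: \<phi>_def)
    qed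
    \<comment> \<open>As \<open>Wm\<close> preserves the form, the block multiplies it by
      \<open>r^d\<close>. By \<open>nu_power\<close> this is the radicand of
      \<open>\<nu>\<close>.\<close>
    have r\<nu>: "r ^ d = \<nu> ^ d"
    proof -
      have "r ^ d = (r ^ 2) ^ (6 * n1 + 10 * n2 + 15 * n3 + 30 * t)"
        unfolding dn power_mult[symmetric] by (simp add: algebra_simps)
      then show ?thesis unfolding \<nu> by (simp only: nu_power[OF s r2])
    qed
    have \<nu>0: "\<nu> \<noteq> 0" using r\<nu> r0 d2 by (auto simp: power_0_left)
    define w2 where "w2 = \<zeta> (2 * d) ^ n3"
    define w3 where "w3 = \<zeta> (5 * d) ^ n1"
    have w0: "\<zeta> n \<noteq> 0" if "n > 0" for n using pw[OF that] that by (auto simp: power_0_left)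
    have "\<zeta> 2 ^ 1 \<noteq> 1" "\<zeta> 2 ^ 2 = 1" using prim[of 2] by (auto simp: primitive_root_of_unity_def)
    then have z2: "\<zeta> 2 = - 1" by (auto simp: power2_eq_1_iff)
    have "\<zeta> (2 * d) ^ d = \<zeta> 2" "\<zeta> (5 * d) ^ d = \<zeta> 5" using root_of_unity_power[OF z _ d2(2)] by simp_all
    then have w2: "w2 ^ d = (- 1) ^ n3" and w3: "w3 ^ d = \<zeta> 5 ^ n1"
      unfolding w2_def w3_def power_mult[symmetric] by (simp_all add: mult.commute power_mult z2)
    define B where "B = {pgl_class (blk (mat 1) (\<zeta> d)), pgl_class (blk (m2 0 1 1 0) w2),
      pgl_class (blk (m2 (\<zeta> 5) 0 0 1) w3), pgl_class (blk ?S \<nu>)}"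
    have B: "{pgl_class (diag3 1 1 (\<zeta> d)),
           pgl_class (vector [vector [0, 1, 0], vector [1, 0, 0], vector [0, 0, \<zeta> (2 * d) ^ n3]]),
           pgl_class (diag3 (\<zeta> 5) 1 (\<zeta> (5 * d) ^ n1)),
           pgl_class (vector [vector [- ((1 + s) / 2), - \<zeta> 4, 0], vector [\<zeta> 4, (1 + s) / 2, 0], vector [0, 0, \<nu>]])} = B"
      unfolding B_def blk_def diag3_def w2_def w3_def \<phi>_def m2_one m2_nth by (rule refl)
    have w20: "w2 \<noteq> 0" and w30: "w3 \<noteq> 0" using w0 d2 by (simp_all add: w2_def w3_def)
    obtain gW where gW: "I.Wm = I.rep gW" using I.gens_rep(3) by blast
    have FW: "?F (I.Wm *v v) = ?F v" for v
      using I.ico_rep[of n1 n2 n3 t a gW v] unfolding gW[symmetric] .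
    have FS: "?F (?S *v v) = \<nu> ^ d * ?F v" for v
      by (simp only: S mat_mult_vec bform_homog[OF bF] FW r\<nu>)
    have iS: "invertible ?S" unfolding S using r0 I.inv_W by (intro invertible_mult invertible_mat)
    have i5: "invertible (m2 (\<zeta> 5) 0 0 1)" using w0[of 5] by (simp add: invertible_m2)
    have "B \<subseteq> ?j ` carrier a.EE"
    proof -
      have "pgl_class (blk (mat 1) (\<zeta> d)) \<in> ?j ` carrier a.EE"
        by (rule a.block_generator[OF dn, where a = a]) (use w0 d2 pw in \<open>simp_all add: invertible_mat\<close>)
      moreover have "pgl_class (blk (m2 0 1 1 0) w2) \<in> ?j ` carrier a.EE"
        by (rule a.block_generator[OF dn, where a = a])
          (use w20 in \<open>simp_all add: invertible_m2 w2 ico_form_swap[OF I.i2]\<close>)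
      moreover have "pgl_class (blk (m2 (\<zeta> 5) 0 0 1) w3) \<in> ?j ` carrier a.EE"
        by (rule a.block_generator[OF dn i5 w30, where a = a]) (simp only: w3 ico_form_diag[OF I.i2 pw[of 5, simplified]])
      moreover have "pgl_class (blk ?S \<nu>) \<in> ?j ` carrier a.EE"
        by (rule a.block_generator[OF dn iS \<nu>0 FS])
      ultimately show ?thesis unfolding B_def by blast
    qed
    then have "generate PGL B = ?j ` carrier a.EE"
    proof (rule a.EE_generate)
      have gen: "x \<in> generate PGL B" if "x \<in> B" for x using that by (rule generate.incl)
      have "pgl_class (blk (mat 1) (\<zeta> d)) = ?j (mat (inverse (\<zeta> d)) ** mat 1)" by (rule blk_class) (use w0 d2 in simp)
      then show "?j (mat (inverse (\<zeta> d))) \<in> generate PGL B"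
        using gen[of "pgl_class (blk (mat 1) (\<zeta> d))"] unfolding matrix_mul_rid by (simp only: B_def insert_iff simp_thms)
      show "invertible (mat (inverse w3) ** m2 (\<zeta> 5) 0 0 1)" using w30 i5 by (intro invertible_mult invertible_mat) simp_all
      show "?j (mat (inverse w3) ** m2 (\<zeta> 5) 0 0 1) \<in> generate PGL B"
        using gen[of "pgl_class (blk (m2 (\<zeta> 5) 0 0 1) w3)"] unfolding blk_class[OF w30] by (simp only: B_def insert_iff simp_thms blk_class[OF w30])
      \<comment> \<open>Projectively \<open>Dm\<close> is diag(\<open>\<eta>^2\<close>, 1), and
        \<open>\<eta>^2\<close> is the \<open>k\<close>-th power of
        \<open>\<zeta> 5\<close>.\<close>
      show "pgl_class (mat (inverse w3) ** m2 (\<zeta> 5) 0 0 1) [^]\<^bsub>PGL\<^esub> k = pgl_class I.Dm"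
      proof -
        have "pgl_class (mat (inverse w3) ** m2 (\<zeta> 5) 0 0 1) = pgl_class (m2 (\<zeta> 5) 0 0 1)"
          by (rule pgl_class_scale) (use w30 in simp)
        moreover have "pgl_class (m2 (\<zeta> 5) 0 0 1) [^]\<^bsub>PGL\<^esub> k = pgl_class (m2 (\<eta> ^ 2) 0 0 1)"
          unfolding PGL_pow[OF i5] mpow_m2_diag \<eta>k by simp
        moreover have "pgl_class I.Dm = pgl_class (m2 (\<eta> ^ 2) 0 0 1)"
        proof -
          have "\<eta> ^ 4 * \<eta> ^ 2 = \<eta>" using I.eta5 by Groebner_Basis.algebra
          then have D: "I.Dm = mat (\<eta> ^ 4) ** m2 (\<eta> ^ 2) 0 0 1" by (simp add: I.Dm_def m2_scale)
          have "pgl_class (mat (\<eta> ^ 4) ** m2 (\<eta> ^ 2) 0 0 1) = pgl_class (m2 (\<eta> ^ 2) 0 0 1)"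
            by (rule pgl_class_scale) (use I.nz in simp)
          then show ?thesis by (simp only: D)
        qed
        ultimately show ?thesis by metis
      qed
      show "invertible (mat (inverse \<nu>) ** ?S)" using \<nu>0 iS by (intro invertible_mult invertible_mat) simp_all
      show "?j (mat (inverse \<nu>) ** ?S) \<in> generate PGL B"
        using gen[of "pgl_class (blk ?S \<nu>)"] by (simp only: B_def insert_iff simp_thms blk_class[OF \<nu>0])
      have "pgl_class (mat (inverse \<nu>) ** ?S) = pgl_class ?S" by (rule pgl_class_scale) (use \<nu>0 in simp)
      also have "\<dots> = pgl_class I.Wm" unfolding S by (rule pgl_class_scale[OF r0])
      finally show "pgl_class (mat (inverse \<nu>) ** ?S) = pgl_class I.Wm" .
    qed
    then show ?thesis unfolding B Ac by (rule sym)
  qed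

  \<comment> \<open>The 2-part is realised inside PGL_3, as the type of \<open>G0\<close> demands:
    blocks that are products of \<open>2^e\<close>-th roots of unity with the lift.\<close>
  define G0 where "G0 = PGL\<lparr>carrier := ?j ` carrier b.EE\<rparr>"
  have "subgroup (?j ` carrier b.EE) PGL" by (rule j.subgroup_img_is_subgroup[OF b.EE_subgroup])
  then have G0: "group G0" unfolding G0_def by (rule subgroup.subgroup_is_group[OF _ PGL_group])
  have jb: "?j \<in> iso b.EE G0"
  proof -
    have "?j \<in> hom b.EE PGL"
    proof (rule homI)
      note sub = subsetD[OF subgroup.subset[OF b.EE_subgroup]]
      show "?j x \<in> carrier PGL" if "x \<in> carrier b.EE" for x by (rule j.hom_closed[OF sub[OF that]])
      have "monoid.mult b.EE = monoid.mult GL" by (simp add: b.EE_def)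
      then show "?j (x \<otimes>\<^bsub>b.EE\<^esub> y) = ?j x \<otimes>\<^bsub>PGL\<^esub> ?j y" if "x \<in> carrier b.EE" "y \<in> carrier b.EE" for x y
        using j.hom_mult[OF sub[OF that(1)] sub[OF that(2)]] by (simp only:)
    qed
    moreover have "inj_on ?j (carrier b.EE)" by (rule inj_onI) (simp only: blk_class_eq)
    ultimately show ?thesis unfolding G0_def iso_def bij_betw_def by (simp add: hom_restrict_carrier)
  qed
  have bG: "b.EE \<cong> G0" using jb by (auto simp: is_iso_def)
  have Gb: "G0 \<cong> b.EE" by (rule group.iso_sym[OF b.EE_group bG])
  have co: "coprime d0 (2 ^ e)" using de(2) by simp
  have eq: "d0 * 2 ^ e = d" using de(1) by (simp only: mult.commute)
  have "icosa_ext (\<zeta> 4) \<eta> \<kappa> (\<zeta> d) (d0 * 2 ^ e)" unfolding eq by (rule a.icosa_ext_axioms)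
  note I.EE_split[OF this b.icosa_ext_axioms co ev(3), unfolded eq]
  then have "integer_mod_group d0 \<times>\<times> b.EE \<cong> a.EE" unfolding is_iso_def by blast
  then have i1: "a.EE \<cong> integer_mod_group d0 \<times>\<times> b.EE"
    by (rule group.iso_sym[OF DirProd_group[OF group_integer_mod_group b.EE_group]])
  have i2: "Aut ?f \<cong> a.EE" by (rule group.iso_sym[OF a.EE_group]) (use ja in \<open>auto simp: is_iso_def\<close>)
  have i3: "integer_mod_group d0 \<times>\<times> b.EE \<cong> integer_mod_group d0 \<times>\<times> G0"
    by (rule group.DirProd_iso_trans[OF group_integer_mod_group iso_refl bG])
  have split: "Aut ?f \<cong> integer_mod_group d0 \<times>\<times> G0" by (rule iso_trans[OF i2 iso_trans[OF i1 i3]])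
  show "\<exists>G0 :: ('a ^ 3 ^ 3) set monoid.
         Aut (pZ ^ d + L) \<cong> integer_mod_group d0 \<times>\<times> G0 \<and>
         is_nonsplit_central_extension G0 (integer_mod_group (2 ^ e)) (alt_group 5) \<and>
         (e = 1 \<longrightarrow> G0 \<cong> SL2_F5) \<and>
         (e = 2 \<longrightarrow> (\<exists>\<phi>\<in>hom (integer_mod_group 2) (AutoGroup SL2_F5).
            G0 \<cong> semidirect_product SL2_F5 (integer_mod_group 2) \<phi>)) \<and>
         (e \<ge> 3 \<longrightarrow> G0 \<cong> SL2_F5_amalgam e \<and>
            is_nonsplit_extension G0 SL2_F5 (integer_mod_group (2 ^ (e - 1))))"
  proof (intro exI[of _ G0] conjI impI)
    show "Aut ?f \<cong> integer_mod_group d0 \<times>\<times> G0" by (rule split)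
    show "is_nonsplit_central_extension G0 (integer_mod_group (2 ^ e)) (alt_group 5)"
      by (rule nonsplit_central_extension_iso[OF b.EE_nonsplit_central jb G0])
    show "G0 \<cong> SL2_F5" if "e = 1" by (rule iso_trans[OF Gb b.EE_2]) (simp add: that)
    show "\<exists>\<phi>\<in>hom (integer_mod_group 2) (AutoGroup SL2_F5). G0 \<cong> semidirect_product SL2_F5 (integer_mod_group 2) \<phi>"
      if "e = 2"
    proof -
      have "(2::nat) ^ e = 4" by (simp add: that)
      then obtain \<phi> where "\<phi> \<in> hom (integer_mod_group 2) (AutoGroup SL2_F5)"
        "b.EE \<cong> semidirect_product SL2_F5 (integer_mod_group 2) \<phi>"
        using b.EE_4 by blast
      then show ?thesis using iso_trans[OF Gb] by blast
    qed
    show "G0 \<cong> SL2_F5_amalgam e" if "e \<ge> 3" by (rule iso_trans[OF Gb b.EE_amalgam]) (use ev in simp_all)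
    show "is_nonsplit_extension G0 SL2_F5 (integer_mod_group (2 ^ (e - 1)))" if e: "e \<ge> 3"
    proof -
      have "(2::nat) ^ 3 dvd 2 ^ e" using e by (rule le_imp_power_dvd)
      then have "is_nonsplit_extension b.EE SL2_F5 (integer_mod_group (2 ^ e div 2))" by (intro b.EE_nonsplit) simp
      moreover have "(2::nat) ^ e div 2 = 2 ^ (e - 1)" using e by (cases e) auto
      ultimately show ?thesis using nonsplit_extension_iso[OF _ jb G0] by simp
    qed
  qed
qed

theorem theorem1p1:
  fixes \<zeta> :: "nat \<Rightarrow> 'a::{alg_closed_field, field_char_0}"
    and d :: nat and L :: "(3, 'a) mpoly"
  assumes "compatible_roots \<zeta>"
    and "d \<ge> 4"
    and "binary_form d L"
    and "smooth_form (pZ ^ d + L)"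
    and "outer_galois_points (pZ ^ d + L) = {proj_point (vector [0, 0, 1])}"
  shows "(Aut_red (pZ ^ d + L) \<cong> alt_group 5 \<longleftrightarrow>
      (\<exists>\<epsilon>\<^sub>1 \<epsilon>\<^sub>2 \<epsilon>\<^sub>3 t a. A5_parameters d \<epsilon>\<^sub>1 \<epsilon>\<^sub>2 \<epsilon>\<^sub>3 t a \<and>
         proj_equivalent (pZ ^ d + L) (pZ ^ d + A5_form (\<zeta> 4) \<epsilon>\<^sub>1 \<epsilon>\<^sub>2 \<epsilon>\<^sub>3 t a))) \<and>
    (\<forall>\<epsilon>\<^sub>1 \<epsilon>\<^sub>2 \<epsilon>\<^sub>3 t a (s :: 'a) (\<nu> :: 'a) e d\<^sub>0.
      A5_parameters d \<epsilon>\<^sub>1 \<epsilon>\<^sub>2 \<epsilon>\<^sub>3 t a \<and>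
        L = A5_form (\<zeta> 4) \<epsilon>\<^sub>1 \<epsilon>\<^sub>2 \<epsilon>\<^sub>3 t a \<and>
        s ^ 2 = 5 \<and>
        \<nu> ^ d = (- 1) ^ \<epsilon>\<^sub>3 * inverse 2 ^ \<epsilon>\<^sub>2 * 5 ^ (3 * \<epsilon>\<^sub>1 + 5 * \<epsilon>\<^sub>2 + 7 * \<epsilon>\<^sub>3 + 15 * t)
          * (9 + 4 * s) ^ \<epsilon>\<^sub>1 * (123 + 55 * s) ^ \<epsilon>\<^sub>2 * (1525 + 682 * s) ^ \<epsilon>\<^sub>3
          * (930249 + 416020 * s) ^ t \<and>
        d = 2 ^ e * d\<^sub>0 \<and> odd d\<^sub>0 \<longrightarrow>
      is_central_extension (Aut (pZ ^ d + L)) (integer_mod_group d) (alt_group 5) \<and>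
      carrier (Aut (pZ ^ d + L)) =
        generate PGL
          {pgl_class (diag3 1 1 (\<zeta> d)),
           pgl_class (vector [vector [0, 1, 0], vector [1, 0, 0], vector [0, 0, \<zeta> (2 * d) ^ \<epsilon>\<^sub>3]]),
           pgl_class (diag3 (\<zeta> 5) 1 (\<zeta> (5 * d) ^ \<epsilon>\<^sub>1)),
           pgl_class (vector [vector [- ((1 + s) / 2), - \<zeta> 4, 0],
                              vector [\<zeta> 4, (1 + s) / 2, 0],
                              vector [0, 0, \<nu>]])} \<and>
      (\<exists>G0 :: ('a ^ 3 ^ 3) set monoid.
         Aut (pZ ^ d + L) \<cong> integer_mod_group d\<^sub>0 \<times>\<times> G0 \<and>
         is_nonsplit_central_extension G0 (integer_mod_group (2 ^ e)) (alt_group 5) \<and>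
         (e = 1 \<longrightarrow> G0 \<cong> SL2_F5) \<and>
         (e = 2 \<longrightarrow> (\<exists>\<phi>\<in>hom (integer_mod_group 2) (AutoGroup SL2_F5).
            G0 \<cong> semidirect_product SL2_F5 (integer_mod_group 2) \<phi>)) \<and>
         (e \<ge> 3 \<longrightarrow> G0 \<cong> SL2_F5_amalgam e \<and>
            is_nonsplit_extension G0 SL2_F5 (integer_mod_group (2 ^ (e - 1))))))"
proof (intro conjI iffI allI impI)
  show "\<exists>n1 n2 n3 t a. A5_parameters d n1 n2 n3 t a \<and> proj_equivalent (pZ ^ d + L) (pZ ^ d + A5_form (\<zeta> 4) n1 n2 n3 t a)"
    if "Aut_red (pZ ^ d + L) \<cong> alt_group 5"
    by (rule A5_imp_normal_form[OF assms that])
  show "Aut_red (pZ ^ d + L) \<cong> alt_group 5"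
    if "\<exists>n1 n2 n3 t a. A5_parameters d n1 n2 n3 t a \<and> proj_equivalent (pZ ^ d + L) (pZ ^ d + A5_form (\<zeta> 4) n1 n2 n3 t a)"
    using that normal_form_imp_A5[OF assms] by blast
qed (elim conjE, (rule Aut_A5_form[OF assms]; assumption))+

end
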